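(* Let $N>1$ be a square-free positive integer and $f_{2,N}=f_{1/2}^{(2)}\otimes\big(\otimes_{p\mid N}f^{\rm St}_{1/2,p}\big)\otimes\big(\otimes_{p\nmid N}f^{\rm sph}_{1/2,p}\big)\in V_{1/2}$. Then the function on the upper half plane corresponding to $E(\cdot,f_{2,N})$, namely $z=x+iy\mapsto y^{-1}E\big(\begin{bmatrix}1&x\\0&1\end{bmatrix}\begin{bmatrix}y&0\\0&1\end{bmatrix},f_{2,N}\big)$, is $$E_{2,N}(z)=1-24\frac{\mu(N)}{\varphi(N)}\sum_{n=1}^\infty\sigma(n')e^{2\pi inz},$$ where $n'=\prod_{p\nmid N}p^{v_p(n)}$ is the part of $n$ relatively prime to $N$. It is a holomorphic modular form of weight $2$ with respect to $\Gamma_0(N)$.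
   Context: $\mathbb{A}$ is the adele ring of $\mathbb{Q}$, $|\cdot|$ the adelic absolute value, $G=\mathrm{GL}(2)$, $B$ its upper triangular subgroup, $K_p=\mathrm{GL}(2,\mathbb{Z}_p)$, $K=\mathrm{O}(2)\prod_pK_p$, $r(\theta)=\begin{bmatrix}\cos\theta&\sin\theta\\-\sin\theta&\cos\theta\end{bmatrix}$. For $s\in\mathbb{C}$ and a prime $p$, $V_{s,p}$ is the space of locally constant $f$ on $\mathrm{GL}(2,\mathbb{Q}_p)$ with $f(\begin{bmatrix}a&b\\0&d\end{bmatrix}g)=|a/d|_p^{s+1/2}f(g)$; $f^{\rm sph}_{s,p}$ is its $K_p$-invariant vector with value $1$ at $1$; $f^{\rm St}_{1/2,p}=\frac1{1-p}\big(f^{\rm sph}_{1/2,p}-\rho(\mathrm{diag}(1,p))f^{\rm sph}_{1/2,p}\big)$ with $\rho$ right translation. $f_s^{(k)}$ on $\mathrm{GL}(2,\mathbb{R})$ is given by $f_s^{(k)}(\begin{bmatrix}a&b\\0&d\end{bmatrix}r(\theta))=|a/d|_\infty^{s+1/2}e^{ik\theta}$. A pure tensor $\otimes f_v$ is the function $g\mapsto\prod_vf_v(g_v)$ on $G(\mathbb{A})$, an element of $V_s$. For $f\in V_{s_0}$ the flat section is $f_s=\delta^{s-s_0}f$, $\delta(g)=|a/d|$ for $g=\begin{bmatrix}a&b\\0&d\end{bmatrix}\kappa$, $\kappa\in K$. $E(g,f_s)=\sum_{\gamma\in B(\mathbb{Q})\backslash G(\mathbb{Q})}f_s(\gamma g)$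 converges for $\mathrm{Re}(s)>1/2$ and continues analytically in $s$; $E(g,f)=\lim_{s\to s_0}E(g,f_s)$. $\sigma(n)=\sum_{d\mid n}d$, $\mu$ is Möbius, $\varphi$ Euler's function. *)

theory Defs
  imports
    "HOL-Complex_Analysis.Complex_Analysis"
    "HOL-Number_Theory.Totient"
    "HOL-Computational_Algebra.Squarefree"
    "HOL-Library.Groups_Big_Fun"
    "HOL-Algebra.QuotRing"
    "HOL-Decision_Procs.Algebra_Aux"
begin

section \<open>The group GL(2) over a ring\<close>

datatype 'a mat2 = Mat2 (ul: 'a) (ur: 'a) (ll: 'a) (lr: 'a)

definition mat2_monoid :: "('a, 'm) ring_scheme \<Rightarrow> 'a mat2 monoid" where
  "mat2_monoid R =
    \<lparr>carrier = {m. set_mat2 m \<subseteq> carrier R},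
     mult = (\<lambda>m n. Mat2
       (ul m \<otimes>\<^bsub>R\<^esub> ul n \<oplus>\<^bsub>R\<^esub> ur m \<otimes>\<^bsub>R\<^esub> ll n) (ul m \<otimes>\<^bsub>R\<^esub> ur n \<oplus>\<^bsub>R\<^esub> ur m \<otimes>\<^bsub>R\<^esub> lr n)
       (ll m \<otimes>\<^bsub>R\<^esub> ul n \<oplus>\<^bsub>R\<^esub> lr m \<otimes>\<^bsub>R\<^esub> ll n) (ll m \<otimes>\<^bsub>R\<^esub> ur n \<oplus>\<^bsub>R\<^esub> lr m \<otimes>\<^bsub>R\<^esub> lr n)),
     one = Mat2 \<one>\<^bsub>R\<^esub> \<zero>\<^bsub>R\<^esub> \<zero>\<^bsub>R\<^esub> \<one>\<^bsub>R\<^esub>\<rparr>"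

definition GL2 :: "('a, 'm) ring_scheme \<Rightarrow> 'a mat2 monoid" where
  "GL2 R = units_of (mat2_monoid R)"

definition borel2 :: "('a, 'm) ring_scheme \<Rightarrow> 'a mat2 set" where
  "borel2 R = {m \<in> carrier (GL2 R). ll m = \<zero>\<^bsub>R\<^esub>}"

abbreviation rat_ring :: "rat ring" where "rat_ring \<equiv> cring_class_ops"
abbreviation real_ring :: "real ring" where "real_ring \<equiv> cring_class_ops"


section \<open>The fields of p-adic numbers\<close>

text \<open>Since \<open>p\<close> has to range over all primes inside one formula, the \<open>p\<close>-adic numbers are a
  family of rings with carriers: Cauchy sequences of rationals modulo null sequences.\<close>

definition rat_padic_abs :: "nat \<Rightarrow> rat \<Rightarrow> real" where
  "rat_padic_abs p q = (if q = 0 then 0 else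
     real p powi (int (multiplicity (int p) (snd (quotient_of q)))
                - int (multiplicity (int p) (fst (quotient_of q)))))"

definition padic_Cauchy :: "nat \<Rightarrow> (nat \<Rightarrow> rat) ring" where
  "padic_Cauchy p =
    \<lparr>carrier = {X. \<forall>e>0. \<exists>M. \<forall>m\<ge>M. \<forall>n\<ge>M. rat_padic_abs p (X m - X n) < e},
     mult = (\<lambda>X Y n. X n * Y n), one = (\<lambda>n. 1),
     zero = (\<lambda>n. 0), add = (\<lambda>X Y n. X n + Y n)\<rparr>"

definition padic_null :: "nat \<Rightarrow> (nat \<Rightarrow> rat) set" where
  "padic_null p = {X. (\<lambda>n. rat_padic_abs p (X n)) \<longlonglongrightarrow> 0}"

type_synonym padic = "(nat \<Rightarrow> rat) set"

definition Qp :: "nat \<Rightarrow> padic ring" where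
  "Qp p = padic_Cauchy p Quot padic_null p"

definition padic_of_rat :: "nat \<Rightarrow> rat \<Rightarrow> padic" where
  "padic_of_rat p q = padic_null p +>\<^bsub>padic_Cauchy p\<^esub> (\<lambda>n. q)"

definition padic_abs :: "nat \<Rightarrow> padic \<Rightarrow> real" where
  "padic_abs p x = (THE r. \<forall>X\<in>x. (\<lambda>n. rat_padic_abs p (X n)) \<longlonglongrightarrow> r)"

definition Zp :: "nat \<Rightarrow> padic ring" where
  "Zp p = (Qp p)\<lparr>carrier := {x \<in> carrier (Qp p). padic_abs p x \<le> 1}\<rparr>"


section \<open>The adele ring of the rational numbers\<close>

text \<open>An adele is a real component together with a family of \<open>p\<close>-adic components; the family
  is \<^const>\<open>undefined\<close> at indices that are not prime.\<close>

type_synonym adele = "real \<times> (nat \<Rightarrow> padic)"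

definition adele_ring :: "adele ring" where
  "adele_ring =
    \<lparr>carrier = {x. snd x \<in> (\<Pi>\<^sub>E p\<in>{p. prime p}. carrier (Qp p)) \<and>
                   finite {p. prime p \<and> snd x p \<notin> carrier (Zp p)}},
     mult = (\<lambda>x y. (fst x * fst y, \<lambda>p\<in>{p. prime p}. snd x p \<otimes>\<^bsub>Qp p\<^esub> snd y p)),
     one = (1, \<lambda>p\<in>{p. prime p}. \<one>\<^bsub>Qp p\<^esub>),
     zero = (0, \<lambda>p\<in>{p. prime p}. \<zero>\<^bsub>Qp p\<^esub>),
     add = (\<lambda>x y. (fst x + fst y, \<lambda>p\<in>{p. prime p}. snd x p \<oplus>\<^bsub>Qp p\<^esub> snd y p))\<rparr>"

text \<open>\<^const>\<open>Prod_any\<close> is the product over all indices when almost all factors are 1, as is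
  the case here for ideles.\<close>

definition adele_abs :: "adele \<Rightarrow> real" where
  "adele_abs x = \<bar>fst x\<bar> * Prod_any (\<lambda>p. if prime p then padic_abs p (snd x p) else 1)"

definition adele_of_rat :: "rat \<Rightarrow> adele" where
  "adele_of_rat q = (of_rat q, \<lambda>p\<in>{p. prime p}. padic_of_rat p q)"

definition comp_inf :: "adele mat2 \<Rightarrow> real mat2" where
  "comp_inf = map_mat2 fst"

definition comp_fin :: "nat \<Rightarrow> adele mat2 \<Rightarrow> padic mat2" where
  "comp_fin p = map_mat2 (\<lambda>x. snd x p)"

definition of_GL2_real :: "real mat2 \<Rightarrow> adele mat2" where
  "of_GL2_real m = Mat2
     (ul m, snd \<one>\<^bsub>adele_ring\<^esub>) (ur m, snd \<zero>\<^bsub>adele_ring\<^esub>)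
     (ll m, snd \<zero>\<^bsub>adele_ring\<^esub>) (lr m, snd \<one>\<^bsub>adele_ring\<^esub>)"

definition O2 :: "real mat2 set" where
  "O2 = {m. m \<otimes>\<^bsub>mat2_monoid real_ring\<^esub> Mat2 (ul m) (ll m) (ur m) (lr m) = \<one>\<^bsub>mat2_monoid real_ring\<^esub>}"

definition max_compact :: "adele mat2 set" where
  "max_compact = {\<kappa> \<in> carrier (GL2 adele_ring).
     comp_inf \<kappa> \<in> O2 \<and> (\<forall>p. prime p \<longrightarrow> comp_fin p \<kappa> \<in> carrier (GL2 (Zp p)))}"


section \<open>Local sections\<close>

text \<open>Functions on a group are taken to be \<^const>\<open>undefined\<close> outside its carrier, so that they
  are determined by their values on the group.\<close>

definition padic_locally_constant :: "nat \<Rightarrow> (padic mat2 \<Rightarrow> complex) \<Rightarrow> bool" where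
  "padic_locally_constant p f \<longleftrightarrow>
    (\<forall>g \<in> carrier (GL2 (Qp p)). \<exists>e>0. \<forall>h \<in> carrier (GL2 (Qp p)).
       padic_abs p (ul h \<ominus>\<^bsub>Qp p\<^esub> ul g) < e \<and> padic_abs p (ur h \<ominus>\<^bsub>Qp p\<^esub> ur g) < e \<and>
       padic_abs p (ll h \<ominus>\<^bsub>Qp p\<^esub> ll g) < e \<and> padic_abs p (lr h \<ominus>\<^bsub>Qp p\<^esub> lr g) < e \<longrightarrow> f h = f g)"

definition V_padic :: "complex \<Rightarrow> nat \<Rightarrow> (padic mat2 \<Rightarrow> complex) set" where
  "V_padic s p = {f \<in> extensional (carrier (GL2 (Qp p))).
     padic_locally_constant p f \<and>
     (\<forall>a \<in> Units (Qp p). \<forall>b \<in> carrier (Qp p). \<forall>d \<in> Units (Qp p). \<forall>g \<in> carrier (GL2 (Qp p)).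
        f (Mat2 a b \<zero>\<^bsub>Qp p\<^esub> d \<otimes>\<^bsub>GL2 (Qp p)\<^esub> g) =
        complex_of_real (padic_abs p (a \<otimes>\<^bsub>Qp p\<^esub> inv\<^bsub>Qp p\<^esub> d)) powr (s + 1/2) * f g)}"

definition right_translate ::
    "('g, 'm) monoid_scheme \<Rightarrow> 'g \<Rightarrow> ('g \<Rightarrow> complex) \<Rightarrow> 'g \<Rightarrow> complex" where
  "right_translate G h f = (\<lambda>g\<in>carrier G. f (g \<otimes>\<^bsub>G\<^esub> h))"

definition f_sph :: "complex \<Rightarrow> nat \<Rightarrow> padic mat2 \<Rightarrow> complex" where
  "f_sph s p = (THE f. f \<in> V_padic s p \<and>
     (\<forall>k \<in> carrier (GL2 (Zp p)). right_translate (GL2 (Qp p)) k f = f) \<and>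
     f \<one>\<^bsub>GL2 (Qp p)\<^esub> = 1)"

definition f_St :: "nat \<Rightarrow> padic mat2 \<Rightarrow> complex" where
  "f_St p = (\<lambda>g\<in>carrier (GL2 (Qp p)). 1 / (1 - of_nat p) *
     (f_sph (1/2) p g -
      right_translate (GL2 (Qp p)) (Mat2 \<one>\<^bsub>Qp p\<^esub> \<zero>\<^bsub>Qp p\<^esub> \<zero>\<^bsub>Qp p\<^esub> (padic_of_rat p (of_nat p)))
        (f_sph (1/2) p) g))"

definition rot2 :: "real \<Rightarrow> real mat2" where
  "rot2 \<theta> = Mat2 (cos \<theta>) (sin \<theta>) (- sin \<theta>) (cos \<theta>)"

text \<open>The condition is consistent only for even \<open>k\<close>, because \<open>rot2 pi\<close> is also upper
  triangular.\<close>

definition f_real :: "int \<Rightarrow> complex \<Rightarrow> real mat2 \<Rightarrow> complex" where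
  "f_real k s = (THE f. f \<in> extensional (carrier (GL2 real_ring)) \<and>
     (\<forall>a b d \<theta>. a \<noteq> 0 \<longrightarrow> d \<noteq> 0 \<longrightarrow>
        f (Mat2 a b 0 d \<otimes>\<^bsub>GL2 real_ring\<^esub> rot2 \<theta>) =
        complex_of_real \<bar>a / d\<bar> powr (s + 1/2) * exp (\<i> * of_int k * of_real \<theta>)))"


section \<open>Global sections and Eisenstein series\<close>

definition pure_tensor ::
    "(real mat2 \<Rightarrow> complex) \<Rightarrow> (nat \<Rightarrow> padic mat2 \<Rightarrow> complex) \<Rightarrow> adele mat2 \<Rightarrow> complex" where
  "pure_tensor f\<^sub>r f\<^sub>p = (\<lambda>g\<in>carrier (GL2 adele_ring).
     f\<^sub>r (comp_inf g) * Prod_any (\<lambda>p. if prime p then f\<^sub>p p (comp_fin p g) else 1))"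

definition height_quot :: "adele mat2 \<Rightarrow> real" where
  "height_quot g = (THE r. \<exists>a \<in> Units adele_ring. \<exists>b \<in> carrier adele_ring.
     \<exists>d \<in> Units adele_ring. \<exists>\<kappa> \<in> max_compact.
       g = Mat2 a b \<zero>\<^bsub>adele_ring\<^esub> d \<otimes>\<^bsub>GL2 adele_ring\<^esub> \<kappa> \<and>
       r = adele_abs (a \<otimes>\<^bsub>adele_ring\<^esub> inv\<^bsub>adele_ring\<^esub> d))"

definition flat_section ::
    "complex \<Rightarrow> (adele mat2 \<Rightarrow> complex) \<Rightarrow> complex \<Rightarrow> adele mat2 \<Rightarrow> complex" where
  "flat_section s\<^sub>0 f s = (\<lambda>g\<in>carrier (GL2 adele_ring).
     complex_of_real (height_quot g) powr (s - s\<^sub>0) * f g)"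

text \<open>\<open>eisenstein_sum f g E\<close> says that \<open>E\<close> is the sum of \<open>f (\<gamma> g)\<close> over representatives
  \<open>\<gamma>\<close> of the cosets \<open>B(Q) \<gamma>\<close> in \<open>G(Q)\<close>.
  The choice of the representative is immaterial when \<open>f\<close> is left invariant under \<open>B(\<rat>)\<close>.\<close>

definition eisenstein_sum :: "(adele mat2 \<Rightarrow> complex) \<Rightarrow> adele mat2 \<Rightarrow> complex \<Rightarrow> bool" where
  "eisenstein_sum f g E \<longleftrightarrow>
     ((\<lambda>C. f (map_mat2 adele_of_rat (SOME \<gamma>. \<gamma> \<in> C) \<otimes>\<^bsub>GL2 adele_ring\<^esub> g)) has_sum E)
       (rcosets\<^bsub>GL2 rat_ring\<^esub> (borel2 rat_ring))"

text \<open>The limit at \<open>s\<^sub>0\<close> of the analytic continuation of the series along the flat section.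
  Any half-plane containing \<open>s\<^sub>0\<close> and the region of convergence may serve as the domain of the
  continuation, which by the identity theorem does not affect the limit.\<close>

definition eisenstein :: "complex \<Rightarrow> (adele mat2 \<Rightarrow> complex) \<Rightarrow> adele mat2 \<Rightarrow> complex" where
  "eisenstein s\<^sub>0 f g = (THE E. \<exists>F c. c < Re s\<^sub>0 \<and> c < 1/2 \<and>
     F meromorphic_on {s. Re s > c} \<and>
     (\<forall>s. Re s > 1/2 \<longrightarrow> eisenstein_sum (flat_section s\<^sub>0 f s) g (F s)) \<and>
     (F \<longlongrightarrow> E) (at s\<^sub>0))"

definition uhp_function :: "(adele mat2 \<Rightarrow> complex) \<Rightarrow> complex \<Rightarrow> complex" where
  "uhp_function \<Phi> z = inverse (of_real (Im z)) *
     \<Phi> (of_GL2_real (Mat2 1 (Re z) 0 1 \<otimes>\<^bsub>GL2 real_ring\<^esub> Mat2 (Im z) 0 0 1))"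

definition f2 :: "nat \<Rightarrow> adele mat2 \<Rightarrow> complex" where
  "f2 N = pure_tensor (f_real 2 (1/2)) (\<lambda>p. if p dvd N then f_St p else f_sph (1/2) p)"


section \<open>Modular forms and arithmetic functions\<close>

definition upper_half_plane :: "complex set" where
  "upper_half_plane = {z. Im z > 0}"

definition Gamma0 :: "nat \<Rightarrow> int mat2 set" where
  "Gamma0 N = {m. ul m * lr m - ur m * ll m = 1 \<and> int N dvd ll m}"

definition slash :: "int \<Rightarrow> (complex \<Rightarrow> complex) \<Rightarrow> int mat2 \<Rightarrow> complex \<Rightarrow> complex" where
  "slash k f m z = (of_int (ll m) * z + of_int (lr m)) powi (-k) *
     f ((of_int (ul m) * z + of_int (ur m)) / (of_int (ll m) * z + of_int (lr m)))"

text \<open>The last condition is holomorphy at all cusps, in the form that every translate under the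
  full modular group \<open>Gamma0 1\<close> is bounded near \<open>\<i>\<infinity>\<close>.\<close>

definition modular_form :: "int \<Rightarrow> int mat2 set \<Rightarrow> (complex \<Rightarrow> complex) \<Rightarrow> bool" where
  "modular_form k \<Gamma> f \<longleftrightarrow>
     f holomorphic_on upper_half_plane \<and>
     (\<forall>m\<in>\<Gamma>. \<forall>z\<in>upper_half_plane. slash k f m z = f z) \<and>
     (\<forall>m\<in>Gamma0 1. \<exists>C M. \<forall>z\<in>upper_half_plane. Im z \<ge> M \<longrightarrow> norm (slash k f m z) \<le> C)"

definition moebius_mu :: "nat \<Rightarrow> int" where
  "moebius_mu n = (if squarefree n then (-1) ^ card (prime_factors n) else 0)"

definition divisor_sum :: "nat \<Rightarrow> nat" where
  "divisor_sum n = (\<Sum>d | d dvd n. d)"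

definition coprime_part :: "nat \<Rightarrow> nat \<Rightarrow> nat" where
  "coprime_part N n = (\<Prod>p | p \<in> prime_factors n \<and> \<not> p dvd N. p ^ multiplicity p n)"

end

theory Submission
  imports Defs
begin

text \<open>The cosets of \<open>B(\<rat>)\<close> in \<open>GL(2, \<rat>)\<close> are indexed by primitive bottom rows \<open>(c, d)\<close> up to
  sign. By the product formula, the flat section at such a coset is
  \<open>y powr (1 + t) * psi N c * (c z + d) ^ -2 * \<bar>c z + d\<bar> powr (-2 t)\<close> with \<open>t = s - 1/2\<close>,
  where \<open>psi N c\<close> collects the values of the Steinberg vectors at the primes dividing \<open>N\<close>.
  Multiplying by the sum over integers prime to \<open>N\<close> replaces the primitive pairs by all
  integer pairs, weighted by a function that is periodic modulo \<open>N\<close> and, as \<open>N > 1\<close>, has mean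
  value zero over a period. Summation over the \<open>N \<times> N\<close> blocks therefore gains a power of
  \<open>c z + d\<close>, so that the series continues to \<open>Re t > -1/2\<close> without analytic continuation of
  zeta functions and \<open>t = 0\<close> may simply be inserted. The value there is summed row by row with
  the Lipschitz formula, which gives the \<open>q\<close>-expansion and boundedness near \<open>\<i>\<infinity>\<close>; a
  unimodular substitution only permutes the pairs and moves the weight.\<close>

section \<open>Lattice sums and the Lipschitz formula\<close>

text \<open>The obstacle is that \<open>s = 1/2\<close> lies on the edge of convergence. In weight 2
  the sum of (c z + d)^-2 over the lattice converges only conditionally, and in level one its
  continuation leaves a multiple of 1 / Im z that spoils holomorphy. A Steinberg factor removes this
  term: relative to the spherical vector it is 1 at one of the p + 1 points of the projective line
  modulo p and -1/p at the other p, so it has mean zero there. Extended by 0 to pairs divisible by p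
  it still has mean zero modulo p, and one prime of \<open>N\<close> makes the whole weight cancel
  over a period. The value 0 also makes the division by the sum over integers exact: the weight is
  supported on the pairs whose gcd is prime to \<open>N\<close>, and each of these is n (c, d) in
  exactly one way, with n prime to \<open>N\<close> and (c, d) primitive up to sign. The constant 24
  is 8 pi^2, from the Lipschitz formula and the two signs of c, divided by pi^2 / 3, the sum of 1 /
  n^2 over the nonzero integers; the Euler factors 1 - p^-2 occur in both and cancel.\<close>

lemma has_sum_int_split:
  fixes f :: "int \<Rightarrow> 'a::{topological_comm_monoid_add}"
  assumes "((\<lambda>n. f (int n)) has_sum a) UNIV" "((\<lambda>n. f (- 1 - int n)) has_sum b) UNIV"
  shows "(f has_sum (a + b)) UNIV"
proof -
  have "(f has_sum a) (range int)"
    using assms(1) by (subst has_sum_reindex) (auto simp: o_def)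
  moreover have "(f has_sum b) (range (\<lambda>n. - 1 - int n))"
    using assms(2) by (subst has_sum_reindex) (auto simp: o_def inj_on_def)
  ultimately have "(f has_sum (a + b)) (range int \<union> range (\<lambda>n. - 1 - int n))"
    by (intro has_sum_Un_disjoint) auto
  also have "range int \<union> range (\<lambda>n. - 1 - int n) = UNIV"
  proof -
    have "x \<in> range int \<or> x \<in> range (\<lambda>n. - 1 - int n)" for x :: int
    proof (cases "x \<ge> 0")
      case True
      then show ?thesis by (metis nonneg_int_cases rangeI)
    next
      case False
      then have "x = - 1 - int (nat (- 1 - x))" by simp
      then show ?thesis by blast
    qed
    then show ?thesis by blast
  qed
  finally show ?thesis .
qed

lemma summable_on_int_powr:
  assumes "b > 1"
  shows "(\<lambda>n::int. (1 + \<bar>real_of_int n\<bar>) powr (- b)) summable_on UNIV"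
proof -
  have *: "summable (\<lambda>n. real n powr (- b))"
    using assms by (subst summable_real_powr_iff) auto
  have "summable (\<lambda>n. (1 + real n) powr (- b))"
    using summable_Suc_iff[THEN iffD2, OF *] by (simp add: add.commute)
  then have 1: "(\<lambda>n. (1 + real n) powr (- b)) summable_on UNIV"
    by (subst summable_on_UNIV_nonneg_real_iff) auto
  have "summable (\<lambda>n. (2 + real n) powr (- b))"
    using summable_Suc_iff[THEN iffD2, OF summable_Suc_iff[THEN iffD2, OF *]] by (simp add: add.commute)
  then have 2: "(\<lambda>n. (2 + real n) powr (- b)) summable_on UNIV"
    by (subst summable_on_UNIV_nonneg_real_iff) auto
  from 1 2 obtain x y where
    "((\<lambda>n. (1 + real n) powr (- b)) has_sum x) UNIV"
    "((\<lambda>n. (2 + real n) powr (- b)) has_sum y) UNIV"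
    unfolding summable_on_def by blast
  then have "((\<lambda>n::int. (1 + \<bar>real_of_int n\<bar>) powr (- b)) has_sum (x + y)) UNIV"
    by (intro has_sum_int_split) (simp_all add: abs_if algebra_simps)
  then show ?thesis
    by (auto simp: summable_on_def)
qed

text \<open>The product, in place of a norm of (k, l), makes the double sum a product of two single
  sums.\<close>

lemma summable_on_int2_powr:
  assumes "b > 1"
  shows "(\<lambda>(k::int, l::int). ((1 + \<bar>real_of_int k\<bar>) * (1 + \<bar>real_of_int l\<bar>)) powr (- b)) summable_on UNIV"
proof -
  obtain S where S: "((\<lambda>n::int. (1 + \<bar>real_of_int n\<bar>) powr (- b)) has_sum S) UNIV"
    using summable_on_int_powr[OF assms] unfolding summable_on_def by blast
  have "(\<lambda>x. ((1 + \<bar>real_of_int (fst x)\<bar>) powr (- b)) * (1 + \<bar>real_of_int (snd x)\<bar>) powr (- b))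
      summable_on (UNIV :: int set) \<times> (UNIV :: int set)"
    apply (rule summable_on_SigmaI[where g = "\<lambda>k. (1 + \<bar>real_of_int k\<bar>) powr (- b) * S"])
    subgoal by (simp add: has_sum_cmult_right S)
    subgoal using S by (intro summable_on_cmult_left) (auto simp: summable_on_def)
    by auto
  then show ?thesis
    by (simp add: case_prod_unfold powr_mult)
qed

text \<open>If |l| is at least 2 (1 + |Re z|) |k|, the real part of k z + l keeps half of |l|.
  Otherwise |k| controls the maximum and the imaginary part k Im z is large enough. The constant is
  the smaller of the two resulting ratios.\<close>

lemma lattice_norm_ge:
  assumes "Im z > 0"
  obtains c where "c > 0" "c \<le> 1"
    "\<And>k l :: int. norm (of_int k * z + of_int l) \<ge> c * max \<bar>real_of_int k\<bar> \<bar>real_of_int l\<bar>"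
proof -
  define R where "R = 1 + \<bar>Re z\<bar>"
  define c where "c = min (1/2) (Im z / (2 * R))"
  have R: "R \<ge> 1" by (simp add: R_def)
  have c: "c > 0" "c \<le> 1/2" "c * (2 * R) \<le> Im z" "c \<le> Im z / (2 * R)"
    using assms R by (auto simp: c_def min_def field_simps)
  have "norm (of_int k * z + of_int l) \<ge> c * max \<bar>real_of_int k\<bar> \<bar>real_of_int l\<bar>" for k l :: int
  proof (cases "\<bar>real_of_int l\<bar> \<ge> 2 * R * \<bar>real_of_int k\<bar>")
    case True
    have "\<bar>real_of_int k * Re z\<bar> \<le> R * \<bar>real_of_int k\<bar>"
      unfolding abs_mult by (subst mult.commute, intro mult_right_mono) (auto simp: R_def)
    with True have 1: "\<bar>real_of_int k * Re z + real_of_int l\<bar> \<ge> \<bar>real_of_int l\<bar> / 2" by linarith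
    have "1 * \<bar>real_of_int k\<bar> \<le> 2 * R * \<bar>real_of_int k\<bar>"
      using R by (intro mult_right_mono) auto
    then have 2: "max \<bar>real_of_int k\<bar> \<bar>real_of_int l\<bar> = \<bar>real_of_int l\<bar>" using True by simp
    have "c * \<bar>real_of_int l\<bar> \<le> (1/2) * \<bar>real_of_int l\<bar>"
      using c by (intro mult_right_mono) auto
    also have "\<dots> \<le> \<bar>Re (of_int k * z + of_int l)\<bar>" using 1 by simp
    also have "\<dots> \<le> norm (of_int k * z + of_int l)" by (rule abs_Re_le_cmod)
    finally show ?thesis unfolding 2 .
  next
    case False
    have "1 * \<bar>real_of_int k\<bar> \<le> 2 * R * \<bar>real_of_int k\<bar>"
      using R by (intro mult_right_mono) auto
    then have "max \<bar>real_of_int k\<bar> \<bar>real_of_int l\<bar> \<le> 2 * R * \<bar>real_of_int k\<bar>" using False by simp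
    then have "c * max \<bar>real_of_int k\<bar> \<bar>real_of_int l\<bar> \<le> c * (2 * R * \<bar>real_of_int k\<bar>)"
      using c by (intro mult_left_mono) auto
    also have "\<dots> = (c * (2 * R)) * \<bar>real_of_int k\<bar>" by simp
    also have "\<dots> \<le> Im z * \<bar>real_of_int k\<bar>"
      using c by (intro mult_right_mono) auto
    also have "\<dots> = \<bar>Im (of_int k * z + of_int l)\<bar>" using assms by (simp add: abs_mult)
    also have "\<dots> \<le> norm (of_int k * z + of_int l)" by (rule abs_Im_le_cmod)
    finally show ?thesis .
  qed
  with c show ?thesis by (intro that[of c]) auto
qed

text \<open>For a nonzero pair the maximum is at least 1, so 1 + |k| and 1 + |l| are at most twice
  the maximum. The product form is the one that \<open>summable_on_int2_powr\<close> can
  sum.\<close>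

lemma lattice_norm_ge':
  assumes "Im z > 0"
  obtains c where "c > 0" 
    "\<And>k l :: int. (k, l) \<noteq> (0, 0) \<Longrightarrow>
      norm (of_int k * z + of_int l) ^ 2 \<ge> c * ((1 + \<bar>real_of_int k\<bar>) * (1 + \<bar>real_of_int l\<bar>))"
proof -
  obtain c where c: "c > 0" "c \<le> 1"
    "\<And>k l :: int. norm (of_int k * z + of_int l) \<ge> c * max \<bar>real_of_int k\<bar> \<bar>real_of_int l\<bar>"
    using lattice_norm_ge[OF assms] by blast
  have "norm (of_int k * z + of_int l) ^ 2 \<ge> (c^2/4) * ((1 + \<bar>real_of_int k\<bar>) * (1 + \<bar>real_of_int l\<bar>))"
    if kl: "(k, l) \<noteq> (0, 0)" for k l :: int
  proof -
    define m where "m = max \<bar>real_of_int k\<bar> \<bar>real_of_int l\<bar>"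
    have m: "m \<ge> 1" using kl by (auto simp: m_def max_def)
    have "(1 + \<bar>real_of_int k\<bar>) * (1 + \<bar>real_of_int l\<bar>) \<le> (2 * m) * (2 * m)"
      using m by (intro mult_mono) (auto simp: m_def)
    then have "(c^2/4) * ((1 + \<bar>real_of_int k\<bar>) * (1 + \<bar>real_of_int l\<bar>)) \<le> (c^2/4) * ((2 * m) * (2 * m))"
      by (intro mult_left_mono) auto
    also have "\<dots> = (c * m) ^ 2" by (simp add: power2_eq_square)
    also have "\<dots> \<le> norm (of_int k * z + of_int l) ^ 2"
      using c(1,3) m by (intro power_mono) (auto simp: m_def)
    finally show ?thesis .
  qed
  with c show ?thesis by (intro that[of "c^2/4"]) auto
qed

section \<open>The Lipschitz formula\<close>

lemma abs_summable_inverse_shifted_square: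
  assumes "Im w \<noteq> 0"
  shows "(\<lambda>d::int. norm (1 / (w + of_int d)^2)) summable_on UNIV"
proof -
  have main: "(\<lambda>d::int. norm (1 / (w + of_int d)^2)) summable_on UNIV" if Im: "Im w > 0" for w
  proof -
    obtain c where c: "c > 0" "c \<le> 1"
      "\<And>k l :: int. norm (of_int k * w + of_int l) \<ge> c * max \<bar>real_of_int k\<bar> \<bar>real_of_int l\<bar>"
      using lattice_norm_ge[OF Im] by blast
    have sq: "(1 + \<bar>real_of_int n\<bar>) powr - 2 = 1 / (1 + \<bar>real_of_int n\<bar>) ^ 2" for n
      by (simp add: powr_minus_divide)
    have "(\<lambda>d::int. 4 / c^2 * (1 + \<bar>real_of_int d\<bar>) powr (- 2)) summable_on UNIV"
      by (intro summable_on_cmult_right summable_on_int_powr) auto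
    then show ?thesis
    proof (rule Infinite_Sum.abs_summable_on_comparison_test')
      fix d :: int
      have "c * (1 + \<bar>real_of_int d\<bar>) / 2 \<le> c * max 1 \<bar>real_of_int d\<bar>"
        using c(1) by (auto simp: max_def)
      also have "\<dots> \<le> norm (w + of_int d)" using c(3)[of 1 d] by simp
      finally have "(c * (1 + \<bar>real_of_int d\<bar>) / 2)^2 \<le> norm (w + of_int d)^2"
        using c(1) by (intro power_mono) auto
      then have "1 / norm (w + of_int d)^2 \<le> 1 / (c * (1 + \<bar>real_of_int d\<bar>) / 2)^2"
        using c(1) by (intro divide_left_mono mult_pos_pos zero_less_power order_less_le_trans[OF _ \<open>(c * (1 + \<bar>real_of_int d\<bar>) / 2)^2 \<le> norm (w + of_int d)^2\<close>]) (auto intro!: divide_pos_pos mult_pos_pos add_pos_nonneg)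
      also have "\<dots> = 4 / c\<^sup>2 * (1 + \<bar>real_of_int d\<bar>) powr - 2"
        unfolding sq by (simp add: power_divide power_mult_distrib)
      finally show "norm (1 / (w + of_int d)^2) \<le> 4 / c\<^sup>2 * (1 + \<bar>real_of_int d\<bar>) powr - 2"
        by (simp add: norm_divide norm_power)
    qed
  qed
  show ?thesis
  proof (cases "Im w > 0")
    case False
    \<comment> \<open>Squares do not see signs, so negating both \<open>w\<close> and
      \<open>d\<close> carries the lower half plane to the upper one.\<close>
    with assms have "(\<lambda>d::int. norm (1 / (- w + of_int d)^2)) summable_on UNIV"
      by (intro main) auto
    also have "?this \<longleftrightarrow> (\<lambda>d::int. norm (1 / (- w + of_int (- d))^2)) summable_on UNIV"
      by (intro summable_on_reindex_bij_betw[symmetric] bij_betw_byWitness[of _ uminus]) auto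
    also have "(\<lambda>d::int. norm (1 / (- w + of_int (- d))^2)) = (\<lambda>d. norm (1 / (w + of_int d)^2))"
      by (intro ext) (simp add: norm_divide norm_power norm_minus_commute norm_minus_cancel[symmetric, of "- w - _"] add.commute)
    finally show ?thesis .
  qed (use main in auto)
qed

text \<open>The function Gamma(w) Gamma(1 - w) sin(pi w) is constant. Its derivative gives the
  cotangent formula for the difference of two Digamma values, and differentiating that formula gives
  the claim.\<close>

lemma Polygamma_1_reflection:
  fixes z :: complex
  assumes "z \<notin> \<int>"
  shows "Polygamma 1 z + Polygamma 1 (1 - z) = of_real pi ^ 2 / sin (of_real pi * z) ^ 2"
proof -
  have sin_nz: "sin (of_real pi * w) \<noteq> 0" if "w \<notin> \<int>" for w :: complex
    using that sin_eq_0[of "of_real pi * w"] by auto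
  have nonint: "w \<notin> \<int>\<^sub>\<le>\<^sub>0 \<and> 1 - w \<notin> \<int>\<^sub>\<le>\<^sub>0" if "w \<notin> \<int>" for w :: complex
    using that nonpos_Ints_Int Ints_diff[of 1 "1 - w"] by auto
  have op: "open (- \<int> :: complex set)"
    using closed_Ints by blast
  have dig: "Digamma w - Digamma (1 - w) = - of_real pi * cos (of_real pi * w) / sin (of_real pi * w)"
    if w: "w \<notin> \<int>" for w :: complex
  proof -
    have "((\<lambda>w. Gamma w * Gamma (1 - w) * sin (of_real pi * w)) has_field_derivative
        (Gamma w * Digamma w) * Gamma (1 - w) * sin (of_real pi * w)
        - Gamma w * (Gamma (1 - w) * Digamma (1 - w)) * sin (of_real pi * w)
        + Gamma w * Gamma (1 - w) * (of_real pi * cos (of_real pi * w))) (at w)"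
      using nonint[OF w] by (auto intro!: derivative_eq_intros simp: algebra_simps)
    moreover have "((\<lambda>w. Gamma w * Gamma (1 - w) * sin (of_real pi * w)) has_field_derivative 0) (at w)"
    proof (rule has_field_derivative_transform_within_open[OF _ op])
      show "((\<lambda>_. of_real pi) has_field_derivative 0) (at w)" by simp
      show "of_real pi = Gamma x * Gamma (1 - x) * sin (of_real pi * x)" if "x \<in> - \<int>" for x :: complex
        using sin_nz[of x] that by (simp add: Gamma_reflection_complex)
    qed (use w in auto)
    ultimately have "(Gamma w * Digamma w) * Gamma (1 - w) * sin (of_real pi * w)
        - Gamma w * (Gamma (1 - w) * Digamma (1 - w)) * sin (of_real pi * w)
        + Gamma w * Gamma (1 - w) * (of_real pi * cos (of_real pi * w)) = 0"
      by (rule DERIV_unique)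
    then have "(Gamma w * Gamma (1 - w)) * ((Digamma w - Digamma (1 - w)) * sin (of_real pi * w)
        + of_real pi * cos (of_real pi * w)) = 0"
      by (simp add: algebra_simps)
    moreover have "Gamma w * Gamma (1 - w) \<noteq> 0"
      using nonint[OF w] by (simp add: Gamma_eq_zero_iff)
    ultimately have "(Digamma w - Digamma (1 - w)) * sin (of_real pi * w)
        + of_real pi * cos (of_real pi * w) = 0" by simp
    then show ?thesis
      using sin_nz[OF w] by (simp add: field_simps eq_neg_iff_add_eq_0)
  qed
  have "((\<lambda>w. Digamma w - Digamma (1 - w)) has_field_derivative Polygamma 1 z + Polygamma 1 (1 - z)) (at z)"
    using nonint[OF assms] by (auto intro!: derivative_eq_intros)
  moreover have "((\<lambda>w. Digamma w - Digamma (1 - w)) has_field_derivative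
      of_real pi ^ 2 / sin (of_real pi * z) ^ 2) (at z)"
  proof (rule has_field_derivative_transform_within_open[OF _ op])
    have alg: "- p * ((- s * p * s - c * (c * p)) / (s * s)) = p ^ 2 * (s ^ 2 + c ^ 2) / s ^ 2"
      for p s c :: complex
      unfolding times_divide_eq_right power2_eq_square
      by (rule arg_cong2[where f = "(/)"]) (simp_all add: algebra_simps)
    let ?s = "sin (of_real pi * z)" and ?c = "cos (of_real pi * z)"
    have "((\<lambda>w. cos (of_real pi * w) / sin (of_real pi * w)) has_field_derivative
        (- ?s * of_real pi * ?s - ?c * (?c * of_real pi)) / (?s * ?s)) (at z)"
      using sin_nz[OF assms] by (auto intro!: derivative_eq_intros simp: mult_ac)
    from DERIV_cmult[OF this, of "- of_real pi"]
    have "((\<lambda>w. - of_real pi * cos (of_real pi * w) / sin (of_real pi * w)) has_field_derivative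
        - of_real pi * ((- ?s * of_real pi * ?s - ?c * (?c * of_real pi)) / (?s * ?s))) (at z)"
      by (simp only: times_divide_eq_right)
    also have "- of_real pi * ((- ?s * of_real pi * ?s - ?c * (?c * of_real pi)) / (?s * ?s))
        = of_real pi ^ 2 * (?s ^ 2 + ?c ^ 2) / ?s ^ 2"
      by (rule alg)
    finally show "((\<lambda>w. - of_real pi * cos (of_real pi * w) / sin (of_real pi * w)) has_field_derivative
        of_real pi ^ 2 / ?s ^ 2) (at z)" by simp
  qed (use assms dig in auto)
  ultimately show ?thesis by (rule DERIV_unique)
qed

text \<open>The terms with d >= 0 and those with d < 0 add up to the trigamma values at w and 1 - w,
  which the reflection formula combines to pi^2 / sin^2. The quotient q / (1 - q)^2 is left
  unexpanded; its expansion into n q^n is postponed until divisor sums are formed.\<close>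

lemma lipschitz_formula:
  assumes "Im w > 0"
  defines "q \<equiv> exp (2 * of_real pi * \<i> * w)"
  shows "((\<lambda>d::int. 1 / (w + of_int d)^2) has_sum (- 4 * of_real pi ^ 2 * (q / (1 - q)^2))) UNIV"
proof -
  have w: "w \<notin> \<int>" using assms(1) by (auto elim!: Ints_cases)
  let ?f = "\<lambda>d::int. 1 / (w + of_int d)^2"
  have abs: "(\<lambda>d. norm (?f d)) summable_on UNIV"
    using abs_summable_inverse_shifted_square[of w] assms by simp
  have nz: "w \<noteq> 0" "1 - w \<noteq> 0" using w by auto
  have 1: "((\<lambda>n. ?f (int n)) has_sum Polygamma 1 w) UNIV"
  proof -
    have "(\<lambda>n. ?f (int n)) summable_on UNIV"
      using summable_on_subset_banach[OF Infinite_Sum.abs_summable_summable[OF abs] subset_UNIV, of "range int"]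
      by (subst (asm) summable_on_reindex) (auto simp: o_def)
    then obtain S where S: "((\<lambda>n. ?f (int n)) has_sum S) UNIV" unfolding summable_on_def by blast
    then have "(\<lambda>n. ?f (int n)) sums S" by (rule has_sum_imp_sums)
    moreover have "(\<lambda>n. ?f (int n)) sums Polygamma 1 w"
      using summable_sums[OF Polygamma_converges'[OF nz(1), of 2]]
      by (simp add: Polygamma_def inverse_eq_divide numeral_2_eq_2)
    ultimately have "S = Polygamma 1 w" by (rule sums_unique2)
    with S show ?thesis by simp
  qed
  have 2: "((\<lambda>n. ?f (- 1 - int n)) has_sum Polygamma 1 (1 - w)) UNIV"
  proof -
    have eq: "?f (- 1 - int n) = 1 / (1 - w + of_nat n)^2" for n
    proof -
      have "w + of_int (- 1 - int n) = - (1 - w + of_nat n)" by simp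
      then show ?thesis by (metis power2_minus)
    qed
    have "(\<lambda>n. ?f (- 1 - int n)) summable_on UNIV"
      using summable_on_subset_banach[OF Infinite_Sum.abs_summable_summable[OF abs] subset_UNIV, of "range (\<lambda>n. - 1 - int n)"]
      by (subst (asm) summable_on_reindex) (auto simp: o_def inj_on_def)
    then obtain S where S: "((\<lambda>n. ?f (- 1 - int n)) has_sum S) UNIV" unfolding summable_on_def by blast
    then have "(\<lambda>n. ?f (- 1 - int n)) sums S" by (rule has_sum_imp_sums)
    moreover have "(\<lambda>n. ?f (- 1 - int n)) sums Polygamma 1 (1 - w)"
      using summable_sums[OF Polygamma_converges'[OF nz(2), of 2]]
      unfolding eq by (simp add: Polygamma_def inverse_eq_divide numeral_2_eq_2)
    ultimately have "S = Polygamma 1 (1 - w)" by (rule sums_unique2)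
    with S show ?thesis by simp
  qed
  have "(?f has_sum (of_real pi ^ 2 / sin (of_real pi * w) ^ 2)) UNIV"
    using has_sum_int_split[OF 1 2] unfolding Polygamma_1_reflection[OF w] .
  moreover have "of_real pi ^ 2 / sin (of_real pi * w) ^ 2 = - 4 * of_real pi ^ 2 * (q / (1 - q)^2)"
  proof -
    define e where "e = exp (\<i> * (of_real pi * w))"
    have e: "e \<noteq> 0" "q = e ^ 2" by (auto simp: e_def q_def exp_double[symmetric] algebra_simps)
    have "sin (of_real pi * w) = (e - inverse e) / (2 * \<i>)"
      by (simp add: sin_exp_eq e_def exp_minus)
    then have "sin (of_real pi * w) = (q - 1) / (2 * \<i> * e)"
      using e by (simp add: field_simps power2_eq_square)
    then have "sin (of_real pi * w) ^ 2 = - ((1 - q)^2 / (4 * q))"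
      using e by (simp add: power_divide power_mult_distrib power2_commute)
    then show ?thesis by (simp add: field_simps)
  qed
  ultimately show ?thesis by simp
qed

section \<open>Hecke sums with periodic weights\<close>

text \<open>The summand of Hecke's series of weight 2. Division by zero makes it vanish at w = 0, so
  sums may run over all integer pairs, (0, 0) included.\<close>

definition hecke_kernel :: "complex \<Rightarrow> complex \<Rightarrow> complex" where
  "hecke_kernel t w = of_real (norm w) powr (- 2 * t) / w ^ 2"

lemma hecke_kernel_0 [simp]: "hecke_kernel t 0 = 0"
  by (simp add: hecke_kernel_def)

lemma hecke_kernel_at_0: "hecke_kernel 0 w = 1 / w ^ 2"
  by (simp add: hecke_kernel_def)

text \<open>This splits off the automorphy factor under a substitution, and the common divisor of a
  pair of integers.\<close>

lemma hecke_kernel_mult: "hecke_kernel t (v * w) = hecke_kernel t v * hecke_kernel t w"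
  by (simp add: hecke_kernel_def norm_mult powr_times_real power_mult_distrib)

lemma norm_hecke_kernel: "norm (hecke_kernel t w) = norm w powr (- 2 * Re t - 2)"
proof (cases "w = 0")
  case False
  then show ?thesis
    by (simp add: hecke_kernel_def norm_divide norm_power norm_powr_real_powr powr_diff)
qed simp

lemma holomorphic_hecke_kernel [holomorphic_intros]: "(\<lambda>t. hecke_kernel t w) holomorphic_on A"
proof (cases "w = 0")
  case False
  then show ?thesis
    unfolding hecke_kernel_def by (intro holomorphic_intros) auto
qed simp

text \<open>Mean value inequality on the segment from r/2 to 2r. There x/r is within a factor 2 of 1
  and the exponent of the derivative is at most 2T + 1 in absolute value, which costs the factor
  \<open>2 powr (2 * T + 1)\<close>. The bound is uniform in t, as the Weierstrass test will
  require.\<close>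

lemma norm_of_real_powr_diff_le:
  fixes t :: complex
  assumes "1 \<le> r" "r / 2 \<le> r'" "r' \<le> 2 * r" "norm t \<le> T" "Re t \<ge> - \<sigma>"
  shows "norm (of_real r' powr (- 2 * t) - of_real r powr (- 2 * t) :: complex)
    \<le> 2 * T * 2 powr (2 * T + 1) * r powr (2 * \<sigma> - 1) * \<bar>r' - r\<bar>"
proof -
  define S where "S = closed_segment (complex_of_real (r/2)) (of_real (2 * r))"
  have S: "S = complex_of_real ` {r / 2..2 * r}"
    unfolding S_def closed_segment_of_real using assms by (simp add: closed_segment_eq_real_ivl)
  have T: "T \<ge> 0" using assms(4) norm_ge_zero[of t] by linarith
  have "norm (of_real r' powr (- 2 * t) - of_real r powr (- 2 * t) :: complex)
    \<le> (2 * T * 2 powr (2 * T + 1) * r powr (2 * \<sigma> - 1)) * norm (of_real r' - of_real r :: complex)"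
  proof (rule field_differentiable_bound[where S = S])
    show "convex S" unfolding S_def by (rule convex_closed_segment)
    fix z assume "z \<in> S"
    then obtain x where x: "z = of_real x" "r / 2 \<le> x" "x \<le> 2 * r" unfolding S by auto
    have xpos: "x > 0" using x assms by linarith
    then have "z \<notin> \<real>\<^sub>\<le>\<^sub>0" using x by (auto simp: complex_nonpos_Reals_iff)
    then show "((\<lambda>z. z powr (- 2 * t)) has_field_derivative (- 2 * t) * z powr (- 2 * t - 1)) (at z within S)"
      by (intro has_field_derivative_at_within[OF has_field_derivative_powr])
    have "norm (z powr (- 2 * t - 1)) = x powr (- 2 * Re t - 1)"
      using xpos unfolding x(1) by (simp add: norm_powr_real_powr)
    also have "\<dots> = r powr (- 2 * Re t - 1) * (x / r) powr (- 2 * Re t - 1)"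
      using xpos assms by (simp add: powr_divide)
    also have "\<dots> \<le> r powr (2 * \<sigma> - 1) * 2 powr (2 * T + 1)"
    proof (rule mult_mono)
      show "r powr (- 2 * Re t - 1) \<le> r powr (2 * \<sigma> - 1)"
        using assms by (intro powr_mono) auto
      define u where "u = x / r"
      have u: "1 / 2 \<le> u" "u \<le> 2" using x assms by (auto simp: u_def field_simps)
      define e where "e = - 2 * Re t - 1"
      have e: "\<bar>e\<bar> \<le> 2 * T + 1" using abs_Re_le_cmod[of t] assms(4) unfolding e_def by linarith
      have "\<bar>ln u\<bar> \<le> ln 2"
      proof -
        have "ln u \<le> ln 2" using u by simp
        moreover have "ln (1/2) \<le> ln u" using u by (subst ln_le_cancel_iff) auto
        moreover have "ln (1/2::real) = - ln 2" by (simp add: ln_div)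
        ultimately show ?thesis by linarith
      qed
      with e have "\<bar>e\<bar> * \<bar>ln u\<bar> \<le> (2 * T + 1) * ln 2"
        by (intro mult_mono) auto
      then have "e * ln u \<le> (2 * T + 1) * ln 2"
        by (metis abs_le_D1 abs_mult)
      then show "(x / r) powr (- 2 * Re t - 1) \<le> 2 powr (2 * T + 1)"
        using u unfolding u_def[symmetric] e_def[symmetric] by (simp add: powr_def)
    qed auto
    finally have "norm (z powr (- 2 * t - 1)) \<le> r powr (2 * \<sigma> - 1) * 2 powr (2 * T + 1)" .
    then have "norm ((- 2 * t) * z powr (- 2 * t - 1)) \<le> (2 * T) * (r powr (2 * \<sigma> - 1) * 2 powr (2 * T + 1))"
      unfolding norm_mult using assms(4) T by (intro mult_mono) auto
    then show "norm ((- 2 * t) * z powr (- 2 * t - 1)) \<le> 2 * T * 2 powr (2 * T + 1) * r powr (2 * \<sigma> - 1)"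
      by (simp add: mult_ac)
  qed (use assms S in auto)
  also have "norm (of_real r' - of_real r :: complex) = \<bar>r' - r\<bar>"
    by (metis norm_of_real of_real_diff)
  finally show ?thesis .
qed

text \<open>The point is the gain of one power of |w| over the size of the kernel itself. The
  changes of |w|^(-2t) and of w^-2 are estimated apart. As |w + \<delta>| >= |w| / 2, the inverse
  square costs a factor 4, whence 8T; together with |2w + \<delta>| <= (5/2) |w| it gives the
  10.\<close>

lemma norm_hecke_kernel_diff_le:
  assumes "norm w \<ge> 1" "2 * norm \<delta> \<le> norm w" "norm t \<le> T" "Re t \<ge> - \<sigma>"
  shows "norm (hecke_kernel t (w + \<delta>) - hecke_kernel t w)
    \<le> (8 * T * 2 powr (2 * T + 1) + 10) * norm \<delta> * norm w powr (2 * \<sigma> - 3)"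
proof -
  define r r' where "r = norm w" and "r' = norm (w + \<delta>)"
  have rr: "r \<ge> 1" "r / 2 \<le> r'" "r' \<le> 2 * r" "\<bar>r' - r\<bar> \<le> norm \<delta>"
    using assms norm_triangle_ineq[of w \<delta>] norm_triangle_ineq2[of w "-\<delta>"] norm_ge_zero[of \<delta>]
      norm_triangle_ineq3[of "w + \<delta>" w]
    unfolding r_def r'_def by auto
  have T: "T \<ge> 0" using assms(3) norm_ge_zero[of t] by linarith
  have nz: "w \<noteq> 0" "w + \<delta> \<noteq> 0" using rr unfolding r_def r'_def by auto
  define P P' where "P = (of_real r powr (- 2 * t) :: complex)" and "P' = (of_real r' powr (- 2 * t) :: complex)"
  have "hecke_kernel t (w + \<delta>) - hecke_kernel t w =
      (P' - P) / (w + \<delta>)^2 + P * (- \<delta> * (2 * w + \<delta>) / ((w + \<delta>)^2 * w^2))"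
    unfolding hecke_kernel_def P_def[unfolded r_def, symmetric] P'_def[unfolded r'_def, symmetric]
    using nz by (simp add: divide_simps) (simp add: algebra_simps power2_eq_square)
  also have "norm \<dots> \<le> norm ((P' - P) / (w + \<delta>)^2) + norm (P * (- \<delta> * (2 * w + \<delta>) / ((w + \<delta>)^2 * w^2)))"
    by (rule norm_triangle_ineq)
  also have "norm ((P' - P) / (w + \<delta>)^2) \<le> (8 * T * 2 powr (2 * T + 1)) * norm \<delta> * r powr (2 * \<sigma> - 3)"
  proof -
    have "norm (P' - P) \<le> 2 * T * 2 powr (2 * T + 1) * r powr (2 * \<sigma> - 1) * \<bar>r' - r\<bar>"
      unfolding P_def P'_def using rr assms by (intro norm_of_real_powr_diff_le) auto
    also have "\<dots> \<le> 2 * T * 2 powr (2 * T + 1) * r powr (2 * \<sigma> - 1) * norm \<delta>"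
      using rr T by (intro mult_left_mono) auto
    finally have 1: "norm (P' - P) \<le> 2 * T * 2 powr (2 * T + 1) * r powr (2 * \<sigma> - 1) * norm \<delta>" .
    have 2: "(r / 2)^2 \<le> r'^2" using rr by (intro power_mono) auto
    have "norm ((P' - P) / (w + \<delta>)^2) = norm (P' - P) / r'^2"
      by (simp add: norm_divide norm_power r'_def)
    also have "\<dots> \<le> (2 * T * 2 powr (2 * T + 1) * r powr (2 * \<sigma> - 1) * norm \<delta>) / (r / 2)^2"
      using 1 2 rr T by (intro frac_le) auto
    also have "\<dots> = (8 * T * 2 powr (2 * T + 1)) * norm \<delta> * (r powr (2 * \<sigma> - 1) / r powr 2)"
      using rr by (simp add: power2_eq_square)
    also have "r powr (2 * \<sigma> - 1) / r powr 2 = r powr (2 * \<sigma> - 3)"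
      by (simp flip: powr_diff)
    finally show ?thesis .
  qed
  also have "norm (P * (- \<delta> * (2 * w + \<delta>) / ((w + \<delta>)^2 * w^2))) \<le> 10 * norm \<delta> * r powr (2 * \<sigma> - 3)"
  proof -
    have 1: "norm P \<le> r powr (2 * \<sigma>)"
      using rr assms unfolding P_def by (simp add: norm_powr_real_powr powr_mono)
    have 2: "norm (2 * w + \<delta>) \<le> 5/2 * r"
      using norm_triangle_ineq[of "2 * w" \<delta>] assms(2) by (simp add: norm_mult r_def)
    have 3: "(r / 2)^2 * r^2 \<le> r'^2 * r^2" using rr by (intro mult_right_mono power_mono) auto
    have "norm (- \<delta> * (2 * w + \<delta>) / ((w + \<delta>)^2 * w^2)) = norm \<delta> * norm (2 * w + \<delta>) / (r'^2 * r^2)"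
      by (simp add: norm_divide norm_mult norm_power r_def r'_def)
    also have "\<dots> \<le> norm \<delta> * (5/2 * r) / ((r / 2)^2 * r^2)"
      using 2 3 rr by (intro frac_le mult_left_mono) auto
    also have "\<dots> = 10 * norm \<delta> / r ^ 3"
      using rr by (simp add: power2_eq_square power3_eq_cube field_simps)
    finally have "norm (P * (- \<delta> * (2 * w + \<delta>) / ((w + \<delta>)^2 * w^2))) \<le> r powr (2 * \<sigma>) * (10 * norm \<delta> / r ^ 3)"
      unfolding norm_mult[of P] using 1 by (intro mult_mono) auto
    also have "\<dots> = 10 * norm \<delta> * (r powr (2 * \<sigma>) / r powr 3)"
      using rr by simp
    also have "r powr (2 * \<sigma>) / r powr 3 = r powr (2 * \<sigma> - 3)"
      by (simp flip: powr_diff)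
    finally show ?thesis .
  qed
  finally show ?thesis by (simp add: r_def algebra_simps)
qed

text \<open>The weight is kept abstract because boundedness at the cusps applies the theory to all
  translates of the Eisenstein weight under the full modular group.\<close>

locale periodic_weight =
  fixes N :: nat and W :: "int \<Rightarrow> int \<Rightarrow> complex"
  assumes N_pos: "N > 0"
    and periodic: "W (c + int N * k) (d + int N * l) = W c d"
    and mean_zero: "(\<Sum>(i, j)\<in>{0..<int N} \<times> {0..<int N}. W i j) = 0"
begin

abbreviation residues :: "(int \<times> int) set" where
  "residues \<equiv> {0..<int N} \<times> {0..<int N}"

text \<open>By \<open>mean_zero\<close> the leading terms within a block cancel; this is what makes the sum of the
  blocks converge absolutely beyond the domain of convergence of the lattice sum.\<close>

definition block :: "complex \<Rightarrow> complex \<Rightarrow> int \<times> int \<Rightarrow> complex" where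
  "block t z = (\<lambda>(k, l). \<Sum>(i, j)\<in>residues.
     W i j * hecke_kernel t (of_int (int N * k + i) * z + of_int (int N * l + j)))"

definition hecke_sum :: "complex \<Rightarrow> complex \<Rightarrow> complex" where
  "hecke_sum t z = (\<Sum>\<^sub>\<infinity>x. block t z x)"

lemma W_mod: "W (c mod int N) (d mod int N) = W c d"
proof -
  have "W (c mod int N) (d mod int N) = W (c mod int N + int N * (c div int N)) (d mod int N + int N * (d div int N))"
    by (rule periodic[symmetric])
  then show ?thesis by simp
qed

lemma W_bounded: obtains B where "B \<ge> 0" "\<And>c d. norm (W c d) \<le> B"
proof -
  define B where "B = (\<Sum>(i, j)\<in>residues. norm (W i j))"
  have "norm (W c d) \<le> B" for c d
  proof -
    have "norm (W (c mod int N) (d mod int N)) \<le> B"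
      unfolding B_def using N_pos
      by (intro member_le_sum[of "(c mod int N, d mod int N)" residues "\<lambda>(i, j). norm (W i j)", simplified]) auto
    then show ?thesis by (simp only: W_mod)
  qed
  moreover have "B \<ge> 0" unfolding B_def by (intro sum_nonneg) auto
  ultimately show ?thesis by (rule that[rotated])
qed

text \<open>One majorant serves all t in a disc around \<open>t0\<close>. A block far from the
  origin is a combination of kernel differences, of size |w|^(2\<sigma> - 3), and this is summable
  over a lattice of rank 2 as soon as \<sigma> < 1/2.\<close>

lemma block_bound:
  assumes z: "Im z > 0" and t0: "Re t0 > - 1/2"
  obtains r M where "r > 0" "cball t0 r \<subseteq> {t. Re t > - 1/2}" "M summable_on UNIV"
    "\<And>x t. t \<in> cball t0 r \<Longrightarrow> norm (block t z x) \<le> M x"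
proof -
  \<comment> \<open>Half the distance from \<open>t0\<close> to the line Re t = -1/2. On the disc Re
    t stays at or above Re t0 - r = -(1/4 - Re t0 / 2), which explains the next constant.\<close>
  define r where "r = (Re t0 + 1/2) / 2"
  define \<sigma> where "\<sigma> = max 0 (1/4 - Re t0 / 2)"
  define T where "T = norm t0 + r"
  have r: "r > 0" using t0 by (simp add: r_def)
  have \<sigma>: "0 \<le> \<sigma>" "\<sigma> < 1/2" using t0 by (auto simp: \<sigma>_def max_def)
  have t: "Re t \<ge> - \<sigma>" "norm t \<le> T" if "t \<in> cball t0 r" for t
  proof -
    have 1: "norm (t - t0) \<le> r" using that by (simp add: dist_norm norm_minus_commute)
    then have "\<bar>Re (t - t0)\<bar> \<le> r" using abs_Re_le_cmod[of "t - t0"] by linarith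
    then have "Re t \<ge> Re t0 - r" by simp
    also have "Re t0 - r = - (1/4 - Re t0 / 2)" by (simp add: r_def field_simps)
    finally show "Re t \<ge> - \<sigma>" by (auto simp: \<sigma>_def)
    show "norm t \<le> T" using 1 norm_triangle_ineq[of "t - t0" t0] by (simp add: T_def)
  qed
  have T: "T \<ge> 0" using r by (simp add: T_def)
  obtain c where c: "c > 0" "c \<le> 1"
    "\<And>k l :: int. norm (of_int k * z + of_int l) \<ge> c * max \<bar>real_of_int k\<bar> \<bar>real_of_int l\<bar>"
    using lattice_norm_ge[OF z] by blast
  obtain c' where c': "c' > 0" 
    "\<And>k l :: int. (k, l) \<noteq> (0, 0) \<Longrightarrow>
      norm (of_int k * z + of_int l) ^ 2 \<ge> c' * ((1 + \<bar>real_of_int k\<bar>) * (1 + \<bar>real_of_int l\<bar>))"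
    using lattice_norm_ge'[OF z] by blast
  obtain B where B: "B \<ge> 0" "\<And>c d. norm (W c d) \<le> B" using W_bounded by blast
  define D where "D = real N * (norm z + 1)"
  have D: "D \<ge> 0" by (simp add: D_def)
  \<comment> \<open>Outside the square \<open>A\<close> some coordinate is at least (2D + 1) / c,
    which forces |w| >= 2D + 1. Since \<open>D\<close> bounds all shifts inside a block,
    \<open>norm_hecke_kernel_diff_le\<close> is applicable there.\<close>
  define m where "m = \<lceil>(2 * D + 1) / c\<rceil>"
  define A where "A = {- m..m} \<times> {- m..m}"
  \<comment> \<open>Chosen so that |w|^(2\<sigma> - 3) is the power -b of |w|^2, to match the
    product majorant.\<close>
  define b where "b = (3 - 2 * \<sigma>) / 2"
  have b: "b > 1" using \<sigma> by (simp add: b_def)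
  define K where "K = real (card residues) * (B * ((8 * T * 2 powr (2 * T + 1) + 10) * D * c' powr (- b)))"
  \<comment> \<open>Continuity on the compact disc bounds each single block. This crude bound is
    used only for the finitely many blocks in \<open>A\<close>.\<close>
  have "\<exists>M. \<forall>t\<in>cball t0 r. norm (block t z x) \<le> M" for x
  proof -
    have "(\<lambda>t. block t z x) holomorphic_on cball t0 r"
      unfolding block_def by (auto simp: case_prod_unfold intro!: holomorphic_intros)
    then have "compact ((\<lambda>t. block t z x) ` cball t0 r)"
      by (intro compact_continuous_image holomorphic_on_imp_continuous_on) auto
    then have "bounded ((\<lambda>t. block t z x) ` cball t0 r)" by (rule compact_imp_bounded)
    then show ?thesis by (auto simp: bounded_iff)
  qed
  then obtain M0 where M0: "\<And>x t. t \<in> cball t0 r \<Longrightarrow> norm (block t z x) \<le> M0 x" by metis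
  define F where "F = (\<lambda>(k::int, l::int). ((1 + \<bar>real_of_int k\<bar>) * (1 + \<bar>real_of_int l\<bar>)) powr (- b))"
  define M where "M = (\<lambda>x. (if x \<in> A then \<bar>M0 x\<bar> else 0) + K * F x)"
  have K: "K \<ge> 0" using B(1) T D by (simp add: K_def)
  have bd: "norm (block t z x) \<le> M x" if tr: "t \<in> cball t0 r" for x t
  proof (cases "x \<in> A")
    case True
    have "F x \<ge> 0" by (auto simp: F_def split: prod.splits)
    then have "norm (block t z x) \<le> \<bar>M0 x\<bar> + K * F x" using M0[OF tr, of x] K
      by (smt (verit) mult_nonneg_nonneg)
    then show ?thesis using True by (simp add: M_def)
  next
    case False
    obtain k l where x: "x = (k, l)" by (cases x)
    have kl: "max \<bar>real_of_int k\<bar> \<bar>real_of_int l\<bar> \<ge> (2 * D + 1) / c"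
    proof (rule ccontr)
      assume "\<not> ?thesis"
      then have "\<bar>k\<bar> \<le> m" "\<bar>l\<bar> \<le> m" unfolding m_def by linarith+
      then show False using False by (auto simp: A_def x)
    qed
    have ne: "(k, l) \<noteq> (0, 0)"
      using kl D c by (auto simp: divide_le_eq)
    define u where "u = of_int k * z + of_int l"
    define w where "w = of_nat N * u"
    have u1: "norm u \<ge> 2 * D + 1"
    proof -
      have "2 * D + 1 = c * ((2 * D + 1) / c)" using c by simp
      also have "\<dots> \<le> c * max \<bar>real_of_int k\<bar> \<bar>real_of_int l\<bar>"
        using kl c by (intro mult_left_mono) auto
      also have "\<dots> \<le> norm u" unfolding u_def by (rule c(3))
      finally show ?thesis .
    qed
    have wu: "norm w \<ge> norm u"
      using N_pos mult_right_mono[of 1 "real N" "norm u"] by (simp add: w_def norm_mult)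
    have "c' * ((1 + \<bar>real_of_int k\<bar>) * (1 + \<bar>real_of_int l\<bar>)) \<le> norm u ^ 2"
      unfolding u_def using c'(2)[OF ne] .
    also have "\<dots> \<le> norm w ^ 2" using wu by (intro power_mono) auto
    finally have "(norm w ^ 2) powr (- b) \<le> (c' * ((1 + \<bar>real_of_int k\<bar>) * (1 + \<bar>real_of_int l\<bar>))) powr (- b)"
      using b c' by (intro powr_mono2') auto
    also have "\<dots> = c' powr (- b) * F x"
      using c' by (simp add: F_def x powr_mult)
    also have "(norm w ^ 2) powr (- b) = norm w powr (2 * \<sigma> - 3)"
    proof -
      have "(norm w ^ 2) powr (- b) = (norm w powr 2) powr (- b)" by simp
      also have "\<dots> = norm w powr (2 * \<sigma> - 3)" unfolding powr_powr by (rule arg_cong[where f = "\<lambda>e. norm w powr e"]) (simp add: b_def field_simps)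
      finally show ?thesis .
    qed
    finally have wF: "norm w powr (2 * \<sigma> - 3) \<le> c' powr (- b) * F x" .
    have "block t z x = (\<Sum>(i, j)\<in>residues. W i j * hecke_kernel t (w + (of_int i * z + of_int j)))"
      by (simp add: block_def x w_def u_def algebra_simps)
    \<comment> \<open>By \<open>mean_zero\<close> the kernel at the corner \<open>w\<close> of the
      block may be subtracted in every term.\<close>
    also have "\<dots> = (\<Sum>(i, j)\<in>residues. W i j * (hecke_kernel t (w + (of_int i * z + of_int j)) - hecke_kernel t w))"
    proof -
      have "(\<Sum>(i, j)\<in>residues. W i j * hecke_kernel t w) = 0"
        using mean_zero by (simp add: case_prod_unfold flip: sum_distrib_right)
      then show ?thesis
        by (simp add: case_prod_unfold right_diff_distrib sum_subtractf)
    qed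
    also have "norm \<dots> \<le> (\<Sum>_\<in>residues. B * ((8 * T * 2 powr (2 * T + 1) + 10) * D * (c' powr (- b) * F x)))"
    proof (intro sum_norm_le, clarify)
      fix i j assume ij: "i \<in> {0..<int N}" "j \<in> {0..<int N}"
      have "norm (of_int i * z + of_int j) \<le> norm (of_int i * z) + norm (of_int j :: complex)"
        by (rule norm_triangle_ineq)
      also have "\<dots> \<le> real N * norm z + real N"
        using ij by (intro add_mono) (auto simp: norm_mult intro!: mult_right_mono)
      also have "\<dots> = D" by (simp add: D_def algebra_simps)
      finally have \<delta>: "norm (of_int i * z + of_int j) \<le> D" .
      have "norm (hecke_kernel t (w + (of_int i * z + of_int j)) - hecke_kernel t w)
          \<le> (8 * T * 2 powr (2 * T + 1) + 10) * norm (of_int i * z + of_int j) * norm w powr (2 * \<sigma> - 3)"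
        using \<delta> u1 wu D t[OF tr] by (intro norm_hecke_kernel_diff_le) auto
      also have "\<dots> \<le> (8 * T * 2 powr (2 * T + 1) + 10) * D * (c' powr (- b) * F x)"
        using \<delta> wF T D by (intro mult_mono mult_nonneg_nonneg add_nonneg_nonneg) auto
      finally show "norm (W i j * (hecke_kernel t (w + (of_int i * z + of_int j)) - hecke_kernel t w))
          \<le> B * ((8 * T * 2 powr (2 * T + 1) + 10) * D * (c' powr (- b) * F x))"
        unfolding norm_mult using B by (intro mult_mono) auto
    qed
    also have "\<dots> = K * F x" by (simp add: K_def mult_ac)
    finally show ?thesis using False by (simp add: M_def)
  qed
  have sm: "M summable_on UNIV"
    unfolding M_def
  proof (intro summable_on_add summable_on_cmult_right)
    have "finite A" by (simp add: A_def)
    then have "finite {x \<in> UNIV. (if x \<in> A then \<bar>M0 x\<bar> else 0) \<noteq> 0}"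
      by (rule finite_subset[rotated]) auto
    then show "(\<lambda>x. if x \<in> A then \<bar>M0 x\<bar> else 0) summable_on UNIV"
      by (rule finite_nonzero_values_imp_summable_on)
    show "F summable_on UNIV" unfolding F_def by (rule summable_on_int2_powr[OF b])
  qed
  have "cball t0 r \<subseteq> {t. Re t > - 1/2}"
  proof
    fix t assume "t \<in> cball t0 r"
    then show "t \<in> {t. Re t > - 1/2}" using t(1)[of t] \<sigma> by simp
  qed
  from that[OF r this sm bd] show ?thesis .
qed

end

section \<open>Continuation in t, and the rows of the lattice sum\<close>

context periodic_weight begin

lemma abs_summable_block:
  assumes "Im z > 0" "Re t > - 1/2"
  shows "(\<lambda>x. norm (block t z x)) summable_on UNIV"
proof -
  obtain r M where rM: "r > 0" "cball t r \<subseteq> {t. Re t > - 1/2}" "M summable_on UNIV"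
    "\<And>x s. s \<in> cball t r \<Longrightarrow> norm (block s z x) \<le> M x"
    using block_bound[OF assms] by blast
  have "t \<in> cball t r" using rM(1) by simp
  from rM(4)[OF this] show ?thesis
    by (rule Infinite_Sum.abs_summable_on_comparison_test'[OF rM(3)])
qed

lemma block_has_sum_hecke_sum:
  assumes "Im z > 0" "Re t > - 1/2"
  shows "(block t z has_sum hecke_sum t z) UNIV"
  unfolding hecke_sum_def
  by (rule has_sum_infsum[OF Infinite_Sum.abs_summable_summable[OF abs_summable_block[OF assms]]])

text \<open>Finite sums of blocks are holomorphic in t and, by the majorant of
  \<open>block_bound\<close>, converge uniformly on small closed discs.\<close>

lemma holomorphic_hecke_sum:
  assumes "Im z > 0"
  shows "(\<lambda>t. hecke_sum t z) holomorphic_on {t. Re t > - 1/2}"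
proof -
  have "(\<lambda>t. hecke_sum t z) analytic_on {t. Re t > - 1/2}"
    unfolding analytic_on_def
  proof
    fix t0 assume "t0 \<in> {t. Re t > - 1/2}"
    then have "Re t0 > - 1/2" by simp
    from block_bound[OF assms this] obtain r M where rM: "r > 0" "cball t0 r \<subseteq> {t. Re t > - 1/2}"
      "M summable_on UNIV" "\<And>x s. s \<in> cball t0 r \<Longrightarrow> norm (block s z x) \<le> M x" by blast
    have lim: "uniform_limit (cball t0 r) (\<lambda>X t. \<Sum>x\<in>X. block t z x) (\<lambda>t. hecke_sum t z)
        (finite_subsets_at_top UNIV)"
      unfolding hecke_sum_def by (rule Weierstrass_m_test_general[OF rM(4) rM(3)])
    have "(\<lambda>t. \<Sum>x\<in>X. block t z x) holomorphic_on S" for X S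
      unfolding block_def by (auto simp: case_prod_unfold intro!: holomorphic_intros)
    then have ev: "\<forall>\<^sub>F X in finite_subsets_at_top UNIV.
        continuous_on (cball t0 r) (\<lambda>t. \<Sum>x\<in>X. block t z x) \<and> (\<lambda>t. \<Sum>x\<in>X. block t z x) holomorphic_on ball t0 r"
      by (intro always_eventually allI conjI holomorphic_on_imp_continuous_on)
    have "(\<lambda>t. hecke_sum t z) holomorphic_on ball t0 r"
      by (rule holomorphic_uniform_limit[OF ev lim finite_subsets_at_top_neq_bot])
    with rM(1) show "\<exists>\<epsilon>>0. (\<lambda>t. hecke_sum t z) holomorphic_on ball t0 \<epsilon>" by blast
  qed
  then show ?thesis by (rule analytic_imp_holomorphic)
qed

lemma div_mod_residue:
  assumes "i \<in> {0..<int N}"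
  shows "(int N * k + i) div int N = k" "(int N * k + i) mod int N = i"
  using assms by (simp_all add: div_pos_pos_trivial mod_pos_pos_trivial)

lemma bij_betw_residues: "bij_betw (\<lambda>(k, i). int N * k + i) (UNIV \<times> {0..<int N}) UNIV"
proof (rule bij_betw_byWitness[of _ "\<lambda>c. (c div int N, c mod int N)"])
  show "\<forall>a\<in>UNIV \<times> {0..<int N}. ((case a of (k, i) \<Rightarrow> int N * k + i) div int N,
      (case a of (k, i) \<Rightarrow> int N * k + i) mod int N) = a"
    by (clarify, simp only: prod.case div_mod_residue)
  show "\<forall>c\<in>UNIV. (case (c div int N, c mod int N) of (k, i) \<Rightarrow> int N * k + i) = c"
    by simp
  show "(\<lambda>c. (c div int N, c mod int N)) ` UNIV \<subseteq> UNIV \<times> {0..<int N}"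
    using N_pos by auto
qed simp

lemma bij_betw_residues2:
  "bij_betw (\<lambda>((k, l), (i, j)). (int N * k + i, int N * l + j)) (UNIV \<times> residues) UNIV"
proof (rule bij_betw_byWitness[of _ "\<lambda>(c, d). ((c div int N, d div int N), (c mod int N, d mod int N))"], goal_cases)
  case 1
  show ?case by (clarify, simp only: prod.case div_mod_residue)
next
  case 4
  show ?case using N_pos by auto
qed auto

text \<open>Up to a constant the kernel is bounded by the product majorant with exponent b = 1 + Re
  t; this is where Re t > 0 enters.\<close>

lemma abs_summable_lattice:
  assumes "Im z > 0" "Re t > 0"
  shows "(\<lambda>(c, d). norm (hecke_kernel t (of_int c * z + of_int d))) summable_on UNIV"
proof -
  obtain c' where c': "c' > 0" 
    "\<And>k l :: int. (k, l) \<noteq> (0, 0) \<Longrightarrow>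
      norm (of_int k * z + of_int l) ^ 2 \<ge> c' * ((1 + \<bar>real_of_int k\<bar>) * (1 + \<bar>real_of_int l\<bar>))"
    using lattice_norm_ge'[OF assms(1)] by blast
  define b where "b = 1 + Re t"
  define F where "F = (\<lambda>(k::int, l::int). ((1 + \<bar>real_of_int k\<bar>) * (1 + \<bar>real_of_int l\<bar>)) powr (- b))"
  have b: "b > 1" using assms by (simp add: b_def)
  have "(\<lambda>x. c' powr (- b) * F x) summable_on UNIV"
    unfolding F_def by (intro summable_on_cmult_right summable_on_int2_powr b)
  then have "(\<lambda>x. norm ((\<lambda>(c, d). hecke_kernel t (of_int c * z + of_int d)) x)) summable_on UNIV"
  proof (rule Infinite_Sum.abs_summable_on_comparison_test')
    fix x :: "int \<times> int"
    obtain k l where x: "x = (k, l)" by (cases x)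
    show "norm ((\<lambda>(c, d). hecke_kernel t (of_int c * z + of_int d)) x) \<le> c' powr (- b) * F x"
    proof (cases "(k, l) = (0, 0)")
      case False
      let ?w = "of_int k * z + of_int l"
      have "norm (hecke_kernel t ?w) = (norm ?w powr 2) powr (- b)"
      proof -
        have "- 2 * Re t - 2 = 2 * (- b)" by (simp add: b_def)
        then show ?thesis by (simp only: norm_hecke_kernel powr_powr)
      qed
      also have "\<dots> = (norm ?w ^ 2) powr (- b)" by simp
      also have "\<dots> \<le> (c' * ((1 + \<bar>real_of_int k\<bar>) * (1 + \<bar>real_of_int l\<bar>))) powr (- b)"
        using b c' False by (intro powr_mono2') auto
      also have "\<dots> = c' powr (- b) * F x"
        using c' by (simp add: F_def x powr_mult)
      finally show ?thesis by (simp add: x)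
    qed (auto simp: x F_def)
  qed
  then show ?thesis by (simp add: case_prod_unfold)
qed

lemma abs_summable_weighted_lattice:
  assumes "Im z > 0" "Re t > 0"
  shows "(\<lambda>(c, d). norm (W c d * hecke_kernel t (of_int c * z + of_int d))) summable_on UNIV"
proof -
  obtain B where B: "B \<ge> 0" "\<And>c d. norm (W c d) \<le> B" using W_bounded by blast
  have "(\<lambda>x. B * (\<lambda>(c, d). norm (hecke_kernel t (of_int c * z + of_int d))) x) summable_on UNIV"
    by (intro summable_on_cmult_right abs_summable_lattice assms)
  then have "(\<lambda>x. norm ((\<lambda>(c, d). W c d * hecke_kernel t (of_int c * z + of_int d)) x)) summable_on UNIV"
    by (rule Infinite_Sum.abs_summable_on_comparison_test')
       (use B in \<open>auto simp: norm_mult intro!: mult_right_mono\<close>)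
  then show ?thesis by (simp add: case_prod_unfold)
qed

text \<open>Where the lattice sum converges absolutely it may be regrouped into blocks. Hence
  \<open>hecke_sum\<close> is its analytic continuation to Re t > -1/2.\<close>

lemma has_sum_hecke_sum:
  assumes "Im z > 0" "Re t > 0"
  shows "((\<lambda>(c, d). W c d * hecke_kernel t (of_int c * z + of_int d)) has_sum hecke_sum t z) UNIV"
proof -
  let ?f = "\<lambda>(c, d). W c d * hecke_kernel t (of_int c * z + of_int d)"
  let ?g = "\<lambda>((k, l), (i, j)). (int N * k + i, int N * l + j)"
  have "(\<lambda>x. norm (?f x)) summable_on UNIV"
    using abs_summable_weighted_lattice[OF assms] by (simp add: case_prod_unfold)
  then obtain S where S: "(?f has_sum S) UNIV"
    using Infinite_Sum.abs_summable_summable unfolding summable_on_def by blast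
  have "((\<lambda>x. ?f (?g x)) has_sum S) (UNIV \<times> residues)"
    using S has_sum_reindex_bij_betw[OF bij_betw_residues2, of ?f S] by simp
  then have "(block t z has_sum S) UNIV"
  proof (rule has_sum_SigmaD)
    fix x :: "int \<times> int"
    obtain k l where x: "x = (k, l)" by (cases x)
    have "((\<lambda>y. ?f (?g (x, y))) has_sum (\<Sum>y\<in>residues. ?f (?g (x, y)))) residues"
      by (intro has_sum_finite) auto
    also have "(\<Sum>y\<in>residues. ?f (?g (x, y))) = block t z x"
    proof -
      have "W (int N * k + i) (int N * l + j) = W i j" for i j
        using periodic[of i k j l] by (simp add: add.commute)
      then show ?thesis by (simp add: block_def x case_prod_unfold)
    qed
    finally show "((\<lambda>y. ?f (?g (x, y))) has_sum block t z x) residues" .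
  qed
  then show ?thesis
    using S block_has_sum_hecke_sum[of z t] assms has_sum_unique by fastforce
qed

text \<open>Eisenstein's order of summation at t = 0: the double series need not converge absolutely
  there, but every single row does.\<close>

definition row :: "complex \<Rightarrow> int \<Rightarrow> complex" where
  "row z c = (\<Sum>\<^sub>\<infinity>d. W c d / (of_int c * z + of_int d) ^ 2)"

lemma abs_summable_row:
  assumes "Im z > 0"
  shows "(\<lambda>d. norm (W c d / (of_int c * z + of_int d) ^ 2)) summable_on UNIV"
proof -
  obtain B where B: "B \<ge> 0" "\<And>c d. norm (W c d) \<le> B" using W_bounded by blast
  have "(\<lambda>d. norm (1 / (of_int c * z + of_int d) ^ 2)) summable_on UNIV"
  proof (cases "c = 0")
    case False
    then show ?thesis using assms by (intro abs_summable_inverse_shifted_square) auto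
  next
    case True
    have "(\<lambda>d::int. 4 * (1 + \<bar>real_of_int d\<bar>) powr (- 2)) summable_on UNIV"
      by (intro summable_on_cmult_right summable_on_int_powr) auto
    then have "(\<lambda>d::int. norm (1 / of_int d ^ 2 :: complex)) summable_on UNIV"
    proof (rule Infinite_Sum.abs_summable_on_comparison_test')
      fix d :: int
      show "norm (1 / of_int d ^ 2 :: complex) \<le> 4 * (1 + \<bar>real_of_int d\<bar>) powr (- 2)"
      proof (cases "d = 0")
        case False
        then have "(1 + \<bar>real_of_int d\<bar>)^2 \<le> (2 * \<bar>real_of_int d\<bar>)^2" by (intro power_mono) auto
        then have "4 / (2 * \<bar>real_of_int d\<bar>)^2 \<le> 4 / (1 + \<bar>real_of_int d\<bar>)^2"
          using False by (intro divide_left_mono) (auto intro!: mult_pos_pos)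
        then show ?thesis
          using False by (simp add: norm_divide norm_power powr_minus_divide power_mult_distrib)
      qed simp
    qed
    then show ?thesis using True by simp
  qed
  then have "(\<lambda>d. B * norm (1 / (of_int c * z + of_int d) ^ 2)) summable_on UNIV"
    by (rule summable_on_cmult_right)
  then show ?thesis
  proof (rule Infinite_Sum.abs_summable_on_comparison_test')
    fix d
    show "norm (W c d / (of_int c * z + of_int d) ^ 2) \<le> B * norm (1 / (of_int c * z + of_int d) ^ 2)"
      using B by (simp add: norm_divide divide_right_mono)
  qed
qed

lemma has_sum_row:
  assumes "Im z > 0"
  shows "((\<lambda>d. W c d / (of_int c * z + of_int d) ^ 2) has_sum row z c) UNIV"
  unfolding row_def
  by (rule has_sum_infsum[OF Infinite_Sum.abs_summable_summable[OF abs_summable_row[OF assms]]])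

end

text \<open>Up to a constant the Lipschitz formula evaluates the sum as q / (1 - q)^2, and |1 - q|
  >= 1 - |q|. The outcome is exponential decay in |Im w|.\<close>

lemma norm_infsum_inverse_shifted_square_le:
  assumes "Im w \<noteq> 0"
  defines "\<rho> \<equiv> exp (- 2 * pi * \<bar>Im w\<bar>)"
  shows "norm (\<Sum>\<^sub>\<infinity>d::int. 1 / (w + of_int d) ^ 2) \<le> 4 * pi ^ 2 * (\<rho> / (1 - \<rho>) ^ 2)"
proof -
  have main: "norm (\<Sum>\<^sub>\<infinity>d::int. 1 / (w + of_int d) ^ 2) \<le> 4 * pi ^ 2 * (exp (- 2 * pi * \<bar>Im w\<bar>) / (1 - exp (- 2 * pi * \<bar>Im w\<bar>)) ^ 2)"
    if w: "Im w > 0" for w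
  proof -
    define q where "q = exp (2 * of_real pi * \<i> * w)"
    have nq: "norm q = exp (- 2 * pi * \<bar>Im w\<bar>)" using w by (simp add: q_def)
    have "(\<Sum>\<^sub>\<infinity>d::int. 1 / (w + of_int d) ^ 2) = - 4 * of_real pi ^ 2 * (q / (1 - q) ^ 2)"
      unfolding q_def by (rule infsumI[OF lipschitz_formula[OF w]])
    also have "norm \<dots> = 4 * pi ^ 2 * (norm q / norm (1 - q) ^ 2)"
      by (simp add: norm_mult norm_divide norm_power)
    also have "\<dots> \<le> 4 * pi ^ 2 * (norm q / (1 - norm q) ^ 2)"
    proof (intro mult_left_mono divide_left_mono power_mono mult_pos_pos zero_less_power)
      have "norm q < 1" using w unfolding nq by simp
      then show "0 \<le> 1 - norm q" "0 < 1 - norm q" by auto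
      show *: "1 - norm q \<le> norm (1 - q)" using norm_triangle_ineq2[of 1 q] by simp
      show "0 < norm (1 - q)" using * \<open>norm q < 1\<close> by linarith
    qed auto
    finally show ?thesis unfolding nq .
  qed
  show ?thesis
  proof (cases "Im w > 0")
    case False
    have "(\<Sum>\<^sub>\<infinity>d::int. 1 / (w + of_int d) ^ 2) = (\<Sum>\<^sub>\<infinity>d::int. 1 / (w + of_int (- d)) ^ 2)"
      by (rule infsum_reindex_bij_betw[symmetric]) (auto intro!: bij_betw_byWitness[of _ uminus])
    also have "(\<lambda>d::int. 1 / (w + of_int (- d)) ^ 2) = (\<lambda>d. 1 / (- w + of_int d) ^ 2)"
    proof
      fix d :: int
      have "w + of_int (- d) = - (- w + of_int d)" by simp
      then show "1 / (w + of_int (- d)) ^ 2 = 1 / (- w + of_int d) ^ 2" by (metis power2_minus)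
    qed
    finally show ?thesis using main[of "- w"] False assms by simp
  qed (use main \<rho>_def in auto)
qed

lemma summable_on_int_geometric:
  fixes \<rho> :: real
  assumes "0 \<le> \<rho>" "\<rho> < 1"
  shows "(\<lambda>c::int. \<rho> ^ nat \<bar>c\<bar>) summable_on UNIV"
proof -
  have "summable (\<lambda>n. \<rho> ^ n)" using assms by (intro summable_geometric) auto
  then have 1: "(\<lambda>n. \<rho> ^ n) summable_on UNIV"
    using assms by (subst summable_on_UNIV_nonneg_real_iff) auto
  then have 2: "(\<lambda>n. \<rho> * \<rho> ^ n) summable_on UNIV" by (rule summable_on_cmult_right)
  from 1 2 obtain x y where "((\<lambda>n. \<rho> ^ n) has_sum x) UNIV" "((\<lambda>n. \<rho> * \<rho> ^ n) has_sum y) UNIV"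
    unfolding summable_on_def by blast
  moreover have "nat \<bar>- 1 - int n\<bar> = Suc n" for n by simp
  ultimately have "((\<lambda>c::int. \<rho> ^ nat \<bar>c\<bar>) has_sum (x + y)) UNIV"
    by (intro has_sum_int_split) simp_all
  then show ?thesis by (auto simp: summable_on_def)
qed

lemma has_sum_sum:
  fixes f :: "'b \<Rightarrow> 'a \<Rightarrow> 'c::topological_comm_monoid_add"
  assumes "\<And>i. i \<in> I \<Longrightarrow> (f i has_sum s i) A"
  shows "((\<lambda>x. \<Sum>i\<in>I. f i x) has_sum (\<Sum>i\<in>I. s i)) A"
  using assms by (induction I rule: infinite_finite_induct) (auto intro!: has_sum_add has_sum_0)

section \<open>Summation by rows at t = 0\<close>

context periodic_weight begin

lemma has_sum_residues:
  fixes f :: "int \<Rightarrow> complex"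
  assumes "(f has_sum S) UNIV"
  shows "((\<lambda>k. \<Sum>i\<in>{0..<int N}. f (int N * k + i)) has_sum S) UNIV"
proof -
  let ?g = "\<lambda>(k, i). int N * k + i"
  have "((\<lambda>x. f (?g x)) has_sum S) (UNIV \<times> {0..<int N})"
    using assms has_sum_reindex_bij_betw[OF bij_betw_residues, of f S] by simp
  then show ?thesis
  proof (rule has_sum_SigmaD)
    fix k
    show "((\<lambda>y. f (?g (k, y))) has_sum (\<Sum>i\<in>{0..<int N}. f (int N * k + i))) {0..<int N}"
      using has_sum_finite[of "{0..<int N}" "\<lambda>y. f (int N * k + y)"] by simp
  qed
qed

text \<open>Sorting d by its residue r modulo \<open>N\<close> makes the weight constant. What
  remains is an unweighted sum at (c z + r) / N, to which the Lipschitz formula applies.\<close>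

lemma row_eq:
  assumes "Im z > 0" "c \<noteq> 0"
  shows "row z c = (\<Sum>r\<in>{0..<int N}. W c r / of_nat N ^ 2 *
     (\<Sum>\<^sub>\<infinity>l::int. 1 / ((of_int c * z + of_int r) / of_nat N + of_int l) ^ 2))"
proof -
  let ?f = "\<lambda>d. W c d / (of_int c * z + of_int d) ^ 2"
  let ?S = "\<lambda>r. \<Sum>\<^sub>\<infinity>l::int. 1 / ((of_int c * z + of_int r) / of_nat N + of_int l) ^ 2"
  have "((\<lambda>(k, i). ?f (int N * k + i)) has_sum row z c) (UNIV \<times> {0..<int N})"
    using has_sum_row[OF assms(1), of c] has_sum_reindex_bij_betw[OF bij_betw_residues, of ?f "row z c"]
    by (simp add: case_prod_unfold)
  then have "((\<lambda>(i, k). ?f (int N * k + i)) has_sum row z c) ({0..<int N} \<times> UNIV)"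
    using has_sum_swap[where f = "\<lambda>(k, i). ?f (int N * k + i)" and S = "row z c"]
    by (simp add: case_prod_unfold)
  then have "((\<lambda>r. W c r / of_nat N ^ 2 * ?S r) has_sum row z c) {0..<int N}"
  proof (rule has_sum_SigmaD)
    fix r assume "r \<in> {0..<int N}"
    let ?w = "(of_int c * z + of_int r) / of_nat N"
    have "Im ?w \<noteq> 0" using assms N_pos by simp
    then have "((\<lambda>l::int. 1 / (?w + of_int l) ^ 2) has_sum ?S r) UNIV"
      by (intro has_sum_infsum Infinite_Sum.abs_summable_summable[OF abs_summable_inverse_shifted_square])
    then have "((\<lambda>l. W c r / of_nat N ^ 2 * (1 / (?w + of_int l) ^ 2)) has_sum W c r / of_nat N ^ 2 * ?S r) UNIV"
      by (rule has_sum_cmult_right)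
    also have "(\<lambda>l. W c r / of_nat N ^ 2 * (1 / (?w + of_int l) ^ 2)) = (\<lambda>l. ?f (int N * l + r))"
    proof
      fix l
      have "of_int c * z + of_int (int N * l + r) = of_nat N * (?w + of_int l)"
        using N_pos by (simp add: field_simps)
      moreover have "W c (int N * l + r) = W c r"
        using periodic[of c 0 r l] by (simp add: add.commute)
      ultimately show "W c r / of_nat N ^ 2 * (1 / (?w + of_int l) ^ 2) = ?f (int N * l + r)"
        by (simp only: power_mult_distrib) simp
    qed
    finally show "((\<lambda>y. case (r, y) of (i, k) \<Rightarrow> ?f (int N * k + i)) has_sum W c r / of_nat N ^ 2 * ?S r) UNIV"
      by simp
  qed
  moreover have "((\<lambda>r. W c r / of_nat N ^ 2 * ?S r) has_sum (\<Sum>r\<in>{0..<int N}. W c r / of_nat N ^ 2 * ?S r)) {0..<int N}"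
    by (intro has_sum_finite) auto
  ultimately show ?thesis by (rule has_sum_unique)
qed

text \<open>The points (c z + r) / N have imaginary part at least |c| y0 / N in absolute value. This
  gives geometric decay in |c| with ratio exp(-2 pi y0 / N), uniformly in Re z.\<close>

lemma row_bound:
  assumes "y0 > 0"
  obtains K \<rho> where "0 \<le> K" "0 \<le> \<rho>" "\<rho> < 1"
    "\<And>z c. Im z \<ge> y0 \<Longrightarrow> c \<noteq> 0 \<Longrightarrow> norm (row z c) \<le> K * \<rho> ^ nat \<bar>c\<bar>"
proof -
  obtain B where B: "B \<ge> 0" "\<And>c d. norm (W c d) \<le> B" using W_bounded by blast
  define \<rho> where "\<rho> = exp (- 2 * pi * (y0 / N))"
  have \<rho>: "0 \<le> \<rho>" "\<rho> < 1" using assms N_pos by (auto simp: \<rho>_def)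
  define K where "K = real N * (B / real N ^ 2 * (4 * pi ^ 2 / (1 - \<rho>) ^ 2))"
  have "norm (row z c) \<le> K * \<rho> ^ nat \<bar>c\<bar>" if z: "Im z \<ge> y0" and c: "c \<noteq> 0" for z c
  proof -
    have Im: "Im z > 0" using z assms by simp
    have "norm (row z c) \<le> (\<Sum>r\<in>{0..<int N}. B / real N ^ 2 * (4 * pi ^ 2 / (1 - \<rho>) ^ 2 * \<rho> ^ nat \<bar>c\<bar>))"
      unfolding row_eq[OF Im c]
    proof (rule sum_norm_le)
      fix r
      let ?w = "(of_int c * z + of_int r) / of_nat N"
      define \<rho>' where "\<rho>' = exp (- 2 * pi * \<bar>Im ?w\<bar>)"
      have Imw: "\<bar>Im ?w\<bar> = \<bar>of_int c\<bar> * Im z / N" using Im N_pos by (simp add: abs_mult)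
      have "norm (\<Sum>\<^sub>\<infinity>l::int. 1 / (?w + of_int l) ^ 2) \<le> 4 * pi ^ 2 * (\<rho>' / (1 - \<rho>') ^ 2)"
        unfolding \<rho>'_def using c Im N_pos by (intro norm_infsum_inverse_shifted_square_le) simp
      also have "\<rho>' / (1 - \<rho>') ^ 2 \<le> \<rho> ^ nat \<bar>c\<bar> / (1 - \<rho>) ^ 2"
      proof -
        have "real_of_int \<bar>c\<bar> * (y0 / N) \<le> \<bar>Im ?w\<bar>"
          unfolding Imw times_divide_eq_right using mult_left_mono[OF z, of "\<bar>real_of_int c\<bar>"]
          by (intro divide_right_mono) auto
        then have "2 * pi * (real_of_int \<bar>c\<bar> * (y0 / N)) \<le> 2 * pi * \<bar>Im ?w\<bar>"
          by (intro mult_left_mono) auto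
        then have "\<rho>' \<le> exp (real (nat \<bar>c\<bar>) * (- 2 * pi * (y0 / N)))"
          unfolding \<rho>'_def exp_le_cancel_iff by (simp add: mult_ac)
        also have "\<dots> = \<rho> ^ nat \<bar>c\<bar>" unfolding \<rho>_def by (rule exp_of_nat_mult)
        finally have 1: "\<rho>' \<le> \<rho> ^ nat \<bar>c\<bar>" .
        \<comment> \<open>As c is nonzero, \<open>\<rho>'\<close> is at most \<open>\<rho>\<close>
          itself, which keeps 1 - \<open>\<rho>'\<close> away from 0 independently of c.\<close>
        also have "\<rho> ^ nat \<bar>c\<bar> \<le> \<rho> ^ 1"
          using \<rho> c by (intro power_decreasing) auto
        finally have 2: "\<rho>' \<le> \<rho>" by simp
        show ?thesis
          using 1 2 \<rho> by (intro frac_le power_mono) (auto simp: \<rho>'_def)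
      qed
      finally have *: "norm (\<Sum>\<^sub>\<infinity>l::int. 1 / (?w + of_int l) ^ 2) \<le> 4 * pi ^ 2 / (1 - \<rho>) ^ 2 * \<rho> ^ nat \<bar>c\<bar>"
        by (simp add: mult_left_mono)
      have "norm (W c r / of_nat N ^ 2) \<le> B / real N ^ 2"
        using B by (simp add: norm_divide norm_power divide_right_mono)
      then show "norm (W c r / of_nat N ^ 2 * (\<Sum>\<^sub>\<infinity>l::int. 1 / (?w + of_int l) ^ 2))
        \<le> B / real N ^ 2 * (4 * pi ^ 2 / (1 - \<rho>) ^ 2 * \<rho> ^ nat \<bar>c\<bar>)"
        unfolding norm_mult using * B by (intro mult_mono) auto
    qed
    also have "\<dots> = K * \<rho> ^ nat \<bar>c\<bar>" by (simp add: K_def)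
    finally show ?thesis .
  qed
  moreover have "K \<ge> 0" using B by (simp add: K_def)
  ultimately show ?thesis using \<rho> that by blast
qed

lemma summable_rows:
  assumes "y0 > 0"
  obtains M where "M summable_on UNIV" "\<And>z c. Im z \<ge> y0 \<Longrightarrow> norm (row z c) \<le> M c"
proof -
  obtain K \<rho> where K: "0 \<le> K" "0 \<le> \<rho>" "\<rho> < 1"
    "\<And>z c. Im z \<ge> y0 \<Longrightarrow> c \<noteq> 0 \<Longrightarrow> norm (row z c) \<le> K * \<rho> ^ nat \<bar>c\<bar>"
    using row_bound[OF assms] by blast
  \<comment> \<open>Row 0 does not involve z, so its value at z = 0 serves for all z.\<close>
  define M where "M c = (if c = 0 then norm (row 0 0) else 0) + K * \<rho> ^ nat \<bar>c\<bar>" for c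
  have "M summable_on UNIV"
    unfolding M_def
  proof (intro summable_on_add summable_on_cmult_right summable_on_int_geometric K)
    have "finite {c. (if c = 0 then norm (row 0 0) else 0) \<noteq> (0::real)}"
      by (rule finite_subset[of _ "{0}"]) auto
    then show "(\<lambda>c. if c = 0 then norm (row 0 0) else 0) summable_on UNIV"
      by (intro finite_nonzero_values_imp_summable_on) auto
  qed
  moreover have "norm (row z c) \<le> M c" if "Im z \<ge> y0" for z c
  proof (cases "c = 0")
    case True
    have "row z 0 = row 0 0" by (simp add: row_def)
    then show ?thesis using True K by (simp add: M_def)
  qed (use K(4)[OF that] in \<open>simp add: M_def\<close>)
  ultimately show ?thesis by (rule that)
qed

text \<open>At t = 0 the lattice sum itself cannot be rearranged. The blocks, however, converge
  absolutely and may be summed over l first; for fixed k this gives \<open>N\<close> complete rows,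
  each absolutely convergent. So the sum of the blocks is the sum of the rows.\<close>

lemma has_sum_rows:
  assumes "Im z > 0"
  shows "(row z has_sum hecke_sum 0 z) UNIV"
proof -
  obtain M where M: "M summable_on UNIV" "\<And>z' c. Im z' \<ge> Im z \<Longrightarrow> norm (row z' c) \<le> M c"
    using summable_rows[OF assms] by blast
  have "(\<lambda>c. norm (row z c)) summable_on UNIV"
    by (rule Infinite_Sum.abs_summable_on_comparison_test'[OF M(1)]) (rule M(2)[OF order_refl])
  then obtain R where R: "(row z has_sum R) UNIV"
    using Infinite_Sum.abs_summable_summable unfolding summable_on_def by blast
  have 1: "((\<lambda>k. \<Sum>i\<in>{0..<int N}. row z (int N * k + i)) has_sum R) UNIV"
    by (rule has_sum_residues[OF R])
  have "(block 0 z has_sum hecke_sum 0 z) (UNIV \<times> UNIV)"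
    using block_has_sum_hecke_sum[OF assms, of 0] by simp
  then have "((\<lambda>k. \<Sum>i\<in>{0..<int N}. row z (int N * k + i)) has_sum hecke_sum 0 z) UNIV"
  proof (rule has_sum_SigmaD)
    fix k
    let ?f = "\<lambda>c d. W c d / (of_int c * z + of_int d) ^ 2"
    have "((\<lambda>l. \<Sum>i\<in>{0..<int N}. \<Sum>j\<in>{0..<int N}. ?f (int N * k + i) (int N * l + j))
        has_sum (\<Sum>i\<in>{0..<int N}. row z (int N * k + i))) UNIV"
      by (intro has_sum_sum has_sum_residues has_sum_row assms)
    also have "(\<lambda>l. \<Sum>i\<in>{0..<int N}. \<Sum>j\<in>{0..<int N}. ?f (int N * k + i) (int N * l + j)) = (\<lambda>l. block 0 z (k, l))"
    proof
      fix l
      have "W (int N * k + i) (int N * l + j) = W i j" for i j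
        using periodic[of i k j l] by (simp add: add.commute)
      then show "(\<Sum>i\<in>{0..<int N}. \<Sum>j\<in>{0..<int N}. ?f (int N * k + i) (int N * l + j)) = block 0 z (k, l)"
        by (simp add: block_def sum.cartesian_product hecke_kernel_at_0)
    qed
    finally show "((\<lambda>l. block 0 z (k, l)) has_sum (\<Sum>i\<in>{0..<int N}. row z (int N * k + i))) UNIV" .
  qed
  with 1 have "hecke_sum 0 z = R" by (metis has_sum_unique)
  with R show ?thesis by simp
qed

text \<open>The uniform row majorant suffices for boundedness towards the cusp, for any weight and
  without a q-expansion.\<close>

lemma hecke_sum_bounded:
  assumes "y0 > 0"
  obtains C where "\<And>z. Im z \<ge> y0 \<Longrightarrow> norm (hecke_sum 0 z) \<le> C"
proof -
  obtain M where M: "M summable_on UNIV" "\<And>z c. Im z \<ge> y0 \<Longrightarrow> norm (row z c) \<le> M c"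
    using summable_rows[OF assms] by blast
  show ?thesis
  proof (rule that)
    fix z assume z: "Im z \<ge> y0"
    then have "Im z > 0" using assms by simp
    from norm_infsum_le[OF has_sum_rows[OF this] has_sum_infsum[OF M(1)] M(2)[OF z]]
    show "norm (hecke_sum 0 z) \<le> infsum M UNIV" .
  qed
qed

text \<open>A matrix of determinant 1 permutes the pairs of residues modulo \<open>N\<close>, so the
  sum over a period does not change.\<close>

lemma periodic_weight_transform:
  assumes det: "a * d - b * c = (1::int)"
  shows "periodic_weight N (\<lambda>x y. W (x * a + y * c) (x * b + y * d))"
proof
  show "N > 0" by (rule N_pos)
  show "W ((x + int N * k) * a + (y + int N * l) * c) ((x + int N * k) * b + (y + int N * l) * d) =
      W (x * a + y * c) (x * b + y * d)" for x k y l
  proof -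
    have "(x + int N * k) * a + (y + int N * l) * c = (x * a + y * c) + int N * (k * a + l * c)"
      "(x + int N * k) * b + (y + int N * l) * d = (x * b + y * d) + int N * (k * b + l * d)"
      by (simp_all add: algebra_simps)
    then show ?thesis by (simp only: periodic)
  qed
  let ?n = "int N"
  \<comment> \<open>Pairs are transformed by the matrix and back by its adjugate; for determinant 1
    the two are inverse to each other modulo \<open>N\<close>.\<close>
  have *: "(((i * a + j * c) mod ?n) * d - ((i * b + j * d) mod ?n) * c) mod ?n = i mod ?n"
    "(((i * b + j * d) mod ?n) * a - ((i * a + j * c) mod ?n) * b) mod ?n = j mod ?n"
    "(((i * d - j * c) mod ?n) * a + ((j * a - i * b) mod ?n) * c) mod ?n = i mod ?n"
    "(((i * d - j * c) mod ?n) * b + ((j * a - i * b) mod ?n) * d) mod ?n = j mod ?n" for i j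
  proof -
    have 1: "(x mod ?n * p - y mod ?n * q) mod ?n = (x * p - y * q) mod ?n"
      "(x mod ?n * p + y mod ?n * q) mod ?n = (x * p + y * q) mod ?n" for x y p q
      by (intro mod_diff_cong mod_add_cong mod_mult_cong; simp)+
    have 2: "(i * a + j * c) * d - (i * b + j * d) * c = i * (a * d - b * c)"
      "(i * b + j * d) * a - (i * a + j * c) * b = j * (a * d - b * c)"
      "(i * d - j * c) * a + (j * a - i * b) * c = i * (a * d - b * c)"
      "(i * d - j * c) * b + (j * a - i * b) * d = j * (a * d - b * c)"
      by (simp_all add: algebra_simps)
    show "(((i * a + j * c) mod ?n) * d - ((i * b + j * d) mod ?n) * c) mod ?n = i mod ?n"
      "(((i * b + j * d) mod ?n) * a - ((i * a + j * c) mod ?n) * b) mod ?n = j mod ?n"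
      "(((i * d - j * c) mod ?n) * a + ((j * a - i * b) mod ?n) * c) mod ?n = i mod ?n"
      "(((i * d - j * c) mod ?n) * b + ((j * a - i * b) mod ?n) * d) mod ?n = j mod ?n"
      by (simp_all only: 1 2 det mult_1_right)
  qed
  have "(\<Sum>(i, j)\<in>residues. W (i * a + j * c) (i * b + j * d)) = (\<Sum>(i, j)\<in>residues. W i j)"
    using N_pos * W_mod
    by (intro sum.reindex_bij_witness[of _ "\<lambda>(i, j). ((i * d - j * c) mod ?n, (j * a - i * b) mod ?n)"
          "\<lambda>(i, j). ((i * a + j * c) mod ?n, (i * b + j * d) mod ?n)"]) auto
  then show "(\<Sum>(i, j)\<in>residues. W (i * a + j * c) (i * b + j * d)) = 0"
    using mean_zero by simp
qed

end

section \<open>Unimodular substitutions\<close>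

lemma Im_moebius_pos:
  assumes "Im z > 0" "a * d - b * c = (1::int)"
  shows "Im ((of_int a * z + of_int b) / (of_int c * z + of_int d)) > 0"
proof -
  have "Im ((of_int a * z + of_int b) * cnj (of_int c * z + of_int d)) = of_int (a * d - b * c) * Im z"
    by (simp add: algebra_simps)
  then show ?thesis
    using assms by (subst Im_complex_div_gt_0) simp
qed

lemma moebius_denominator_nonzero:
  assumes "Im z > 0" "a * d - b * c = (1::int)"
  shows "of_int c * z + of_int d \<noteq> 0"
  using Im_moebius_pos[OF assms] by auto

lemma bij_betw_int_matrix:
  assumes "a * d - b * c = (1::int)"
  shows "bij_betw (\<lambda>(x, y). (x * a + y * c, x * b + y * d)) UNIV UNIV"
proof (rule bij_betw_byWitness[of _ "\<lambda>(x, y). (x * d - y * c, y * a - x * b)"], goal_cases)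
  case 1
  have "(x * a + y * c) * d - (x * b + y * d) * c = x * (a * d - b * c)"
    "(x * b + y * d) * a - (x * a + y * c) * b = y * (a * d - b * c)" for x y
    by (simp_all add: algebra_simps)
  then show ?case unfolding assms by simp
next
  case 2
  have "(x * d - y * c) * a + (y * a - x * b) * c = x * (a * d - b * c)"
    "(x * d - y * c) * b + (y * a - x * b) * d = y * (a * d - b * c)" for x y
    by (simp_all add: algebra_simps)
  then show ?case unfolding assms by simp
qed auto

text \<open>For Re t > 0 this is a reindexing of an absolutely convergent sum, with the automorphy
  factor pulled out of the kernel. At t = 0 no reindexing is possible, so the identity is carried
  there by continuity of both continuations.\<close>

lemma (in periodic_weight) hecke_sum_moebius:
  assumes z: "Im z > 0" and det: "a * d - b * c = (1::int)"
    and W': "periodic_weight N W'" "\<And>x y. W' (x * a + y * c) (x * b + y * d) = W x y"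
  defines "j \<equiv> of_int c * z + of_int d"
  shows "hecke_sum 0 ((of_int a * z + of_int b) / j) / j ^ 2 = periodic_weight.hecke_sum N W' 0 z"
proof -
  interpret W': periodic_weight N W' by (rule W')
  define z' where "z' = (of_int a * z + of_int b) / j"
  have z': "Im z' > 0" unfolding z'_def j_def by (rule Im_moebius_pos[OF z det])
  have j: "j \<noteq> 0" unfolding j_def by (rule moebius_denominator_nonzero[OF z det])
  have eq: "hecke_kernel t j * hecke_sum t z' = W'.hecke_sum t z" if t: "Re t > 0" for t
  proof -
    let ?g = "\<lambda>(x, y). (x * a + y * c, x * b + y * d)"
    let ?f = "\<lambda>(x, y). W' x y * hecke_kernel t (of_int x * z + of_int y)"
    have "((\<lambda>(x, y). W x y * hecke_kernel t (of_int x * z' + of_int y)) has_sum hecke_sum t z') UNIV"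
      by (rule has_sum_hecke_sum[OF z' t])
    then have "((\<lambda>xy. hecke_kernel t j * (\<lambda>(x, y). W x y * hecke_kernel t (of_int x * z' + of_int y)) xy)
        has_sum (hecke_kernel t j * hecke_sum t z')) UNIV"
      by (rule has_sum_cmult_right)
    also have "(\<lambda>xy. hecke_kernel t j * (\<lambda>(x, y). W x y * hecke_kernel t (of_int x * z' + of_int y)) xy)
        = (\<lambda>xy. ?f (?g xy))"
    proof
      fix xy :: "int \<times> int"
      obtain x y where xy: "xy = (x, y)" by (cases xy)
      have "j * (of_int x * z' + of_int y) = of_int (x * a + y * c) * z + of_int (x * b + y * d)"
      proof -
        have "j * (of_int x * z' + of_int y) = of_int x * (j * z') + of_int y * j"
          by (simp add: algebra_simps)
        also have "j * z' = of_int a * z + of_int b" using j by (simp add: z'_def)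
        finally show ?thesis by (simp add: j_def algebra_simps)
      qed
      then have "hecke_kernel t (of_int (x * a + y * c) * z + of_int (x * b + y * d)) =
          hecke_kernel t j * hecke_kernel t (of_int x * z' + of_int y)"
        by (metis hecke_kernel_mult)
      then show "hecke_kernel t j * (\<lambda>(x, y). W x y * hecke_kernel t (of_int x * z' + of_int y)) xy = ?f (?g xy)"
        by (simp add: xy W'(2) del: of_int_add of_int_mult)
    qed
    finally have "(?f has_sum (hecke_kernel t j * hecke_sum t z')) UNIV"
      using has_sum_reindex_bij_betw[OF bij_betw_int_matrix[OF det], of ?f] by simp
    then show ?thesis using W'.has_sum_hecke_sum[OF z t] by (rule has_sum_unique)
  qed
  \<comment> \<open>Points of the positive real axis tending to 0, where the reindexed identity is
    available.\<close>
  define s where "s n = complex_of_real (inverse (real (Suc n)))" for n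
  have "s \<longlonglongrightarrow> of_real 0" unfolding s_def
    by (rule tendsto_of_real[OF LIMSEQ_inverse_real_of_nat])
  then have s: "s \<longlonglongrightarrow> 0" by simp
  have op: "open {t. Re t > - 1/2}" by (simp add: open_halfspace_Re_gt)
  have lim: "(\<lambda>n. f (s n)) \<longlonglongrightarrow> f 0" if "f holomorphic_on {t. Re t > - 1/2}" for f
  proof (rule continuous_on_tendsto_compose[OF holomorphic_on_imp_continuous_on[OF that] s])
    show "\<forall>\<^sub>F n in sequentially. s n \<in> {t. Re t > - 1/2}"
      by (intro always_eventually allI) (auto simp: s_def intro: less_le_trans[of _ 0])
  qed simp
  have "(\<lambda>n. hecke_kernel (s n) j * hecke_sum (s n) z') \<longlonglongrightarrow> hecke_kernel 0 j * hecke_sum 0 z'"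
    by (intro lim holomorphic_intros holomorphic_hecke_sum z')
  moreover have "(\<lambda>n. W'.hecke_sum (s n) z) \<longlonglongrightarrow> W'.hecke_sum 0 z"
    by (intro lim W'.holomorphic_hecke_sum z)
  moreover have "hecke_kernel (s n) j * hecke_sum (s n) z' = W'.hecke_sum (s n) z" for n
    by (rule eq) (simp add: s_def)
  ultimately have "hecke_kernel 0 j * hecke_sum 0 z' = W'.hecke_sum 0 z"
    by (simp add: LIMSEQ_unique)
  then show ?thesis by (simp add: hecke_kernel_at_0 z'_def)
qed

section \<open>Divisor sums and sieving\<close>

lemma prod_primes_dvd_iff:
  assumes "finite X" "\<And>p. p \<in> X \<Longrightarrow> prime p"
  shows "\<Prod>X dvd (n::nat) \<longleftrightarrow> (\<forall>p\<in>X. p dvd n)"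
  using assms
proof (induction X rule: finite_induct)
  case (insert p X)
  have "coprime p (\<Prod>X)"
    using insert by (intro prod_coprime_right) (auto intro!: primes_coprime)
  then have "p * \<Prod>X dvd n \<longleftrightarrow> p dvd n \<and> \<Prod>X dvd n"
    by (meson divides_mult dvd_mult_left dvd_mult_right)
  then show ?case using insert by simp
qed simp

lemma int_prod_primes_dvd_iff:
  assumes "finite X" "\<And>p. p \<in> X \<Longrightarrow> prime p"
  shows "int (\<Prod>X) dvd d \<longleftrightarrow> (\<forall>p\<in>X. int p dvd d)"
proof -
  have "int k dvd d \<longleftrightarrow> k dvd nat \<bar>d\<bar>" for k
    by (simp flip: int_dvd_int_iff)
  then show ?thesis using prod_primes_dvd_iff[OF assms, of "nat \<bar>d\<bar>"] by simp
qed

text \<open>Inclusion-exclusion: the product of the factors 1 - [p divides d] is multiplied out over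
  the subsets of \<open>A\<close>.\<close>

lemma prod_indicator_not_dvd:
  assumes "finite A" "\<And>p. p \<in> A \<Longrightarrow> prime p"
  shows "(\<Prod>p\<in>A. if int p dvd d then 0 else 1 :: complex)
    = (\<Sum>X\<in>Pow A. (- 1) ^ card X * (if int (\<Prod>X) dvd d then 1 else 0))"
proof -
  have "(\<Prod>p\<in>A. if int p dvd d then 0 else 1 :: complex) = (\<Prod>p\<in>A. (if int p dvd d then - 1 else 0) + 1)"
    by (intro prod.cong) auto
  also have "\<dots> = (\<Sum>X\<in>Pow A. (\<Prod>p\<in>X. if int p dvd d then - 1 else 0))"
    by (simp add: prod_add[OF assms(1)])
  also have "\<dots> = (\<Sum>X\<in>Pow A. (- 1) ^ card X * (if int (\<Prod>X) dvd d then 1 else 0))"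
  proof (intro sum.cong refl)
    fix X assume "X \<in> Pow A"
    then have X: "finite X" "\<And>p. p \<in> X \<Longrightarrow> prime p" using assms finite_subset by auto
    show "(\<Prod>p\<in>X. if int p dvd d then - 1 else 0 :: complex) = (- 1) ^ card X * (if int (\<Prod>X) dvd d then 1 else 0)"
    proof (cases "\<forall>p\<in>X. int p dvd d")
      case True
      then have "(\<Prod>p\<in>X. if int p dvd d then - 1 else 0 :: complex) = (\<Prod>p\<in>X. - 1)"
        by (intro prod.cong) auto
      then show ?thesis using True int_prod_primes_dvd_iff[OF X, of d] by simp
    next
      case False
      then have "(\<Prod>p\<in>X. if int p dvd d then - 1 else 0 :: complex) = 0"
        using X(1) by (auto simp: prod_zero_iff)
      then show ?thesis using False int_prod_primes_dvd_iff[OF X, of d] by simp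
    qed
  qed
  finally show ?thesis .
qed

lemma has_sum_coprime_sieve:
  fixes f :: "int \<Rightarrow> complex"
  assumes A: "finite A" "\<And>p. p \<in> A \<Longrightarrow> prime p"
    and s: "\<And>X. X \<subseteq> A \<Longrightarrow> ((\<lambda>d. f (int (\<Prod>X) * d)) has_sum s X) UNIV"
  shows "((\<lambda>d. (\<Prod>p\<in>A. if int p dvd d then 0 else 1) * f d) has_sum
    (\<Sum>X\<in>Pow A. (- 1) ^ card X * s X)) UNIV"
proof -
  have "((\<lambda>d. \<Sum>X\<in>Pow A. (- 1) ^ card X * ((if int (\<Prod>X) dvd d then 1 else 0) * f d)) has_sum
    (\<Sum>X\<in>Pow A. (- 1) ^ card X * s X)) UNIV"
  proof (intro has_sum_sum has_sum_cmult_right)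
    fix X assume "X \<in> Pow A"
    then have X: "X \<subseteq> A" "finite X" "\<And>p. p \<in> X \<Longrightarrow> prime p" using A finite_subset by auto
    define m where "m = int (\<Prod>X)"
    have m: "m \<noteq> 0" using X(2) X(3)[of 0] unfolding m_def by (auto simp: prod_zero_iff)
    have "bij_betw (\<lambda>d. m * d) UNIV {d. m dvd d}"
      using m by (auto simp: bij_betw_def inj_on_def elim!: dvdE)
    from has_sum_reindex_bij_betw[OF this, of f "s X"] s[OF X(1)]
    have "(f has_sum s X) {d. m dvd d}" by (simp add: m_def)
    then show "((\<lambda>d. (if int (\<Prod>X) dvd d then 1 else 0) * f d) has_sum s X) UNIV"
      by (rule has_sum_cong_neutral[THEN iffD1, rotated -1]) (auto simp: m_def)
  qed
  also have "(\<lambda>d. \<Sum>X\<in>Pow A. (- 1) ^ card X * ((if int (\<Prod>X) dvd d then 1 else 0) * f d))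
    = (\<lambda>d. (\<Prod>p\<in>A. if int p dvd d then 0 else 1) * f d)"
    by (simp only: prod_indicator_not_dvd[OF A] sum_distrib_right mult.assoc)
  finally show ?thesis .
qed

text \<open>Multiplying out the product over p gives, for each subset with product M, the sum of (m
  / k) M over the divisors k of m that are multiples of M. In terms of n = (m / k) M this is the sum
  of n over the same set of divisors, and now the sum over subsets sieves n.\<close>

lemma sum_divisors_sieve:
  fixes m :: nat
  assumes A: "finite A" "\<And>p. p \<in> A \<Longrightarrow> prime p" and m: "m > 0"
  shows "(\<Sum>k | k dvd m. of_nat (m div k) * (\<Prod>p\<in>A. if p dvd k then 1 - of_nat p else 1))
    = (\<Sum>n | n dvd m \<and> (\<forall>p\<in>A. \<not> p dvd n). of_nat n :: complex)"
proof -
  have fin: "finite {k. k dvd m}" using m by simp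
  have 1: "(\<Prod>p\<in>A. if p dvd k then 1 - of_nat p else 1 :: complex)
    = (\<Sum>X\<in>Pow A. (- 1) ^ card X * (if \<Prod>X dvd k then of_nat (\<Prod>X) else 0))" for k
  proof -
    have "(\<Prod>p\<in>A. if p dvd k then 1 - of_nat p else 1 :: complex) = (\<Prod>p\<in>A. (if p dvd k then - of_nat p else 0) + 1)"
      by (intro prod.cong) auto
    also have "\<dots> = (\<Sum>X\<in>Pow A. (\<Prod>p\<in>X. if p dvd k then - of_nat p else 0))"
      by (simp add: prod_add[OF A(1)])
    also have "\<dots> = (\<Sum>X\<in>Pow A. (- 1) ^ card X * (if \<Prod>X dvd k then of_nat (\<Prod>X) else 0))"
    proof (intro sum.cong refl)
      fix X assume "X \<in> Pow A"
      then have X: "finite X" "\<And>p. p \<in> X \<Longrightarrow> prime p" using A finite_subset by auto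
      show "(\<Prod>p\<in>X. if p dvd k then - of_nat p else 0 :: complex) = (- 1) ^ card X * (if \<Prod>X dvd k then of_nat (\<Prod>X) else 0)"
      proof (cases "\<forall>p\<in>X. p dvd k")
        case True
        then have "(\<Prod>p\<in>X. if p dvd k then - of_nat p else 0 :: complex) = (\<Prod>p\<in>X. - of_nat p)"
          by (intro prod.cong) auto
        then show ?thesis using True prod_primes_dvd_iff[OF X, of k] by (simp add: prod_uminus)
      next
        case False
        then have "(\<Prod>p\<in>X. if p dvd k then - of_nat p else 0 :: complex) = 0"
          using X(1) by (auto simp: prod_zero_iff)
        then show ?thesis using False prod_primes_dvd_iff[OF X, of k] by auto
      qed
    qed
    finally show ?thesis .
  qed
  have "(\<Sum>k | k dvd m. of_nat (m div k) * (\<Prod>p\<in>A. if p dvd k then 1 - of_nat p else 1 :: complex))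
    = (\<Sum>X\<in>Pow A. (- 1) ^ card X * (\<Sum>k | k dvd m. of_nat (m div k) * (if \<Prod>X dvd k then of_nat (\<Prod>X) else 0)))"
    unfolding 1 sum_distrib_left by (subst sum.swap) (simp add: mult_ac)
  also have "\<dots> = (\<Sum>X\<in>Pow A. (- 1) ^ card X * (\<Sum>n | n dvd m. if \<Prod>X dvd n then of_nat n else 0))"
  proof (rule sum.cong[OF refl])
    fix X assume "X \<in> Pow A"
    then have X: "finite X" "\<And>p. p \<in> X \<Longrightarrow> prime p" using A finite_subset by auto
    define M where "M = \<Prod>X"
    have M: "M > 0" unfolding M_def using X by (auto simp: prod_pos prime_gt_0_nat)
    \<comment> \<open>The map from k to M m / k is an involution of the divisors of m that are
      multiples of M.\<close>
    have st: "k > 0 \<and> M * m div k dvd m \<and> M dvd M * m div k \<and> M * m div k > 0 \<and>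
        M * m div (M * m div k) = k \<and> m div k * M = M * m div k"
      if k: "k dvd m" "M dvd k" for k
    proof -
      obtain a where a: "k = M * a" using k(2) by blast
      obtain b where b: "m = k * b" using k(1) by blast
      have pos: "a > 0" "b > 0" "k > 0" using m a b by (auto intro!: Nat.gr0I)
      have 1: "M * m = k * (M * b)" using b by simp
      have 2: "M * m div k = M * b" unfolding 1 using pos by simp
      have 3: "M * m = (M * b) * k" using b by simp
      have "M * m div (M * b) = k" unfolding 3 using M pos by simp
      moreover have "M * b dvd m" unfolding b a by simp
      ultimately show ?thesis unfolding 2 using M pos b by simp
    qed
    have "(\<Sum>k | k dvd m. of_nat (m div k) * (if M dvd k then of_nat M else 0 :: complex))
       = (\<Sum>k | k dvd m \<and> M dvd k. of_nat (m div k * M))"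
      using fin by (intro sum.mono_neutral_cong_right) auto
    also have "\<dots> = (\<Sum>n | n dvd m \<and> M dvd n. of_nat n)"
      using st by (intro sum.reindex_bij_witness[of _ "\<lambda>n. M * m div n" "\<lambda>k. M * m div k"]) auto
    also have "\<dots> = (\<Sum>n | n dvd m. if M dvd n then of_nat n else 0)"
      using fin by (intro sum.mono_neutral_cong_left) auto
    finally show "(- 1) ^ card X * (\<Sum>k | k dvd m. of_nat (m div k) * (if \<Prod>X dvd k then of_nat (\<Prod>X) else 0 :: complex))
       = (- 1) ^ card X * (\<Sum>n | n dvd m. if \<Prod>X dvd n then of_nat n else 0)"
      unfolding M_def by (rule arg_cong)
  qed
  also have "\<dots> = (\<Sum>n | n dvd m. of_nat n * (\<Sum>X\<in>Pow A. (- 1) ^ card X * (if int (\<Prod>X) dvd int n then 1 else 0)))"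
    unfolding sum_distrib_left
    by (subst sum.swap, intro sum.cong refl) (auto simp: int_dvd_int_iff simp del: of_nat_prod)
  also have "\<dots> = (\<Sum>n | n dvd m. of_nat n * (\<Prod>p\<in>A. if int p dvd int n then 0 else 1))"
    by (simp only: prod_indicator_not_dvd[OF A])
  also have "\<dots> = (\<Sum>n | n dvd m \<and> (\<forall>p\<in>A. \<not> p dvd n). of_nat n)"
    using fin A(1)
    by (intro sum.mono_neutral_cong_right) (auto simp: prod_zero_iff intro!: prod.neutral)
  finally show ?thesis .
qed

text \<open>m is its coprime part times powers of primes dividing \<open>N\<close>; a divisor of m
  without primes of \<open>N\<close> is coprime to the second factor and so divides the
  first.\<close>

lemma dvd_coprime_part_iff:
  assumes "m > 0" "N > 0"
  shows "n dvd coprime_part N m \<longleftrightarrow> n dvd m \<and> (\<forall>p\<in>prime_factors N. \<not> p dvd n)"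
proof -
  define rest where "rest = (\<Prod>p | p \<in> prime_factors m \<and> p dvd N. p ^ multiplicity p m)"
  have m: "m = coprime_part N m * rest"
  proof -
    have "m = (\<Prod>p\<in>prime_factors m. p ^ multiplicity p m)"
      using assms by (simp add: prod_prime_factors)
    also have "prime_factors m = {p \<in> prime_factors m. \<not> p dvd N} \<union> {p \<in> prime_factors m. p dvd N}" by auto
    also have "(\<Prod>p\<in>\<dots>. p ^ multiplicity p m) = coprime_part N m * rest"
      unfolding coprime_part_def rest_def by (rule prod.union_disjoint) auto
    finally show ?thesis .
  qed
  have cop: "\<not> p dvd coprime_part N m" if p: "p \<in> prime_factors N" for p
  proof
    assume "p dvd coprime_part N m"
    then obtain q where "q \<in> prime_factors m" "\<not> q dvd N" "p dvd q ^ multiplicity q m"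
      using p unfolding coprime_part_def by (subst (asm) prime_dvd_prod_iff) auto
    moreover have "p = q" using calculation p
      by (metis in_prime_factors_iff prime_dvd_power primes_dvd_imp_eq)
    ultimately show False using p by auto
  qed
  show ?thesis
  proof (intro iffI conjI ballI notI)
    assume n: "n dvd coprime_part N m"
    show "n dvd m" using n by (subst m) (rule dvd_mult2)
    fix p assume "p \<in> prime_factors N" "p dvd n"
    then show False using cop n dvd_trans by blast
  next
    assume n: "n dvd m \<and> (\<forall>p\<in>prime_factors N. \<not> p dvd n)"
    have "coprime n rest"
      unfolding rest_def
    proof (intro prod_coprime_right coprime_power_right_iff[THEN iffD2] disjI1)
      fix p assume "p \<in> {p \<in> prime_factors m. p dvd N}"
      then have "prime p" "p \<in> prime_factors N" using assms by (auto simp: in_prime_factors_iff)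
      then show "coprime n p" using n by (metis coprime_commute prime_imp_coprime)
    qed
    then show "n dvd coprime_part N m"
      using n m by (metis coprime_dvd_mult_left_iff)
  qed
qed

lemma divisor_sum_coprime_part:
  assumes "m > 0" "N > 0"
  shows "divisor_sum (coprime_part N m) = (\<Sum>n | n dvd m \<and> (\<forall>p\<in>prime_factors N. \<not> p dvd n). n)"
  unfolding divisor_sum_def using dvd_coprime_part_iff[OF assms] by simp

text \<open>For square-free \<open>N\<close> both functions are products over the primes of
  \<open>N\<close>, with factors -1 and p - 1.\<close>

lemma moebius_mu_div_totient:
  assumes "squarefree N" "N > 0"
  shows "(of_int (moebius_mu N) / of_nat (totient N) :: complex) = (\<Prod>p\<in>prime_factors N. - 1 / (of_nat p - 1))"
proof -
  have "totient N = (\<Prod>p\<in>prime_factors N. p ^ (multiplicity p N - 1) * (p - 1))"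
    using assms(2) by (simp add: totient_formula1)
  also have "\<dots> = (\<Prod>p\<in>prime_factors N. p - 1)"
  proof (intro prod.cong refl)
    fix p assume p: "p \<in> prime_factors N"
    then have "multiplicity p N = 1"
      using assms squarefree_factorial_semiring'[of N] by auto
    then show "p ^ (multiplicity p N - 1) * (p - 1) = p - 1" by simp
  qed
  finally have t: "of_nat (totient N) = (\<Prod>p\<in>prime_factors N. of_nat p - 1 :: complex)"
  proof -
    assume a: "totient N = (\<Prod>p\<in>prime_factors N. p - 1)"
    show ?thesis unfolding a of_nat_prod
      by (intro prod.cong refl) (auto simp: of_nat_diff in_prime_factors_iff prime_ge_1_nat)
  qed
  have "of_int (moebius_mu N) = (\<Prod>p\<in>prime_factors N. - 1 :: complex)"
    using assms by (simp add: moebius_mu_def)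
  then show ?thesis by (simp only: t prod_dividef)
qed

text \<open>Up to the factor -1 / (p - 1) the local values 1 and -1 / (p - 1) are 1 - p and 1, those
  of \<open>sum_divisors_sieve\<close>. The extracted factors multiply up to the quotient of Moebius
  and Euler functions.\<close>

lemma sum_divisors_eq_divisor_sum_coprime_part:
  assumes "squarefree N" "N > 0" "m > 0"
  shows "(\<Sum>k | k dvd m. of_nat (m div k) * (\<Prod>p\<in>prime_factors N. if p dvd k then 1 else - 1 / (of_nat p - 1)))
    = of_int (moebius_mu N) / of_nat (totient N) * (of_nat (divisor_sum (coprime_part N m)) :: complex)"
proof -
  define w where "w = (\<Prod>p\<in>prime_factors N. - 1 / (of_nat p - 1) :: complex)"
  have eqk: "(\<Prod>p\<in>prime_factors N. if p dvd k then 1 else - 1 / (of_nat p - 1))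
      = w * (\<Prod>p\<in>prime_factors N. if p dvd k then 1 - of_nat p else 1)" for k
    unfolding w_def prod.distrib[symmetric]
  proof (intro prod.cong refl)
    fix p assume "p \<in> prime_factors N"
    then have "p > 1" using prime_gt_1_nat in_prime_factors_imp_prime by blast
    then have "of_nat p \<noteq> (1 :: complex)" by (simp add: of_nat_eq_1_iff)
    then have nz: "of_nat p - 1 \<noteq> (0 :: complex)" by simp
    have "- 1 / x * - x = 1" if "x \<noteq> 0" for x :: complex using that by simp
    from this[OF nz] have "- 1 / (of_nat p - 1) * (1 - of_nat p) = (1 :: complex)"
      by (simp only: minus_diff_eq)
    then show "(if p dvd k then 1 else - 1 / (of_nat p - 1)) = - 1 / (of_nat p - 1) * (if p dvd k then 1 - of_nat p else (1::complex))"
      by simp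
  qed
  have "(\<Sum>k | k dvd m. of_nat (m div k) * (\<Prod>p\<in>prime_factors N. if p dvd k then 1 else - 1 / (of_nat p - 1)))
    = w * (\<Sum>k | k dvd m. of_nat (m div k) * (\<Prod>p\<in>prime_factors N. if p dvd k then 1 - of_nat p else 1))"
    unfolding eqk sum_distrib_left by (rule sum.cong[OF refl mult.left_commute])
  also have "(\<Sum>k | k dvd m. of_nat (m div k) * (\<Prod>p\<in>prime_factors N. if p dvd k then 1 - of_nat p else 1))
    = (of_nat (divisor_sum (coprime_part N m)) :: complex)"
    unfolding divisor_sum_coprime_part[OF assms(3,2)] of_nat_sum
    using assms(3) by (intro sum_divisors_sieve) auto
  also have "w = of_int (moebius_mu N) / of_nat (totient N)"
    unfolding w_def using assms by (simp add: moebius_mu_div_totient)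
  finally show ?thesis .
qed

section \<open>The weight of the Eisenstein series\<close>

text \<open>For a primitive pair, p divides c exactly when (c : d) is the point (0 : 1) of the
  projective line modulo p. There the Steinberg vector equals the spherical one; elsewhere it is
  -1/p times it.\<close>

definition psi :: "nat \<Rightarrow> int \<Rightarrow> complex" where
  "psi N c = (\<Prod>p\<in>prime_factors N. if int p dvd c then 1 else - 1 / of_nat p)"

text \<open>Extends the factor of \<open>psi\<close> to pairs that p may divide. Among the p^2 pairs
  of residues the value is 0 once, 1 for p - 1 pairs and -1/p for p^2 - p pairs, with sum 0.\<close>

definition eis_factor :: "nat \<Rightarrow> int \<Rightarrow> int \<Rightarrow> complex" where
  "eis_factor p c d = (if int p dvd c then if int p dvd d then 0 else 1 else - 1 / of_nat p)"

definition eis_weight :: "nat \<Rightarrow> int \<Rightarrow> int \<Rightarrow> complex" where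
  "eis_weight N c d = (\<Prod>p\<in>prime_factors N. eis_factor p c d)"

lemma sum_residues_shift:
  fixes f :: "int \<Rightarrow> int \<Rightarrow> complex"
  assumes n: "n > 0" and f: "\<And>i j. f (i mod n) (j mod n) = f i j"
  shows "(\<Sum>(i, j)\<in>{0..<n} \<times> {0..<n}. f (i + a) (j + b)) = (\<Sum>(i, j)\<in>{0..<n} \<times> {0..<n}. f i j)"
proof (rule sum.reindex_bij_witness[of _ "\<lambda>(i, j). ((i - a) mod n, (j - b) mod n)"
          "\<lambda>(i, j). ((i + a) mod n, (j + b) mod n)"], goal_cases)
  case (1 x)
  then show ?case by (auto simp: mod_simps)
next
  case (3 x)
  then show ?case by (auto simp: mod_simps)
qed (use n f in auto)

lemma bij_betw_affine_mod:
  fixes M i p :: int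
  assumes "p > 0" "coprime M p"
  shows "bij_betw (\<lambda>u. (i + M * u) mod p) {0..<p} {0..<p}"
proof -
  have "inj_on (\<lambda>u. (i + M * u) mod p) {0..<p}"
  proof (rule inj_onI)
    fix u v assume uv: "u \<in> {0..<p}" "v \<in> {0..<p}" and eq: "(i + M * u) mod p = (i + M * v) mod p"
    then have "p dvd M * (u - v)"
      by (simp add: mod_eq_dvd_iff algebra_simps)
    then have "p dvd u - v"
      using assms(2) by (simp add: coprime_commute coprime_dvd_mult_right_iff)
    then have "u mod p = v mod p" by (simp add: mod_eq_dvd_iff)
    then show "u = v" using uv by simp
  qed
  moreover have "(\<lambda>u. (i + M * u) mod p) ` {0..<p} \<subseteq> {0..<p}" using assms by auto
  ultimately show ?thesis
    by (simp add: bij_betw_def endo_inj_surj)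
qed

lemma eis_factor_mod: "eis_factor p (c mod int p) (d mod int p) = eis_factor p c d"
  by (simp add: eis_factor_def dvd_mod_iff)

lemma int_dvd_residue_iff:
  assumes "u \<in> {0..<int p}"
  shows "int p dvd u \<longleftrightarrow> u = 0"
  using assms zdvd_imp_le[of "int p" u] by fastforce

lemma sum_eis_factor_0:
  assumes "p > 0"
  shows "(\<Sum>v\<in>{0..<int p}. eis_factor p 0 v) = of_nat p - 1"
proof -
  have card: "card ({0..<int p} - {0}) = p - 1"
    using assms by (subst card_Diff_singleton) auto
  have "(\<Sum>v\<in>{0..<int p}. eis_factor p 0 v) = (\<Sum>v\<in>{0..<int p}. if v = 0 then 0 else 1)"
    by (rule sum.cong[OF refl]) (simp only: eis_factor_def int_dvd_residue_iff dvd_0_right if_True)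
  also have "\<dots> = (\<Sum>v\<in>{0..<int p} - {0}. 1)"
    by (rule sum.mono_neutral_cong_right) auto
  also have "\<dots> = of_nat (card ({0..<int p} - {0}))" by (simp only: sum_constant mult_1_right)
  also have "\<dots> = of_nat p - 1" unfolding card using assms by (subst of_nat_diff) auto
  finally show ?thesis .
qed
lemma sum_eis_factor_nonzero:
  assumes "p > 0" "\<not> int p dvd u"
  shows "(\<Sum>v\<in>{0..<int p}. eis_factor p u v) = - 1"
proof -
  have "(\<Sum>v\<in>{0..<int p}. eis_factor p u v) = (\<Sum>v\<in>{0..<int p}. - 1 / of_nat p)"
    using assms(2) by (simp only: eis_factor_def if_False)
  also have "\<dots> = of_nat (card {0..<int p}) * (- 1 / of_nat p)" by (rule sum_constant)
  also have "card {0..<int p} = p" by (simp only: card_atLeastLessThan_int diff_0_right nat_int)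
  also have "of_nat p * (- 1 / of_nat p) = (- 1 :: complex)"
  proof -
    have "x * (- 1 / x) = - 1" if "x \<noteq> 0" for x :: complex using that by simp
    then show ?thesis using assms(1) by (metis less_irrefl of_nat_eq_0_iff)
  qed
  finally show ?thesis .
qed

text \<open>An affine map with slope invertible modulo p permutes the residues, so the shift may be
  dropped. Then the row u = 0 gives p - 1, and each of the other p - 1 rows gives -1.\<close>

lemma sum_eis_factor_shift:
  assumes p: "prime p" and M: "coprime M (int p)"
  shows "(\<Sum>(u, v)\<in>{0..<int p} \<times> {0..<int p}. eis_factor p (i + M * u) (j + M * v)) = 0"
proof -
  have p0: "p > 0" "int p > 0" using p by (auto simp: prime_gt_0_nat)
  have "(\<Sum>(u, v)\<in>{0..<int p} \<times> {0..<int p}. eis_factor p (i + M * u) (j + M * v))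
      = (\<Sum>u\<in>{0..<int p}. \<Sum>v\<in>{0..<int p}. eis_factor p ((i + M * u) mod int p) ((j + M * v) mod int p))"
    by (simp add: eis_factor_mod sum.cartesian_product)
  also have "\<dots> = (\<Sum>u\<in>{0..<int p}. \<Sum>v\<in>{0..<int p}. eis_factor p ((i + M * u) mod int p) v)"
    by (intro sum.cong refl sum.reindex_bij_betw bij_betw_affine_mod p0 M)
  also have "\<dots> = (\<Sum>u\<in>{0..<int p}. \<Sum>v\<in>{0..<int p}. eis_factor p u v)"
    by (rule sum.reindex_bij_betw[OF bij_betw_affine_mod[OF p0(2) M], of "\<lambda>u. \<Sum>v\<in>{0..<int p}. eis_factor p u v"])
  also have "\<dots> = (\<Sum>v\<in>{0..<int p}. eis_factor p 0 v)
      + (\<Sum>u\<in>{0..<int p} - {0}. \<Sum>v\<in>{0..<int p}. eis_factor p u v)"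
    using p0 by (intro sum.remove) auto
  also have "(\<Sum>u\<in>{0..<int p} - {0}. \<Sum>v\<in>{0..<int p}. eis_factor p u v) = (\<Sum>u\<in>{0..<int p} - {0}. - 1)"
    using p0 int_dvd_residue_iff by (intro sum.cong[OF refl] sum_eis_factor_nonzero) blast+
  also have "\<dots> = - (of_nat p - 1)"
  proof -
    have "card ({0..<int p} - {0}) = p - 1"
      using p0 by (subst card_Diff_singleton) auto
    then show ?thesis using p0 by (simp add: of_nat_diff)
  qed
  finally show ?thesis using p0 by (simp add: sum_eis_factor_0)
qed

lemma eis_weight_cong:
  assumes "\<And>p. p \<in> prime_factors N \<Longrightarrow> [c = c'] (mod int p)" "\<And>p. p \<in> prime_factors N \<Longrightarrow> [d = d'] (mod int p)"
  shows "eis_weight N c d = eis_weight N c' d'"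
  unfolding eis_weight_def
proof (intro prod.cong refl)
  fix p assume "p \<in> prime_factors N"
  then have "c mod int p = c' mod int p" "d mod int p = d' mod int p" using assms by (auto simp: cong_def)
  then show "eis_factor p c d = eis_factor p c' d'" by (metis eis_factor_mod)
qed

lemma eis_weight_mod:
  assumes "N > 0"
  shows "eis_weight N (c mod int N) (d mod int N) = eis_weight N c d"
  by (rule eis_weight_cong) (auto simp: cong_def mod_mod_cancel)

text \<open>A single prime p of \<open>N\<close> produces the mean value zero. Write N = p M; M is
  prime to p because \<open>N\<close> is square-free. Translations by multiples of M leave every
  factor but the one at p unchanged, and averaging over p^2 of them meets the vanishing sum at
  p.\<close>

lemma periodic_weight_eis_weight:
  assumes N: "N > 1" "squarefree N"
  shows "periodic_weight N (eis_weight N)"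
proof
  show "N > 0" using N by simp
  show "eis_weight N (c + int N * k) (d + int N * l) = eis_weight N c d" for c k d l
    by (rule eis_weight_cong) (auto simp: cong_iff_dvd_diff in_prime_factors_iff intro!: dvd_mult2)
  obtain p where p: "prime p" "p dvd N" using N by (metis prime_factor_nat less_irrefl)
  obtain M where M: "N = p * M" using p by blast
  have pN: "p \<in> prime_factors N" using p N by (simp add: in_prime_factors_iff)
  have "\<not> p dvd M"
  proof
    assume "p dvd M"
    then have "p ^ 2 dvd N" by (simp add: M power2_eq_square)
    then show False using N p squarefree_factorial_semiring[of N] by auto
  qed
  then have cop: "coprime (int M) (int p)"
    using p by (metis coprime_commute coprime_int_iff prime_imp_coprime)
  have p0: "p > 0" using p by (simp add: prime_gt_0_nat)
  let ?R = "{0..<int N} \<times> {0..<int N}" and ?Q = "{0..<int p} \<times> {0..<int p}"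
  define g where "g c d = (\<Prod>q\<in>prime_factors N - {p}. eis_factor q c d)" for c d
  have split: "eis_weight N c d = eis_factor p c d * g c d" for c d
    unfolding eis_weight_def g_def using pN by (intro prod.remove) auto
  have g: "g (c + int M * u) (d + int M * v) = g c d" for c d u v
    unfolding g_def
  proof (intro prod.cong refl)
    fix q assume q: "q \<in> prime_factors N - {p}"
    then have "prime q" "q \<noteq> p" "q dvd p * M" by (auto simp: in_prime_factors_iff M)
    then have "q dvd M" using p by (metis prime_dvd_mult_iff primes_dvd_imp_eq)
    then have "(c + int M * u) mod int q = c mod int q" "(d + int M * v) mod int q = d mod int q"
      by (auto simp: mod_eq_dvd_iff)
    then show "eis_factor q (c + int M * u) (d + int M * v) = eis_factor q c d" by (metis eis_factor_mod)
  qed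
  \<comment> \<open>A sum over a full period does not change under translation, so it may be
    repeated once for each of the p^2 translations.\<close>
  have "of_nat (p * p) * (\<Sum>(i, j)\<in>?R. eis_weight N i j) = (\<Sum>(u, v)\<in>?Q. \<Sum>(i, j)\<in>?R. eis_weight N i j)"
    by simp
  also have "\<dots> = (\<Sum>(u, v)\<in>?Q. \<Sum>(i, j)\<in>?R. eis_weight N (i + int M * u) (j + int M * v))"
    using N eis_weight_mod[of N] by (intro sum.cong refl) (auto simp: sum_residues_shift)
  also have "\<dots> = (\<Sum>(i, j)\<in>?R. g i j * (\<Sum>(u, v)\<in>?Q. eis_factor p (i + int M * u) (j + int M * v)))"
    unfolding split g case_prod_unfold sum_distrib_left by (subst sum.swap) (simp add: mult.commute)
  also have "\<dots> = 0" by (simp add: sum_eis_factor_shift[OF p(1) cop])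
  finally show "(\<Sum>(i, j)\<in>?R. eis_weight N i j) = 0" using p0 by simp
qed

text \<open>Modulo a prime p of \<open>N\<close> the entry c vanishes, and a and d are invertible
  because a d - b c = 1. So divisibility of the first coordinate is preserved, and so is that of the
  second in the only case where it is tested.\<close>

lemma eis_weight_Gamma0:
  assumes det: "a * d - b * c = (1::int)" and c: "int N dvd c"
  shows "eis_weight N (x * a + y * c) (x * b + y * d) = eis_weight N x y"
  unfolding eis_weight_def
proof (intro prod.cong refl)
  fix p assume p: "p \<in> prime_factors N"
  then have pc: "int p dvd c" using c by (metis dvd_trans in_prime_factors_iff of_nat_dvd_iff)
  have pp: "prime (int p)" using p by (auto simp: in_prime_factors_iff)
  have nd: "\<not> int p dvd a \<and> \<not> int p dvd d"
  proof (rule ccontr)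
    assume "\<not> ?thesis"
    then have "int p dvd a * d" by auto
    then have "int p dvd a * d - b * c" using pc by (intro dvd_diff) auto
    then show False using pp by (simp add: det)
  qed
  have 1: "int p dvd x * a + y * c \<longleftrightarrow> int p dvd x"
    using pc nd pp by (simp add: dvd_add_left_iff prime_dvd_mult_iff)
  have 2: "int p dvd x * b + y * d \<longleftrightarrow> int p dvd y" if "int p dvd x"
    using that nd pp by (simp add: dvd_add_right_iff prime_dvd_mult_iff)
  show "eis_factor p (x * a + y * c) (x * b + y * d) = eis_factor p x y"
    using 1 2 by (simp add: eis_factor_def)
qed

lemma eis_weight_minus: "eis_weight N (- c) (- d) = eis_weight N c d"
  unfolding eis_weight_def eis_factor_def dvd_minus_iff ..

lemma norm_psi_le: "norm (psi N c) \<le> 1"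
proof -
  have "norm (if int p dvd c then 1 else - 1 / of_nat p :: complex) \<le> 1" if "p \<in> prime_factors N" for p
  proof -
    have "1 \<le> p" using in_prime_factors_imp_prime[OF that] prime_ge_1_nat by blast
    then have "norm (- 1 / of_nat p :: complex) \<le> 1"
      unfolding norm_divide norm_minus_cancel norm_one norm_of_nat by simp
    then show ?thesis by simp
  qed
  then show ?thesis
    unfolding psi_def prod_norm[symmetric] by (intro prod_le_1) auto
qed

section \<open>From primitive pairs to all pairs\<close>

definition primitive_pairs :: "(int \<times> int) set" where
  "primitive_pairs = {(c, d). coprime c d \<and> (c > 0 \<or> c = 0 \<and> d = 1)}"

definition coprime_integers :: "nat \<Rightarrow> int set" where
  "coprime_integers N = {n. coprime n (int N)}"

text \<open>Twice the Riemann zeta function at 2 + 2t, without the Euler factors at the primes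
  dividing \<open>N\<close>.\<close>

definition eis_L :: "nat \<Rightarrow> complex \<Rightarrow> complex" where
  "eis_L N t = (\<Sum>\<^sub>\<infinity>n\<in>coprime_integers N. hecke_kernel t (of_int n))"

text \<open>n is invertible modulo every prime of \<open>N\<close> and so does not affect
  divisibility; the entries of a primitive pair are never both divisible, so the value 0 does not
  occur.\<close>

lemma eis_weight_mult_primitive:
  assumes n: "n \<in> coprime_integers N" and cd: "coprime c d"
  shows "eis_weight N (n * c) (n * d) = psi N c"
  unfolding eis_weight_def psi_def
proof (intro prod.cong refl)
  fix p assume p: "p \<in> prime_factors N"
  then have pp: "prime (int p)" and pN: "int p dvd int N" by (auto simp: in_prime_factors_iff)
  have nu: "\<not> is_unit (int p)" using pp not_prime_unit by blast
  have n': "\<not> int p dvd n"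
    using n pN nu coprime_common_divisor[of n "int N" "int p"] unfolding coprime_integers_def by blast
  have cd': "\<not> (int p dvd c \<and> int p dvd d)"
    using cd nu coprime_common_divisor[of c d "int p"] by blast
  show "eis_factor p (n * c) (n * d) = (if int p dvd c then 1 else - 1 / of_nat p)"
    unfolding eis_factor_def prime_dvd_mult_iff[OF pp] using n' cd' by presburger
qed

text \<open>The inverse map divides a pair by its gcd, taken with the sign \<open>sg\<close> that
  brings the quotient into \<open>primitive_pairs\<close>.\<close>

lemma bij_betw_primitive_pairs:
  assumes N: "N > 1"
  shows "bij_betw (\<lambda>(n, (c, d)). (n * c, n * d)) (coprime_integers N \<times> primitive_pairs)
    {(a, b). (a, b) \<noteq> (0, 0) \<and> coprime (gcd a b) (int N)}"
proof -
  define sg where "sg = (\<lambda>(a :: int, b :: int). if a > 0 \<or> (a = 0 \<and> b > 0) then 1 else - 1 :: int)"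
  define g where "g = (\<lambda>(a, b). sg (a, b) * gcd a b)"
  have n0: "n \<noteq> 0" if "n \<in> coprime_integers N" for n
    using that N by (auto simp: coprime_integers_def)
  have sq: "sg x * sg x = 1" for x by (auto simp: sg_def split: prod.splits)
  have key: "g (n * c, n * d) = n" if n: "n \<noteq> 0" and cd: "(c, d) \<in> primitive_pairs" for n c d
  proof -
    have gc: "gcd (n * c) (n * d) = \<bar>n\<bar>"
      using cd by (simp add: primitive_pairs_def gcd_mult_left)
    have "sg (n * c, n * d) = sgn n"
      using n cd by (auto simp: sg_def primitive_pairs_def sgn_if zero_less_mult_iff)
    then show ?thesis by (simp add: g_def gc sgn_mult_abs)
  qed
  have key2: "a div g (a, b) = sg (a, b) * (a div gcd a b) \<and> b div g (a, b) = sg (a, b) * (b div gcd a b)" for a b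
    by (simp add: g_def sg_def div_minus_right dvd_neg_div)
  show ?thesis
  proof (rule bij_betw_byWitness[of _ "\<lambda>(a, b). (g (a, b), (a div g (a, b), b div g (a, b)))"], goal_cases)
    case 1
    show ?case using key n0 by auto
  next
    case 2
    have "g (a, b) dvd a" "g (a, b) dvd b" for a b by (auto simp: g_def sg_def)
    then show ?case by auto
  next
    case 3
    show ?case
    proof clarify
      fix n c d assume n: "n \<in> coprime_integers N" and cd: "(c, d) \<in> primitive_pairs"
      have "gcd (n * c) (n * d) = \<bar>n\<bar>"
        using cd by (simp add: primitive_pairs_def gcd_mult_left)
      moreover have "(n * c, n * d) \<noteq> (0, 0)" using n0[OF n] cd by (auto simp: primitive_pairs_def)
      ultimately show "(n * c, n * d) \<noteq> (0, 0) \<and> coprime (gcd (n * c) (n * d)) (int N)"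
        using n by (auto simp: coprime_integers_def)
    qed
  next
    case 4
    have "g (a, b) \<in> coprime_integers N \<and> (a div g (a, b), b div g (a, b)) \<in> primitive_pairs"
      if ne: "(a, b) \<noteq> (0, 0)" and cop: "coprime (gcd a b) (int N)" for a b
    proof -
      define h where "h = gcd a b"
      have h: "h > 0" using ne unfolding h_def by (metis gcd_pos_int prod.inject)
      have c1: "coprime (a div h) (b div h)" unfolding h_def using ne by (intro div_gcd_coprime) auto
      have a: "a = a div h * h" and b: "b = b div h * h" by (auto simp: h_def)
      have "g (a, b) \<in> coprime_integers N"
        using cop by (auto simp: g_def sg_def coprime_integers_def)
      moreover have "(a div g (a, b), b div g (a, b)) \<in> primitive_pairs"
      proof -
        have sa: "a > 0 \<longleftrightarrow> a div h > 0" "b > 0 \<longleftrightarrow> b div h > 0" "a = 0 \<longleftrightarrow> a div h = 0"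
          using h a b by (metis zero_less_mult_pos2 mult_pos_pos, metis zero_less_mult_pos2 mult_pos_pos, metis mult_zero_left div_0)
        have unit: "\<bar>b div h\<bar> = 1" if "a div h = 0" using c1 that by simp
        have "coprime (sg (a, b) * (a div h)) (sg (a, b) * (b div h))" using c1 by (simp add: sg_def)
        moreover have "sg (a, b) * (a div h) > 0 \<or> sg (a, b) * (a div h) = 0 \<and> sg (a, b) * (b div h) = 1"
          using sa unit unfolding sg_def by (auto split: if_splits)
        ultimately show ?thesis unfolding key2 h_def[symmetric] by (simp add: primitive_pairs_def key2 h_def)
      qed
      ultimately show ?thesis by blast
    qed
    then show ?case unfolding image_subset_iff by fast
  qed
qed

lemma abs_summable_hecke_kernel_int:
  assumes t0: "Re t0 > - 1/2"
  obtains r M where "r > 0" "M summable_on (UNIV :: int set)"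
    "\<And>n t. t \<in> cball t0 r \<Longrightarrow> norm (hecke_kernel t (of_int n)) \<le> M n"
proof -
  define r where "r = (Re t0 + 1/2) / 2"
  \<comment> \<open>The smallest exponent of decay on the disc; it equals Re t0 + 3/2 and so exceeds
    1.\<close>
  define b where "b = 2 + 2 * (Re t0 - r)"
  have r: "r > 0" "b > 1" using t0 by (auto simp: r_def b_def field_simps)
  define M where "M n = 2 powr b * (1 + \<bar>real_of_int n\<bar>) powr (- b)" for n
  have "norm (hecke_kernel t (of_int n)) \<le> M n" if t: "t \<in> cball t0 r" for n t
  proof (cases "n = 0")
    case False
    have "norm (t - t0) \<le> r" using t by (simp add: dist_norm norm_minus_commute)
    then have "\<bar>Re (t - t0)\<bar> \<le> r" using abs_Re_le_cmod[of "t - t0"] by linarith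
    then have "- 2 * Re t - 2 \<le> - b" by (simp add: b_def)
    then have "norm (hecke_kernel t (of_int n)) \<le> \<bar>real_of_int n\<bar> powr (- b)"
      unfolding norm_hecke_kernel norm_of_int using False by (intro powr_mono) auto
    also have "\<dots> \<le> ((1 + \<bar>real_of_int n\<bar>) / 2) powr (- b)"
      using False r by (intro powr_mono2') auto
    also have "\<dots> = M n" unfolding M_def by (subst powr_divide) (auto simp: powr_minus field_simps)
    finally show ?thesis .
  qed (simp add: M_def)
  moreover have "M summable_on UNIV"
    unfolding M_def by (intro summable_on_cmult_right summable_on_int_powr r)
  ultimately show ?thesis using that r(1) by blast
qed

lemma has_sum_eis_L:
  assumes "Re t > - 1/2"
  shows "((\<lambda>n. hecke_kernel t (of_int n)) has_sum eis_L N t) (coprime_integers N)"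
proof -
  obtain r M where rM: "r > 0" "M summable_on (UNIV :: int set)"
    "\<And>n s. s \<in> cball t r \<Longrightarrow> norm (hecke_kernel s (of_int n)) \<le> M n"
    using abs_summable_hecke_kernel_int[OF assms] by blast
  have "t \<in> cball t r" using rM(1) by simp
  from Infinite_Sum.abs_summable_on_comparison_test'[OF rM(2) rM(3)[OF this]]
  have "(\<lambda>n. hecke_kernel t (of_int n)) summable_on UNIV"
    by (rule Infinite_Sum.abs_summable_summable)
  then have "(\<lambda>n. hecke_kernel t (of_int n)) summable_on coprime_integers N"
    by (rule summable_on_subset_banach) simp
  then show ?thesis unfolding eis_L_def by (rule has_sum_infsum)
qed

lemma holomorphic_eis_L: "eis_L N holomorphic_on {t. Re t > - 1/2}"
proof -
  have "eis_L N analytic_on {t. Re t > - 1/2}"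
    unfolding analytic_on_def
  proof
    fix t0 assume "t0 \<in> {t. Re t > - 1/2}"
    then have "Re t0 > - 1/2" by simp
    from abs_summable_hecke_kernel_int[OF this] obtain r M where rM: "r > 0" "M summable_on (UNIV :: int set)"
      "\<And>n s. s \<in> cball t0 r \<Longrightarrow> norm (hecke_kernel s (of_int n)) \<le> M n" by blast
    have "M summable_on coprime_integers N"
      by (rule summable_on_subset_banach[OF rM(2)]) simp
    then have lim: "uniform_limit (cball t0 r) (\<lambda>X t. \<Sum>n\<in>X. hecke_kernel t (of_int n)) (\<lambda>t. eis_L N t)
        (finite_subsets_at_top (coprime_integers N))"
      unfolding eis_L_def by (intro Weierstrass_m_test_general[OF rM(3)])
    have "(\<lambda>t. \<Sum>n\<in>X. hecke_kernel t (of_int n)) holomorphic_on S" for X S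
      by (intro holomorphic_intros)
    then have ev: "\<forall>\<^sub>F X in finite_subsets_at_top (coprime_integers N).
        continuous_on (cball t0 r) (\<lambda>t. \<Sum>n\<in>X. hecke_kernel t (of_int n)) \<and>
        (\<lambda>t. \<Sum>n\<in>X. hecke_kernel t (of_int n)) holomorphic_on ball t0 r"
      by (intro always_eventually allI conjI holomorphic_on_imp_continuous_on)
    have "(\<lambda>t. eis_L N t) holomorphic_on ball t0 r"
      by (rule holomorphic_uniform_limit[OF ev lim finite_subsets_at_top_neq_bot])
    with rM(1) show "\<exists>\<epsilon>>0. eis_L N holomorphic_on ball t0 \<epsilon>" by blast
  qed
  then show ?thesis by (rule analytic_imp_holomorphic)
qed

text \<open>Twice Euler's value pi^2 / 6; the term at n = 0 is 0 by division by zero.\<close>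

lemma has_sum_inverse_squares_int:
  "((\<lambda>n::int. 1 / of_int n ^ 2) has_sum (of_real (pi ^ 2 / 3) :: complex)) UNIV" (is "(?f has_sum _) _")
proof -
  have 1: "(\<lambda>n. 1 / of_nat (Suc n) ^ 2 :: real) sums (pi ^ 2 / 6)"
    using inverse_squares_sums by (simp add: add.commute)
  have 2: "(\<lambda>n. 1 / of_nat (Suc n) ^ 2 :: complex) sums of_real (pi ^ 2 / 6)"
    using sums_of_real[OF 1, where 'a = complex] by simp
  have 3: "summable (\<lambda>n. norm (1 / of_nat (Suc n) ^ 2 :: complex))"
    using sums_summable[OF 1] by (simp only: norm_divide norm_power norm_of_nat norm_one)
  have b: "((\<lambda>n. ?f (- 1 - int n)) has_sum of_real (pi ^ 2 / 6)) UNIV"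
  proof -
    have "?f (- 1 - int n) = 1 / of_nat (Suc n) ^ 2" for n
      using power2_minus[of "1 + of_nat n :: complex"] by (simp add: algebra_simps)
    then show ?thesis using norm_summable_imp_has_sum[OF 3 2] by simp
  qed
  have a: "((\<lambda>n. ?f (int n)) has_sum of_real (pi ^ 2 / 6)) UNIV"
  proof (rule norm_summable_imp_has_sum)
    show "summable (\<lambda>n. norm (?f (int n)))"
      using 3 by (subst summable_Suc_iff[symmetric]) simp
    show "(\<lambda>n. ?f (int n)) sums of_real (pi ^ 2 / 6)"
      using 2 sums_Suc_iff[of "\<lambda>n. ?f (int n)" "of_real (pi ^ 2 / 6)"] by simp
  qed
  have "(?f has_sum (of_real (pi ^ 2 / 6) + of_real (pi ^ 2 / 6))) UNIV"
    by (rule has_sum_int_split[OF a b])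
  also have "of_real (pi ^ 2 / 6) + of_real (pi ^ 2 / 6) = (of_real (pi ^ 2 / 3) :: complex)"
    by (simp flip: of_real_add)
  finally show ?thesis .
qed

lemma prod_one_minus:
  fixes f :: "nat \<Rightarrow> complex"
  assumes "finite A"
  shows "(\<Prod>p\<in>A. g p - f p) = (\<Sum>X\<in>Pow A. (- 1) ^ card X * (\<Prod>p\<in>X. f p) * (\<Prod>p\<in>A - X. g p))"
proof -
  have "(\<Prod>p\<in>A. g p - f p) = (\<Prod>p\<in>A. (- f p) + g p)" by simp
  also have "\<dots> = (\<Sum>X\<in>Pow A. (- 1) ^ card X * (\<Prod>p\<in>X. f p) * (\<Prod>p\<in>A - X. g p))"
    unfolding prod_add[OF assms] prod_uminus ..
  finally show ?thesis .
qed

lemma coprime_int_iff_prime_factors: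
  assumes "N > 1"
  shows "coprime d (int N) \<longleftrightarrow> (\<forall>p\<in>prime_factors N. \<not> int p dvd d)"
proof
  assume "coprime d (int N)"
  then show "\<forall>p\<in>prime_factors N. \<not> int p dvd d"
    by (metis coprime_common_divisor in_prime_factors_iff int_dvd_int_iff not_prime_unit prime_nat_int_transfer)
next
  assume *: "\<forall>p\<in>prime_factors N. \<not> int p dvd d"
  show "coprime d (int N)"
  proof (rule ccontr)
    assume "\<not> ?thesis"
    then have "gcd (nat \<bar>d\<bar>) N \<noteq> 1"
      by (metis coprime_iff_gcd_eq_1 gcd_int_int_eq int_nat_eq abs_ge_zero gcd_abs1_int of_nat_1)
    then obtain p where "prime p" "p dvd gcd (nat \<bar>d\<bar>) N" by (metis prime_factor_nat)
    then have "p \<in> prime_factors N" "int p dvd d" using assms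
      by (auto simp: in_prime_factors_iff simp flip: int_dvd_int_iff)
    then show False using * by blast
  qed
qed

text \<open>Sieving the sum over all integers by the primes of \<open>N\<close> produces the factors
  1 - p^-2.\<close>

lemma eis_L_0:
  assumes "N > 1"
  shows "eis_L N 0 = of_real (pi ^ 2 / 3) * (\<Prod>p\<in>prime_factors N. 1 - 1 / of_nat p ^ 2)"
proof -
  let ?P = "prime_factors N" and ?f = "\<lambda>n::int. 1 / of_int n ^ 2 :: complex"
  have "((\<lambda>d. (\<Prod>p\<in>?P. if int p dvd d then 0 else 1) * ?f d) has_sum
     (\<Sum>X\<in>Pow ?P. (- 1) ^ card X * ((\<Prod>p\<in>X. 1 / of_nat p ^ 2) * of_real (pi ^ 2 / 3)))) UNIV"
  proof (rule has_sum_coprime_sieve)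
    fix X
    have "?f (int (\<Prod>X) * d) = (\<Prod>p\<in>X. 1 / of_nat p ^ 2) * ?f d" for d
      by (simp add: prod_dividef power_mult_distrib prod_power_distrib)
    then show "((\<lambda>d. ?f (int (\<Prod>X) * d)) has_sum (\<Prod>p\<in>X. 1 / of_nat p ^ 2) * of_real (pi ^ 2 / 3)) UNIV"
      by (simp only:) (intro has_sum_cmult_right has_sum_inverse_squares_int)
  qed auto
  also have "(\<Sum>X\<in>Pow ?P. (- 1) ^ card X * ((\<Prod>p\<in>X. 1 / of_nat p ^ 2) * of_real (pi ^ 2 / 3)))
     = of_real (pi ^ 2 / 3) * (\<Prod>p\<in>?P. 1 - 1 / of_nat p ^ 2 :: complex)"
    by (simp add: prod_one_minus sum_distrib_left mult_ac)
  finally have "((\<lambda>d. (\<Prod>p\<in>?P. if int p dvd d then 0 else 1) * ?f d) has_sum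
      of_real (pi ^ 2 / 3) * (\<Prod>p\<in>?P. 1 - 1 / of_nat p ^ 2)) UNIV" .
  then have "((\<lambda>n. hecke_kernel 0 (of_int n)) has_sum
      of_real (pi ^ 2 / 3) * (\<Prod>p\<in>?P. 1 - 1 / of_nat p ^ 2)) (coprime_integers N)"
  proof (rule has_sum_cong_neutral[THEN iffD1, rotated -1])
    note iff = coprime_int_iff_prime_factors[OF assms]
    fix d
    show "(\<Prod>p\<in>?P. if int p dvd d then 0 else 1) * ?f d = hecke_kernel 0 (of_int d)" if "d \<in> UNIV \<inter> coprime_integers N"
      using that unfolding coprime_integers_def iff hecke_kernel_at_0 by (simp cong: prod.cong_simp)
    show "(\<Prod>p\<in>?P. if int p dvd d then 0 else 1) * ?f d = 0" if "d \<in> UNIV - coprime_integers N"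
      using that unfolding coprime_integers_def iff by (auto simp: prod_zero_iff)
  qed auto
  with has_sum_eis_L[of 0 N] show ?thesis using has_sum_unique by fastforce
qed

lemma eis_L_0_nonzero:
  assumes "N > 1"
  shows "eis_L N 0 \<noteq> 0"
proof -
  have "1 - 1 / of_nat p ^ 2 \<noteq> (0 :: complex)" if "p \<in> prime_factors N" for p
  proof
    assume "1 - 1 / of_nat p ^ 2 = (0 :: complex)"
    moreover have "x ^ 2 = 1" if "1 - 1 / x ^ 2 = 0" for x :: complex
      using that by (cases "x = 0") (auto simp: field_simps)
    ultimately have "(of_nat p :: complex) ^ 2 = 1" by blast
    then have "p ^ 2 = 1" by (metis of_nat_1 of_nat_eq_iff of_nat_power)
    then show False using in_prime_factors_imp_prime[OF that] by simp
  qed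
  then show ?thesis using assms by (simp add: eis_L_0 prod_zero_iff)
qed

text \<open>The terms at 1 and -1 contribute 2. All others together are at most pi^2 / 3 - 2 in
  absolute value, which is below 2 because pi^2 < 12. No Euler product is involved.\<close>

lemma eis_L_nonzero:
  assumes t: "Re t > 0" and N: "N > 1"
  shows "eis_L N t \<noteq> 0"
proof
  assume 0: "eis_L N t = 0"
  let ?C = "coprime_integers N"
  have sub: "{1, - 1} \<subseteq> ?C" by (auto simp: coprime_integers_def)
  have "((\<lambda>n. hecke_kernel t (of_int n)) has_sum eis_L N t) ?C"
    using t by (intro has_sum_eis_L) auto
  then have "((\<lambda>n. hecke_kernel t (of_int n)) has_sum (0 - (\<Sum>n\<in>{1, - 1}. hecke_kernel t (of_int n)))) (?C - {1, - 1})"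
    unfolding 0 using sub by (intro has_sum_Diff has_sum_finite) auto
  moreover have "0 - (\<Sum>n\<in>{1, - 1}. hecke_kernel t (of_int n)) = - 2"
  proof -
    have "hecke_kernel t 1 = 1" "hecke_kernel t (- 1) = 1" by (simp_all add: hecke_kernel_def)
    then show ?thesis by simp
  qed
  ultimately have 1: "((\<lambda>n. hecke_kernel t (of_int n)) has_sum - 2) (?C - {1, - 1})" by simp
  have "((\<lambda>n. Re (1 / of_int n ^ 2)) has_sum Re (of_real (pi ^ 2 / 3))) (UNIV :: int set)"
    by (rule has_sum_Re[OF has_sum_inverse_squares_int])
  moreover have "Re (1 / of_int n ^ 2) = 1 / real_of_int n ^ 2" for n
  proof -
    have "1 / of_int n ^ 2 = (of_real (1 / real_of_int n ^ 2) :: complex)" by simp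
    then show ?thesis by (simp only: Re_complex_of_real)
  qed
  ultimately have "((\<lambda>n. 1 / real_of_int n ^ 2) has_sum pi ^ 2 / 3) UNIV"
    by (simp only: Re_complex_of_real)
  then have "((\<lambda>n. 1 / real_of_int n ^ 2) has_sum (pi ^ 2 / 3 - (\<Sum>n\<in>{1, - 1}. 1 / real_of_int n ^ 2))) (UNIV - {1, - 1})"
    by (intro has_sum_Diff has_sum_finite) auto
  moreover have "(\<Sum>n\<in>{1, - 1}. 1 / real_of_int n ^ 2) = 2" by simp
  ultimately have 2: "((\<lambda>n. 1 / real_of_int n ^ 2) has_sum (pi ^ 2 / 3 - 2)) (UNIV - {1, - 1})"
    by (simp only:)
  then have 3: "(\<lambda>n. 1 / real_of_int n ^ 2) summable_on (?C - {1, - 1})"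
    by (rule summable_on_subset_banach[OF has_sum_imp_summable]) auto
  have "norm (- 2 :: complex) \<le> infsum (\<lambda>n. 1 / real_of_int n ^ 2) (?C - {1, - 1})"
  proof (rule norm_infsum_le[OF 1 has_sum_infsum[OF 3]])
    fix n assume "n \<in> ?C - {1, - 1}"
    show "norm (hecke_kernel t (of_int n)) \<le> 1 / real_of_int n ^ 2"
    proof (cases "n = 0")
      case False
      have "norm (hecke_kernel t (of_int n)) \<le> \<bar>real_of_int n\<bar> powr (- 2)"
        unfolding norm_hecke_kernel norm_of_int using False t by (intro powr_mono) auto
      also have "\<dots> = 1 / real_of_int n ^ 2" using False by (simp add: powr_minus_divide)
      finally show ?thesis .
    qed simp
  qed
  also have "\<dots> \<le> pi ^ 2 / 3 - 2"
    using has_sum_mono2[OF has_sum_infsum[OF 3] 2] by auto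
  also have "\<dots> < 2"
  proof -
    have "pi ^ 2 \<le> 3.2 ^ 2" using pi_approx by (intro power_mono) auto
    then show ?thesis by (simp add: power2_eq_square)
  qed
  finally show False by simp
qed

text \<open>The weight vanishes on pairs whose gcd shares a prime with \<open>N\<close>, and equals
  \<open>psi N c\<close> on the pairs n (c, d) that remain. So the absolutely convergent lattice sum
  is a product of the sum over n and the wanted sum, and the first factor is not zero.\<close>

lemma has_sum_primitive_pairs:
  assumes z: "Im z > 0" and t: "Re t > 0" and N: "N > 1" "squarefree N"
  shows "((\<lambda>(c, d). psi N c * hecke_kernel t (of_int c * z + of_int d)) has_sum
    periodic_weight.hecke_sum N (eis_weight N) t z / eis_L N t) primitive_pairs"
proof -
  interpret periodic_weight N "eis_weight N" by (rule periodic_weight_eis_weight[OF N])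
  let ?f = "\<lambda>(a, b). eis_weight N a b * hecke_kernel t (of_int a * z + of_int b)"
  let ?T = "{(a, b). (a, b) \<noteq> (0, 0) \<and> coprime (gcd a b) (int N)}"
  let ?C = "coprime_integers N"
  have full: "(?f has_sum hecke_sum t z) UNIV" by (rule has_sum_hecke_sum[OF z t])
  have zero: "eis_weight N a b = 0" if "(a, b) \<notin> ?T" for a b
  proof -
    have "\<exists>p\<in>prime_factors N. int p dvd a \<and> int p dvd b"
    proof (cases "(a, b) = (0, 0)")
      case True
      obtain p where "prime p" "p dvd N" using N by (metis prime_factor_nat less_irrefl)
      then show ?thesis using True N by (auto simp: in_prime_factors_iff)
    next
      case False
      then have "\<not> coprime (gcd a b) (int N)" using that by auto
      then have "gcd (nat (gcd a b)) N \<noteq> 1"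
        by (metis coprime_iff_gcd_eq_1 gcd_int_int_eq int_nat_eq gcd_ge_0_int of_nat_1)
      then obtain p where p: "prime p" "p dvd gcd (nat (gcd a b)) N" by (metis prime_factor_nat)
      then have "p dvd nat (gcd a b)" "p dvd N" by auto
      then have "int p dvd int (nat (gcd a b))" "p dvd N" by (simp_all only: int_dvd_int_iff)
      then have "int p dvd gcd a b" "p dvd N" by auto
      then show ?thesis using p N by (auto simp: in_prime_factors_iff)
    qed
    then obtain p where "p \<in> prime_factors N" "eis_factor p a b = 0" by (auto simp: eis_factor_def)
    then show ?thesis unfolding eis_weight_def by (auto simp: prod_zero_iff)
  qed
  have "(?f has_sum hecke_sum t z) ?T"
    by (rule has_sum_cong_neutral[THEN iffD1, OF _ _ _ full]) (use zero in \<open>auto split: prod.splits\<close>)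
  then have "((\<lambda>x. ?f ((\<lambda>(n, (c, d)). (n * c, n * d)) x)) has_sum hecke_sum t z) (?C \<times> primitive_pairs)"
    using has_sum_reindex_bij_betw[OF bij_betw_primitive_pairs[OF N(1)], of ?f] by blast
  then have *: "((\<lambda>(n, x). hecke_kernel t (of_int n) *
      (case x of (c, d) \<Rightarrow> psi N c * hecke_kernel t (of_int c * z + of_int d))) has_sum hecke_sum t z) (?C \<times> primitive_pairs)"
  proof (rule has_sum_cong[THEN iffD1, rotated])
    fix x assume "x \<in> ?C \<times> primitive_pairs"
    then obtain n c d where x: "x = (n, (c, d))" "n \<in> ?C" "coprime c d"
      by (auto simp: primitive_pairs_def)
    have "hecke_kernel t (of_int (n * c) * z + of_int (n * d)) =
        hecke_kernel t (of_int n) * hecke_kernel t (of_int c * z + of_int d)"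
      unfolding hecke_kernel_mult[symmetric] by (simp add: algebra_simps)
    then show "?f ((\<lambda>(n, (c, d)). (n * c, n * d)) x) = (\<lambda>(n, x). hecke_kernel t (of_int n) *
      (case x of (c, d) \<Rightarrow> psi N c * hecke_kernel t (of_int c * z + of_int d))) x"
      by (simp add: x eis_weight_mult_primitive del: of_int_mult)
  qed
  \<comment> \<open>The wanted sum exists as a part of the absolutely convergent lattice sum; it has
    to be named before the product can be split.\<close>
  have "?f summable_on primitive_pairs"
    by (rule summable_on_subset_banach[OF has_sum_imp_summable[OF full]]) auto
  then obtain S where "(?f has_sum S) primitive_pairs" unfolding summable_on_def by blast
  then have S: "((\<lambda>(c, d). psi N c * hecke_kernel t (of_int c * z + of_int d)) has_sum S) primitive_pairs"
  proof (rule has_sum_cong[THEN iffD1, rotated])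
    fix x assume "x \<in> primitive_pairs"
    then obtain c d where x: "x = (c, d)" "coprime c d" by (auto simp: primitive_pairs_def)
    have "eis_weight N (1 * c) (1 * d) = psi N c"
      by (rule eis_weight_mult_primitive) (auto simp: coprime_integers_def x)
    then show "?f x = (\<lambda>(c, d). psi N c * hecke_kernel t (of_int c * z + of_int d)) x" by (simp add: x)
  qed
  have "((\<lambda>n. hecke_kernel t (of_int n) * S) has_sum hecke_sum t z) ?C"
    by (rule has_sum_SigmaD[OF *]) (use has_sum_cmult_right[OF S] in \<open>simp add: case_prod_unfold\<close>)
  moreover have "((\<lambda>n. hecke_kernel t (of_int n) * S) has_sum eis_L N t * S) ?C"
    using t by (intro has_sum_cmult_left has_sum_eis_L) auto
  ultimately have "hecke_sum t z = eis_L N t * S" by (rule has_sum_unique)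
  then have "S = hecke_sum t z / eis_L N t" using eis_L_nonzero[OF t N(1)] by simp
  with S show ?thesis by simp
qed

section \<open>The \<open>q\<close>-expansion\<close>

lemma has_sum_nat_times_power:
  fixes x :: complex
  assumes "norm x < 1"
  shows "((\<lambda>n. of_nat n * x ^ n) has_sum x / (1 - x) ^ 2) {1..}"
    and "(\<lambda>n. norm (of_nat n * x ^ n)) summable_on {1..}"
    and "infsum (\<lambda>n. norm (of_nat n * x ^ n)) {1..} = norm x / (1 - norm x) ^ 2"
proof -
  have S: "bij_betw Suc UNIV {1..}" by (auto simp: bij_betw_def image_def) (metis Suc_le_D)
  \<comment> \<open>Stated for general fields because it is applied both to the complex number
    \<open>x\<close> and to the real number \<open>norm x\<close>.\<close>
  have key: "((\<lambda>n. of_nat n * y ^ n) has_sum y / (1 - y) ^ 2) {1..}"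
    if y: "norm y < 1" for y :: "'b :: {real_normed_field, banach}"
  proof -
    have "(\<lambda>n. y * (of_nat (Suc n) * y ^ n)) sums (y * (1 / (1 - y) ^ 2))"
      by (intro sums_mult geometric_deriv_sums y)
    then have 1: "(\<lambda>n. of_nat (Suc n) * y ^ Suc n) sums (y / (1 - y) ^ 2)"
      by (simp add: mult_ac)
    have "(\<lambda>n. norm y * (of_nat (Suc n) * norm y ^ n)) sums (norm y * (1 / (1 - norm y) ^ 2))"
      by (intro sums_mult geometric_deriv_sums) (use y in simp)
    moreover have "norm (of_nat (Suc n) * y ^ Suc n) = norm y * (of_nat (Suc n) * norm y ^ n)" for n
      by (simp only: norm_mult norm_power norm_of_nat power_Suc mult_ac)
    ultimately have 2: "summable (\<lambda>n. norm (of_nat (Suc n) * y ^ Suc n))"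
      by (simp only: sums_summable)
    from norm_summable_imp_has_sum[OF 2 1]
    show ?thesis using has_sum_reindex_bij_betw[OF S, of "\<lambda>n. of_nat n * y ^ n"] by simp
  qed
  show "((\<lambda>n. of_nat n * x ^ n) has_sum x / (1 - x) ^ 2) {1..}" by (rule key[OF assms])
  have "((\<lambda>n. of_nat n * norm x ^ n) has_sum norm x / (1 - norm x) ^ 2) {1..}"
    by (rule key) (use assms in simp)
  then have *: "((\<lambda>n. norm (of_nat n * x ^ n)) has_sum norm x / (1 - norm x) ^ 2) {1..}"
    by (simp add: norm_mult norm_power)
  then show "(\<lambda>n. norm (of_nat n * x ^ n)) summable_on {1..}"
    "infsum (\<lambda>n. norm (of_nat n * x ^ n)) {1..} = norm x / (1 - norm x) ^ 2"
    by (rule has_sum_imp_summable, rule infsumI)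
qed

text \<open>For k >= 1 the inner sum is at most |q|^k / (1 - |q|)^2 times the bound of the
  coefficients, which is a geometric majorant.\<close>

lemma abs_summable_lambert:
  fixes q :: complex and b :: "nat \<Rightarrow> complex"
  assumes q: "norm q < 1" and b: "\<And>k. norm (b k) \<le> B"
  shows "(\<lambda>(k, n). norm (b k * (of_nat n * (q ^ k) ^ n))) summable_on {1..} \<times> {1..}"
proof (rule summable_on_SigmaI)
  have qk: "norm (q ^ k) \<le> norm q" "norm (q ^ k) < 1" if "k \<in> {1..}" for k
  proof -
    have "norm q ^ k \<le> norm q ^ 1" using that q by (intro power_decreasing) auto
    then show "norm (q ^ k) \<le> norm q" "norm (q ^ k) < 1" using q by (auto simp: norm_power)
  qed
  define g where "g k = norm (b k) * (norm (q ^ k) / (1 - norm (q ^ k)) ^ 2)" for k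
  show "((\<lambda>n. case (k, n) of (k, n) \<Rightarrow> norm (b k * (of_nat n * (q ^ k) ^ n))) has_sum g k) {1..}"
    if "k \<in> {1..}" for k
  proof -
    have "((\<lambda>n. norm (b k) * norm (of_nat n * (q ^ k) ^ n)) has_sum g k) {1..}"
      unfolding g_def has_sum_nat_times_power(3)[OF qk(2)[OF that], symmetric]
      by (intro has_sum_cmult_right has_sum_infsum has_sum_nat_times_power(2) qk(2) that)
    then show ?thesis by (simp add: norm_mult)
  qed
  have "summable (\<lambda>k. norm q ^ k)" using q by (intro summable_geometric) auto
  then have "(\<lambda>k. norm q ^ k) summable_on UNIV"
    by (subst summable_on_UNIV_nonneg_real_iff) auto
  then have "(\<lambda>k. B / (1 - norm q) ^ 2 * norm q ^ k) summable_on UNIV"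
    by (rule summable_on_cmult_right)
  then have "(\<lambda>k. B / (1 - norm q) ^ 2 * norm q ^ k) summable_on {1..}"
    by (rule summable_on_subset_banach) simp
  then have "(\<lambda>k. norm (g k)) summable_on {1..}"
  proof (rule Infinite_Sum.abs_summable_on_comparison_test')
    fix k :: nat assume k: "k \<in> {1..}"
    have "norm (q ^ k) / (1 - norm (q ^ k)) ^ 2 \<le> norm q ^ k / (1 - norm q) ^ 2"
      using qk[OF k] q by (intro frac_le power_mono) (auto simp: norm_power)
    then have "g k \<le> B * (norm q ^ k / (1 - norm q) ^ 2)"
      unfolding g_def using b[of k] order_trans[OF norm_ge_zero b] by (intro mult_mono) auto
    moreover have "g k \<ge> 0" unfolding g_def by (intro mult_nonneg_nonneg divide_nonneg_nonneg) auto
    ultimately show "norm (g k) \<le> B / (1 - norm q) ^ 2 * norm q ^ k" by simp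
  qed
  then show "g summable_on {1..}" by (rule Infinite_Sum.abs_summable_summable)
qed auto

text \<open>Each q^k / (1 - q^k)^2 is the sum of n q^(k n); collecting the terms with k n = m turns
  this Lambert series into a power series in q.\<close>

lemma has_sum_lambert:
  fixes q :: complex and b :: "nat \<Rightarrow> complex"
  assumes q: "norm q < 1" and b: "\<And>k. norm (b k) \<le> B"
  shows "\<exists>S. ((\<lambda>k. b k * (q ^ k / (1 - q ^ k) ^ 2)) has_sum S) {1..} \<and>
    ((\<lambda>m. (\<Sum>k | k dvd m. of_nat (m div k) * b k) * q ^ m) has_sum S) {1..}"
proof -
  let ?f = "\<lambda>(k, n). b k * (of_nat n * (q ^ k) ^ n)"
  have "(\<lambda>x. norm (?f x)) summable_on {1..} \<times> {1..}"
    using abs_summable_lambert[OF assms] by (simp add: case_prod_unfold)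
  then obtain S where S: "(?f has_sum S) ({1..} \<times> {1..})"
    using Infinite_Sum.abs_summable_summable unfolding summable_on_def by blast
  have 1: "((\<lambda>k. b k * (q ^ k / (1 - q ^ k) ^ 2)) has_sum S) {1..}"
  proof (rule has_sum_SigmaD[OF S])
    fix k :: nat assume "k \<in> {1..}"
    then have "norm q ^ k \<le> norm q ^ 1" using q by (intro power_decreasing) auto
    then have "norm (q ^ k) < 1" using q by (simp add: norm_power)
    from has_sum_cmult_right[OF has_sum_nat_times_power(1)[OF this]]
    show "((\<lambda>n. ?f (k, n)) has_sum b k * (q ^ k / (1 - q ^ k) ^ 2)) {1..}" by simp
  qed
  have bij: "bij_betw (\<lambda>(m, k). (k, m div k)) (Sigma {1::nat..} (\<lambda>m. {k. k dvd m})) ({1..} \<times> {1..})"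
  proof (rule bij_betw_byWitness[of _ "\<lambda>(k, n). (k * n, k)"], goal_cases)
    case 3
    have "k \<ge> 1 \<and> m div k \<ge> 1" if "m \<ge> 1" "k dvd m" for k m :: nat
      using that by (metis One_nat_def Suc_leI dvd_div_eq_0_iff dvd_pos_nat gr0I less_le_trans not_one_le_zero zero_less_one)
    then show ?case by auto
  qed auto
  have "((\<lambda>x. ?f ((\<lambda>(m, k). (k, m div k)) x)) has_sum S) (Sigma {1..} (\<lambda>m. {k. k dvd m}))"
    using S has_sum_reindex_bij_betw[OF bij, of ?f] by blast
  then have "((\<lambda>m. \<Sum>k | k dvd m. b k * (of_nat (m div k) * (q ^ k) ^ (m div k))) has_sum S) {1..}"
  proof (rule has_sum_SigmaD)
    fix m :: nat assume "m \<in> {1..}"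
    then have "finite {k. k dvd m}" by simp
    from has_sum_finite[OF this, of "\<lambda>k. b k * (of_nat (m div k) * (q ^ k) ^ (m div k))"]
    show "((\<lambda>y. ?f ((\<lambda>(m, k). (k, m div k)) (m, y))) has_sum (\<Sum>k | k dvd m. b k * (of_nat (m div k) * (q ^ k) ^ (m div k))))
       {k. k dvd m}" by simp
  qed
  also have "(\<lambda>m. \<Sum>k | k dvd m. b k * (of_nat (m div k) * (q ^ k) ^ (m div k)))
    = (\<lambda>m. (\<Sum>k | k dvd m. of_nat (m div k) * b k) * q ^ m)"
  proof
    fix m :: nat
    have "b k * (of_nat (m div k) * (q ^ k) ^ (m div k)) = of_nat (m div k) * b k * q ^ m" if "k dvd m" for k
      using that by (simp flip: power_mult)
    then show "(\<Sum>k | k dvd m. b k * (of_nat (m div k) * (q ^ k) ^ (m div k))) = (\<Sum>k | k dvd m. of_nat (m div k) * b k) * q ^ m"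
      unfolding sum_distrib_right by (intro sum.cong[OF refl]) auto
  qed
  finally show ?thesis using 1 by blast
qed

lemma psi_prod_mult:
  assumes X: "X \<subseteq> prime_factors N"
  shows "psi N (int (\<Prod>X) * c) = (\<Prod>p\<in>prime_factors N - X. if int p dvd c then 1 else - 1 / of_nat p)"
proof -
  have fX: "finite X" using X finite_subset by blast
  have pr: "prime p" if "p \<in> X" for p using that X by auto
  have "psi N (int (\<Prod>X) * c) = (\<Prod>p\<in>prime_factors N - X. if int p dvd int (\<Prod>X) * c then 1 else - 1 / of_nat p)"
    unfolding psi_def
  proof (rule prod.mono_neutral_right)
    show "\<forall>p\<in>prime_factors N - (prime_factors N - X). (if int p dvd int (\<Prod>X) * c then 1 else - 1 / of_nat p) = (1 :: complex)"
    proof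
      fix p assume "p \<in> prime_factors N - (prime_factors N - X)"
      then have "p dvd \<Prod>X" using fX by (intro dvd_prodI) auto
      then have "int p dvd int (\<Prod>X) * c" by (intro dvd_mult2) (simp only: int_dvd_int_iff)
      then show "(if int p dvd int (\<Prod>X) * c then 1 else - 1 / of_nat p) = (1 :: complex)" by (simp only: if_True)
    qed
  qed auto
  also have "\<dots> = (\<Prod>p\<in>prime_factors N - X. if int p dvd c then 1 else - 1 / of_nat p)"
  proof (rule prod.cong[OF refl])
    fix p assume p: "p \<in> prime_factors N - X"
    then have pp: "prime p" by auto
    have "\<not> p dvd \<Prod>X"
    proof
      assume "p dvd \<Prod>X"
      then obtain r where "r \<in> X" "p dvd r" using pp fX by (subst (asm) prime_dvd_prod_iff) auto
      then have "p = r" using pp pr primes_dvd_imp_eq by blast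
      then show False using p \<open>r \<in> X\<close> by blast
    qed
    then have "int p dvd int (\<Prod>X) * c \<longleftrightarrow> int p dvd c"
      using pp by (simp only: prime_dvd_mult_iff prime_nat_int_transfer int_dvd_int_iff simp_thms)
    then show "(if int p dvd int (\<Prod>X) * c then 1 else - 1 / of_nat p) = (if int p dvd c then 1 else - 1 / of_nat p :: complex)"
      by (simp only:)
  qed
  finally show ?thesis .
qed

text \<open>The sum over subsets is a product of local factors. At p it is 1 - p^-2 if p divides c,
  and otherwise -1/p - p^-2 = -(1 - p^-2) / (p - 1). The common factor 1 - p^-2 later cancels
  against \<open>eis_L N 0\<close>.\<close>

lemma psi_sieve:
  "(\<Sum>X\<in>Pow (prime_factors N). (- 1) ^ card X * (\<Prod>p\<in>X. 1 / of_nat p ^ 2) * psi N (int (\<Prod>X) * c))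
    = (\<Prod>p\<in>prime_factors N. 1 - 1 / of_nat p ^ 2) *
      (\<Prod>p\<in>prime_factors N. if int p dvd c then 1 else - 1 / (of_nat p - 1))"
proof -
  have "(\<Sum>X\<in>Pow (prime_factors N). (- 1) ^ card X * (\<Prod>p\<in>X. 1 / of_nat p ^ 2) * psi N (int (\<Prod>X) * c))
    = (\<Sum>X\<in>Pow (prime_factors N). (- 1) ^ card X * (\<Prod>p\<in>X. 1 / of_nat p ^ 2) *
        (\<Prod>p\<in>prime_factors N - X. if int p dvd c then 1 else - 1 / of_nat p))"
    by (rule sum.cong[OF refl]) (simp only: psi_prod_mult Pow_iff)
  also have "\<dots> = (\<Prod>p\<in>prime_factors N. (if int p dvd c then 1 else - 1 / of_nat p) - 1 / of_nat p ^ 2)"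
    by (rule prod_one_minus[symmetric]) simp
  also have "\<dots> = (\<Prod>p\<in>prime_factors N. (1 - 1 / of_nat p ^ 2) * (if int p dvd c then 1 else - 1 / (of_nat p - 1)))"
  proof (rule prod.cong[OF refl])
    fix p assume "p \<in> prime_factors N"
    then have p: "p > 1" by (metis in_prime_factors_imp_prime prime_gt_1_nat)
    have alg: "- 1 / x - 1 / x ^ 2 = (1 - 1 / x ^ 2) * (- 1 / (x - 1))" if "x \<noteq> 0" "x \<noteq> 1" for x :: complex
    proof -
      have "x - 1 \<noteq> 0" using that by simp
      then have "(1 - 1 / x ^ 2) * (- 1 / (x - 1)) = (x ^ 2 - 1) / x ^ 2 * (- 1 / (x - 1))"
        using that by (simp add: diff_divide_distrib)
      also have "x ^ 2 - 1 = (x + 1) * (x - 1)" by (simp add: power2_eq_square algebra_simps)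
      also have "(x + 1) * (x - 1) / x ^ 2 * (- 1 / (x - 1)) = - ((x + 1) / x ^ 2)"
        using \<open>x - 1 \<noteq> 0\<close> by simp
      also have "\<dots> = - 1 / x - 1 / x ^ 2" using that by (simp add: add_divide_distrib power2_eq_square)
      finally show ?thesis by simp
    qed
    have "(of_nat p :: complex) \<noteq> 0" "(of_nat p :: complex) \<noteq> 1" using p by auto
    from alg[OF this] show "(if int p dvd c then 1 else - 1 / of_nat p) - 1 / of_nat p ^ 2
      = (1 - 1 / of_nat p ^ 2) * (if int p dvd c then 1 else - 1 / (of_nat p - 1) :: complex)"
      by (cases "int p dvd c") (simp_all only: if_True if_False mult_1_right)
  qed
  also have "\<dots> = (\<Prod>p\<in>prime_factors N. 1 - 1 / of_nat p ^ 2) *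
      (\<Prod>p\<in>prime_factors N. if int p dvd c then 1 else - 1 / (of_nat p - 1))" by (rule prod.distrib)
  finally show ?thesis .
qed

text \<open>Along a row only the primes dividing both \<open>N\<close> and c restrict d; the others
  contribute constants, which \<open>psi N c\<close> contains. This prepares the sieve in d.\<close>

lemma eis_weight_eq_psi:
  "eis_weight N c d = psi N c * (\<Prod>p | p \<in> prime_factors N \<and> int p dvd c. if int p dvd d then 0 else 1)"
proof -
  have "eis_weight N c d = (\<Prod>p\<in>prime_factors N. (if int p dvd c then 1 else - 1 / of_nat p) *
      (if int p dvd c then (if int p dvd d then 0 else 1) else 1))"
    unfolding eis_weight_def eis_factor_def by (rule prod.cong[OF refl]) (auto simp only: mult_1_left mult_1_right if_True if_False split: if_split)
  also have "\<dots> = psi N c * (\<Prod>p\<in>prime_factors N. if int p dvd c then (if int p dvd d then 0 else 1) else 1)"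
    unfolding psi_def by (rule prod.distrib)
  also have "(\<Prod>p\<in>prime_factors N. if int p dvd c then (if int p dvd d then 0 else 1) else 1)
    = (\<Prod>p | p \<in> prime_factors N \<and> int p dvd c. if int p dvd d then 0 else 1 :: complex)"
    by (rule prod.inter_filter[symmetric]) simp
  finally show ?thesis .
qed

lemma row_eis_weight_minus:
  assumes "Im z > 0" "N > 1" "squarefree N"
  shows "periodic_weight.row (eis_weight N) z (- c) = periodic_weight.row (eis_weight N) z c"
proof -
  interpret periodic_weight N "eis_weight N" by (rule periodic_weight_eis_weight[OF assms(2,3)])
  have "(\<Sum>\<^sub>\<infinity>d. eis_weight N (- c) d / (of_int (- c) * z + of_int d) ^ 2)
    = (\<Sum>\<^sub>\<infinity>d. eis_weight N (- c) (- d) / (of_int (- c) * z + of_int (- d)) ^ 2)"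
    by (rule infsum_reindex_bij_betw[symmetric, of uminus]) (auto intro!: bij_betw_byWitness[of _ uminus])
  also have "(\<lambda>d. eis_weight N (- c) (- d) / (of_int (- c) * z + of_int (- d)) ^ 2)
    = (\<lambda>d. eis_weight N c d / (of_int c * z + of_int d) ^ 2)"
  proof
    fix d
    have "of_int (- c) * z + of_int (- d) = - (of_int c * z + of_int d)" by simp
    then show "eis_weight N (- c) (- d) / (of_int (- c) * z + of_int (- d)) ^ 2
      = eis_weight N c d / (of_int c * z + of_int d) ^ 2"
      by (simp only: eis_weight_minus power2_minus)
  qed
  finally show ?thesis unfolding row_def .
qed

text \<open>Every prime divides 0, so row 0 is sieved by all primes of \<open>N\<close>. After
  division by \<open>eis_L N 0\<close> it becomes the constant term 1.\<close>

lemma row_eis_weight_0: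
  assumes "Im z > 0" "N > 1" "squarefree N"
  shows "periodic_weight.row (eis_weight N) z 0 = eis_L N 0"
proof -
  interpret periodic_weight N "eis_weight N" by (rule periodic_weight_eis_weight[OF assms(2,3)])
  have "((\<lambda>d. eis_weight N 0 d / (of_int 0 * z + of_int d) ^ 2) has_sum row z 0) UNIV"
    by (rule has_sum_row[OF assms(1)])
  then have "((\<lambda>n. hecke_kernel 0 (of_int n)) has_sum row z 0) (coprime_integers N)"
  proof (rule has_sum_cong_neutral[THEN iffD1, rotated -1])
    fix d
    have eq: "eis_weight N 0 d = (\<Prod>p\<in>prime_factors N. if int p dvd d then 0 else 1)"
      by (simp add: eis_weight_def eis_factor_def)
    show "eis_weight N 0 d / (of_int 0 * z + of_int d) ^ 2 = hecke_kernel 0 (of_int d)"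
      if "d \<in> UNIV \<inter> coprime_integers N"
      using that unfolding eq coprime_integers_def coprime_int_iff_prime_factors[OF assms(2)] hecke_kernel_at_0
      by (simp cong: prod.cong_simp)
    show "eis_weight N 0 d / (of_int 0 * z + of_int d) ^ 2 = 0" if "d \<in> UNIV - coprime_integers N"
      using that unfolding eq coprime_integers_def coprime_int_iff_prime_factors[OF assms(2)]
      by (auto simp: prod_zero_iff)
  qed auto
  with has_sum_eis_L[of 0 N] show ?thesis using has_sum_unique by fastforce
qed

text \<open>For a set X of primes dividing \<open>N\<close> and c, with product m and c = m k, the
  multiples d of m contribute m^-2 times the Lipschitz sum at k z. All subsets of the primes of
  \<open>N\<close> are listed, with 0 where m does not divide c, and c is written as m times c div
  m, so that the sums over c and over X can be exchanged.\<close>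

lemma row_eis_weight_pos:
  assumes z: "Im z > 0" and N: "N > 1" "squarefree N" and c: "c > 0"
  defines "q \<equiv> exp (2 * of_real pi * \<i> * z)"
  shows "periodic_weight.row (eis_weight N) z (int c) =
    (\<Sum>X\<in>Pow (prime_factors N). if \<Prod>X dvd c then
       (- 1) ^ card X * (\<Prod>p\<in>X. 1 / of_nat p ^ 2) * psi N (int (\<Prod>X * (c div \<Prod>X))) *
       (- 4 * of_real pi ^ 2 * (q ^ (c div \<Prod>X) / (1 - q ^ (c div \<Prod>X)) ^ 2)) else 0)"
proof -
  interpret periodic_weight N "eis_weight N" by (rule periodic_weight_eis_weight[OF N])
  define A where "A = {p \<in> prime_factors N. int p dvd int c}"
  have A: "finite A" "p \<in> A \<Longrightarrow> prime p" for p by (auto simp: A_def)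
  let ?e = "\<lambda>k. - 4 * of_real pi ^ 2 * (q ^ k / (1 - q ^ k) ^ 2)"
  let ?f = "\<lambda>d. 1 / (of_int (int c) * z + of_int d) ^ 2"
  define s where "s X = (\<Prod>p\<in>X. 1 / of_nat p ^ 2) * ?e (c div \<Prod>X)" for X
  have "((\<lambda>d. (\<Prod>p\<in>A. if int p dvd d then 0 else 1) * ?f d) has_sum (\<Sum>X\<in>Pow A. (- 1) ^ card X * s X)) UNIV"
  proof (rule has_sum_coprime_sieve[OF A])
    fix X assume X: "X \<subseteq> A"
    define m where "m = \<Prod>X"
    have "m dvd c"
      unfolding m_def using X A finite_subset[OF X] by (subst prod_primes_dvd_iff) (auto simp: A_def)
    then obtain k where k: "c = m * k" by blast
    have mk: "m > 0" "k > 0" using c k by auto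
    have "Im (of_nat k * z) > 0" using z mk by simp
    from lipschitz_formula[OF this]
    have "((\<lambda>d. 1 / (of_nat k * z + of_int d) ^ 2) has_sum ?e k) UNIV"
      by (simp add: q_def mult_ac flip: exp_of_nat_mult)
    then have "((\<lambda>d. 1 / of_nat m ^ 2 * (1 / (of_nat k * z + of_int d) ^ 2)) has_sum 1 / of_nat m ^ 2 * ?e k) UNIV"
      by (rule has_sum_cmult_right)
    also have "(\<lambda>d. 1 / of_nat m ^ 2 * (1 / (of_nat k * z + of_int d) ^ 2)) = (\<lambda>d. ?f (int m * d))"
    proof
      fix d
      have "of_int (int c) * z + of_int (int m * d) = of_nat m * (of_nat k * z + of_int d)"
        by (simp add: k algebra_simps)
      then show "1 / of_nat m ^ 2 * (1 / (of_nat k * z + of_int d) ^ 2) = ?f (int m * d)"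
        by (simp only: power_mult_distrib) simp
    qed
    also have "1 / of_nat m ^ 2 * ?e k = s X"
      using mk by (simp add: s_def m_def[symmetric] k) (simp add: m_def prod_dividef prod_power_distrib)
    finally show "((\<lambda>d. ?f (int (\<Prod>X) * d)) has_sum s X) UNIV" unfolding m_def .
  qed
  then have "((\<lambda>d. psi N (int c) * ((\<Prod>p\<in>A. if int p dvd d then 0 else 1) * ?f d)) has_sum
      psi N (int c) * (\<Sum>X\<in>Pow A. (- 1) ^ card X * s X)) UNIV"
    by (rule has_sum_cmult_right)
  also have "(\<lambda>d. psi N (int c) * ((\<Prod>p\<in>A. if int p dvd d then 0 else 1) * ?f d))
    = (\<lambda>d. eis_weight N (int c) d / (of_int (int c) * z + of_int d) ^ 2)"
    unfolding eis_weight_eq_psi A_def by simp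
  finally have "row z (int c) = psi N (int c) * (\<Sum>X\<in>Pow A. (- 1) ^ card X * s X)"
    using has_sum_row[OF z] has_sum_unique by blast
  also have "\<dots> = (\<Sum>X\<in>Pow A. psi N (int c) * ((- 1) ^ card X * s X))"
    by (rule sum_distrib_left)
  also have "\<dots> = (\<Sum>X\<in>Pow (prime_factors N). if \<Prod>X dvd c then
       (- 1) ^ card X * (\<Prod>p\<in>X. 1 / of_nat p ^ 2) * psi N (int (\<Prod>X * (c div \<Prod>X))) * ?e (c div \<Prod>X) else 0)"
  proof (rule sum.mono_neutral_cong_left)
    have iff: "\<Prod>X dvd c \<longleftrightarrow> X \<subseteq> A" if "X \<subseteq> prime_factors N" for X
      using that finite_subset[OF that] by (subst prod_primes_dvd_iff) (auto simp: A_def)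
    show "\<forall>X\<in>Pow (prime_factors N) - Pow A. (if \<Prod>X dvd c then
       (- 1) ^ card X * (\<Prod>p\<in>X. 1 / of_nat p ^ 2) * psi N (int (\<Prod>X * (c div \<Prod>X))) * ?e (c div \<Prod>X) else 0) = 0"
    proof
      fix X assume "X \<in> Pow (prime_factors N) - Pow A"
      then have "\<not> \<Prod>X dvd c" using iff by blast
      then show "(if \<Prod>X dvd c then (- 1) ^ card X * (\<Prod>p\<in>X. 1 / of_nat p ^ 2) *
        psi N (int (\<Prod>X * (c div \<Prod>X))) * ?e (c div \<Prod>X) else 0) = 0" by (rule if_not_P)
    qed
    fix X assume "X \<in> Pow A"
    moreover have "A \<subseteq> prime_factors N" by (auto simp: A_def)
    ultimately have dv: "\<Prod>X dvd c" using iff by auto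
    then have "\<Prod>X * (c div \<Prod>X) = c" by simp
    then show "psi N (int c) * ((- 1) ^ card X * s X) = (if \<Prod>X dvd c then
       (- 1) ^ card X * (\<Prod>p\<in>X. 1 / of_nat p ^ 2) * psi N (int (\<Prod>X * (c div \<Prod>X))) * ?e (c div \<Prod>X) else 0)"
      unfolding if_P[OF dv] s_def by (simp only: mult_ac)
  qed (auto simp: A_def)
  finally show ?thesis .
qed

text \<open>For fixed X the rows are summed over c = \<open>\<Prod>X\<close> k, so with k as the
  index the sum over X can be taken inside and evaluated by \<open>psi_sieve\<close>. A single
  Lambert series remains, with coefficients \<open>\<nu>\<close>, and its power series carries the
  divisor sums.\<close>

lemma hecke_sum_eis_weight:
  assumes z: "Im z > 0" and N: "N > 1" "squarefree N"
  shows "((\<lambda>n. of_nat (divisor_sum (coprime_part N n)) * exp (2 * of_real pi * \<i> * of_nat n * z)) summable_on {1..}) \<and>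
    periodic_weight.hecke_sum N (eis_weight N) 0 z / eis_L N 0 =
    1 - 24 * (of_int (moebius_mu N) / of_nat (totient N)) *
      (\<Sum>\<^sub>\<infinity>n\<in>{1..}. of_nat (divisor_sum (coprime_part N n)) * exp (2 * of_real pi * \<i> * of_nat n * z))"
proof -
  interpret periodic_weight N "eis_weight N" by (rule periodic_weight_eis_weight[OF N])
  define q where "q = exp (2 * of_real pi * \<i> * z)"
  have q: "norm q < 1" using z by (simp add: q_def)
  define E where "E k = q ^ k / (1 - q ^ k) ^ 2" for k
  define C where "C = (- 4 * of_real pi ^ 2 :: complex)"
  define co where "co X = ((- 1) ^ card X * (\<Prod>p\<in>X. 1 / of_nat p ^ 2) :: complex)" for X :: "nat set"
  define \<nu> where "\<nu> k = (\<Prod>p\<in>prime_factors N. if p dvd k then 1 else - 1 / (of_nat p - 1) :: complex)" for k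
  define K where "K = (\<Prod>p\<in>prime_factors N. 1 - 1 / of_nat p ^ 2 :: complex)"
  define \<mu> where "\<mu> = (of_int (moebius_mu N) / of_nat (totient N) :: complex)"
  have "\<exists>S. ((\<lambda>k. psi N (int (\<Prod>X * k)) * E k) has_sum S) {1..}" for X
  proof -
    have "\<exists>S. ((\<lambda>k. psi N (int (\<Prod>X * k)) * (q ^ k / (1 - q ^ k) ^ 2)) has_sum S) {1..} \<and>
      ((\<lambda>m. (\<Sum>k | k dvd m. of_nat (m div k) * psi N (int (\<Prod>X * k))) * q ^ m) has_sum S) {1..}"
      by (rule has_sum_lambert[OF q norm_psi_le])
    then show ?thesis unfolding E_def by (elim ex_forward conjunct1)
  qed
  then obtain S where S: "\<And>X. ((\<lambda>k. psi N (int (\<Prod>X * k)) * E k) has_sum S X) {1..}" by metis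
  define R where "R = (\<Sum>X\<in>Pow (prime_factors N). co X * C * S X)"
  have R1: "((\<lambda>c. row z (int c)) has_sum R) {1..}"
  proof -
    have "((\<lambda>c. \<Sum>X\<in>Pow (prime_factors N). if \<Prod>X dvd c then
         co X * C * (psi N (int (\<Prod>X * (c div \<Prod>X))) * E (c div \<Prod>X)) else 0) has_sum R) {1..}"
      unfolding R_def
    proof (rule has_sum_sum)
      fix X assume "X \<in> Pow (prime_factors N)"
      then have X: "finite X" "\<And>p. p \<in> X \<Longrightarrow> p > 0" using finite_subset by (auto intro: prime_gt_0_nat)
      define m where "m = \<Prod>X"
      have m: "m > 0" unfolding m_def using X by (auto intro: prod_pos)
      have bij: "bij_betw (\<lambda>k. m * k) {1..} {c \<in> {1..}. m dvd c}"
        using m by (auto simp: bij_betw_def inj_on_def image_iff elim!: dvdE)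
      let ?g = "\<lambda>c. co X * C * (psi N (int (m * (c div m))) * E (c div m))"
      have "((\<lambda>k. ?g (m * k)) has_sum co X * C * S X) {1..}"
        using has_sum_cmult_right[OF S[of X], of "co X * C"] m by (simp add: m_def[symmetric])
      then have "(?g has_sum co X * C * S X) {c \<in> {1..}. m dvd c}"
        using has_sum_reindex_bij_betw[OF bij, of ?g] by blast
      then show "((\<lambda>c. if \<Prod>X dvd c then co X * C * (psi N (int (\<Prod>X * (c div \<Prod>X))) * E (c div \<Prod>X)) else 0)
          has_sum co X * C * S X) {1..}"
        by (rule has_sum_cong_neutral[THEN iffD1, rotated -1]) (auto simp: m_def)
    qed
    then show ?thesis
    proof (rule has_sum_cong[THEN iffD1, rotated])
      fix c :: nat assume "c \<in> {1..}"
      then have "c > 0" by simp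
      show "(\<Sum>X\<in>Pow (prime_factors N). if \<Prod>X dvd c then
         co X * C * (psi N (int (\<Prod>X * (c div \<Prod>X))) * E (c div \<Prod>X)) else 0) = row z (int c)"
        unfolding row_eis_weight_pos[OF z N \<open>c > 0\<close>] q_def[symmetric] E_def co_def C_def
        by (rule sum.cong[OF refl]) (simp only: mult_ac)
    qed
  qed
  \<comment> \<open>The same total \<open>R\<close>, now with the sum over X inside the sum over
    k.\<close>
  have R2: "((\<lambda>k. C * K * (\<nu> k * E k)) has_sum R) {1..}"
  proof -
    have "((\<lambda>k. \<Sum>X\<in>Pow (prime_factors N). co X * C * (psi N (int (\<Prod>X * k)) * E k)) has_sum R) {1..}"
      unfolding R_def by (intro has_sum_sum has_sum_cmult_right S)
    also have "(\<lambda>k. \<Sum>X\<in>Pow (prime_factors N). co X * C * (psi N (int (\<Prod>X * k)) * E k)) = (\<lambda>k. C * K * (\<nu> k * E k))"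
    proof
      fix k
      have "(\<Sum>X\<in>Pow (prime_factors N). co X * C * (psi N (int (\<Prod>X * k)) * E k))
        = C * E k * (\<Sum>X\<in>Pow (prime_factors N). co X * psi N (int (\<Prod>X) * int k))"
        unfolding sum_distrib_left by (rule sum.cong[OF refl]) (simp only: mult_ac of_nat_mult)
      also have "(\<Sum>X\<in>Pow (prime_factors N). co X * psi N (int (\<Prod>X) * int k)) = K * \<nu> k"
        unfolding co_def psi_sieve K_def \<nu>_def int_dvd_int_iff ..
      finally show "(\<Sum>X\<in>Pow (prime_factors N). co X * C * (psi N (int (\<Prod>X * k)) * E k)) = C * K * (\<nu> k * E k)"
        by (simp only: mult_ac)
    qed
    finally show ?thesis .
  qed
  have "norm (\<nu> k) \<le> 1" for k
    unfolding \<nu>_def prod_norm[symmetric]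
  proof (intro prod_le_1 conjI)
    fix p assume "p \<in> prime_factors N"
    then have "p > 1" by (metis in_prime_factors_imp_prime prime_gt_1_nat)
    then have "norm (of_nat p - 1 :: complex) = real (p - 1)"
      by (metis less_imp_le norm_of_nat of_nat_1 of_nat_diff)
    then have "norm (- 1 / (of_nat p - 1) :: complex) \<le> 1"
      unfolding norm_divide norm_minus_cancel norm_one using \<open>p > 1\<close> by (simp add: divide_le_eq_1)
    then show "norm (if p dvd k then 1 else - 1 / (of_nat p - 1) :: complex) \<le> 1" by (cases "p dvd k") simp_all
  qed auto
  then have "\<exists>D. ((\<lambda>k. \<nu> k * (q ^ k / (1 - q ^ k) ^ 2)) has_sum D) {1..} \<and>
      ((\<lambda>m. (\<Sum>k | k dvd m. of_nat (m div k) * \<nu> k) * q ^ m) has_sum D) {1..}"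
    by (rule has_sum_lambert[OF q])
  then obtain D where
    D: "((\<lambda>k. \<nu> k * (q ^ k / (1 - q ^ k) ^ 2)) has_sum D) {1..}"
       "((\<lambda>m. (\<Sum>k | k dvd m. of_nat (m div k) * \<nu> k) * q ^ m) has_sum D) {1..}" by (elim exE conjE)
  have "R = C * K * D"
    using R2 has_sum_cmult_right[OF D(1), of "C * K"] has_sum_unique unfolding E_def by blast
  have qm: "q ^ m = exp (2 * of_real pi * \<i> * of_nat m * z)" for m
    by (simp add: q_def mult_ac flip: exp_of_nat_mult)
  let ?g = "\<lambda>n. of_nat (divisor_sum (coprime_part N n)) * exp (2 * of_real pi * \<i> * of_nat n * z)"
  have D': "((\<lambda>n. \<mu> * ?g n) has_sum D) {1..}"
  proof (rule has_sum_cong[THEN iffD1, OF _ D(2)])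
    fix m :: nat assume "m \<in> {1..}"
    then have "m > 0" by simp
    have "N > 0" using N by simp
    show "(\<Sum>k | k dvd m. of_nat (m div k) * \<nu> k) * q ^ m = \<mu> * ?g m"
      unfolding \<nu>_def sum_divisors_eq_divisor_sum_coprime_part[OF N(2) \<open>N > 0\<close> \<open>m > 0\<close>] \<mu>_def qm
      by (rule mult.assoc)
  qed
  \<comment> \<open>The expansion is known only for the series multiplied by \<open>\<mu>\<close>;
    that \<open>\<mu>\<close> is nonzero makes the bare series summable.\<close>
  have mu0: "\<mu> \<noteq> 0"
    using N unfolding \<mu>_def moebius_mu_def by auto
  have sm: "?g summable_on {1..}"
  proof -
    have "inverse \<mu> * (\<mu> * x) = x" for x using mu0 by simp
    then show ?thesis
      using has_sum_imp_summable[OF has_sum_cmult_right[OF D', of "inverse \<mu>"]] by (simp only:)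
  qed
  then have Dg: "D = \<mu> * infsum ?g {1..}"
    using D' has_sum_cmult_right[OF has_sum_infsum[OF sm], of \<mu>] has_sum_unique by blast
  have bS: "bij_betw Suc UNIV {1..}" by (auto simp: bij_betw_def image_def) (metis Suc_le_D)
  have pos: "((\<lambda>n. row z (int n)) has_sum (row z 0 + R)) UNIV"
  proof -
    have "((\<lambda>n. row z (int n)) has_sum row z 0) {0}"
      using has_sum_finite[of "{0}" "\<lambda>n. row z (int n)"] by simp
    then have "((\<lambda>n. row z (int n)) has_sum (row z 0 + R)) ({0} \<union> {1..})"
      by (rule has_sum_Un_disjoint[OF _ R1]) auto
    moreover have "{0} \<union> {1..} = (UNIV :: nat set)" by auto
    ultimately show ?thesis by simp
  qed
  \<comment> \<open>Rows c and -c agree, so the negative rows contribute \<open>R\<close> once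
    more.\<close>
  have neg: "((\<lambda>n. row z (- 1 - int n)) has_sum R) UNIV"
  proof -
    have "row z (- 1 - int n) = row z (int (Suc n))" for n
      using row_eis_weight_minus[OF z N, of "int (Suc n)"] by (simp add: algebra_simps)
    then show ?thesis
      using R1 has_sum_reindex_bij_betw[OF bS, of "\<lambda>n. row z (int n)" R] by simp
  qed
  have "hecke_sum 0 z = row z 0 + R + R"
    using has_sum_int_split[OF pos neg] has_sum_rows[OF z] has_sum_unique by blast
  also have "\<dots> = eis_L N 0 + 2 * (C * K * D)"
    unfolding row_eis_weight_0[OF z N] \<open>R = C * K * D\<close> by simp
  \<comment> \<open>2 C K is -8 pi^2 K, and \<open>eis_L N 0\<close> is (pi^2 / 3) K.\<close>
  also have "\<dots> = eis_L N 0 - 24 * eis_L N 0 * D"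
    unfolding C_def K_def eis_L_0[OF N(1)] by simp
  finally have "hecke_sum 0 z / eis_L N 0 = 1 - 24 * D"
    using eis_L_0_nonzero[OF N(1)] by (simp add: diff_divide_distrib)
  then show ?thesis using sm unfolding Dg \<mu>_def by (simp only: mult.assoc simp_thms)
qed

section \<open>Modularity\<close>

lemma slash_2: "slash 2 f m z = f ((of_int (ul m) * z + of_int (ur m)) / (of_int (ll m) * z + of_int (lr m)))
    / (of_int (ll m) * z + of_int (lr m)) ^ 2"
  by (simp add: slash_def power_int_minus field_simps)

text \<open>The series is a power series in q converging on the whole unit disc, composed with q =
  exp(2 pi i z).\<close>

lemma holomorphic_eis_q_expansion:
  assumes N: "N > 1" "squarefree N"
  shows "(\<lambda>z. \<Sum>\<^sub>\<infinity>n\<in>{1..}. of_nat (divisor_sum (coprime_part N n)) * exp (2 * of_real pi * \<i> * of_nat n * z))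
    holomorphic_on upper_half_plane"
proof -
  \<comment> \<open>The series starts at n = 1, whereas
    \<open>divisor_sum (coprime_part N 0)\<close> is 1; the coefficient at 0 must be set to 0 by
    hand.\<close>
  define a where "a n = (if n = 0 then 0 else of_nat (divisor_sum (coprime_part N n)) :: complex)" for n
  define g where "g w = suminf (\<lambda>n. a n * w ^ n)" for w
  have powexp: "exp w ^ n = exp (of_nat n * w)" for w :: complex and n
    by (simp add: exp_of_nat_mult)
  have has: "((\<lambda>n. of_nat (divisor_sum (coprime_part N n)) * w ^ n) has_sum g w) {1..} \<and> (\<lambda>n. a n * w ^ n) sums g w"
    if w: "norm w < 1" for w
  proof -
    have "(\<lambda>n. of_nat (divisor_sum (coprime_part N n)) * w ^ n) summable_on {1..}"
    proof (cases "w = 0")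
      case True
      then have "(\<lambda>n. of_nat (divisor_sum (coprime_part N n)) * w ^ n) summable_on {1..}
        \<longleftrightarrow> (\<lambda>_. 0 :: complex) summable_on {1::nat..}"
        by (intro summable_on_cong) auto
      then show ?thesis by simp
    next
      case False
      \<comment> \<open>Every nonzero w of the unit disc is exp(2 pi i z) for a z in the upper half
        plane, where summability is already known.\<close>
      define z where "z = Ln w / (2 * of_real pi * \<i>)"
      have "Im z = - Re (Ln w) / (2 * pi)" by (simp add: z_def Im_divide power2_eq_square)
      also have "\<dots> > 0" using False w by (auto simp: divide_less_0_iff)
      finally have z: "Im z > 0" .
      have "exp (2 * of_real pi * \<i> * of_nat n * z) = w ^ n" for n
      proof -
        have "2 * of_real pi * \<i> * of_nat n * z = of_nat n * Ln w" by (simp add: z_def)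
        then have "exp (2 * of_real pi * \<i> * of_nat n * z) = exp (Ln w) ^ n"
          by (simp only: exp_of_nat_mult)
        then show ?thesis using False by simp
      qed
      then show ?thesis using hecke_sum_eis_weight[OF z N] by simp
    qed
    then have 1: "((\<lambda>n. of_nat (divisor_sum (coprime_part N n)) * w ^ n) has_sum
        (\<Sum>\<^sub>\<infinity>n\<in>{1..}. of_nat (divisor_sum (coprime_part N n)) * w ^ n)) {1..}" (is "(_ has_sum ?S) _")
      by (rule has_sum_infsum)
    then have "((\<lambda>n. a n * w ^ n) has_sum ?S) UNIV"
      by (rule has_sum_cong_neutral[THEN iffD1, rotated -1]) (auto simp: a_def)
    then have 2: "(\<lambda>n. a n * w ^ n) sums ?S" by (rule has_sum_imp_sums)
    then have "g w = ?S" unfolding g_def by (simp add: sums_iff)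
    then show ?thesis using 1 2 by simp
  qed
  have "g holomorphic_on ball 0 1"
  proof (rule power_series_holomorphic[where a = a])
    show "(\<lambda>n. a n * (w - 0) ^ n) sums g w" if "w \<in> ball 0 1" for w
      using has[of w] that by simp
  qed
  moreover have "(\<lambda>z. exp (2 * of_real pi * \<i> * z)) holomorphic_on upper_half_plane"
    by (intro holomorphic_intros)
  moreover have q: "exp (2 * of_real pi * \<i> * z) \<in> ball 0 1" if "z \<in> upper_half_plane" for z
    using that by (simp add: upper_half_plane_def)
  ultimately have "(g \<circ> (\<lambda>z. exp (2 * of_real pi * \<i> * z))) holomorphic_on upper_half_plane"
    by (intro holomorphic_on_compose_gen[of _ _ _ "ball 0 1"]) auto
  then show ?thesis
  proof (rule holomorphic_transform)
    fix z assume "z \<in> upper_half_plane"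
    then have "norm (exp (2 * of_real pi * \<i> * z)) < 1" using q[of z] by (simp add: dist_norm)
    from has[OF this] have "((\<lambda>n. of_nat (divisor_sum (coprime_part N n)) * exp (2 * of_real pi * \<i> * z) ^ n)
        has_sum g (exp (2 * of_real pi * \<i> * z))) {1..}" by blast
    from infsumI[OF this] show "(g \<circ> (\<lambda>z. exp (2 * of_real pi * \<i> * z))) z =
      (\<Sum>\<^sub>\<infinity>n\<in>{1..}. of_nat (divisor_sum (coprime_part N n)) * exp (2 * of_real pi * \<i> * of_nat n * z))"
      by (simp add: powexp mult_ac)
  qed
qed

text \<open>Holomorphy in z is read off the q-expansion, invariance from the fact that
  \<open>Gamma0 N\<close> fixes the weight. At a general cusp the slashed function is the Hecke sum
  of a moved weight, which is bounded like that of any periodic weight.\<close>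

lemma modular_form_eis:
  assumes N: "N > 1" "squarefree N"
    and f: "\<And>z. z \<in> upper_half_plane \<Longrightarrow> f z = periodic_weight.hecke_sum N (eis_weight N) 0 z / eis_L N 0"
  shows "modular_form 2 (Gamma0 N) f"
proof -
  interpret periodic_weight N "eis_weight N" by (rule periodic_weight_eis_weight[OF N])
  have sl: "slash 2 f m z = periodic_weight.hecke_sum N W' 0 z / eis_L N 0"
    if z: "z \<in> upper_half_plane" and det: "ul m * lr m - ur m * ll m = 1"
      and W': "periodic_weight N W'" "\<And>x y. W' (x * ul m + y * ll m) (x * ur m + y * lr m) = eis_weight N x y"
    for m z W'
  proof -
    have z': "Im z > 0" using z by (simp add: upper_half_plane_def)
    let ?j = "of_int (ll m) * z + of_int (lr m)"
    have "(of_int (ul m) * z + of_int (ur m)) / ?j \<in> upper_half_plane"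
      using Im_moebius_pos[OF z' det] by (simp add: upper_half_plane_def)
    from f[OF this] have "slash 2 f m z = hecke_sum 0 ((of_int (ul m) * z + of_int (ur m)) / ?j) / ?j ^ 2 / eis_L N 0"
      by (simp add: slash_2 mult.commute)
    then show ?thesis unfolding hecke_sum_moebius[OF z' det W'] .
  qed
  have "f holomorphic_on upper_half_plane"
  proof (rule holomorphic_transform)
    show "(\<lambda>z. 1 - 24 * (of_int (moebius_mu N) / of_nat (totient N)) *
      (\<Sum>\<^sub>\<infinity>n\<in>{1..}. of_nat (divisor_sum (coprime_part N n)) * exp (2 * of_real pi * \<i> * of_nat n * z)))
      holomorphic_on upper_half_plane"
      by (intro holomorphic_intros holomorphic_eis_q_expansion N)
  qed (use f hecke_sum_eis_weight[OF _ N] in \<open>auto simp: upper_half_plane_def\<close>)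
  moreover have "slash 2 f m z = f z" if "m \<in> Gamma0 N" "z \<in> upper_half_plane" for m z
    using that f[of z] periodic_weight_axioms
    by (subst sl[where W' = "eis_weight N"]) (auto simp: Gamma0_def eis_weight_Gamma0)
  moreover have "\<exists>C M. \<forall>z\<in>upper_half_plane. Im z \<ge> M \<longrightarrow> norm (slash 2 f m z) \<le> C" if m: "m \<in> Gamma0 1" for m
  proof -
    have det: "ul m * lr m - ur m * ll m = 1" using m by (simp add: Gamma0_def)
    \<comment> \<open>The weight composed with the inverse matrix, so that composing with the matrix
      itself returns \<open>eis_weight N\<close>.\<close>
    define W' where "W' x y = eis_weight N (x * lr m + y * (- ll m)) (x * (- ur m) + y * ul m)" for x y
    have W': "periodic_weight N W'"
      unfolding W'_def by (rule periodic_weight_transform) (use det in \<open>simp add: algebra_simps\<close>)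
    have inv: "W' (x * ul m + y * ll m) (x * ur m + y * lr m) = eis_weight N x y" for x y
    proof -
      have "(x * ul m + y * ll m) * lr m + (x * ur m + y * lr m) * (- ll m) = x * (ul m * lr m - ur m * ll m)"
        "(x * ul m + y * ll m) * (- ur m) + (x * ur m + y * lr m) * ul m = y * (ul m * lr m - ur m * ll m)"
        by (simp_all add: algebra_simps)
      then show ?thesis unfolding W'_def det by simp
    qed
    interpret W': periodic_weight N W' by (rule W')
    obtain C where C: "\<And>z. Im z \<ge> 1 \<Longrightarrow> norm (W'.hecke_sum 0 z) \<le> C"
      using W'.hecke_sum_bounded[of 1] by auto
    have "norm (slash 2 f m z) \<le> C / norm (eis_L N 0)" if "z \<in> upper_half_plane" "Im z \<ge> 1" for z
      unfolding sl[OF that(1) det W' inv] norm_divide using C[OF that(2)] by (intro divide_right_mono) auto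
    then show ?thesis by blast
  qed
  ultimately show ?thesis unfolding modular_form_def by blast
qed

section \<open>The \<open>p\<close>-adic absolute value on the rationals\<close>

text \<open>The definition refers to the reduced fraction. Any other fraction is related to it by
  cross-multiplication, under which multiplicities add.\<close>

lemma rat_padic_abs_divide:
  assumes p: "prime p" and ab: "a \<noteq> 0" "b \<noteq> 0"
  shows "rat_padic_abs p (of_int a / of_int b) =
    real p powi (int (multiplicity (int p) b) - int (multiplicity (int p) a))"
proof -
  obtain n d where nd: "quotient_of (of_int a / of_int b) = (n, d)" by (cases "quotient_of (of_int a / of_int b)")
  have d: "d > 0" using quotient_of_denom_pos[OF nd] .
  have eq: "of_int a / of_int b = (of_int n / of_int d :: rat)" by (rule quotient_of_div[OF nd])
  have n: "n \<noteq> 0" using eq ab d by auto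
  have "(of_int (a * d) :: rat) = of_int (n * b)" using eq ab d by (simp add: field_simps)
  then have "a * d = n * b" by (simp only: of_int_eq_iff)
  then have "multiplicity (int p) (a * d) = multiplicity (int p) (n * b)" by simp
  then have "multiplicity (int p) a + multiplicity (int p) d = multiplicity (int p) n + multiplicity (int p) b"
    using p ab d n by (simp add: prime_elem_multiplicity_mult_distrib)
  then have "int (multiplicity (int p) d) - int (multiplicity (int p) n)
    = int (multiplicity (int p) b) - int (multiplicity (int p) a)" by linarith
  then show ?thesis using ab nd by (simp add: rat_padic_abs_def)
qed

lemma rat_fraction_cases:
  fixes x :: rat
  obtains "x = 0" | a b where "x = of_int a / of_int b" "a \<noteq> 0" "b > 0" "coprime a b"
proof (cases "x = 0")
  case False
  obtain n d where nd: "quotient_of x = (n, d)" by (cases "quotient_of x")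
  have "x = of_int n / of_int d" "d > 0" "coprime n d"
    using quotient_of_div[OF nd] quotient_of_denom_pos[OF nd] quotient_of_coprime[OF nd] by auto
  with False that(2)[of n d] show ?thesis by auto
qed (use that(1) in blast)

context
  fixes p :: nat
  assumes p: "prime p"
begin

lemma rat_padic_abs_0 [simp]: "rat_padic_abs p 0 = 0"
  by (simp add: rat_padic_abs_def)

lemma rat_padic_abs_pos: "x \<noteq> 0 \<Longrightarrow> rat_padic_abs p x > 0"
  using p by (simp add: rat_padic_abs_def prime_gt_0_nat zero_less_power_int)

lemma rat_padic_abs_nonneg: "rat_padic_abs p x \<ge> 0"
  using rat_padic_abs_pos[of x] by (cases "x = 0") auto

lemma rat_padic_abs_eq_0_iff: "rat_padic_abs p x = 0 \<longleftrightarrow> x = 0"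
  using rat_padic_abs_pos[of x] by (cases "x = 0") auto

lemma rat_padic_abs_mult: "rat_padic_abs p (x * y) = rat_padic_abs p x * rat_padic_abs p y"
proof (cases x rule: rat_fraction_cases)
  case (2 a b)
  note x = 2
  show ?thesis
  proof (cases y rule: rat_fraction_cases)
    case (2 c d)
    have "x * y = of_int (a * c) / of_int (b * d)" using x 2 by simp
    moreover have "rat_padic_abs p (of_int (a * c) / of_int (b * d)) = real p powi
        (int (multiplicity (int p) (b * d)) - int (multiplicity (int p) (a * c)))"
      using x 2 by (intro rat_padic_abs_divide p) auto
    ultimately have "rat_padic_abs p (x * y) = real p powi
        (int (multiplicity (int p) (b * d)) - int (multiplicity (int p) (a * c)))" by (simp only:)
    also have "\<dots> = real p powi ((int (multiplicity (int p) b) - int (multiplicity (int p) a)) +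
        (int (multiplicity (int p) d) - int (multiplicity (int p) c)))"
      using x 2 p by (simp add: prime_elem_multiplicity_mult_distrib algebra_simps)
    also have "\<dots> = rat_padic_abs p x * rat_padic_abs p y"
      using x 2 p by (simp add: rat_padic_abs_divide power_int_add prime_gt_0_nat)
    finally show ?thesis .
  qed simp
qed simp

lemma rat_padic_abs_of_int_le_1: "rat_padic_abs p (of_int a) \<le> 1"
proof (cases "a = 0")
  case False
  have "rat_padic_abs p (of_int a) = inverse (real p ^ multiplicity (int p) a)"
    using rat_padic_abs_divide[OF p False, of 1] by (simp add: power_int_minus)
  also have "\<dots> \<le> 1" using prime_ge_1_nat[OF p] by (simp add: inverse_le_1_iff)
  finally show ?thesis .
qed simp

lemma rat_padic_abs_1 [simp]: "rat_padic_abs p 1 = 1"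
  using rat_padic_abs_divide[OF p, of 1 1] by simp

lemma rat_padic_abs_inverse: "rat_padic_abs p (inverse x) = inverse (rat_padic_abs p x)"
proof (cases "x = 0")
  case False
  then have "rat_padic_abs p x * rat_padic_abs p (inverse x) = 1"
    by (simp flip: rat_padic_abs_mult)
  then show ?thesis by (metis inverse_unique)
qed simp

lemma rat_padic_abs_minus: "rat_padic_abs p (- x) = rat_padic_abs p x"
proof -
  have "rat_padic_abs p (- 1) * rat_padic_abs p (- 1) = 1" by (simp flip: rat_padic_abs_mult)
  then have "rat_padic_abs p (- 1) = 1"
    using rat_padic_abs_nonneg[of "- 1"] by (metis abs_of_nonneg abs_1 abs_mult_self_eq power2_eq_square real_sqrt_abs real_sqrt_one)
  then show ?thesis using rat_padic_abs_mult[of "- 1" x] by simp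
qed

text \<open>If a reduced fraction a/b has absolute value at most 1, then p does not divide b, and 1
  + a/b has the same denominator. The general ultrametric inequality follows on dividing by the
  larger summand.\<close>

lemma rat_padic_abs_add_1_le:
  assumes "rat_padic_abs p z \<le> 1"
  shows "rat_padic_abs p (1 + z) \<le> 1"
proof (cases z rule: rat_fraction_cases)
  case (2 a b)
  have p1: "real p > 1" using prime_gt_1_nat[OF p] by simp
  have "int (multiplicity (int p) b) - int (multiplicity (int p) a) \<le> 0"
  proof (rule ccontr)
    assume "\<not> ?thesis"
    then have "1 < real p powi (int (multiplicity (int p) b) - int (multiplicity (int p) a))"
      using p1 by (intro one_less_power_int) auto
    then show False using assms 2 rat_padic_abs_divide[OF p, of a b] by simp
  qed
  then have le: "multiplicity (int p) b \<le> multiplicity (int p) a" by simp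
  have nd: "\<not> int p dvd b"
  proof
    assume pb: "int p dvd b"
    have nu: "\<not> is_unit (int p)" using p not_prime_unit prime_nat_int_transfer by blast
    then have "multiplicity (int p) b > 0" using pb 2 by (subst multiplicity_gt_zero_iff) auto
    then have "multiplicity (int p) a > 0" using le by simp
    then have "int p dvd a" by (metis not_dvd_imp_multiplicity_0 less_irrefl)
    with pb 2(4) have "is_unit (int p)" by (meson coprime_common_divisor)
    with nu show False by simp
  qed
  have "1 + z = of_int (a + b) * inverse (of_int b)" using 2 by (simp add: field_simps)
  then have "rat_padic_abs p (1 + z) = rat_padic_abs p (of_int (a + b)) * inverse (rat_padic_abs p (of_int b))"
    by (simp only: rat_padic_abs_mult rat_padic_abs_inverse)
  also have "rat_padic_abs p (of_int b) = 1"
    using rat_padic_abs_divide[OF p, of b 1] 2 nd by (simp add: not_dvd_imp_multiplicity_0)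
  finally show ?thesis using rat_padic_abs_of_int_le_1[of "a + b"] by simp
qed simp

lemma rat_padic_abs_add: "rat_padic_abs p (x + y) \<le> max (rat_padic_abs p x) (rat_padic_abs p y)"
proof -
  have main: "rat_padic_abs p (x + y) \<le> rat_padic_abs p x"
    if le: "rat_padic_abs p y \<le> rat_padic_abs p x" for x y
  proof (cases "x = 0")
    case True
    then show ?thesis using le rat_padic_abs_nonneg[of y] by (simp add: rat_padic_abs_eq_0_iff)
  next
    case False
    have pos: "rat_padic_abs p x > 0" by (rule rat_padic_abs_pos[OF False])
    have "rat_padic_abs p (y * inverse x) \<le> 1"
      unfolding rat_padic_abs_mult rat_padic_abs_inverse using le pos by (simp add: field_simps)
    then have "rat_padic_abs p (1 + y * inverse x) \<le> 1" by (rule rat_padic_abs_add_1_le)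
    then have "rat_padic_abs p x * rat_padic_abs p (1 + y * inverse x) \<le> rat_padic_abs p x"
      using pos by (simp add: mult_left_le)
    also have "rat_padic_abs p x * rat_padic_abs p (1 + y * inverse x) = rat_padic_abs p (x + y)"
    proof -
      have "x * (1 + y * inverse x) = x + y" using False by (simp add: distrib_left)
      then show ?thesis by (simp only: rat_padic_abs_mult[symmetric])
    qed
    finally show ?thesis .
  qed
  show ?thesis using main[of x y] main[of y x] by (simp add: max_def add.commute)
qed

lemma rat_padic_abs_diff: "rat_padic_abs p (x - y) \<le> max (rat_padic_abs p x) (rat_padic_abs p y)"
  using rat_padic_abs_add[of x "- y"] by (simp add: rat_padic_abs_minus)

lemma rat_padic_abs_triangle: "rat_padic_abs p (x + y) \<le> rat_padic_abs p x + rat_padic_abs p y"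
  using rat_padic_abs_add[of x y] rat_padic_abs_nonneg[of x] rat_padic_abs_nonneg[of y] by (auto simp: max_def split: if_splits)

lemma rat_padic_abs_triangle': "\<bar>rat_padic_abs p x - rat_padic_abs p y\<bar> \<le> rat_padic_abs p (x - y)"
  using rat_padic_abs_triangle[of "x - y" y] rat_padic_abs_triangle[of "y - x" x] rat_padic_abs_minus[of "x - y"] by simp

lemma rat_padic_abs_commute: "rat_padic_abs p (x - y) = rat_padic_abs p (y - x)"
  using rat_padic_abs_minus[of "x - y"] by simp

section \<open>The ring of Cauchy sequences and the ideal of null sequences\<close>

lemma padic_Cauchy_iff:
  "X \<in> carrier (padic_Cauchy p) \<longleftrightarrow> (\<forall>e>0. \<exists>M. \<forall>m\<ge>M. \<forall>n\<ge>M. rat_padic_abs p (X m - X n) < e)"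
  by (simp add: padic_Cauchy_def)

lemma padic_Cauchy_convergent:
  assumes "X \<in> carrier (padic_Cauchy p)"
  shows "convergent (\<lambda>n. rat_padic_abs p (X n))"
  unfolding Cauchy_convergent_iff[symmetric] Cauchy_def dist_real_def
  using assms unfolding padic_Cauchy_iff by (meson order_le_less_trans rat_padic_abs_triangle')

lemma padic_Cauchy_bounded:
  assumes "X \<in> carrier (padic_Cauchy p)"
  obtains B where "B > 0" "\<And>n. rat_padic_abs p (X n) \<le> B"
proof -
  have "Bseq (\<lambda>n. rat_padic_abs p (X n))"
    by (rule Cauchy_Bseq) (use padic_Cauchy_convergent[OF assms] in \<open>simp add: Cauchy_convergent_iff\<close>)
  then show ?thesis using that by (auto simp: Bseq_def abs_of_nonneg rat_padic_abs_nonneg)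
qed

lemma padic_Cauchy_add:
  assumes "X \<in> carrier (padic_Cauchy p)" "Y \<in> carrier (padic_Cauchy p)"
  shows "(\<lambda>n. X n + Y n) \<in> carrier (padic_Cauchy p)"
  unfolding padic_Cauchy_iff
proof (intro allI impI)
  fix e :: real assume "e > 0"
  then obtain M1 M2 where M: "\<And>m n. m \<ge> M1 \<Longrightarrow> n \<ge> M1 \<Longrightarrow> rat_padic_abs p (X m - X n) < e"
    "\<And>m n. m \<ge> M2 \<Longrightarrow> n \<ge> M2 \<Longrightarrow> rat_padic_abs p (Y m - Y n) < e"
    using assms unfolding padic_Cauchy_iff by meson
  have "rat_padic_abs p (X m + Y m - (X n + Y n)) < e" if "m \<ge> max M1 M2" "n \<ge> max M1 M2" for m n
    using rat_padic_abs_add[of "X m - X n" "Y m - Y n"] M[of m n] that by (simp add: algebra_simps)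
  then show "\<exists>M. \<forall>m\<ge>M. \<forall>n\<ge>M. rat_padic_abs p (X m + Y m - (X n + Y n)) < e" by blast
qed

lemma padic_Cauchy_minus:
  assumes "X \<in> carrier (padic_Cauchy p)"
  shows "(\<lambda>n. - X n) \<in> carrier (padic_Cauchy p)"
  using assms unfolding padic_Cauchy_iff by (simp add: rat_padic_abs_commute)

lemma padic_Cauchy_mult:
  assumes "X \<in> carrier (padic_Cauchy p)" "Y \<in> carrier (padic_Cauchy p)"
  shows "(\<lambda>n. X n * Y n) \<in> carrier (padic_Cauchy p)"
  unfolding padic_Cauchy_iff
proof (intro allI impI)
  fix e :: real assume e: "e > 0"
  obtain B C where B: "B > 0" "\<And>n. rat_padic_abs p (X n) \<le> B" and C: "C > 0" "\<And>n. rat_padic_abs p (Y n) \<le> C"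
    using assms padic_Cauchy_bounded by metis
  have "e / C > 0" "e / B > 0" using e B C by auto
  then obtain M1 M2 where M: "\<And>m n. m \<ge> M1 \<Longrightarrow> n \<ge> M1 \<Longrightarrow> rat_padic_abs p (X m - X n) < e / C"
    "\<And>m n. m \<ge> M2 \<Longrightarrow> n \<ge> M2 \<Longrightarrow> rat_padic_abs p (Y m - Y n) < e / B"
    using assms unfolding padic_Cauchy_iff by meson
  have "rat_padic_abs p (X m * Y m - X n * Y n) < e" if "m \<ge> max M1 M2" "n \<ge> max M1 M2" for m n
  proof -
    have "rat_padic_abs p ((X m - X n) * Y m) < e"
    proof -
      have "rat_padic_abs p (X m - X n) * rat_padic_abs p (Y m) \<le> rat_padic_abs p (X m - X n) * C"
        by (intro mult_left_mono C rat_padic_abs_nonneg)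
      also have "\<dots> < e" using M(1)[of m n] that C by (simp add: field_simps)
      finally show ?thesis by (simp add: rat_padic_abs_mult)
    qed
    moreover have "rat_padic_abs p (X n * (Y m - Y n)) < e"
    proof -
      have "rat_padic_abs p (X n) * rat_padic_abs p (Y m - Y n) \<le> B * rat_padic_abs p (Y m - Y n)"
        by (intro mult_right_mono B rat_padic_abs_nonneg)
      also have "\<dots> < e" using M(2)[of m n] that B by (simp add: field_simps)
      finally show ?thesis by (simp add: rat_padic_abs_mult)
    qed
    moreover have "X m * Y m - X n * Y n = (X m - X n) * Y m + X n * (Y m - Y n)" by (simp add: algebra_simps)
    ultimately show ?thesis using rat_padic_abs_add[of "(X m - X n) * Y m" "X n * (Y m - Y n)"] by simp
  qed
  then show "\<exists>M. \<forall>m\<ge>M. \<forall>n\<ge>M. rat_padic_abs p (X m * Y m - X n * Y n) < e" by blast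
qed

lemma padic_Cauchy_const: "(\<lambda>n. q) \<in> carrier (padic_Cauchy p)"
  by (simp add: padic_Cauchy_iff)

lemma padic_Cauchy_simps:
  "X \<otimes>\<^bsub>padic_Cauchy p\<^esub> Y = (\<lambda>n. X n * Y n)" "X \<oplus>\<^bsub>padic_Cauchy p\<^esub> Y = (\<lambda>n. X n + Y n)"
  "\<one>\<^bsub>padic_Cauchy p\<^esub> = (\<lambda>n. 1)" "\<zero>\<^bsub>padic_Cauchy p\<^esub> = (\<lambda>n. 0)"
  by (simp_all add: padic_Cauchy_def)

lemma cring_padic_Cauchy: "cring (padic_Cauchy p)"
proof (rule cringI)
  show "abelian_group (padic_Cauchy p)"
  proof (rule abelian_groupI)
    fix X assume "X \<in> carrier (padic_Cauchy p)"
    then show "\<exists>Y\<in>carrier (padic_Cauchy p). Y \<oplus>\<^bsub>padic_Cauchy p\<^esub> X = \<zero>\<^bsub>padic_Cauchy p\<^esub>"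
      using padic_Cauchy_minus by (intro bexI[of _ "\<lambda>n. - X n"]) (auto simp: padic_Cauchy_simps)
  qed (auto simp: padic_Cauchy_simps padic_Cauchy_add padic_Cauchy_const add_ac)
  show "comm_monoid (padic_Cauchy p)"
    by (rule comm_monoidI) (auto simp: padic_Cauchy_simps padic_Cauchy_mult padic_Cauchy_const mult_ac)
qed (auto simp: padic_Cauchy_simps algebra_simps)

lemma padic_null_iff: "X \<in> padic_null p \<longleftrightarrow> (\<lambda>n. rat_padic_abs p (X n)) \<longlonglongrightarrow> 0"
  by (simp add: padic_null_def)

lemma padic_null_Cauchy: "X \<in> padic_null p \<Longrightarrow> X \<in> carrier (padic_Cauchy p)"
proof -
  assume "X \<in> padic_null p"
  then have lim: "(\<lambda>n. rat_padic_abs p (X n)) \<longlonglongrightarrow> 0" by (simp add: padic_null_iff)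
  show ?thesis
    unfolding padic_Cauchy_iff
  proof (intro allI impI)
    fix e :: real assume "e > 0"
    from LIMSEQ_D[OF lim this] obtain M where "\<And>n. n \<ge> M \<Longrightarrow> rat_padic_abs p (X n) < e"
      by (auto simp: abs_of_nonneg rat_padic_abs_nonneg)
    then have "rat_padic_abs p (X m - X n) < e" if "m \<ge> M" "n \<ge> M" for m n
      using rat_padic_abs_diff[of "X m" "X n"] that by (meson le_less_trans max_less_iff_conj)
    then show "\<exists>M. \<forall>m\<ge>M. \<forall>n\<ge>M. rat_padic_abs p (X m - X n) < e" by blast
  qed
qed

lemma ideal_padic_null: "ideal (padic_null p) (padic_Cauchy p)"
proof -
  interpret C: cring "padic_Cauchy p" by (rule cring_padic_Cauchy)
  have neg: "\<ominus>\<^bsub>padic_Cauchy p\<^esub> X = (\<lambda>n. - X n)" if "X \<in> carrier (padic_Cauchy p)" for X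
    using that padic_Cauchy_minus by (intro C.minus_equality) (auto simp: padic_Cauchy_simps)
  have prod: "(\<lambda>n. Y n * X n) \<in> padic_null p" if X: "X \<in> padic_null p" and Y: "Y \<in> carrier (padic_Cauchy p)" for X Y
  proof -
    obtain B where B: "B > 0" "\<And>n. rat_padic_abs p (Y n) \<le> B" using padic_Cauchy_bounded[OF Y] by blast
    have "(\<lambda>n. B * rat_padic_abs p (X n)) \<longlonglongrightarrow> B * 0"
      using X unfolding padic_null_iff by (rule tendsto_mult_left)
    then have "(\<lambda>n. B * rat_padic_abs p (X n)) \<longlonglongrightarrow> 0" by simp
    then show ?thesis
      unfolding padic_null_iff
    proof (rule tendsto_sandwich[OF _ _ tendsto_const, rotated -1])
      show "\<forall>\<^sub>F n in sequentially. 0 \<le> rat_padic_abs p (Y n * X n)" by (simp add: rat_padic_abs_nonneg)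
      show "\<forall>\<^sub>F n in sequentially. rat_padic_abs p (Y n * X n) \<le> B * rat_padic_abs p (X n)"
        using B by (auto simp: rat_padic_abs_mult rat_padic_abs_nonneg intro!: always_eventually mult_right_mono)
    qed
  qed
  show ?thesis
  proof (rule idealI)
    show "ring (padic_Cauchy p)" by (rule C.ring_axioms)
    show "subgroup (padic_null p) (add_monoid (padic_Cauchy p))"
    proof (rule group.subgroupI)
      show "group (add_monoid (padic_Cauchy p))" by (rule C.add.is_group)
      show "padic_null p \<subseteq> carrier (add_monoid (padic_Cauchy p))" using padic_null_Cauchy by auto
      show "padic_null p \<noteq> {}" by (auto simp: padic_null_def intro!: exI[of _ "\<lambda>_. 0"])
      show "inv\<^bsub>add_monoid (padic_Cauchy p)\<^esub> X \<in> padic_null p" if "X \<in> padic_null p" for X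
        using neg[OF padic_null_Cauchy[OF that]] that
        by (simp add: a_inv_def padic_null_iff rat_padic_abs_minus)
      show "X \<otimes>\<^bsub>add_monoid (padic_Cauchy p)\<^esub> Y \<in> padic_null p" if "X \<in> padic_null p" "Y \<in> padic_null p" for X Y
      proof -
        have "(\<lambda>n. rat_padic_abs p (X n) + rat_padic_abs p (Y n)) \<longlonglongrightarrow> 0 + 0"
          using that unfolding padic_null_iff by (rule tendsto_add)
        then have "(\<lambda>n. rat_padic_abs p (X n) + rat_padic_abs p (Y n)) \<longlonglongrightarrow> 0" by simp
        then have "(\<lambda>n. rat_padic_abs p (X n + Y n)) \<longlonglongrightarrow> 0"
          by (rule tendsto_sandwich[OF _ _ tendsto_const, rotated -1])
             (auto simp: rat_padic_abs_nonneg rat_padic_abs_triangle)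
        then show ?thesis by (simp add: padic_Cauchy_simps padic_null_iff)
      qed
    qed
    show "X \<otimes>\<^bsub>padic_Cauchy p\<^esub> Y \<in> padic_null p" if "Y \<in> padic_null p" "X \<in> carrier (padic_Cauchy p)" for X Y
      using prod[OF that] by (simp add: padic_Cauchy_simps)
    show "Y \<otimes>\<^bsub>padic_Cauchy p\<^esub> X \<in> padic_null p" if "Y \<in> padic_null p" "X \<in> carrier (padic_Cauchy p)" for X Y
      using prod[OF that] by (simp add: padic_Cauchy_simps mult.commute)
  qed
qed

end

section \<open>GL(2) over commutative rings and ultrametric fields\<close>

definition mat2_det :: "('a, 'm) ring_scheme \<Rightarrow> 'a mat2 \<Rightarrow> 'a" where
  "mat2_det R m = ul m \<otimes>\<^bsub>R\<^esub> lr m \<ominus>\<^bsub>R\<^esub> ur m \<otimes>\<^bsub>R\<^esub> ll m"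

lemma mat2_carrier_iff:
  "m \<in> carrier (mat2_monoid R) \<longleftrightarrow> ul m \<in> carrier R \<and> ur m \<in> carrier R \<and> ll m \<in> carrier R \<and> lr m \<in> carrier R"
  by (cases m) (simp add: mat2_monoid_def)

lemma mat2_mult:
  "m \<otimes>\<^bsub>mat2_monoid R\<^esub> n = Mat2
       (ul m \<otimes>\<^bsub>R\<^esub> ul n \<oplus>\<^bsub>R\<^esub> ur m \<otimes>\<^bsub>R\<^esub> ll n) (ul m \<otimes>\<^bsub>R\<^esub> ur n \<oplus>\<^bsub>R\<^esub> ur m \<otimes>\<^bsub>R\<^esub> lr n)
       (ll m \<otimes>\<^bsub>R\<^esub> ul n \<oplus>\<^bsub>R\<^esub> lr m \<otimes>\<^bsub>R\<^esub> ll n) (ll m \<otimes>\<^bsub>R\<^esub> ur n \<oplus>\<^bsub>R\<^esub> lr m \<otimes>\<^bsub>R\<^esub> lr n)"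
  by (simp add: mat2_monoid_def)

lemma mat2_one: "\<one>\<^bsub>mat2_monoid R\<^esub> = Mat2 \<one>\<^bsub>R\<^esub> \<zero>\<^bsub>R\<^esub> \<zero>\<^bsub>R\<^esub> \<one>\<^bsub>R\<^esub>"
  by (simp add: mat2_monoid_def)

lemma GL2_mult: "m \<otimes>\<^bsub>GL2 R\<^esub> n = m \<otimes>\<^bsub>mat2_monoid R\<^esub> n"
  by (simp add: GL2_def units_of_def)

lemma GL2_one: "\<one>\<^bsub>GL2 R\<^esub> = \<one>\<^bsub>mat2_monoid R\<^esub>"
  by (simp add: GL2_def units_of_def)

lemma GL2_carrier: "carrier (GL2 R) = Units (mat2_monoid R)"
  by (simp add: GL2_def units_of_def)

context cring
begin

lemma mat2_det_closed:
  "m \<in> carrier (mat2_monoid R) \<Longrightarrow> mat2_det R m \<in> carrier R"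
  by (simp add: mat2_det_def mat2_carrier_iff)

lemma mat2_det_mult:
  assumes "m \<in> carrier (mat2_monoid R)" "n \<in> carrier (mat2_monoid R)"
  shows "mat2_det R (m \<otimes>\<^bsub>mat2_monoid R\<^esub> n) = mat2_det R m \<otimes> mat2_det R n"
  using assms unfolding mat2_det_def mat2_mult mat2_carrier_iff mat2.sel by algebra

lemma monoid_mat2: "monoid (mat2_monoid R)"
proof (rule monoidI)
  fix l m n assume lmn: "l \<in> carrier (mat2_monoid R)" "m \<in> carrier (mat2_monoid R)" "n \<in> carrier (mat2_monoid R)"
  show "l \<otimes>\<^bsub>mat2_monoid R\<^esub> m \<otimes>\<^bsub>mat2_monoid R\<^esub> n = l \<otimes>\<^bsub>mat2_monoid R\<^esub> (m \<otimes>\<^bsub>mat2_monoid R\<^esub> n)"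
    using lmn by (simp add: mat2_mult mat2_carrier_iff l_distr r_distr m_assoc a_ac)
qed (auto simp: mat2_mult mat2_carrier_iff mat2_one intro: mat2.expand)

definition mat2_scaled_adj :: "'a \<Rightarrow> 'a mat2 \<Rightarrow> 'a mat2" where
  "mat2_scaled_adj d m = Mat2 (d \<otimes> lr m) (\<ominus> (d \<otimes> ur m)) (\<ominus> (d \<otimes> ll m)) (d \<otimes> ul m)"

lemma mat2_scaled_adj_mult:
  assumes m: "m \<in> carrier (mat2_monoid R)" and d: "d \<in> carrier R" "d \<otimes> mat2_det R m = \<one>"
  shows "mat2_scaled_adj d m \<otimes>\<^bsub>mat2_monoid R\<^esub> m = \<one>\<^bsub>mat2_monoid R\<^esub>"
    and "m \<otimes>\<^bsub>mat2_monoid R\<^esub> mat2_scaled_adj d m = \<one>\<^bsub>mat2_monoid R\<^esub>"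
proof -
  have c: "ul m \<in> carrier R" "ur m \<in> carrier R" "ll m \<in> carrier R" "lr m \<in> carrier R"
    using m by (auto simp: mat2_carrier_iff)
  have "d \<otimes> lr m \<otimes> ul m \<oplus> \<ominus> (d \<otimes> ur m) \<otimes> ll m = d \<otimes> mat2_det R m"
    "d \<otimes> lr m \<otimes> ur m \<oplus> \<ominus> (d \<otimes> ur m) \<otimes> lr m = \<zero>"
    "\<ominus> (d \<otimes> ll m) \<otimes> ul m \<oplus> d \<otimes> ul m \<otimes> ll m = \<zero>"
    "\<ominus> (d \<otimes> ll m) \<otimes> ur m \<oplus> d \<otimes> ul m \<otimes> lr m = d \<otimes> mat2_det R m"
    using d(1) c unfolding mat2_det_def by algebra+
  then show "mat2_scaled_adj d m \<otimes>\<^bsub>mat2_monoid R\<^esub> m = \<one>\<^bsub>mat2_monoid R\<^esub>"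
    by (simp add: mat2_scaled_adj_def mat2_mult mat2_one d(2))
  have "ul m \<otimes> (d \<otimes> lr m) \<oplus> ur m \<otimes> \<ominus> (d \<otimes> ll m) = d \<otimes> mat2_det R m"
    "ul m \<otimes> \<ominus> (d \<otimes> ur m) \<oplus> ur m \<otimes> (d \<otimes> ul m) = \<zero>"
    "ll m \<otimes> (d \<otimes> lr m) \<oplus> lr m \<otimes> \<ominus> (d \<otimes> ll m) = \<zero>"
    "ll m \<otimes> \<ominus> (d \<otimes> ur m) \<oplus> lr m \<otimes> (d \<otimes> ul m) = d \<otimes> mat2_det R m"
    using d(1) c unfolding mat2_det_def by algebra+
  then show "m \<otimes>\<^bsub>mat2_monoid R\<^esub> mat2_scaled_adj d m = \<one>\<^bsub>mat2_monoid R\<^esub>"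
    by (simp add: mat2_scaled_adj_def mat2_mult mat2_one d(2))
qed

lemma GL2_iff: "m \<in> carrier (GL2 R) \<longleftrightarrow> m \<in> carrier (mat2_monoid R) \<and> mat2_det R m \<in> Units R"
proof
  assume "m \<in> carrier (GL2 R)"
  then have m: "m \<in> Units (mat2_monoid R)" by (simp add: GL2_carrier)
  then obtain n where n: "n \<in> carrier (mat2_monoid R)" "n \<otimes>\<^bsub>mat2_monoid R\<^esub> m = \<one>\<^bsub>mat2_monoid R\<^esub>"
    and mc: "m \<in> carrier (mat2_monoid R)" by (auto simp: Units_def)
  have c: "mat2_det R n \<in> carrier R" "mat2_det R m \<in> carrier R" using n mc by (auto simp: mat2_det_closed)
  have 1: "mat2_det R n \<otimes> mat2_det R m = \<one>"
    using mat2_det_mult[OF n(1) mc] unfolding n(2) by (simp add: mat2_det_def mat2_one)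
  then have "mat2_det R m \<otimes> mat2_det R n = \<one>" using m_comm c by simp
  with 1 c mc show "m \<in> carrier (mat2_monoid R) \<and> mat2_det R m \<in> Units R"
    unfolding Units_def by blast
next
  assume m: "m \<in> carrier (mat2_monoid R) \<and> mat2_det R m \<in> Units R"
  define d where "d = inv (mat2_det R m)"
  have d: "d \<in> carrier R" "d \<otimes> mat2_det R m = \<one>" using m by (auto simp: d_def)
  have "mat2_scaled_adj d m \<in> carrier (mat2_monoid R)"
    using d m by (simp add: mat2_scaled_adj_def mat2_carrier_iff)
  then show "m \<in> carrier (GL2 R)"
    using m mat2_scaled_adj_mult[OF _ d] unfolding GL2_carrier Units_def by blast
qed

lemma GL2_mult_closed:
  "m \<in> carrier (GL2 R) \<Longrightarrow> n \<in> carrier (GL2 R) \<Longrightarrow> m \<otimes>\<^bsub>GL2 R\<^esub> n \<in> carrier (GL2 R)"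
  unfolding GL2_mult GL2_carrier by (rule monoid.Units_m_closed[OF monoid_mat2])

lemma GL2_group: "group (GL2 R)"
  unfolding GL2_def by (rule monoid.units_group[OF monoid_mat2])

end

text \<open>An upper triangular factor multiplies the determinant by a d and the bottom row by d;
  this is the resulting cancellation in the height, with A = |a| and D = |d|.\<close>

lemma quotient_square_cancel:
  fixes D :: real
  assumes "D > 0"
  shows "A * D * M / (D * X) ^ 2 = A * (1 / D) * (M / X ^ 2)"
  using assms by (cases "X = 0") (auto simp: field_simps power2_eq_square)

text \<open>The fields \<open>Qp p\<close> share one type and differ in carrier and operations, so
  the local theory is developed once, for a ring with carrier.\<close>

locale ultrametric_field = field R for R (structure) +
  fixes av :: "'a \<Rightarrow> real"
  assumes av_zero [simp]: "av \<zero> = 0"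
    and av_pos: "x \<in> carrier R \<Longrightarrow> x \<noteq> \<zero> \<Longrightarrow> av x > 0"
    and av_mult: "x \<in> carrier R \<Longrightarrow> y \<in> carrier R \<Longrightarrow> av (x \<otimes> y) = av x * av y"
    and av_add: "x \<in> carrier R \<Longrightarrow> y \<in> carrier R \<Longrightarrow> av (x \<oplus> y) \<le> max (av x) (av y)"
begin

lemma av_nonneg: "x \<in> carrier R \<Longrightarrow> av x \<ge> 0"
  using av_pos[of x] by (cases "x = \<zero>") auto

lemma av_one [simp]: "av \<one> = 1"
  using av_mult[of \<one> \<one>] av_pos[of \<one>] by simp

lemma av_minus: "x \<in> carrier R \<Longrightarrow> av (\<ominus> x) = av x"
proof -
  assume x: "x \<in> carrier R"
  have "av (\<ominus> \<one>) * av (\<ominus> \<one>) = 1" using av_mult[of "\<ominus> \<one>" "\<ominus> \<one>"] by (simp add: l_minus)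
  then have "av (\<ominus> \<one>) = 1"
    using av_nonneg[of "\<ominus> \<one>"] by (metis a_inv_closed abs_of_nonneg one_closed real_sqrt_abs2 real_sqrt_one)
  then show ?thesis using av_mult[of "\<ominus> \<one>" x] x by (simp add: l_minus)
qed

lemma av_diff: "x \<in> carrier R \<Longrightarrow> y \<in> carrier R \<Longrightarrow> av (x \<ominus> y) \<le> max (av x) (av y)"
  using av_add[of x "\<ominus> y"] by (simp add: av_minus a_minus_def)

text \<open>Writing x as y minus the difference shows that |x| cannot exceed |y| unless the
  difference is at least as large as x.\<close>

lemma av_eq_of_diff_less:
  assumes "x \<in> carrier R" "y \<in> carrier R" "av (y \<ominus> x) < av x"
  shows "av y = av x"
proof -
  have 1: "y = (y \<ominus> x) \<oplus> x" and 2: "x = y \<ominus> (y \<ominus> x)" using assms(1,2) by algebra+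
  have "av y \<le> av x" using av_add[of "y \<ominus> x" x] assms 1 by auto
  moreover have "av x \<le> max (av y) (av (y \<ominus> x))" using av_diff[of y "y \<ominus> x"] assms(1,2) 2 by auto
  ultimately show ?thesis using assms(3) by auto
qed

lemma Units_iff: "x \<in> Units R \<longleftrightarrow> x \<in> carrier R \<and> x \<noteq> \<zero>"
  using field_Units by auto

lemma av_inv: "x \<in> Units R \<Longrightarrow> av (inv x) = 1 / av x"
proof -
  assume x: "x \<in> Units R"
  then have "av x * av (inv x) = 1" using av_mult[of x "inv x"] by auto
  then show ?thesis using av_pos[of x] x by (auto simp: Units_iff field_simps)
qed

text \<open>On \<open>B K\<close>, with \<open>K\<close> the integral matrices, this is \<open>\<bar>a / d\<bar>\<close>, because \<open>K\<close> preserves the maximum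
  norm of the bottom row.\<close>

definition height :: "'a mat2 \<Rightarrow> real" where
  "height m = av (mat2_det R m) / max (av (ll m)) (av (lr m)) ^ 2"

abbreviation integers :: "('a, 'b) ring_scheme" where
  "integers \<equiv> R\<lparr>carrier := {x \<in> carrier R. av x \<le> 1}\<rparr>"

lemma integers_mult: "m \<otimes>\<^bsub>mat2_monoid integers\<^esub> n = m \<otimes>\<^bsub>mat2_monoid R\<^esub> n"
  and integers_one: "\<one>\<^bsub>mat2_monoid integers\<^esub> = \<one>\<^bsub>mat2_monoid R\<^esub>"
  by (simp_all add: mat2_mult mat2_one)

text \<open>Integral matrices have determinants of absolute value at most 1; for a matrix and its
  integral inverse the product is 1, so both equal 1. Conversely, the adjugate divided by a
  determinant of absolute value 1 is integral.\<close>

lemma GL2_integers_iff: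
  "k \<in> carrier (GL2 integers) \<longleftrightarrow> k \<in> carrier (mat2_monoid integers) \<and> av (mat2_det R k) = 1"
proof
  assume "k \<in> carrier (GL2 integers)"
  then obtain n where n: "n \<in> carrier (mat2_monoid integers)" "n \<otimes>\<^bsub>mat2_monoid R\<^esub> k = \<one>\<^bsub>mat2_monoid R\<^esub>"
    and k: "k \<in> carrier (mat2_monoid integers)"
    unfolding GL2_carrier Units_def integers_mult integers_one by blast
  have c: "n \<in> carrier (mat2_monoid R)" "k \<in> carrier (mat2_monoid R)"
    using n k by (auto simp: mat2_carrier_iff)
  have "mat2_det R n \<otimes> mat2_det R k = \<one>"
    using mat2_det_mult[OF c] unfolding n(2) by (simp add: mat2_det_def mat2_one)
  then have 1: "av (mat2_det R n) * av (mat2_det R k) = 1"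
    using av_mult[of "mat2_det R n" "mat2_det R k"] c by (simp add: mat2_det_closed)
  have le: "av (mat2_det R m) \<le> 1" if "m \<in> carrier (mat2_monoid integers)" for m
  proof -
    have c: "ul m \<in> carrier R" "ur m \<in> carrier R" "ll m \<in> carrier R" "lr m \<in> carrier R"
      "av (ul m) \<le> 1" "av (ur m) \<le> 1" "av (ll m) \<le> 1" "av (lr m) \<le> 1"
      using that by (auto simp: mat2_carrier_iff)
    then have "av (ul m \<otimes> lr m) \<le> 1" "av (ur m \<otimes> ll m) \<le> 1"
      by (auto simp: av_mult av_nonneg intro!: mult_le_one)
    then show ?thesis using av_diff[of "ul m \<otimes> lr m" "ur m \<otimes> ll m"] c unfolding mat2_det_def by auto
  qed
  have "av (mat2_det R n) * av (mat2_det R k) \<le> 1 * av (mat2_det R k)"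
    using le[OF n(1)] c by (intro mult_right_mono) (auto simp: av_nonneg mat2_det_closed)
  then have "av (mat2_det R k) = 1" using 1 le[OF k] by simp
  with k show "k \<in> carrier (mat2_monoid integers) \<and> av (mat2_det R k) = 1" by simp
next
  assume k: "k \<in> carrier (mat2_monoid integers) \<and> av (mat2_det R k) = 1"
  define d where "d = inv (mat2_det R k)"
  have c: "ul k \<in> carrier R" "ur k \<in> carrier R" "ll k \<in> carrier R" "lr k \<in> carrier R"
    "av (ul k) \<le> 1" "av (ur k) \<le> 1" "av (ll k) \<le> 1" "av (lr k) \<le> 1"
    using k by (auto simp: mat2_carrier_iff)
  have kc: "k \<in> carrier (mat2_monoid R)" using c by (simp add: mat2_carrier_iff)
  have u: "mat2_det R k \<in> Units R" using k mat2_det_closed[OF kc] by (auto simp: Units_iff)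
  have d: "d \<in> carrier R" "d \<otimes> mat2_det R k = \<one>" "av d = 1" using u k by (auto simp: d_def av_inv)
  have "mat2_scaled_adj d k \<in> carrier (mat2_monoid integers)"
    using c d by (auto simp: mat2_scaled_adj_def mat2_carrier_iff av_mult av_minus)
  then show "k \<in> carrier (GL2 integers)"
    using k mat2_scaled_adj_mult[OF kc d(1,2)] unfolding GL2_carrier Units_def integers_mult integers_one by blast
qed

lemma av_less_imp_zero: "x \<in> carrier R \<Longrightarrow> av x \<le> 0 \<Longrightarrow> x = \<zero>"
  using av_pos[of x] by force

lemma max_av_row_pos:
  assumes "m \<in> carrier (GL2 R)"
  shows "max (av (ll m)) (av (lr m)) > 0"
proof (rule ccontr)
  assume "\<not> ?thesis"
  moreover have c: "ul m \<in> carrier R" "ur m \<in> carrier R" "ll m \<in> carrier R" "lr m \<in> carrier R"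
    using assms by (auto simp: GL2_iff mat2_carrier_iff)
  ultimately have "ll m = \<zero>" "lr m = \<zero>"
    using av_less_imp_zero[of "ll m"] av_less_imp_zero[of "lr m"] by (auto simp: not_less)
  then have "mat2_det R m = \<zero>" using c by (simp add: mat2_det_def)
  then show False using assms by (simp add: GL2_iff Units_iff)
qed

lemma height_pos: "m \<in> carrier (GL2 R) \<Longrightarrow> height m > 0"
  using max_av_row_pos[of m] av_pos[of "mat2_det R m"]
  by (auto simp: height_def GL2_iff Units_iff intro!: divide_pos_pos zero_less_power)

lemma height_one: "height \<one>\<^bsub>GL2 R\<^esub> = 1"
  by (simp add: height_def GL2_one mat2_one mat2_det_def)

lemma integers_subset: "k \<in> carrier (GL2 integers) \<Longrightarrow> k \<in> carrier (GL2 R)"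
  using mat2_det_closed[of k] unfolding GL2_integers_iff GL2_iff Units_iff by (auto simp: mat2_carrier_iff)

lemma max_av_row_mult_le:
  assumes m: "m \<in> carrier (mat2_monoid R)" and k: "k \<in> carrier (mat2_monoid integers)"
  shows "max (av (ll (m \<otimes>\<^bsub>mat2_monoid R\<^esub> k))) (av (lr (m \<otimes>\<^bsub>mat2_monoid R\<^esub> k))) \<le> max (av (ll m)) (av (lr m))"
proof -
  have c: "ll m \<in> carrier R" "lr m \<in> carrier R"
    "ul k \<in> carrier R" "ur k \<in> carrier R" "ll k \<in> carrier R" "lr k \<in> carrier R"
    "av (ul k) \<le> 1" "av (ur k) \<le> 1" "av (ll k) \<le> 1" "av (lr k) \<le> 1"
    using m k by (auto simp: mat2_carrier_iff)
  have "av (x \<otimes> u \<oplus> y \<otimes> v) \<le> max (av x) (av y)"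
    if "x \<in> carrier R" "y \<in> carrier R" "u \<in> carrier R" "v \<in> carrier R" "av u \<le> 1" "av v \<le> 1" for x y u v
  proof -
    have "av (x \<otimes> u) \<le> av x" "av (y \<otimes> v) \<le> av y"
      using that by (auto simp: av_mult av_nonneg intro: mult_left_le)
    then show ?thesis using av_add[of "x \<otimes> u" "y \<otimes> v"] that by fastforce
  qed
  then show ?thesis using c by (simp add: mat2_mult)
qed

text \<open>Right multiplication by an integral matrix cannot increase the maximum norm of the
  bottom row. Applied to k and to its inverse this gives equality.\<close>

lemma height_mult_integers:
  assumes m: "m \<in> carrier (GL2 R)" and k: "k \<in> carrier (GL2 integers)"
  shows "height (m \<otimes>\<^bsub>GL2 R\<^esub> k) = height m"
proof -
  obtain n where n: "n \<in> carrier (mat2_monoid integers)" "k \<otimes>\<^bsub>mat2_monoid R\<^esub> n = \<one>\<^bsub>mat2_monoid R\<^esub>"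
    and k': "k \<in> carrier (mat2_monoid integers)"
    using k unfolding GL2_carrier Units_def integers_mult integers_one by blast
  interpret M: monoid "mat2_monoid R" by (rule monoid_mat2)
  have c: "m \<in> carrier (mat2_monoid R)" "k \<in> carrier (mat2_monoid R)" "n \<in> carrier (mat2_monoid R)"
    using m k' n by (auto simp: GL2_iff mat2_carrier_iff)
  let ?mk = "m \<otimes>\<^bsub>mat2_monoid R\<^esub> k"
  have "?mk \<otimes>\<^bsub>mat2_monoid R\<^esub> n = m" using c n by (simp add: M.m_assoc)
  then have "max (av (ll m)) (av (lr m)) \<le> max (av (ll ?mk)) (av (lr ?mk))"
    using max_av_row_mult_le[OF M.m_closed[OF c(1,2)] n(1)] by (simp only:)
  with max_av_row_mult_le[OF c(1) k']
  have "max (av (ll ?mk)) (av (lr ?mk)) = max (av (ll m)) (av (lr m))" by (rule antisym)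
  moreover have "av (mat2_det R ?mk) = av (mat2_det R m)"
    using k c by (simp add: mat2_det_mult av_mult mat2_det_closed GL2_integers_iff)
  ultimately show ?thesis unfolding height_def GL2_mult by simp
qed

lemma upper_triangular_GL2:
  assumes "a \<in> Units R" "b \<in> carrier R" "d \<in> Units R"
  shows "Mat2 a b \<zero> d \<in> carrier (GL2 R)"
proof -
  have "mat2_det R (Mat2 a b \<zero> d) = a \<otimes> d" using assms by (simp add: mat2_det_def a_minus_def Units_closed)
  then show ?thesis using assms by (simp add: GL2_iff mat2_carrier_iff Units_closed)
qed

lemma height_upper_triangular_mult:
  assumes abd: "a \<in> Units R" "b \<in> carrier R" "d \<in> Units R" and m: "m \<in> carrier (GL2 R)"
  shows "height (Mat2 a b \<zero> d \<otimes>\<^bsub>GL2 R\<^esub> m) = av (a \<otimes> inv d) * height m"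
proof -
  have c: "ul m \<in> carrier R" "ur m \<in> carrier R" "ll m \<in> carrier R" "lr m \<in> carrier R" "m \<in> carrier (mat2_monoid R)"
    using m by (auto simp: GL2_iff mat2_carrier_iff)
  have abd': "a \<in> carrier R" "d \<in> carrier R" using abd by auto
  have d0: "av d > 0" using abd av_pos by (auto simp: Units_iff)
  have "av (mat2_det R (Mat2 a b \<zero> d \<otimes>\<^bsub>mat2_monoid R\<^esub> m)) = av a * av d * av (mat2_det R m)"
  proof -
    have "mat2_det R (Mat2 a b \<zero> d) = a \<otimes> d" using abd abd' by (simp add: mat2_det_def a_minus_def)
    moreover have "Mat2 a b \<zero> d \<in> carrier (mat2_monoid R)" using abd abd' by (simp add: mat2_carrier_iff)
    ultimately show ?thesis using c abd' by (simp add: mat2_det_mult av_mult mat2_det_closed)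
  qed
  moreover have "ll (Mat2 a b \<zero> d \<otimes>\<^bsub>mat2_monoid R\<^esub> m) = d \<otimes> ll m"
    "lr (Mat2 a b \<zero> d \<otimes>\<^bsub>mat2_monoid R\<^esub> m) = d \<otimes> lr m" using c abd' by (simp_all add: mat2_mult)
  moreover have "max (av d * x) (av d * y) = av d * max x y" for x y
    using d0 by (simp add: max_mult_distrib_left)
  moreover have "av (d \<otimes> ll m) = av d * av (ll m)" "av (d \<otimes> lr m) = av d * av (lr m)"
    using c abd' by (simp_all add: av_mult)
  moreover note quotient_square_cancel[OF d0]
  moreover have "av (a \<otimes> inv d) = av a * (1 / av d)" using abd abd' by (simp add: av_mult av_inv)
  ultimately show ?thesis unfolding height_def GL2_mult by (simp only:)
qed

lemma height_integers: "k \<in> carrier (GL2 integers) \<Longrightarrow> height k = 1"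
proof -
  assume k: "k \<in> carrier (GL2 integers)"
  have "\<one>\<^bsub>GL2 R\<^esub> \<otimes>\<^bsub>GL2 R\<^esub> k = k"
    using group.is_monoid[OF GL2_group] integers_subset[OF k] by (simp add: monoid.l_one)
  then show ?thesis
    using height_mult_integers[OF monoid.one_closed[OF group.is_monoid[OF GL2_group]] k] height_one by simp
qed

text \<open>The smaller entry of the bottom row is divided by the larger one. The quotient x is
  integral, and a unipotent matrix, or one that also swaps the columns, clears the lower left
  entry.\<close>

lemma iwasawa:
  assumes m: "m \<in> carrier (GL2 R)"
  obtains a b d k where "a \<in> Units R" "b \<in> carrier R" "d \<in> Units R" "k \<in> carrier (GL2 integers)"
    "m = Mat2 a b \<zero> d \<otimes>\<^bsub>GL2 R\<^esub> k"
proof -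
  have c: "ul m \<in> carrier R" "ur m \<in> carrier R" "ll m \<in> carrier R" "lr m \<in> carrier R" "m \<in> carrier (mat2_monoid R)"
    and det: "mat2_det R m \<noteq> \<zero>"
    using m by (auto simp: GL2_iff mat2_carrier_iff Units_iff)
  show thesis
  proof (cases "av (ll m) \<le> av (lr m)")
    case True
    then have "av (lr m) > 0" using max_av_row_pos[OF m] by simp
    then have u: "lr m \<in> Units R" using c by (auto simp: Units_iff)
    define x where "x = ll m \<otimes> inv (lr m)"
    have x: "x \<in> carrier R" "lr m \<otimes> x = ll m"
      unfolding x_def by (use u c in simp) (subst m_lcomm, use u c in auto)
    have "av x \<le> 1" using True u c \<open>av (lr m) > 0\<close> by (simp add: x_def av_mult av_inv)
    define a where "a = ul m \<ominus> ur m \<otimes> x"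
    have "a \<otimes> lr m = mat2_det R m"
    proof -
      have "a \<otimes> lr m = ul m \<otimes> lr m \<ominus> ur m \<otimes> (lr m \<otimes> x)" using c x(1) unfolding a_def by algebra
      then show ?thesis by (simp add: x(2) mat2_det_def)
    qed
    then have au: "a \<in> Units R" using det c x unfolding Units_iff a_def by auto
    have k: "Mat2 \<one> \<zero> x \<one> \<in> carrier (GL2 integers)"
      using x \<open>av x \<le> 1\<close> by (auto simp: GL2_integers_iff mat2_carrier_iff mat2_det_def a_minus_def)
    have "ul m = a \<oplus> ur m \<otimes> x" using c x(1) unfolding a_def by algebra
    then have "m = Mat2 a (ur m) \<zero> (lr m) \<otimes>\<^bsub>GL2 R\<^esub> Mat2 \<one> \<zero> x \<one>"
      using c x au by (cases m) (auto simp: GL2_mult mat2_mult)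
    with that[OF au c(2) u k] show thesis .
  next
    case False
    then have "av (ll m) > 0" using c av_nonneg[of "lr m"] by simp
    then have u: "ll m \<in> Units R" using c by (auto simp: Units_iff)
    define x where "x = lr m \<otimes> inv (ll m)"
    have x: "x \<in> carrier R" "ll m \<otimes> x = lr m"
      unfolding x_def by (use u c in simp) (subst m_lcomm, use u c in auto)
    have "av x \<le> 1" using False u c \<open>av (ll m) > 0\<close> by (simp add: x_def av_mult av_inv)
    define a where "a = ul m \<otimes> x \<ominus> ur m"
    have "a \<otimes> ll m = mat2_det R m"
    proof -
      have "a \<otimes> ll m = ul m \<otimes> (ll m \<otimes> x) \<ominus> ur m \<otimes> ll m" using c x(1) unfolding a_def by algebra
      then show ?thesis by (simp add: x(2) mat2_det_def)
    qed
    then have au: "a \<in> Units R" using det c x unfolding Units_iff a_def by auto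
    have k: "Mat2 \<zero> (\<ominus> \<one>) \<one> x \<in> carrier (GL2 integers)"
      using x \<open>av x \<le> 1\<close> by (auto simp: GL2_integers_iff mat2_carrier_iff mat2_det_def a_minus_def av_minus l_minus)
    have "ur m = a \<otimes> \<ominus> \<one> \<oplus> ul m \<otimes> x" using c x(1) unfolding a_def by algebra
    then have "m = Mat2 a (ul m) \<zero> (ll m) \<otimes>\<^bsub>GL2 R\<^esub> Mat2 \<zero> (\<ominus> \<one>) \<one> x"
      using c x au by (cases m) (auto simp: GL2_mult mat2_mult)
    with that[OF au c(1) u k] show thesis .
  qed
qed

end

section \<open>The field of \<open>p\<close>-adic numbers\<close>

context
  fixes p :: nat
  assumes p: "prime p"
begin

interpretation C: cring "padic_Cauchy p" by (rule cring_padic_Cauchy[OF p])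
interpretation I: ideal "padic_null p" "padic_Cauchy p" by (rule ideal_padic_null[OF p])

abbreviation padic_class :: "(nat \<Rightarrow> rat) \<Rightarrow> padic" where
  "padic_class X \<equiv> padic_null p +>\<^bsub>padic_Cauchy p\<^esub> X"

abbreviation Cauchy_sequences :: "(nat \<Rightarrow> rat) set" where
  "Cauchy_sequences \<equiv> carrier (padic_Cauchy p)"

lemma Qp_carrier: "carrier (Qp p) = padic_class ` Cauchy_sequences"
  by (auto simp: Qp_def FactRing_def A_RCOSETS_def')

lemma Qp_mult:
  "X \<in> Cauchy_sequences \<Longrightarrow> Y \<in> Cauchy_sequences \<Longrightarrow>
    padic_class X \<otimes>\<^bsub>Qp p\<^esub> padic_class Y = padic_class (\<lambda>n. X n * Y n)"
  using I.rcoset_mult_add[of X Y] by (simp add: Qp_def FactRing_def padic_Cauchy_simps[OF p])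

lemma Qp_add:
  "X \<in> Cauchy_sequences \<Longrightarrow> Y \<in> Cauchy_sequences \<Longrightarrow>
    padic_class X \<oplus>\<^bsub>Qp p\<^esub> padic_class Y = padic_class (\<lambda>n. X n + Y n)"
  using I.a_rcos_sum[of X Y] by (simp add: Qp_def FactRing_def padic_Cauchy_simps[OF p])

lemma Qp_one: "\<one>\<^bsub>Qp p\<^esub> = padic_class (\<lambda>n. 1)"
  by (simp add: Qp_def FactRing_def padic_Cauchy_simps[OF p])

lemma Qp_zero: "\<zero>\<^bsub>Qp p\<^esub> = padic_class (\<lambda>n. 0)"
proof -
  have "padic_class \<zero>\<^bsub>padic_Cauchy p\<^esub> = padic_null p"
    by (rule I.a_rcos_const[OF I.zero_closed])
  then show ?thesis by (simp add: Qp_def FactRing_def padic_Cauchy_simps[OF p])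
qed

lemma padic_class_eqI:
  assumes "X \<in> Cauchy_sequences" "(\<lambda>n. Y n - X n) \<in> padic_null p"
  shows "padic_class X = padic_class Y"
proof (rule C.a_repr_independence)
  show "Y \<in> padic_class X"
    unfolding a_r_coset_def' using assms(2)
    by (auto simp: padic_Cauchy_simps[OF p] intro!: bexI[of _ "\<lambda>n. Y n - X n"])
qed (rule assms(1), rule I.a_subgroup)

lemma padic_class_self: "X \<in> Cauchy_sequences \<Longrightarrow> X \<in> padic_class X"
  by (rule I.a_rcos_self)

text \<open>Two representatives differ by a null sequence, so their absolute values have the same
  limit; this is what makes the definite description in \<open>padic_abs\<close> meaningful.\<close>

lemma padic_class_tendsto:
  assumes X: "X \<in> Cauchy_sequences"
  shows "(\<lambda>n. rat_padic_abs p (X n)) \<longlonglongrightarrow> padic_abs p (padic_class X)"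
proof -
  obtain r where r: "(\<lambda>n. rat_padic_abs p (X n)) \<longlonglongrightarrow> r"
    using padic_Cauchy_convergent[OF p X] by (auto simp: convergent_def)
  have lim: "(\<lambda>n. rat_padic_abs p (Y n)) \<longlonglongrightarrow> r" if Y: "Y \<in> padic_class X" for Y
  proof -
    obtain h where h: "h \<in> padic_null p" "Y = (\<lambda>n. h n + X n)"
      using Y unfolding a_r_coset_def' by (auto simp: padic_Cauchy_simps[OF p])
    have "(\<lambda>n. rat_padic_abs p (Y n) - rat_padic_abs p (X n)) \<longlonglongrightarrow> 0"
    proof (rule tendsto_rabs_zero_cancel, rule tendsto_sandwich[OF _ _ tendsto_const])
      show "\<forall>\<^sub>F n in sequentially. \<bar>rat_padic_abs p (Y n) - rat_padic_abs p (X n)\<bar> \<le> rat_padic_abs p (h n)"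
        using rat_padic_abs_triangle'[OF p, of "Y n" "X n" for n] by (simp add: h(2))
      show "(\<lambda>n. rat_padic_abs p (h n)) \<longlonglongrightarrow> 0" using h(1) by (simp add: padic_null_def)
    qed auto
    from tendsto_add[OF this r] show ?thesis by simp
  qed
  have "padic_abs p (padic_class X) = r"
    unfolding padic_abs_def
  proof (rule the_equality)
    show "\<forall>Y\<in>padic_class X. (\<lambda>n. rat_padic_abs p (Y n)) \<longlonglongrightarrow> r" using lim by blast
    show "s = r" if "\<forall>Y\<in>padic_class X. (\<lambda>n. rat_padic_abs p (Y n)) \<longlonglongrightarrow> s" for s
      using that padic_class_self[OF X] r LIMSEQ_unique by blast
  qed
  with r show ?thesis by simp
qed

lemma padic_abs_eqI:
  "X \<in> Cauchy_sequences \<Longrightarrow> (\<lambda>n. rat_padic_abs p (X n)) \<longlonglongrightarrow> r \<Longrightarrow> padic_abs p (padic_class X) = r"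
  using padic_class_tendsto LIMSEQ_unique by blast

lemma cring_Qp: "cring (Qp p)"
  unfolding Qp_def by (rule I.quotient_is_cring[OF C.is_cring])

lemma padic_abs_pos_Cauchy:
  assumes X: "X \<in> Cauchy_sequences" and nz: "padic_class X \<noteq> \<zero>\<^bsub>Qp p\<^esub>"
  shows "padic_abs p (padic_class X) > 0"
proof -
  have "padic_abs p (padic_class X) \<noteq> 0"
  proof
    assume "padic_abs p (padic_class X) = 0"
    then have "X \<in> padic_null p" using padic_class_tendsto[OF X] by (simp add: padic_null_def)
    then have "padic_class X = padic_class (\<lambda>n. 0)"
      using padic_class_eqI[of "\<lambda>n. 0" X] padic_Cauchy_const[OF p] by simp
    with nz Qp_zero show False by simp
  qed
  moreover have "padic_abs p (padic_class X) \<ge> 0"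
    using padic_class_tendsto[OF X] rat_padic_abs_nonneg[OF p] by (intro LIMSEQ_le_const) auto
  ultimately show ?thesis by simp
qed

text \<open>A Cauchy sequence of nonzero class is eventually bounded away from 0, so the termwise
  inverses again form a Cauchy sequence.\<close>

lemma padic_inverse:
  assumes X: "X \<in> Cauchy_sequences" and nz: "padic_class X \<noteq> \<zero>\<^bsub>Qp p\<^esub>"
  obtains Y where "Y \<in> Cauchy_sequences" "padic_class X \<otimes>\<^bsub>Qp p\<^esub> padic_class Y = \<one>\<^bsub>Qp p\<^esub>"
proof -
  define L where "L = padic_abs p (padic_class X)"
  have L: "L > 0" unfolding L_def by (rule padic_abs_pos_Cauchy[OF X nz])
  have "\<forall>\<^sub>F n in sequentially. rat_padic_abs p (X n) > L / 2"
    using padic_class_tendsto[OF X] L unfolding L_def by (intro order_tendstoD) auto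
  then obtain M0 where M0: "\<And>n. n \<ge> M0 \<Longrightarrow> rat_padic_abs p (X n) > L / 2"
    by (auto simp: eventually_sequentially)
  have X0: "X n \<noteq> 0" if "n \<ge> M0" for n using M0[OF that] L by (auto simp: rat_padic_abs_0[OF p])
  \<comment> \<open>Zero terms can occur only before \<open>M0\<close>; there
    \<open>inverse 0 = 0\<close> is harmless, since neither the Cauchy property nor the class
    depends on finitely many terms.\<close>
  define Y where "Y n = inverse (X n)" for n
  have Y: "Y \<in> Cauchy_sequences"
    unfolding padic_Cauchy_iff[OF p]
  proof (intro allI impI)
    fix e :: real assume e: "e > 0"
    then have "e * (L / 2 * (L / 2)) > 0" using L by simp
    then obtain M where M: "\<And>m n. m \<ge> M \<Longrightarrow> n \<ge> M \<Longrightarrow> rat_padic_abs p (X m - X n) < e * (L / 2 * (L / 2))"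
      using X unfolding padic_Cauchy_iff[OF p] by meson
    have "rat_padic_abs p (Y m - Y n) < e" if mn: "m \<ge> max M M0" "n \<ge> max M M0" for m n
    proof -
      have nz: "X m \<noteq> 0" "X n \<noteq> 0" using X0 mn by auto
      then have "(Y m - Y n) * (X m * X n) = X n - X m" by (simp add: Y_def field_simps)
      then have "rat_padic_abs p (Y m - Y n) * (rat_padic_abs p (X m) * rat_padic_abs p (X n)) = rat_padic_abs p (X n - X m)"
        by (simp flip: rat_padic_abs_mult[OF p])
      also have "\<dots> < e * (L / 2 * (L / 2))" using M mn by simp
      also have "\<dots> \<le> e * (rat_padic_abs p (X m) * rat_padic_abs p (X n))"
        using M0[of m] M0[of n] mn e L by (intro mult_left_mono mult_mono) auto
      finally show ?thesis
        using rat_padic_abs_pos[OF p nz(1)] rat_padic_abs_pos[OF p nz(2)] by simp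
    qed
    then show "\<exists>M. \<forall>m\<ge>M. \<forall>n\<ge>M. rat_padic_abs p (Y m - Y n) < e" by blast
  qed
  have "padic_class (\<lambda>n. 1) = padic_class (\<lambda>n. X n * Y n)"
  proof (rule padic_class_eqI[OF padic_Cauchy_const[OF p]])
    have "\<forall>\<^sub>F n in sequentially. rat_padic_abs p (X n * Y n - 1) = 0"
      unfolding eventually_sequentially using X0 by (intro exI[of _ M0]) (simp add: Y_def rat_padic_abs_0[OF p])
    then show "(\<lambda>n. X n * Y n - 1) \<in> padic_null p"
      unfolding padic_null_iff[OF p] by (rule tendsto_eventually)
  qed
  then have "padic_class X \<otimes>\<^bsub>Qp p\<^esub> padic_class Y = \<one>\<^bsub>Qp p\<^esub>"
    using Qp_mult[OF X Y] Qp_one by simp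
  with Y that show ?thesis by blast
qed

lemma field_Qp: "field (Qp p)"
proof -
  interpret Q: cring "Qp p" by (rule cring_Qp)
  have one_abs: "padic_abs p \<one>\<^bsub>Qp p\<^esub> = 1"
    unfolding Qp_one by (rule padic_abs_eqI) (auto simp: padic_Cauchy_const[OF p] rat_padic_abs_1[OF p])
  have zero_abs: "padic_abs p \<zero>\<^bsub>Qp p\<^esub> = 0"
    unfolding Qp_zero by (rule padic_abs_eqI) (auto simp: padic_Cauchy_const[OF p] rat_padic_abs_0[OF p])
  show ?thesis
  proof (rule Q.cring_fieldI, intro equalityI subsetI)
    fix x assume x: "x \<in> Units (Qp p)"
    have "x \<noteq> \<zero>\<^bsub>Qp p\<^esub>"
    proof
      assume "x = \<zero>\<^bsub>Qp p\<^esub>"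
      then have "\<one>\<^bsub>Qp p\<^esub> = \<zero>\<^bsub>Qp p\<^esub>" using Q.Units_r_inv[OF x] Q.Units_inv_closed[OF x] by simp
      with one_abs zero_abs show False by simp
    qed
    with x show "x \<in> carrier (Qp p) - {\<zero>\<^bsub>Qp p\<^esub>}" by auto
  next
    fix x assume "x \<in> carrier (Qp p) - {\<zero>\<^bsub>Qp p\<^esub>}"
    then obtain X where X: "X \<in> Cauchy_sequences" "x = padic_class X" "padic_class X \<noteq> \<zero>\<^bsub>Qp p\<^esub>"
      by (auto simp: Qp_carrier)
    from padic_inverse[OF X(1,3)] obtain Y where
      Y: "Y \<in> Cauchy_sequences" "padic_class X \<otimes>\<^bsub>Qp p\<^esub> padic_class Y = \<one>\<^bsub>Qp p\<^esub>" .
    have c: "padic_class X \<in> carrier (Qp p)" "padic_class Y \<in> carrier (Qp p)" using X Y by (auto simp: Qp_carrier)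
    then have "padic_class Y \<otimes>\<^bsub>Qp p\<^esub> padic_class X = \<one>\<^bsub>Qp p\<^esub>" using Y Q.m_comm by simp
    with c Y X(2) show "x \<in> Units (Qp p)" unfolding Units_def by blast
  qed
qed

lemma ultrametric_field_Qp: "ultrametric_field (Qp p) (padic_abs p)"
proof -
  interpret field "Qp p" by (rule field_Qp)
  show ?thesis
  proof
    show "padic_abs p \<zero>\<^bsub>Qp p\<^esub> = 0"
      unfolding Qp_zero by (rule padic_abs_eqI) (auto simp: padic_Cauchy_const[OF p] rat_padic_abs_0[OF p])
    fix x assume x: "x \<in> carrier (Qp p)"
    then obtain X where X: "X \<in> Cauchy_sequences" "x = padic_class X" by (auto simp: Qp_carrier)
    show "padic_abs p x > 0" if "x \<noteq> \<zero>\<^bsub>Qp p\<^esub>" using padic_abs_pos_Cauchy[OF X(1)] that X(2) by simp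
    fix y assume "y \<in> carrier (Qp p)"
    then obtain Y where Y: "Y \<in> Cauchy_sequences" "y = padic_class Y" by (auto simp: Qp_carrier)
    show "padic_abs p (x \<otimes>\<^bsub>Qp p\<^esub> y) = padic_abs p x * padic_abs p y"
      unfolding X(2) Y(2) Qp_mult[OF X(1) Y(1)]
    proof (rule padic_abs_eqI[OF padic_Cauchy_mult[OF p X(1) Y(1)]])
      show "(\<lambda>n. rat_padic_abs p (X n * Y n)) \<longlonglongrightarrow> padic_abs p (padic_class X) * padic_abs p (padic_class Y)"
        unfolding rat_padic_abs_mult[OF p] by (intro tendsto_mult padic_class_tendsto X Y)
    qed
    have "padic_abs p (padic_class (\<lambda>n. X n + Y n)) \<le> max (padic_abs p (padic_class X)) (padic_abs p (padic_class Y))"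
    proof (rule LIMSEQ_le)
      show "(\<lambda>n. rat_padic_abs p (X n + Y n)) \<longlonglongrightarrow> padic_abs p (padic_class (\<lambda>n. X n + Y n))"
        by (rule padic_class_tendsto[OF padic_Cauchy_add[OF p X(1) Y(1)]])
      show "(\<lambda>n. max (rat_padic_abs p (X n)) (rat_padic_abs p (Y n)))
          \<longlonglongrightarrow> max (padic_abs p (padic_class X)) (padic_abs p (padic_class Y))"
        by (intro tendsto_max padic_class_tendsto X Y)
      show "\<exists>M. \<forall>n\<ge>M. rat_padic_abs p (X n + Y n) \<le> max (rat_padic_abs p (X n)) (rat_padic_abs p (Y n))"
        by (intro exI allI impI rat_padic_abs_add[OF p])
    qed
    then show "padic_abs p (x \<oplus>\<^bsub>Qp p\<^esub> y) \<le> max (padic_abs p x) (padic_abs p y)"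
      unfolding X(2) Y(2) Qp_add[OF X(1) Y(1)] .
  qed
qed

lemma padic_of_rat_closed: "padic_of_rat p q \<in> carrier (Qp p)"
  by (simp add: padic_of_rat_def Qp_carrier padic_Cauchy_const[OF p])

lemma padic_of_rat_mult: "padic_of_rat p (q * r) = padic_of_rat p q \<otimes>\<^bsub>Qp p\<^esub> padic_of_rat p r"
  by (simp add: padic_of_rat_def Qp_mult padic_Cauchy_const[OF p])

lemma padic_of_rat_add: "padic_of_rat p (q + r) = padic_of_rat p q \<oplus>\<^bsub>Qp p\<^esub> padic_of_rat p r"
  by (simp add: padic_of_rat_def Qp_add padic_Cauchy_const[OF p])

lemma padic_of_rat_0: "padic_of_rat p 0 = \<zero>\<^bsub>Qp p\<^esub>"
  by (simp add: padic_of_rat_def Qp_zero)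

lemma padic_abs_of_rat: "padic_abs p (padic_of_rat p q) = rat_padic_abs p q"
  unfolding padic_of_rat_def by (rule padic_abs_eqI) (auto simp: padic_Cauchy_const[OF p])

end

section \<open>Local sections\<close>

lemma powr_of_real_mult_nonneg:
  fixes x y :: real
  assumes "x \<ge> 0" "y \<ge> 0"
  shows "complex_of_real (x * y) powr s = complex_of_real x powr s * complex_of_real y powr s"
  using assms by (simp add: powr_times_real)

context ultrametric_field
begin

text \<open>The absolute value of the determinant and the maximum norm of the bottom row are
  nonzero, and an ultrametric absolute value is constant near a nonzero point.\<close>

lemma height_locally_constant:
  assumes g: "g \<in> carrier (GL2 R)"
  shows "\<exists>e>0. \<forall>h \<in> carrier (GL2 R).
       av (ul h \<ominus> ul g) < e \<and> av (ur h \<ominus> ur g) < e \<and>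
       av (ll h \<ominus> ll g) < e \<and> av (lr h \<ominus> lr g) < e \<longrightarrow> height h = height g"
proof -
  have c: "ul g \<in> carrier R" "ur g \<in> carrier R" "ll g \<in> carrier R" "lr g \<in> carrier R" "g \<in> carrier (mat2_monoid R)"
    using g by (auto simp: GL2_iff mat2_carrier_iff)
  define D where "D = av (mat2_det R g)"
  have D: "D > 0" using g av_pos[of "mat2_det R g"] by (auto simp: D_def GL2_iff Units_iff)
  define m where "m = max (av (ll g)) (av (lr g))"
  have m: "m > 0" unfolding m_def by (rule max_av_row_pos[OF g])
  define B where "B = Max {1, av (ul g), av (ur g), av (ll g), av (lr g)}"
  have B: "1 \<le> B" "av (ul g) \<le> B" "av (ur g) \<le> B" "av (ll g) \<le> B" "av (lr g) \<le> B"
    unfolding B_def by (auto intro!: Max_ge)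
  \<comment> \<open>The bound 1 keeps the bottom row of h below B, the bound D / B keeps the change
    of the determinant below its size D, and m does the same for the bottom row.\<close>
  define e where "e = min 1 (min (D / B) m)"
  have e0: "e > 0" "e \<le> 1" "e \<le> D / B" "e \<le> m"
    using D B m by (auto simp: e_def)
  then have "e * B \<le> D" using B by (simp add: le_divide_eq)
  note e = e0(1,2) this e0(4)
  show ?thesis
  proof (intro exI[of _ e] conjI ballI impI e(1))
    fix h assume h: "h \<in> carrier (GL2 R)"
      and close: "av (ul h \<ominus> ul g) < e \<and> av (ur h \<ominus> ur g) < e \<and> av (ll h \<ominus> ll g) < e \<and> av (lr h \<ominus> lr g) < e"
    have ch: "ul h \<in> carrier R" "ur h \<in> carrier R" "ll h \<in> carrier R" "lr h \<in> carrier R"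
      using h by (auto simp: GL2_iff mat2_carrier_iff)
    have near: "av y \<le> max (av x) (av (y \<ominus> x))" if "x \<in> carrier R" "y \<in> carrier R" for x y
    proof -
      have "y = x \<oplus> (y \<ominus> x)" using that by algebra
      then show ?thesis using av_add[of x "y \<ominus> x"] that by simp
    qed
    have le: "av (lr h) \<le> B" "av (ll h) \<le> B"
      using near[of "lr g" "lr h"] near[of "ll g" "ll h"] c ch close B e by auto
    have pr: "av (x \<otimes> y) < D" if "x \<in> carrier R" "y \<in> carrier R" "av x < e" "av y \<le> B" for x y
    proof -
      have "av (x \<otimes> y) = av x * av y" using that by (simp add: av_mult)
      also have "\<dots> \<le> av x * B" using that by (intro mult_left_mono) (auto simp: av_nonneg)
      also have "\<dots> < e * B" using that B by (intro mult_strict_right_mono) auto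
      also have "\<dots> \<le> D" by (rule e(3))
      finally show ?thesis .
    qed
    have "av (mat2_det R h) = av (mat2_det R g)"
    proof (rule av_eq_of_diff_less)
      \<comment> \<open>The difference of the determinants is rewritten so that each product
        contains one small difference of entries and one factor of size at most B.\<close>
      let ?t = "((ul h \<ominus> ul g) \<otimes> lr h \<oplus> (lr h \<ominus> lr g) \<otimes> ul g) \<ominus> ((ur h \<ominus> ur g) \<otimes> ll h \<oplus> (ll h \<ominus> ll g) \<otimes> ur g)"
      have "mat2_det R h \<ominus> mat2_det R g = ?t"
        using c ch unfolding mat2_det_def by algebra
      moreover have "av ?t < D"
      proof -
        have t: "av ((ul h \<ominus> ul g) \<otimes> lr h) < D" "av ((lr h \<ominus> lr g) \<otimes> ul g) < D"
          "av ((ur h \<ominus> ur g) \<otimes> ll h) < D" "av ((ll h \<ominus> ll g) \<otimes> ur g) < D"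
          using c ch close le B by (simp_all add: pr)
        have tc: "(ul h \<ominus> ul g) \<otimes> lr h \<in> carrier R" "(lr h \<ominus> lr g) \<otimes> ul g \<in> carrier R"
          "(ur h \<ominus> ur g) \<otimes> ll h \<in> carrier R" "(ll h \<ominus> ll g) \<otimes> ur g \<in> carrier R"
          using c ch by simp_all
        have 1: "av ((ul h \<ominus> ul g) \<otimes> lr h \<oplus> (lr h \<ominus> lr g) \<otimes> ul g) < D"
          using av_add[OF tc(1,2)] t(1,2) by simp
        have 2: "av ((ur h \<ominus> ur g) \<otimes> ll h \<oplus> (ll h \<ominus> ll g) \<otimes> ur g) < D"
          using av_add[OF tc(3,4)] t(3,4) by simp
        show ?thesis using av_diff[OF a_closed[OF tc(1,2)] a_closed[OF tc(3,4)]] 1 2 by simp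
      qed
      ultimately show "av (mat2_det R h \<ominus> mat2_det R g) < av (mat2_det R g)" by (simp add: D_def)
      show "mat2_det R g \<in> carrier R" "mat2_det R h \<in> carrier R"
        using g h unfolding GL2_iff by (simp_all add: mat2_det_closed)
    qed
    moreover have "max (av (ll h)) (av (lr h)) = m"
    proof -
      have "max (av (ll h)) (av (lr h)) \<le> m"
        using near[of "lr g" "lr h"] near[of "ll g" "ll h"] c ch close e by (auto simp: m_def)
      moreover have "m \<le> max (av (ll h)) (av (lr h))"
      proof (cases "av (ll g) \<le> av (lr g)")
        case True
        then have "av (lr h) = av (lr g)"
          using close e c ch by (intro av_eq_of_diff_less) (auto simp: m_def)
        then show ?thesis using True by (simp add: m_def)
      next
        case False
        then have "av (ll h) = av (ll g)"
          using close e c ch by (intro av_eq_of_diff_less) (auto simp: m_def)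
        then show ?thesis using False by (simp add: m_def)
      qed
      ultimately show ?thesis by (rule antisym)
    qed
    ultimately show "height h = height g" by (simp add: height_def m_def)
  qed
qed

end

abbreviation padic_height :: "nat \<Rightarrow> padic mat2 \<Rightarrow> real" where
  "padic_height p \<equiv> ultrametric_field.height (Qp p) (padic_abs p)"

text \<open>The power of the height has all three properties; the Iwasawa decomposition shows that
  they determine the function, so the definite description picks it.\<close>

lemma f_sph_eq:
  assumes p: "prime p"
  shows "f_sph s p = (\<lambda>g\<in>carrier (GL2 (Qp p)). complex_of_real (padic_height p g) powr (s + 1/2))"
proof -
  interpret Q: ultrametric_field "Qp p" "padic_abs p" by (rule ultrametric_field_Qp[OF p])
  interpret G: group "GL2 (Qp p)" by (rule Q.GL2_group)
  define F where "F = (\<lambda>g\<in>carrier (GL2 (Qp p)). complex_of_real (Q.height g) powr (s + 1/2))"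
  have Zp: "Zp p = Q.integers" by (simp add: Zp_def)
  have "F \<in> V_padic s p"
    unfolding V_padic_def
  proof (intro CollectI conjI ballI)
    show "padic_locally_constant p F"
      unfolding padic_locally_constant_def
    proof
      fix g assume g: "g \<in> carrier (GL2 (Qp p))"
      from Q.height_locally_constant[OF g] obtain e where e: "e > 0"
        "\<forall>h \<in> carrier (GL2 (Qp p)). padic_abs p (ul h \<ominus>\<^bsub>Qp p\<^esub> ul g) < e \<and> padic_abs p (ur h \<ominus>\<^bsub>Qp p\<^esub> ur g) < e \<and>
       padic_abs p (ll h \<ominus>\<^bsub>Qp p\<^esub> ll g) < e \<and> padic_abs p (lr h \<ominus>\<^bsub>Qp p\<^esub> lr g) < e \<longrightarrow> Q.height h = Q.height g" by blast
      show "\<exists>e>0. \<forall>h \<in> carrier (GL2 (Qp p)).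
       padic_abs p (ul h \<ominus>\<^bsub>Qp p\<^esub> ul g) < e \<and> padic_abs p (ur h \<ominus>\<^bsub>Qp p\<^esub> ur g) < e \<and>
       padic_abs p (ll h \<ominus>\<^bsub>Qp p\<^esub> ll g) < e \<and> padic_abs p (lr h \<ominus>\<^bsub>Qp p\<^esub> lr g) < e \<longrightarrow> F h = F g"
        using e g by (intro exI[of _ e]) (simp add: F_def)
    qed
    fix a b d g assume abd: "a \<in> Units (Qp p)" "b \<in> carrier (Qp p)" "d \<in> Units (Qp p)" and g: "g \<in> carrier (GL2 (Qp p))"
    have "Mat2 a b \<zero>\<^bsub>Qp p\<^esub> d \<otimes>\<^bsub>GL2 (Qp p)\<^esub> g \<in> carrier (GL2 (Qp p))"
      by (intro G.m_closed Q.upper_triangular_GL2 abd g)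
    moreover have "padic_abs p (a \<otimes>\<^bsub>Qp p\<^esub> inv\<^bsub>Qp p\<^esub> d) \<ge> 0" using abd by (intro Q.av_nonneg) auto
    moreover note powr_of_real_mult_nonneg[OF this less_imp_le[OF Q.height_pos[OF g]], of "s + 1/2"]
    ultimately show "F (Mat2 a b \<zero>\<^bsub>Qp p\<^esub> d \<otimes>\<^bsub>GL2 (Qp p)\<^esub> g) =
        complex_of_real (padic_abs p (a \<otimes>\<^bsub>Qp p\<^esub> inv\<^bsub>Qp p\<^esub> d)) powr (s + 1/2) * F g"
      using g unfolding F_def
      by (simp only: restrict_apply' Q.height_upper_triangular_mult[OF abd g])
  qed (simp add: F_def)
  moreover have "right_translate (GL2 (Qp p)) k F = F" if k: "k \<in> carrier (GL2 (Zp p))" for k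
  proof
    fix g
    have k': "k \<in> carrier (GL2 Q.integers)" using k by (simp add: Zp)
    show "right_translate (GL2 (Qp p)) k F g = F g"
      using G.m_closed[OF _ Q.integers_subset[OF k']] Q.height_mult_integers[OF _ k']
      by (cases "g \<in> carrier (GL2 (Qp p))") (simp_all add: right_translate_def F_def)
  qed
  moreover have "F \<one>\<^bsub>GL2 (Qp p)\<^esub> = 1"
    by (simp add: F_def Q.height_one)
  moreover have "f = F" if f: "f \<in> V_padic s p"
    "\<forall>k \<in> carrier (GL2 (Zp p)). right_translate (GL2 (Qp p)) k f = f" "f \<one>\<^bsub>GL2 (Qp p)\<^esub> = 1" for f
  proof (rule extensionalityI[of _ "carrier (GL2 (Qp p))"])
    show "f \<in> extensional (carrier (GL2 (Qp p)))" using f(1) by (simp add: V_padic_def)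
    fix g assume g: "g \<in> carrier (GL2 (Qp p))"
    from Q.iwasawa[OF g] obtain a b d k where abd: "a \<in> Units (Qp p)" "b \<in> carrier (Qp p)" "d \<in> Units (Qp p)"
      and k: "k \<in> carrier (GL2 Q.integers)" and gk: "g = Mat2 a b \<zero>\<^bsub>Qp p\<^esub> d \<otimes>\<^bsub>GL2 (Qp p)\<^esub> k" .
    have kG: "k \<in> carrier (GL2 (Qp p))" by (rule Q.integers_subset[OF k])
    have "f k = right_translate (GL2 (Qp p)) k f \<one>\<^bsub>GL2 (Qp p)\<^esub>"
      using kG by (simp add: right_translate_def)
    also have "\<dots> = 1" using f(2,3) k by (simp add: Zp)
    finally have "f k = 1" .
    moreover have "f g = complex_of_real (padic_abs p (a \<otimes>\<^bsub>Qp p\<^esub> inv\<^bsub>Qp p\<^esub> d)) powr (s + 1/2) * f k"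
    proof -
      have "\<forall>a \<in> Units (Qp p). \<forall>b \<in> carrier (Qp p). \<forall>d \<in> Units (Qp p). \<forall>g \<in> carrier (GL2 (Qp p)).
        f (Mat2 a b \<zero>\<^bsub>Qp p\<^esub> d \<otimes>\<^bsub>GL2 (Qp p)\<^esub> g) =
        complex_of_real (padic_abs p (a \<otimes>\<^bsub>Qp p\<^esub> inv\<^bsub>Qp p\<^esub> d)) powr (s + 1/2) * f g"
        using f(1) unfolding V_padic_def mem_Collect_eq by (elim conjE)
      from bspec[OF bspec[OF bspec[OF bspec[OF this abd(1)] abd(2)] abd(3)] kG]
      show ?thesis unfolding gk .
    qed
    ultimately have "f g = complex_of_real (padic_abs p (a \<otimes>\<^bsub>Qp p\<^esub> inv\<^bsub>Qp p\<^esub> d)) powr (s + 1/2)"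
      by (simp only: mult_1_right)
    also have "padic_abs p (a \<otimes>\<^bsub>Qp p\<^esub> inv\<^bsub>Qp p\<^esub> d) = Q.height g"
      unfolding gk Q.height_upper_triangular_mult[OF abd kG] Q.height_integers[OF k] by simp
    finally show "f g = F g" using g by (simp add: F_def)
  qed (simp add: F_def)
  ultimately have "f_sph s p = F"
    unfolding f_sph_def by (intro the_equality conjI ballI) blast+
  then show ?thesis by (simp only: F_def)
qed

lemma f_sph_half:
  assumes "prime p" "g \<in> carrier (GL2 (Qp p))"
  shows "f_sph (1/2) p g = complex_of_real (padic_height p g)"
  using assms by (simp add: f_sph_eq)

lemma rat_padic_abs_self: "prime p \<Longrightarrow> rat_padic_abs p (of_nat p) = 1 / real p"
  using rat_padic_abs_divide[of p "int p" 1] not_prime_unit[of "int p"]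
  by (simp add: prime_gt_0_nat power_int_minus inverse_eq_divide)

text \<open>Right translation by diag(1, p) divides by p both the absolute value of the determinant
  and that of the lower right entry. So the height h becomes h / p if the lower left entry
  dominates, and h p if it is smaller by a factor p. With 1 / (1 - p) these give -h / p and
  h.\<close>

lemma f_St_values:
  assumes p: "prime p" and g: "g \<in> carrier (GL2 (Qp p))"
  shows f_St_large: "padic_abs p (lr g) \<le> padic_abs p (ll g) \<Longrightarrow> f_St p g = complex_of_real (padic_height p g) * (- 1 / of_nat p)"
    and f_St_small: "padic_abs p (ll g) \<le> padic_abs p (lr g) / real p \<Longrightarrow> f_St p g = complex_of_real (padic_height p g)"
proof -
  interpret Q: ultrametric_field "Qp p" "padic_abs p" by (rule ultrametric_field_Qp[OF p])
  interpret G: group "GL2 (Qp p)" by (rule Q.GL2_group)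
  have p1: "real p > 1" using prime_gt_1_nat[OF p] by simp
  define \<pi> where "\<pi> = padic_of_rat p (of_nat p)"
  have pi: "\<pi> \<in> carrier (Qp p)" "padic_abs p \<pi> = 1 / real p"
    by (simp_all add: \<pi>_def padic_of_rat_closed[OF p] padic_abs_of_rat[OF p] rat_padic_abs_self[OF p])
  define t where "t = Mat2 \<one>\<^bsub>Qp p\<^esub> \<zero>\<^bsub>Qp p\<^esub> \<zero>\<^bsub>Qp p\<^esub> \<pi>"
  have c: "ul g \<in> carrier (Qp p)" "ur g \<in> carrier (Qp p)" "ll g \<in> carrier (Qp p)" "lr g \<in> carrier (Qp p)"
     "g \<in> carrier (mat2_monoid (Qp p))"
    using g by (auto simp: Q.GL2_iff mat2_carrier_iff)
  have "\<pi> \<in> Units (Qp p)" using pi p1 by (auto simp: Q.Units_iff)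
  then have t: "t \<in> carrier (GL2 (Qp p))" "t \<in> carrier (mat2_monoid (Qp p))"
    unfolding t_def using Q.upper_triangular_GL2[of "\<one>\<^bsub>Qp p\<^esub>" "\<zero>\<^bsub>Qp p\<^esub>" \<pi>] pi
    by (auto simp: mat2_carrier_iff)
  define D where "D = padic_abs p (mat2_det (Qp p) g)"
  define x y where "x = padic_abs p (ll g)" and "y = padic_abs p (lr g)"
  have xy: "max x y > 0" "x \<ge> 0" "y \<ge> 0" unfolding x_def y_def using Q.max_av_row_pos[OF g] Q.av_nonneg c by auto
  have h1: "Q.height g = D / max x y ^ 2" by (simp add: Q.height_def D_def x_def y_def)
  have "mat2_det (Qp p) t = \<pi>" using pi by (simp add: t_def mat2_det_def a_minus_def)
  then have "padic_abs p (mat2_det (Qp p) (g \<otimes>\<^bsub>mat2_monoid (Qp p)\<^esub> t)) = D / real p"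
    using c t pi by (simp add: Q.mat2_det_mult Q.av_mult Q.mat2_det_closed D_def)
  moreover have "ll (g \<otimes>\<^bsub>mat2_monoid (Qp p)\<^esub> t) = ll g" "lr (g \<otimes>\<^bsub>mat2_monoid (Qp p)\<^esub> t) = lr g \<otimes>\<^bsub>Qp p\<^esub> \<pi>"
    using c pi by (simp_all add: mat2_mult t_def)
  moreover have "padic_abs p (lr g \<otimes>\<^bsub>Qp p\<^esub> \<pi>) = y / real p" using c pi by (simp add: Q.av_mult y_def)
  ultimately have h2: "Q.height (g \<otimes>\<^bsub>GL2 (Qp p)\<^esub> t) = (D / real p) / max x (y / real p) ^ 2"
    unfolding Q.height_def GL2_mult by (simp add: x_def)
  have eq: "f_St p g = complex_of_real (1 / (1 - real p) * (Q.height g - Q.height (g \<otimes>\<^bsub>GL2 (Qp p)\<^esub> t)))"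
    using g t unfolding f_St_def \<pi>_def[symmetric] t_def[symmetric]
    by (simp add: right_translate_def f_sph_half[OF p])
  show "f_St p g = complex_of_real (padic_height p g) * (- 1 / of_nat p)" if le: "padic_abs p (lr g) \<le> padic_abs p (ll g)"
  proof -
    have "y \<le> x" using le by (simp add: x_def y_def)
    moreover have "y / real p \<le> y / 1" using p1 xy by (intro divide_left_mono) auto
    ultimately have "max x y = x" "max x (y / real p) = x" by auto
    then have ht: "Q.height (g \<otimes>\<^bsub>GL2 (Qp p)\<^esub> t) = Q.height g / real p" unfolding h2 h1 by simp
    have alg: "k * (h - h / P) = h * (k * (1 - 1 / P))" for k h P :: real by (simp add: algebra_simps)
    have "1 / (1 - real p) * (Q.height g - Q.height (g \<otimes>\<^bsub>GL2 (Qp p)\<^esub> t))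
      = Q.height g * (1 / (1 - real p) * (1 - 1 / real p))" unfolding ht by (rule alg)
    also have "1 / (1 - real p) * (1 - 1 / real p) = - (1 / real p)"
    proof -
      have "1 / (1 - P) * (1 - 1 / P) = - (1 / P)" if "P > 1" for P :: real
      proof -
        have "1 - 1 / P = (1 - P) * (- (1 / P))" using that by (simp add: field_simps)
        then show ?thesis using that by simp
      qed
      from this[OF p1] show ?thesis .
    qed
    finally have "f_St p g = complex_of_real (Q.height g * - (1 / real p))" unfolding eq by (simp only:)
    also have "\<dots> = complex_of_real (Q.height g) * (- 1 / of_nat p)"
      by (simp only: of_real_mult of_real_minus of_real_divide of_real_1 of_real_of_nat_eq minus_divide_left)
    finally show ?thesis .
  qed
  show "f_St p g = complex_of_real (padic_height p g)" if le: "padic_abs p (ll g) \<le> padic_abs p (lr g) / real p"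
  proof -
    have "x \<le> y / real p" using le by (simp add: x_def y_def)
    moreover have "y / real p \<le> y / 1" using p1 xy by (intro divide_left_mono) auto
    ultimately have m: "max x y = y" "max x (y / real p) = y / real p" by auto
    then have "y > 0" using xy by simp
    then have ht: "Q.height (g \<otimes>\<^bsub>GL2 (Qp p)\<^esub> t) = Q.height g * real p"
      unfolding h2 h1 m using p1 by (simp add: power_divide power2_eq_square)
    have "1 / (1 - P) * (h - h * P) = h" if "P > 1" for P h :: real
    proof -
      have "h - h * P = h * (1 - P)" by (simp add: algebra_simps)
      then show ?thesis using that by simp
    qed
    from this[OF p1] have "1 / (1 - real p) * (Q.height g - Q.height (g \<otimes>\<^bsub>GL2 (Qp p)\<^esub> t)) = Q.height g"
      unfolding ht .
    then show ?thesis unfolding eq by (simp only:)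
  qed
qed

lemma GL2_real_iff: "m \<in> carrier (GL2 real_ring) \<longleftrightarrow> ul m * lr m - ur m * ll m \<noteq> 0"
  using cring_class.GL2_iff[of m] field_class.field_Units[where ?'a = real]
  by (simp add: mat2_carrier_iff class_simps mat2_det_def)

lemma GL2_real_mult:
  "m \<otimes>\<^bsub>GL2 real_ring\<^esub> n = Mat2 (ul m * ul n + ur m * ll n) (ul m * ur n + ur m * lr n)
    (ll m * ul n + lr m * ll n) (ll m * ur n + lr m * lr n)"
  by (simp add: GL2_mult mat2_mult class_simps)

text \<open>Polar coordinates of the bottom row determine the rotation and the lower right entry;
  the top row is then rotated back.\<close>

lemma real_iwasawa:
  assumes g: "g \<in> carrier (GL2 real_ring)"
  obtains a b d \<theta> where "a \<noteq> 0" "d \<noteq> 0" "g = Mat2 a b 0 d \<otimes>\<^bsub>GL2 real_ring\<^esub> rot2 \<theta>"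
proof -
  define D where "D = ul g * lr g - ur g * ll g"
  have D: "D \<noteq> 0" using g by (simp add: GL2_real_iff D_def)
  define r where "r = sqrt (ll g ^ 2 + lr g ^ 2)"
  have "ll g \<noteq> 0 \<or> lr g \<noteq> 0" using D by (auto simp: D_def)
  then have r2: "r ^ 2 = ll g ^ 2 + lr g ^ 2" "r > 0" by (auto simp: r_def sum_power2_gt_zero_iff)
  have "(lr g / r) ^ 2 + (- ll g / r) ^ 2 = 1"
  proof -
    have "(lr g / r) ^ 2 + (- ll g / r) ^ 2 = (ll g ^ 2 + lr g ^ 2) / r ^ 2"
      by (simp add: power_divide add_divide_distrib)
    also have "\<dots> = 1" unfolding r2(1)[symmetric] using r2(2) by simp
    finally show ?thesis .
  qed
  then obtain \<theta> where \<theta>: "lr g / r = cos \<theta>" "- ll g / r = sin \<theta>" using sincos_total_2pi by metis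
  have row: "lr g = r * cos \<theta>" "ll g = - r * sin \<theta>"
    using \<theta> r2 by (simp_all add: field_simps)
  define b where "b = ul g * (- sin \<theta>) + ur g * cos \<theta>"
  define a where "a = ul g * cos \<theta> + ur g * sin \<theta>"
  have "a * r = D" unfolding a_def D_def row by (simp add: algebra_simps)
  then have "a \<noteq> 0" using D by auto
  have sc: "sin \<theta> * sin \<theta> + cos \<theta> * cos \<theta> = 1" by (simp flip: power2_eq_square)
  have "a * cos \<theta> + b * (- sin \<theta>) = ul g * (sin \<theta> * sin \<theta> + cos \<theta> * cos \<theta>)"
    "a * sin \<theta> + b * cos \<theta> = ur g * (sin \<theta> * sin \<theta> + cos \<theta> * cos \<theta>)"
    unfolding a_def b_def by (simp_all only: algebra_simps) 
  then have "g = Mat2 a b 0 r \<otimes>\<^bsub>GL2 real_ring\<^esub> rot2 \<theta>"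
    unfolding sc using row by (cases g) (simp add: GL2_real_mult rot2_def)
  then show ?thesis using that[of a r b \<theta>] \<open>a \<noteq> 0\<close> r2 by simp
qed

text \<open>For g = b r(\<theta>) the bottom row is d (-sin \<theta>, cos \<theta>), hence lr - i ll
  = d exp(i \<theta>). Squaring removes the sign of d, which is the consistency that even weight
  provides.\<close>

lemma f_real_2_half:
  assumes "g \<in> carrier (GL2 real_ring)"
  shows "f_real 2 (1/2) g = of_real (\<bar>ul g * lr g - ur g * ll g\<bar> / (ll g ^ 2 + lr g ^ 2)) *
    ((of_real (lr g) - \<i> * of_real (ll g)) ^ 2 / of_real (ll g ^ 2 + lr g ^ 2))"
proof -
  define F where "F = (\<lambda>g\<in>carrier (GL2 real_ring). of_real (\<bar>ul g * lr g - ur g * ll g\<bar> / (ll g ^ 2 + lr g ^ 2)) *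
    ((of_real (lr g) - \<i> * of_real (ll g)) ^ 2 / of_real (ll g ^ 2 + lr g ^ 2)) :: complex)"
  have F: "F (Mat2 a b 0 d \<otimes>\<^bsub>GL2 real_ring\<^esub> rot2 \<theta>) =
        complex_of_real \<bar>a / d\<bar> powr (1/2 + 1/2) * exp (\<i> * of_int 2 * of_real \<theta>)"
    if ad: "a \<noteq> 0" "d \<noteq> 0" for a b d \<theta>
  proof -
    let ?g = "Mat2 a b 0 d \<otimes>\<^bsub>GL2 real_ring\<^esub> rot2 \<theta>"
    have sc: "sin \<theta> * sin \<theta> + cos \<theta> * cos \<theta> = 1" by (simp flip: power2_eq_square)
    have g: "ul ?g = a * cos \<theta> - b * sin \<theta>" "ur ?g = a * sin \<theta> + b * cos \<theta>"
      "ll ?g = - d * sin \<theta>" "lr ?g = d * cos \<theta>" by (simp_all add: GL2_real_mult rot2_def)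
    have det: "ul ?g * lr ?g - ur ?g * ll ?g = a * d"
    proof -
      have "ul ?g * lr ?g - ur ?g * ll ?g = a * d * (sin \<theta> * sin \<theta> + cos \<theta> * cos \<theta>)"
        unfolding g by (simp only: algebra_simps)
      then show ?thesis unfolding sc by simp
    qed
    have row: "ll ?g ^ 2 + lr ?g ^ 2 = d ^ 2"
    proof -
      have "ll ?g ^ 2 + lr ?g ^ 2 = d ^ 2 * (sin \<theta> * sin \<theta> + cos \<theta> * cos \<theta>)"
        unfolding g by (simp only: algebra_simps power2_eq_square)
      then show ?thesis unfolding sc by simp
    qed
    have "of_real (lr ?g) - \<i> * of_real (ll ?g) = of_real d * exp (\<i> * of_real \<theta>)"
      unfolding g by (simp add: exp_Euler algebra_simps cos_of_real sin_of_real)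
    then have "(of_real (lr ?g) - \<i> * of_real (ll ?g)) ^ 2 = of_real d ^ 2 * exp (\<i> * of_real \<theta>) ^ 2"
      by (simp only: power_mult_distrib)
    also have "exp (\<i> * of_real \<theta>) ^ 2 = exp (\<i> * of_int 2 * of_real \<theta>)"
      by (simp flip: exp_double add: mult_ac)
    finally have e: "(of_real (lr ?g) - \<i> * of_real (ll ?g)) ^ 2 / of_real (d ^ 2) = exp (\<i> * of_int 2 * of_real \<theta>)"
      using ad by simp
    have "?g \<in> carrier (GL2 real_ring)" unfolding GL2_real_iff det using ad by simp
    moreover have "\<bar>a * d\<bar> / d ^ 2 = \<bar>a / d\<bar>" using ad by (simp add: abs_mult power2_eq_square)
        (metis abs_mult_self_eq abs_eq_0 nonzero_mult_divide_mult_cancel_right)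
    ultimately show ?thesis unfolding F_def by (simp only: restrict_apply' det row e) simp
  qed
  have "f_real 2 (1/2) = F"
    unfolding f_real_def
  proof (rule the_equality)
    show "F \<in> extensional (carrier (GL2 real_ring)) \<and> (\<forall>a b d \<theta>. a \<noteq> 0 \<longrightarrow> d \<noteq> 0 \<longrightarrow>
        F (Mat2 a b 0 d \<otimes>\<^bsub>GL2 real_ring\<^esub> rot2 \<theta>) =
        complex_of_real \<bar>a / d\<bar> powr (1/2 + 1/2) * exp (\<i> * of_int 2 * of_real \<theta>))"
      using F by (auto simp: F_def)
    fix f assume f: "f \<in> extensional (carrier (GL2 real_ring)) \<and> (\<forall>a b d \<theta>. a \<noteq> 0 \<longrightarrow> d \<noteq> 0 \<longrightarrow>
        f (Mat2 a b 0 d \<otimes>\<^bsub>GL2 real_ring\<^esub> rot2 \<theta>) =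
        complex_of_real \<bar>a / d\<bar> powr (1/2 + 1/2) * exp (\<i> * of_int 2 * of_real \<theta>))"
    show "f = F"
    proof (rule extensionalityI[of _ "carrier (GL2 real_ring)"])
      fix g assume g: "g \<in> carrier (GL2 real_ring)"
      from real_iwasawa[OF g] obtain a b d \<theta> where
        "a \<noteq> 0" "d \<noteq> 0" "g = Mat2 a b 0 d \<otimes>\<^bsub>GL2 real_ring\<^esub> rot2 \<theta>" .
      then show "f g = F g" using f F by auto
    qed (use f in \<open>auto simp: F_def\<close>)
  qed
  then show ?thesis using assms by (simp add: F_def)
qed

section \<open>The adele ring and adelic heights\<close>

lemma Zp_carrier: "x \<in> carrier (Zp p) \<longleftrightarrow> x \<in> carrier (Qp p) \<and> padic_abs p x \<le> 1"
  by (simp add: Zp_def)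

lemma adele_carrier_iff:
  "x \<in> carrier adele_ring \<longleftrightarrow> snd x \<in> extensional {p. prime p} \<and> (\<forall>p. prime p \<longrightarrow> snd x p \<in> carrier (Qp p)) \<and>
     finite {p. prime p \<and> \<not> padic_abs p (snd x p) \<le> 1}"
proof -
  have "{p. prime p \<and> snd x p \<notin> carrier (Zp p)} = {p. prime p \<and> \<not> padic_abs p (snd x p) \<le> 1}"
    if "\<forall>p. prime p \<longrightarrow> snd x p \<in> carrier (Qp p)"
    using that by (auto simp: Zp_carrier)
  then show ?thesis by (auto simp: adele_ring_def PiE_iff)
qed

lemma adele_simps:
  "x \<otimes>\<^bsub>adele_ring\<^esub> y = (fst x * fst y, \<lambda>p\<in>{p. prime p}. snd x p \<otimes>\<^bsub>Qp p\<^esub> snd y p)"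
  "x \<oplus>\<^bsub>adele_ring\<^esub> y = (fst x + fst y, \<lambda>p\<in>{p. prime p}. snd x p \<oplus>\<^bsub>Qp p\<^esub> snd y p)"
  "\<one>\<^bsub>adele_ring\<^esub> = (1, \<lambda>p\<in>{p. prime p}. \<one>\<^bsub>Qp p\<^esub>)"
  "\<zero>\<^bsub>adele_ring\<^esub> = (0, \<lambda>p\<in>{p. prime p}. \<zero>\<^bsub>Qp p\<^esub>)"
  by (simp_all add: adele_ring_def)

lemma adeleI:
  assumes "\<And>p. prime p \<Longrightarrow> x p \<in> carrier (Qp p)" "finite F"
    and "\<And>p. prime p \<Longrightarrow> p \<notin> F \<Longrightarrow> padic_abs p (x p) \<le> 1"
  shows "(r, \<lambda>p\<in>{p. prime p}. x p) \<in> carrier adele_ring"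
proof -
  have "{p. prime p \<and> \<not> padic_abs p (snd (r, \<lambda>p\<in>{p. prime p}. x p) p) \<le> 1} \<subseteq> F"
    using assms(3) by auto
  then have "finite {p. prime p \<and> \<not> padic_abs p (snd (r, \<lambda>p\<in>{p. prime p}. x p) p) \<le> 1}"
    using assms(2) finite_subset by blast
  then show ?thesis using assms(1) by (simp add: adele_carrier_iff)
qed

lemma adele_component: "x \<in> carrier adele_ring \<Longrightarrow> prime p \<Longrightarrow> snd x p \<in> carrier (Qp p)"
  by (simp add: adele_carrier_iff)

lemma adele_finite: "x \<in> carrier adele_ring \<Longrightarrow> finite {p. prime p \<and> \<not> padic_abs p (snd x p) \<le> 1}"
  by (simp add: adele_carrier_iff)

lemma adele_eqI:
  assumes "x \<in> carrier adele_ring" "y \<in> carrier adele_ring" "fst x = fst y" "\<And>p. prime p \<Longrightarrow> snd x p = snd y p"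
  shows "x = y"
proof (rule prod_eqI[OF assms(3)])
  show "snd x = snd y"
    by (rule extensionalityI[of _ "{p. prime p}"]) (use assms in \<open>auto simp: adele_carrier_iff\<close>)
qed

lemma adele_mult_closed:
  assumes "x \<in> carrier adele_ring" "y \<in> carrier adele_ring"
  shows "x \<otimes>\<^bsub>adele_ring\<^esub> y \<in> carrier adele_ring"
  unfolding adele_simps
proof (rule adeleI)
  let ?F = "{p. prime p \<and> \<not> padic_abs p (snd x p) \<le> 1} \<union> {p. prime p \<and> \<not> padic_abs p (snd y p) \<le> 1}"
  show "finite ?F" using adele_finite assms by blast
  fix p :: nat assume p: "prime p"
  interpret Q: ultrametric_field "Qp p" "padic_abs p" by (rule ultrametric_field_Qp[OF p])
  have c: "snd x p \<in> carrier (Qp p)" "snd y p \<in> carrier (Qp p)" using adele_component assms p by auto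
  show "snd x p \<otimes>\<^bsub>Qp p\<^esub> snd y p \<in> carrier (Qp p)" using c by simp
  show "padic_abs p (snd x p \<otimes>\<^bsub>Qp p\<^esub> snd y p) \<le> 1" if "p \<notin> ?F"
    using that p c by (auto simp: Q.av_mult Q.av_nonneg intro: mult_le_one)
qed

lemma adele_add_closed:
  assumes "x \<in> carrier adele_ring" "y \<in> carrier adele_ring"
  shows "x \<oplus>\<^bsub>adele_ring\<^esub> y \<in> carrier adele_ring"
  unfolding adele_simps
proof (rule adeleI)
  let ?F = "{p. prime p \<and> \<not> padic_abs p (snd x p) \<le> 1} \<union> {p. prime p \<and> \<not> padic_abs p (snd y p) \<le> 1}"
  show "finite ?F" using adele_finite assms by blast
  fix p :: nat assume p: "prime p"
  interpret Q: ultrametric_field "Qp p" "padic_abs p" by (rule ultrametric_field_Qp[OF p])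
  have c: "snd x p \<in> carrier (Qp p)" "snd y p \<in> carrier (Qp p)" using adele_component assms p by auto
  show "snd x p \<oplus>\<^bsub>Qp p\<^esub> snd y p \<in> carrier (Qp p)" using c by simp
  show "padic_abs p (snd x p \<oplus>\<^bsub>Qp p\<^esub> snd y p) \<le> 1" if "p \<notin> ?F"
    using that p Q.av_add[OF c] by auto
qed

lemma adele_one_closed: "\<one>\<^bsub>adele_ring\<^esub> \<in> carrier adele_ring"
  unfolding adele_simps
proof (rule adeleI[of _ "{}"])
  fix p :: nat assume p: "prime p"
  interpret Q: ultrametric_field "Qp p" "padic_abs p" by (rule ultrametric_field_Qp[OF p])
  show "\<one>\<^bsub>Qp p\<^esub> \<in> carrier (Qp p)" "padic_abs p \<one>\<^bsub>Qp p\<^esub> \<le> 1" by auto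
qed simp

lemma adele_zero_closed: "\<zero>\<^bsub>adele_ring\<^esub> \<in> carrier adele_ring"
  unfolding adele_simps
proof (rule adeleI[of _ "{}"])
  fix p :: nat assume p: "prime p"
  interpret Q: ultrametric_field "Qp p" "padic_abs p" by (rule ultrametric_field_Qp[OF p])
  show "\<zero>\<^bsub>Qp p\<^esub> \<in> carrier (Qp p)" "padic_abs p \<zero>\<^bsub>Qp p\<^esub> \<le> 1" by auto
qed simp

lemma cring_adele_ring: "cring adele_ring"
proof -
  have Q: "cring (Qp p)" if "prime p" for p using cring_Qp[OF that] .
  note closed = adele_mult_closed adele_add_closed adele_one_closed adele_zero_closed
  show ?thesis
  proof (rule cringI)
    show "abelian_group adele_ring"
    proof (rule abelian_groupI)
      fix x assume x: "x \<in> carrier adele_ring"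
      define y where "y = (- fst x, \<lambda>p\<in>{p. prime p}. \<ominus>\<^bsub>Qp p\<^esub> snd x p)"
      have y: "y \<in> carrier adele_ring"
        unfolding y_def
      proof (rule adeleI[OF _ adele_finite[OF x]])
        fix p :: nat assume p: "prime p"
        interpret Q: ultrametric_field "Qp p" "padic_abs p" by (rule ultrametric_field_Qp[OF p])
        have c: "snd x p \<in> carrier (Qp p)" by (rule adele_component[OF x p])
        show "\<ominus>\<^bsub>Qp p\<^esub> snd x p \<in> carrier (Qp p)" using c by simp
        show "padic_abs p (\<ominus>\<^bsub>Qp p\<^esub> snd x p) \<le> 1" if "p \<notin> {p. prime p \<and> \<not> padic_abs p (snd x p) \<le> 1}"
          using that p c by (simp add: Q.av_minus)
      qed
      have "y \<oplus>\<^bsub>adele_ring\<^esub> x = \<zero>\<^bsub>adele_ring\<^esub>"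
      proof (rule adele_eqI[OF closed(2)[OF y x] closed(4)])
        fix p :: nat assume p: "prime p"
        interpret cring "Qp p" by (rule Q[OF p])
        show "snd (y \<oplus>\<^bsub>adele_ring\<^esub> x) p = snd \<zero>\<^bsub>adele_ring\<^esub> p"
          using p adele_component[OF x p] by (simp add: adele_simps y_def l_neg)
      qed (simp add: adele_simps y_def)
      with y show "\<exists>y\<in>carrier adele_ring. y \<oplus>\<^bsub>adele_ring\<^esub> x = \<zero>\<^bsub>adele_ring\<^esub>" by blast
      show "\<zero>\<^bsub>adele_ring\<^esub> \<oplus>\<^bsub>adele_ring\<^esub> x = x"
      proof (rule adele_eqI[OF closed(2)[OF closed(4) x] x])
        fix p :: nat assume p: "prime p"
        interpret cring "Qp p" by (rule Q[OF p])
        show "snd (\<zero>\<^bsub>adele_ring\<^esub> \<oplus>\<^bsub>adele_ring\<^esub> x) p = snd x p"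
          using p adele_component[OF x p] by (simp add: adele_simps)
      qed (simp add: adele_simps)
      fix y assume y: "y \<in> carrier adele_ring"
      show "x \<oplus>\<^bsub>adele_ring\<^esub> y = y \<oplus>\<^bsub>adele_ring\<^esub> x"
      proof (rule adele_eqI[OF closed(2)[OF x y] closed(2)[OF y x]])
        fix p :: nat assume p: "prime p"
        interpret cring "Qp p" by (rule Q[OF p])
        show "snd (x \<oplus>\<^bsub>adele_ring\<^esub> y) p = snd (y \<oplus>\<^bsub>adele_ring\<^esub> x) p"
          using p adele_component[OF x p] adele_component[OF y p] by (simp add: adele_simps a_comm)
      qed (simp add: adele_simps)
      fix z assume z: "z \<in> carrier adele_ring"
      show "x \<oplus>\<^bsub>adele_ring\<^esub> y \<oplus>\<^bsub>adele_ring\<^esub> z = x \<oplus>\<^bsub>adele_ring\<^esub> (y \<oplus>\<^bsub>adele_ring\<^esub> z)"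
      proof (rule adele_eqI[OF closed(2)[OF closed(2)[OF x y] z] closed(2)[OF x closed(2)[OF y z]]])
        fix p :: nat assume p: "prime p"
        interpret cring "Qp p" by (rule Q[OF p])
        show "snd (x \<oplus>\<^bsub>adele_ring\<^esub> y \<oplus>\<^bsub>adele_ring\<^esub> z) p = snd (x \<oplus>\<^bsub>adele_ring\<^esub> (y \<oplus>\<^bsub>adele_ring\<^esub> z)) p"
          using p adele_component[OF x p] adele_component[OF y p] adele_component[OF z p]
          by (simp add: adele_simps a_assoc)
      qed (simp add: adele_simps)
    qed (auto intro: closed)
    show "comm_monoid adele_ring"
    proof (rule comm_monoidI)
      fix x assume x: "x \<in> carrier adele_ring"
      show "\<one>\<^bsub>adele_ring\<^esub> \<otimes>\<^bsub>adele_ring\<^esub> x = x"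
      proof (rule adele_eqI[OF closed(1)[OF closed(3) x] x])
        fix p :: nat assume p: "prime p"
        interpret cring "Qp p" by (rule Q[OF p])
        show "snd (\<one>\<^bsub>adele_ring\<^esub> \<otimes>\<^bsub>adele_ring\<^esub> x) p = snd x p"
          using p adele_component[OF x p] by (simp add: adele_simps)
      qed (simp add: adele_simps)
      fix y assume y: "y \<in> carrier adele_ring"
      show "x \<otimes>\<^bsub>adele_ring\<^esub> y = y \<otimes>\<^bsub>adele_ring\<^esub> x"
      proof (rule adele_eqI[OF closed(1)[OF x y] closed(1)[OF y x]])
        fix p :: nat assume p: "prime p"
        interpret cring "Qp p" by (rule Q[OF p])
        show "snd (x \<otimes>\<^bsub>adele_ring\<^esub> y) p = snd (y \<otimes>\<^bsub>adele_ring\<^esub> x) p"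
          using p adele_component[OF x p] adele_component[OF y p] by (simp add: adele_simps m_comm)
      qed (simp add: adele_simps)
      fix z assume z: "z \<in> carrier adele_ring"
      show "x \<otimes>\<^bsub>adele_ring\<^esub> y \<otimes>\<^bsub>adele_ring\<^esub> z = x \<otimes>\<^bsub>adele_ring\<^esub> (y \<otimes>\<^bsub>adele_ring\<^esub> z)"
      proof (rule adele_eqI[OF closed(1)[OF closed(1)[OF x y] z] closed(1)[OF x closed(1)[OF y z]]])
        fix p :: nat assume p: "prime p"
        interpret cring "Qp p" by (rule Q[OF p])
        show "snd (x \<otimes>\<^bsub>adele_ring\<^esub> y \<otimes>\<^bsub>adele_ring\<^esub> z) p = snd (x \<otimes>\<^bsub>adele_ring\<^esub> (y \<otimes>\<^bsub>adele_ring\<^esub> z)) p"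
          using p adele_component[OF x p] adele_component[OF y p] adele_component[OF z p]
          by (simp add: adele_simps m_assoc)
      qed (simp add: adele_simps)
    qed (auto intro: closed)
    fix x y z assume x: "x \<in> carrier adele_ring" and y: "y \<in> carrier adele_ring" and z: "z \<in> carrier adele_ring"
    show "(x \<oplus>\<^bsub>adele_ring\<^esub> y) \<otimes>\<^bsub>adele_ring\<^esub> z = x \<otimes>\<^bsub>adele_ring\<^esub> z \<oplus>\<^bsub>adele_ring\<^esub> y \<otimes>\<^bsub>adele_ring\<^esub> z"
    proof (rule adele_eqI[OF closed(1)[OF closed(2)[OF x y] z] closed(2)[OF closed(1)[OF x z] closed(1)[OF y z]]])
      fix p :: nat assume p: "prime p"
      interpret cring "Qp p" by (rule Q[OF p])
      show "snd ((x \<oplus>\<^bsub>adele_ring\<^esub> y) \<otimes>\<^bsub>adele_ring\<^esub> z) p = snd (x \<otimes>\<^bsub>adele_ring\<^esub> z \<oplus>\<^bsub>adele_ring\<^esub> y \<otimes>\<^bsub>adele_ring\<^esub> z) p"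
        using p adele_component[OF x p] adele_component[OF y p] adele_component[OF z p]
        by (simp add: adele_simps l_distr)
    qed (simp add: adele_simps algebra_simps)
  qed
qed

interpretation adele: cring adele_ring by (rule cring_adele_ring)

lemma adele_Units_components:
  assumes a: "a \<in> Units adele_ring"
  shows "fst a \<noteq> 0" "fst (inv\<^bsub>adele_ring\<^esub> a) = 1 / fst a"
    and "prime p \<Longrightarrow> snd a p \<in> Units (Qp p)"
    and "prime p \<Longrightarrow> snd (inv\<^bsub>adele_ring\<^esub> a) p = inv\<^bsub>Qp p\<^esub> (snd a p)"
    and "finite {p. prime p \<and> padic_abs p (snd a p) \<noteq> 1}"
proof -
  let ?b = "inv\<^bsub>adele_ring\<^esub> a"
  have c: "a \<in> carrier adele_ring" "?b \<in> carrier adele_ring" using a by auto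
  have "a \<otimes>\<^bsub>adele_ring\<^esub> ?b = \<one>\<^bsub>adele_ring\<^esub>" by (rule adele.Units_r_inv[OF a])
  then have f: "fst a * fst ?b = 1"
    and s: "(\<lambda>p\<in>{p. prime p}. snd a p \<otimes>\<^bsub>Qp p\<^esub> snd ?b p) = (\<lambda>p\<in>{p. prime p}. \<one>\<^bsub>Qp p\<^esub>)"
    by (simp_all add: adele_simps)
  show f0: "fst a \<noteq> 0" using f by auto
  show "fst ?b = 1 / fst a" using f f0 by (simp add: field_simps)
  have m: "snd a p \<otimes>\<^bsub>Qp p\<^esub> snd ?b p = \<one>\<^bsub>Qp p\<^esub>" if "prime p" for p
    using fun_cong[OF s, of p] that by simp
  have comps: "snd a p \<in> Units (Qp p) \<and> snd ?b p = inv\<^bsub>Qp p\<^esub> (snd a p) \<and> padic_abs p (snd a p) * padic_abs p (snd ?b p) = 1"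
    if p: "prime p" for p
  proof -
    interpret Q: ultrametric_field "Qp p" "padic_abs p" by (rule ultrametric_field_Qp[OF p])
    have cc: "snd a p \<in> carrier (Qp p)" "snd ?b p \<in> carrier (Qp p)" using adele_component c p by auto
    have "snd ?b p \<otimes>\<^bsub>Qp p\<^esub> snd a p = \<one>\<^bsub>Qp p\<^esub>" using m[OF p] Q.m_comm cc by simp
    then have "snd a p \<in> Units (Qp p)" using cc m[OF p] unfolding Units_def by blast
    moreover have "snd ?b p = inv\<^bsub>Qp p\<^esub> (snd a p)" using Q.comm_inv_char[OF cc m[OF p]] by simp
    moreover have "padic_abs p (snd a p) * padic_abs p (snd ?b p) = 1"
      using Q.av_mult[OF cc] m[OF p] by simp
    ultimately show ?thesis by blast
  qed
  show "prime p \<Longrightarrow> snd a p \<in> Units (Qp p)" "prime p \<Longrightarrow> snd ?b p = inv\<^bsub>Qp p\<^esub> (snd a p)" using comps by auto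
  \<comment> \<open>If the component and its inverse are both integral at p, their absolute values
    are at most 1 with product 1, so both are 1. Only primes where one of the two adeles is not
    integral remain.\<close>
  have "{p. prime p \<and> padic_abs p (snd a p) \<noteq> 1} \<subseteq>
    {p. prime p \<and> \<not> padic_abs p (snd a p) \<le> 1} \<union> {p. prime p \<and> \<not> padic_abs p (snd ?b p) \<le> 1}"
  proof safe
    fix p :: nat assume p: "prime p" "padic_abs p (snd a p) \<noteq> 1" "padic_abs p (snd a p) \<le> 1" "padic_abs p (snd ?b p) \<le> 1"
    interpret Q: ultrametric_field "Qp p" "padic_abs p" by (rule ultrametric_field_Qp[OF p(1)])
    have "padic_abs p (snd a p) \<ge> 0" by (rule Q.av_nonneg[OF adele_component[OF c(1) p(1)]])
    then have "padic_abs p (snd a p) * padic_abs p (snd ?b p) \<le> padic_abs p (snd a p) * 1"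
      using p by (intro mult_left_mono) auto
    then have "1 \<le> padic_abs p (snd a p)"
      using conjunct2[OF conjunct2[OF comps[OF p(1)]]] by simp
    then show False using p(2,3) by simp
  qed
  then show "finite {p. prime p \<and> padic_abs p (snd a p) \<noteq> 1}"
    using adele_finite[OF c(1)] adele_finite[OF c(2)] finite_subset by blast
qed

lemma adele_UnitsI:
  assumes r: "r \<noteq> 0" and x: "\<And>p. prime p \<Longrightarrow> x p \<in> Units (Qp p)"
    and fin: "finite F" "\<And>p. prime p \<Longrightarrow> p \<notin> F \<Longrightarrow> padic_abs p (x p) = 1"
  shows "(r, \<lambda>p\<in>{p. prime p}. x p) \<in> Units adele_ring"
proof -
  let ?a = "(r, \<lambda>p\<in>{p. prime p}. x p)" and ?b = "(1 / r, \<lambda>p\<in>{p. prime p}. inv\<^bsub>Qp p\<^esub> (x p))"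
  have a: "?a \<in> carrier adele_ring"
  proof (rule adeleI[OF _ fin(1)])
    fix p :: nat assume p: "prime p"
    show "x p \<in> carrier (Qp p)" using x[OF p] by (auto simp: Units_def)
    show "padic_abs p (x p) \<le> 1" if "p \<notin> F" using fin(2)[OF p that] by simp
  qed
  have b: "?b \<in> carrier adele_ring"
  proof (rule adeleI[OF _ fin(1)])
    fix p :: nat assume p: "prime p"
    interpret Q: ultrametric_field "Qp p" "padic_abs p" by (rule ultrametric_field_Qp[OF p])
    show "inv\<^bsub>Qp p\<^esub> (x p) \<in> carrier (Qp p)" using x[OF p] by simp
    show "padic_abs p (inv\<^bsub>Qp p\<^esub> (x p)) \<le> 1" if "p \<notin> F" using fin(2)[OF p that] x[OF p] by (simp add: Q.av_inv)
  qed
  have ab: "?a \<otimes>\<^bsub>adele_ring\<^esub> ?b = \<one>\<^bsub>adele_ring\<^esub>"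
  proof (rule adele_eqI[OF adele_mult_closed[OF a b] adele_one_closed])
    fix p :: nat assume p: "prime p"
    interpret Q: ultrametric_field "Qp p" "padic_abs p" by (rule ultrametric_field_Qp[OF p])
    show "snd (?a \<otimes>\<^bsub>adele_ring\<^esub> ?b) p = snd \<one>\<^bsub>adele_ring\<^esub> p" using p x[OF p] by (simp add: adele_simps)
  qed (use r in \<open>simp add: adele_simps\<close>)
  then have "?b \<otimes>\<^bsub>adele_ring\<^esub> ?a = \<one>\<^bsub>adele_ring\<^esub>" using adele.m_comm[OF a b] by simp
  with a b ab show ?thesis unfolding Units_def by blast
qed

section \<open>Components of adelic matrices\<close>

lemma comp_inf_sel: "ul (comp_inf m) = fst (ul m)" "ur (comp_inf m) = fst (ur m)"
  "ll (comp_inf m) = fst (ll m)" "lr (comp_inf m) = fst (lr m)"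
  by (cases m; simp add: comp_inf_def)+

lemma comp_fin_sel: "ul (comp_fin p m) = snd (ul m) p" "ur (comp_fin p m) = snd (ur m) p"
  "ll (comp_fin p m) = snd (ll m) p" "lr (comp_fin p m) = snd (lr m) p"
  by (cases m; simp add: comp_fin_def)+

lemma comp_inf_mult:
  "comp_inf (m \<otimes>\<^bsub>GL2 adele_ring\<^esub> n) = comp_inf m \<otimes>\<^bsub>GL2 real_ring\<^esub> comp_inf n"
  by (rule mat2.expand) (simp add: comp_inf_sel GL2_mult mat2_mult adele_simps class_simps)

lemma comp_fin_mult:
  "prime p \<Longrightarrow> comp_fin p (m \<otimes>\<^bsub>GL2 adele_ring\<^esub> n) = comp_fin p m \<otimes>\<^bsub>GL2 (Qp p)\<^esub> comp_fin p n"
  by (rule mat2.expand) (simp add: comp_fin_sel GL2_mult mat2_mult adele_simps)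

lemma comp_fin_carrier:
  "m \<in> carrier (mat2_monoid adele_ring) \<Longrightarrow> prime p \<Longrightarrow> comp_fin p m \<in> carrier (mat2_monoid (Qp p))"
  by (simp add: mat2_carrier_iff comp_fin_sel adele_component)

lemma adele_minus_components:
  assumes "x \<in> carrier adele_ring" "y \<in> carrier adele_ring"
  shows "fst (x \<ominus>\<^bsub>adele_ring\<^esub> y) = fst x - fst y"
    and "prime p \<Longrightarrow> snd (x \<ominus>\<^bsub>adele_ring\<^esub> y) p = snd x p \<ominus>\<^bsub>Qp p\<^esub> snd y p"
proof -
  have eq: "x = (x \<ominus>\<^bsub>adele_ring\<^esub> y) \<oplus>\<^bsub>adele_ring\<^esub> y" using assms by algebra
  have c: "x \<ominus>\<^bsub>adele_ring\<^esub> y \<in> carrier adele_ring" using assms by simp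
  have "fst x = fst (x \<ominus>\<^bsub>adele_ring\<^esub> y) + fst y" by (subst eq) (simp add: adele_simps)
  then show "fst (x \<ominus>\<^bsub>adele_ring\<^esub> y) = fst x - fst y" by simp
  assume p: "prime p"
  interpret Q: ultrametric_field "Qp p" "padic_abs p" by (rule ultrametric_field_Qp[OF p])
  have "snd x p = snd (x \<ominus>\<^bsub>adele_ring\<^esub> y) p \<oplus>\<^bsub>Qp p\<^esub> snd y p" by (subst eq) (simp add: adele_simps p)
  moreover have "u = v \<ominus>\<^bsub>Qp p\<^esub> w" if "v = u \<oplus>\<^bsub>Qp p\<^esub> w" "u \<in> carrier (Qp p)" "w \<in> carrier (Qp p)" for u v w
    unfolding that(1) using that(2,3) by algebra
  ultimately show "snd (x \<ominus>\<^bsub>adele_ring\<^esub> y) p = snd x p \<ominus>\<^bsub>Qp p\<^esub> snd y p"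
    using adele_component[OF c p] adele_component[OF assms(2) p] by blast
qed

lemma adele_det_components:
  assumes m: "m \<in> carrier (mat2_monoid adele_ring)"
  shows "fst (mat2_det adele_ring m) = ul (comp_inf m) * lr (comp_inf m) - ur (comp_inf m) * ll (comp_inf m)"
    and "prime p \<Longrightarrow> snd (mat2_det adele_ring m) p = mat2_det (Qp p) (comp_fin p m)"
proof -
  have c: "ul m \<in> carrier adele_ring" "ur m \<in> carrier adele_ring" "ll m \<in> carrier adele_ring" "lr m \<in> carrier adele_ring"
    using m by (auto simp: mat2_carrier_iff)
  note comps = adele_minus_components[OF adele_mult_closed[OF c(1,4)] adele_mult_closed[OF c(2,3)]]
  show "fst (mat2_det adele_ring m) = ul (comp_inf m) * lr (comp_inf m) - ur (comp_inf m) * ll (comp_inf m)"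
    unfolding mat2_det_def comps(1) comp_inf_sel by (simp add: adele_simps)
  show "prime p \<Longrightarrow> snd (mat2_det adele_ring m) p = mat2_det (Qp p) (comp_fin p m)"
    unfolding mat2_det_def comp_fin_sel by (simp add: comps(2)) (simp add: adele_simps)
qed

text \<open>Invertibility at every place is not enough: the determinant is an idele only if it is a
  local unit at almost all primes, which is the condition on \<open>F\<close>.\<close>

lemma GL2_adeleI:
  assumes m: "m \<in> carrier (mat2_monoid adele_ring)"
    and inf: "comp_inf m \<in> carrier (GL2 real_ring)"
    and fin: "\<And>p. prime p \<Longrightarrow> comp_fin p m \<in> carrier (GL2 (Qp p))"
    and F: "finite F" "\<And>p. prime p \<Longrightarrow> p \<notin> F \<Longrightarrow> padic_abs p (mat2_det (Qp p) (comp_fin p m)) = 1"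
  shows "m \<in> carrier (GL2 adele_ring)"
proof -
  let ?d = "mat2_det adele_ring m"
  have d: "?d \<in> carrier adele_ring" by (rule adele.mat2_det_closed[OF m])
  have "snd ?d = (\<lambda>p\<in>{p. prime p}. snd ?d p)"
    using d by (intro extensionalityI[of _ "{p. prime p}"]) (auto simp: adele_carrier_iff)
  then have eq: "?d = (fst ?d, \<lambda>p\<in>{p. prime p}. snd ?d p)" by (metis prod.collapse)
  have "(fst ?d, \<lambda>p\<in>{p. prime p}. snd ?d p) \<in> Units adele_ring"
  proof (rule adele_UnitsI[OF _ _ F(1)])
    show "fst ?d \<noteq> 0"
      using inf cring_class.GL2_iff[of "comp_inf m"] field_class.field_Units[where ?'a = real]
      unfolding adele_det_components(1)[OF m] by (simp add: mat2_carrier_iff class_simps mat2_det_def)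
    fix p :: nat assume p: "prime p"
    interpret Q: ultrametric_field "Qp p" "padic_abs p" by (rule ultrametric_field_Qp[OF p])
    show "snd ?d p \<in> Units (Qp p)" using fin[OF p] unfolding adele_det_components(2)[OF m p] Q.GL2_iff by simp
    show "padic_abs p (snd ?d p) = 1" if "p \<notin> F" using F(2)[OF p that] unfolding adele_det_components(2)[OF m p] .
  qed
  with eq m show ?thesis unfolding adele.GL2_iff by metis
qed

lemma mat2_adele_eqI:
  assumes "m \<in> carrier (mat2_monoid adele_ring)" "n \<in> carrier (mat2_monoid adele_ring)"
    "comp_inf m = comp_inf n" "\<And>p. prime p \<Longrightarrow> comp_fin p m = comp_fin p n"
  shows "m = n"
proof (rule mat2.expand, intro conjI)
  have c: "ul m \<in> carrier adele_ring" "ur m \<in> carrier adele_ring" "ll m \<in> carrier adele_ring" "lr m \<in> carrier adele_ring"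
    "ul n \<in> carrier adele_ring" "ur n \<in> carrier adele_ring" "ll n \<in> carrier adele_ring" "lr n \<in> carrier adele_ring"
    using assms(1,2) by (auto simp: mat2_carrier_iff)
  show "ul m = ul n" by (rule adele_eqI) (use c assms(3,4) comp_inf_sel(1) comp_fin_sel(1) in metis)+
  show "ur m = ur n" by (rule adele_eqI) (use c assms(3,4) comp_inf_sel(2) comp_fin_sel(2) in metis)+
  show "ll m = ll n" by (rule adele_eqI) (use c assms(3,4) comp_inf_sel(3) comp_fin_sel(3) in metis)+
  show "lr m = lr n" by (rule adele_eqI) (use c assms(3,4) comp_inf_sel(4) comp_fin_sel(4) in metis)+
qed

lemma GL2_adele_components:
  assumes m: "m \<in> carrier (GL2 adele_ring)"
  shows "comp_inf m \<in> carrier (GL2 real_ring)"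
    and "prime p \<Longrightarrow> comp_fin p m \<in> carrier (GL2 (Qp p))"
    and "finite {p. prime p \<and> comp_fin p m \<notin> carrier (GL2 (Zp p))}"
proof -
  have mc: "m \<in> carrier (mat2_monoid adele_ring)" and u: "mat2_det adele_ring m \<in> Units adele_ring"
    using m by (auto simp: adele.GL2_iff)
  have c: "ul m \<in> carrier adele_ring" "ur m \<in> carrier adele_ring" "ll m \<in> carrier adele_ring" "lr m \<in> carrier adele_ring"
    using mc by (auto simp: mat2_carrier_iff)
  note di = adele_det_components(1)[OF mc] and df = adele_det_components(2)[OF mc]
  show "comp_inf m \<in> carrier (GL2 real_ring)"
    using adele_Units_components(1)[OF u] cring_class.GL2_iff[of "comp_inf m"] field_class.field_Units[where ?'a = real]
    unfolding di by (simp add: mat2_carrier_iff class_simps mat2_det_def)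
  show fin: "comp_fin p m \<in> carrier (GL2 (Qp p))" if p: "prime p" for p
  proof -
    interpret Q: ultrametric_field "Qp p" "padic_abs p" by (rule ultrametric_field_Qp[OF p])
    show ?thesis unfolding Q.GL2_iff using comp_fin_carrier[OF mc p] adele_Units_components(3)[OF u p] df[OF p] by simp
  qed
  let ?bad = "\<lambda>x. {p. prime p \<and> \<not> padic_abs p (snd x p) \<le> 1}"
  have "{p. prime p \<and> comp_fin p m \<notin> carrier (GL2 (Zp p))} \<subseteq>
    ?bad (ul m) \<union> ?bad (ur m) \<union> ?bad (ll m) \<union> ?bad (lr m) \<union> {p. prime p \<and> padic_abs p (snd (mat2_det adele_ring m) p) \<noteq> 1}"
  proof
    fix p assume pm: "p \<in> {p. prime p \<and> comp_fin p m \<notin> carrier (GL2 (Zp p))}"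
    then have p: "prime p" and nk: "comp_fin p m \<notin> carrier (GL2 (Zp p))" by simp_all
    interpret Q: ultrametric_field "Qp p" "padic_abs p" by (rule ultrametric_field_Qp[OF p])
    have Z: "carrier (GL2 (Zp p)) = carrier (GL2 Q.integers)" by (simp add: Zp_def)
    show "p \<in> ?bad (ul m) \<union> ?bad (ur m) \<union> ?bad (ll m) \<union> ?bad (lr m) \<union> {p. prime p \<and> padic_abs p (snd (mat2_det adele_ring m) p) \<noteq> 1}"
      using nk p fin[OF p] unfolding Z Q.GL2_integers_iff Q.GL2_iff by (auto simp: df[OF p] mat2_carrier_iff comp_fin_sel)
  qed
  then show "finite {p. prime p \<and> comp_fin p m \<notin> carrier (GL2 (Zp p))}"
    by (rule finite_subset) (use adele_finite c adele_Units_components(5)[OF u] in auto)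
qed

text \<open>The archimedean counterpart of the local height, with the Euclidean norm of the bottom
  row, which O(2) preserves, in place of the maximum norm.\<close>

definition real_height :: "real mat2 \<Rightarrow> real" where
  "real_height m = \<bar>ul m * lr m - ur m * ll m\<bar> / (ll m ^ 2 + lr m ^ 2)"

lemma real_height_upper_triangular_mult:
  assumes ad: "a \<noteq> 0" "d \<noteq> 0" and k: "k \<in> O2"
  shows "real_height (Mat2 a b 0 d \<otimes>\<^bsub>GL2 real_ring\<^esub> k) = \<bar>a / d\<bar>"
proof -
  have k1: "ul k * ul k + ur k * ur k = 1" "ul k * ll k + ur k * lr k = 0" "ll k * ll k + lr k * lr k = 1"
    using k by (simp_all add: O2_def mat2_mult mat2_one class_simps)
  \<comment> \<open>Lagrange's identity for the two orthonormal rows; only the absolute value of the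
    determinant is fixed, as O(2) contains reflections.\<close>
  have "(ul k * lr k - ur k * ll k) ^ 2 = (ul k * ul k + ur k * ur k) * (ll k * ll k + lr k * lr k)
      - (ul k * ll k + ur k * lr k) ^ 2"
    by (simp add: power2_eq_square algebra_simps)
  then have "(ul k * lr k - ur k * ll k) ^ 2 = 1" unfolding k1 by simp
  then have det: "\<bar>ul k * lr k - ur k * ll k\<bar> = 1" by (simp add: power2_eq_1_iff abs_if) linarith
  let ?g = "Mat2 a b 0 d \<otimes>\<^bsub>GL2 real_ring\<^esub> k"
  have "ul ?g * lr ?g - ur ?g * ll ?g = a * d * (ul k * lr k - ur k * ll k)"
    by (simp add: GL2_real_mult algebra_simps)
  moreover have "ll ?g ^ 2 + lr ?g ^ 2 = d ^ 2 * (ll k * ll k + lr k * lr k)"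
    by (simp add: GL2_real_mult power2_eq_square algebra_simps)
  ultimately have "real_height ?g = \<bar>a * d * (ul k * lr k - ur k * ll k)\<bar> / (d ^ 2 * 1)"
    unfolding real_height_def k1(3) by (simp only:)
  also have "\<bar>a * d * (ul k * lr k - ur k * ll k)\<bar> = \<bar>a\<bar> * \<bar>d\<bar> * 1"
    unfolding abs_mult det ..
  also have "d ^ 2 * 1 = \<bar>d\<bar> * \<bar>d\<bar>" by (simp add: power2_eq_square)
  finally show ?thesis
    using nonzero_mult_divide_mult_cancel_right[of "\<bar>d\<bar>" "\<bar>a\<bar>" "\<bar>d\<bar>"] ad
    by (simp only: mult_1_right abs_divide abs_eq_0 simp_thms)
qed

lemma rot2_O2: "rot2 \<theta> \<in> O2"
proof -
  have "cos \<theta> * cos \<theta> + sin \<theta> * sin \<theta> = 1" "sin \<theta> * sin \<theta> + cos \<theta> * cos \<theta> = 1"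
    by (simp_all flip: power2_eq_square)
  then show ?thesis by (simp add: O2_def rot2_def mat2_mult mat2_one class_simps)
qed

section \<open>Adelic height and Iwasawa decomposition\<close>

definition adele_height :: "adele mat2 \<Rightarrow> real" where
  "adele_height m = real_height (comp_inf m) *
     Prod_any (\<lambda>p. if prime p then padic_height p (comp_fin p m) else 1)"

text \<open>At each place the height is |a / d| whatever the decomposition, so the idele norm of a /
  d depends on m alone. This gives the uniqueness required in \<open>height_quot\<close>.\<close>

lemma adele_abs_decomposition:
  assumes ad: "a \<in> Units adele_ring" "d \<in> Units adele_ring" and b: "b \<in> carrier adele_ring"
    and \<kappa>: "\<kappa> \<in> max_compact" and m: "m = Mat2 a b \<zero>\<^bsub>adele_ring\<^esub> d \<otimes>\<^bsub>GL2 adele_ring\<^esub> \<kappa>"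
  shows "adele_abs (a \<otimes>\<^bsub>adele_ring\<^esub> inv\<^bsub>adele_ring\<^esub> d) = adele_height m"
proof -
  have tri: "comp_inf (Mat2 a b \<zero>\<^bsub>adele_ring\<^esub> d) = Mat2 (fst a) (fst b) 0 (fst d)"
    by (rule mat2.expand) (simp add: comp_inf_sel adele_simps)
  have "real_height (comp_inf m) = \<bar>fst a / fst d\<bar>"
    unfolding m comp_inf_mult tri
    by (rule real_height_upper_triangular_mult)
       (use ad \<kappa> adele_Units_components(1) in \<open>auto simp: max_compact_def\<close>)
  moreover have loc: "padic_abs p (snd (a \<otimes>\<^bsub>adele_ring\<^esub> inv\<^bsub>adele_ring\<^esub> d) p) = padic_height p (comp_fin p m)"
    if p: "prime p" for p
  proof -
    interpret Q: ultrametric_field "Qp p" "padic_abs p" by (rule ultrametric_field_Qp[OF p])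
    have k: "comp_fin p \<kappa> \<in> carrier (GL2 Q.integers)"
      using \<kappa> p by (simp add: max_compact_def Zp_def)
    have "comp_fin p (Mat2 a b \<zero>\<^bsub>adele_ring\<^esub> d) = Mat2 (snd a p) (snd b p) \<zero>\<^bsub>Qp p\<^esub> (snd d p)"
      by (rule mat2.expand) (simp add: comp_fin_sel adele_simps p)
    then have "padic_height p (comp_fin p m) = padic_abs p (snd a p \<otimes>\<^bsub>Qp p\<^esub> inv\<^bsub>Qp p\<^esub> (snd d p)) * 1"
      unfolding m comp_fin_mult[OF p] Q.height_integers[OF k, symmetric]
      using Q.height_upper_triangular_mult[OF adele_Units_components(3)[OF ad(1) p] adele_component[OF b p]
        adele_Units_components(3)[OF ad(2) p] Q.integers_subset[OF k]] by simp
    then show ?thesis by (simp add: adele_simps p adele_Units_components(4)[OF ad(2) p])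
  qed
  moreover have "\<bar>fst (a \<otimes>\<^bsub>adele_ring\<^esub> inv\<^bsub>adele_ring\<^esub> d)\<bar> = \<bar>fst a / fst d\<bar>"
    by (simp add: adele_simps adele_Units_components(2)[OF ad(2)])
  moreover have "(\<lambda>p. if prime p then padic_abs p (snd (a \<otimes>\<^bsub>adele_ring\<^esub> inv\<^bsub>adele_ring\<^esub> d) p) else 1)
    = (\<lambda>p. if prime p then padic_height p (comp_fin p m) else 1)"
    by (intro ext) (simp add: loc)
  ultimately show ?thesis unfolding adele_abs_def adele_height_def by (simp only:)
qed

text \<open>The decompositions at the single places are glued together. They form adeles because the
  triangular part is trivial wherever m is already integral, that is at almost all primes.\<close>

lemma adelic_iwasawa:
  assumes m: "m \<in> carrier (GL2 adele_ring)"
  shows "\<exists>a \<in> Units adele_ring. \<exists>b \<in> carrier adele_ring. \<exists>d \<in> Units adele_ring. \<exists>\<kappa> \<in> max_compact.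
    m = Mat2 a b \<zero>\<^bsub>adele_ring\<^esub> d \<otimes>\<^bsub>GL2 adele_ring\<^esub> \<kappa>"
proof -
  note comps = GL2_adele_components[OF m]
  \<comment> \<open>The last clause is the one needed for gluing: an arbitrary local choice of a, b,
    d need not be integral at almost all primes.\<close>
  define P where "P p x \<longleftrightarrow> (case x of (a, b, d, k) \<Rightarrow> a \<in> Units (Qp p) \<and> b \<in> carrier (Qp p) \<and> d \<in> Units (Qp p) \<and>
    k \<in> carrier (GL2 (Zp p)) \<and> comp_fin p m = Mat2 a b \<zero>\<^bsub>Qp p\<^esub> d \<otimes>\<^bsub>GL2 (Qp p)\<^esub> k \<and>
    (comp_fin p m \<in> carrier (GL2 (Zp p)) \<longrightarrow> a = \<one>\<^bsub>Qp p\<^esub> \<and> b = \<zero>\<^bsub>Qp p\<^esub> \<and> d = \<one>\<^bsub>Qp p\<^esub>))" for p x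
  have ex: "\<exists>x. P p x" if p: "prime p" for p
  proof -
    interpret Q: ultrametric_field "Qp p" "padic_abs p" by (rule ultrametric_field_Qp[OF p])
    have Zp: "Zp p = Q.integers" by (simp add: Zp_def)
    show ?thesis
    proof (cases "comp_fin p m \<in> carrier (GL2 (Zp p))")
      case True
      have "comp_fin p m = Mat2 \<one>\<^bsub>Qp p\<^esub> \<zero>\<^bsub>Qp p\<^esub> \<zero>\<^bsub>Qp p\<^esub> \<one>\<^bsub>Qp p\<^esub> \<otimes>\<^bsub>GL2 (Qp p)\<^esub> comp_fin p m"
        using monoid.l_one[OF Q.monoid_mat2, of "comp_fin p m"] comps(2)[OF p]
        by (simp add: GL2_mult mat2_one Q.GL2_iff)
      then have "P p (\<one>\<^bsub>Qp p\<^esub>, \<zero>\<^bsub>Qp p\<^esub>, \<one>\<^bsub>Qp p\<^esub>, comp_fin p m)"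
        using True by (simp add: P_def)
      then show ?thesis ..
    next
      case False
      from Q.iwasawa[OF comps(2)[OF p]] obtain a b d k where
        "a \<in> Units (Qp p)" "b \<in> carrier (Qp p)" "d \<in> Units (Qp p)" "k \<in> carrier (GL2 Q.integers)"
        "comp_fin p m = Mat2 a b \<zero>\<^bsub>Qp p\<^esub> d \<otimes>\<^bsub>GL2 (Qp p)\<^esub> k" .
      then have "P p (a, b, d, k)" using False by (simp add: P_def Zp)
      then show ?thesis ..
    qed
  qed
  define x where "x p = (SOME x. P p x)" for p
  have x: "P p (x p)" if "prime p" for p unfolding x_def by (rule someI_ex[OF ex[OF that]])
  define xa xb xd xk where "xa p = fst (x p)" and "xb p = fst (snd (x p))" and "xd p = fst (snd (snd (x p)))"
    and "xk p = snd (snd (snd (x p)))" for p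
  have X: "xa p \<in> Units (Qp p)" "xb p \<in> carrier (Qp p)" "xd p \<in> Units (Qp p)" "xk p \<in> carrier (GL2 (Zp p))"
    "comp_fin p m = Mat2 (xa p) (xb p) \<zero>\<^bsub>Qp p\<^esub> (xd p) \<otimes>\<^bsub>GL2 (Qp p)\<^esub> xk p"
    "comp_fin p m \<in> carrier (GL2 (Zp p)) \<Longrightarrow> xa p = \<one>\<^bsub>Qp p\<^esub> \<and> xb p = \<zero>\<^bsub>Qp p\<^esub> \<and> xd p = \<one>\<^bsub>Qp p\<^esub>"
    if "prime p" for p
  proof -
    have "P p (xa p, xb p, xd p, xk p)" using x[OF that] by (simp only: xa_def xb_def xd_def xk_def prod.collapse)
    then show "xa p \<in> Units (Qp p)" "xb p \<in> carrier (Qp p)" "xd p \<in> Units (Qp p)" "xk p \<in> carrier (GL2 (Zp p))"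
      "comp_fin p m = Mat2 (xa p) (xb p) \<zero>\<^bsub>Qp p\<^esub> (xd p) \<otimes>\<^bsub>GL2 (Qp p)\<^esub> xk p"
      "comp_fin p m \<in> carrier (GL2 (Zp p)) \<Longrightarrow> xa p = \<one>\<^bsub>Qp p\<^esub> \<and> xb p = \<zero>\<^bsub>Qp p\<^esub> \<and> xd p = \<one>\<^bsub>Qp p\<^esub>"
      unfolding P_def prod.case by blast+
  qed
  from real_iwasawa[OF comps(1)] obtain ra rb rd \<theta> where
    r: "ra \<noteq> 0" "rd \<noteq> 0" "comp_inf m = Mat2 ra rb 0 rd \<otimes>\<^bsub>GL2 real_ring\<^esub> rot2 \<theta>" .
  let ?S = "{p::nat. prime p}" and ?F = "{p. prime p \<and> comp_fin p m \<notin> carrier (GL2 (Zp p))}"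
  define a b d where "a = (ra, \<lambda>p\<in>?S. xa p)" and "b = (rb, \<lambda>p\<in>?S. xb p)" and "d = (rd, \<lambda>p\<in>?S. xd p)"
  define \<kappa> where "\<kappa> = Mat2 (ul (rot2 \<theta>), \<lambda>p\<in>?S. ul (xk p)) (ur (rot2 \<theta>), \<lambda>p\<in>?S. ur (xk p))
    (ll (rot2 \<theta>), \<lambda>p\<in>?S. ll (xk p)) (lr (rot2 \<theta>), \<lambda>p\<in>?S. lr (xk p))"
  have one: "padic_abs p \<one>\<^bsub>Qp p\<^esub> = 1" "padic_abs p \<zero>\<^bsub>Qp p\<^esub> = 0" if p: "prime p" for p
  proof -
    interpret Q: ultrametric_field "Qp p" "padic_abs p" by (rule ultrametric_field_Qp[OF p])
    show "padic_abs p \<one>\<^bsub>Qp p\<^esub> = 1" "padic_abs p \<zero>\<^bsub>Qp p\<^esub> = 0" by auto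
  qed
  have a: "a \<in> Units adele_ring"
    unfolding a_def by (rule adele_UnitsI[OF r(1) X(1) comps(3)]) (use X(6) one in auto)
  have d: "d \<in> Units adele_ring"
    unfolding d_def by (rule adele_UnitsI[OF r(2) X(3) comps(3)]) (use X(6) one in auto)
  have b: "b \<in> carrier adele_ring"
    unfolding b_def by (rule adeleI[OF X(2) comps(3)]) (use X(6) one in auto)
  have k: "xk p \<in> carrier (GL2 (Qp p))" "ul (xk p) \<in> carrier (Qp p) \<and> padic_abs p (ul (xk p)) \<le> 1"
    "ur (xk p) \<in> carrier (Qp p) \<and> padic_abs p (ur (xk p)) \<le> 1"
    "ll (xk p) \<in> carrier (Qp p) \<and> padic_abs p (ll (xk p)) \<le> 1"
    "lr (xk p) \<in> carrier (Qp p) \<and> padic_abs p (lr (xk p)) \<le> 1"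
    "padic_abs p (mat2_det (Qp p) (xk p)) = 1" if p: "prime p" for p
  proof -
    interpret Q: ultrametric_field "Qp p" "padic_abs p" by (rule ultrametric_field_Qp[OF p])
    have kk: "xk p \<in> carrier (GL2 Q.integers)" using X(4)[OF p] by (simp add: Zp_def)
    show "xk p \<in> carrier (GL2 (Qp p))" by (rule Q.integers_subset[OF kk])
    show "ul (xk p) \<in> carrier (Qp p) \<and> padic_abs p (ul (xk p)) \<le> 1"
    "ur (xk p) \<in> carrier (Qp p) \<and> padic_abs p (ur (xk p)) \<le> 1"
    "ll (xk p) \<in> carrier (Qp p) \<and> padic_abs p (ll (xk p)) \<le> 1"
    "lr (xk p) \<in> carrier (Qp p) \<and> padic_abs p (lr (xk p)) \<le> 1"
    "padic_abs p (mat2_det (Qp p) (xk p)) = 1"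
      using kk unfolding Q.GL2_integers_iff mat2_carrier_iff by auto
  qed
  have ci: "comp_inf \<kappa> = rot2 \<theta>" by (rule mat2.expand) (simp add: comp_inf_sel \<kappa>_def)
  have cf: "comp_fin p \<kappa> = xk p" if "prime p" for p
    by (rule mat2.expand) (simp add: comp_fin_sel \<kappa>_def that)
  have \<kappa>c: "\<kappa> \<in> carrier (mat2_monoid adele_ring)"
    unfolding mat2_carrier_iff \<kappa>_def mat2.sel
    by (intro conjI adeleI[of _ "{}"]) (use k in auto)
  have "\<kappa> \<in> carrier (GL2 adele_ring)"
  proof (rule GL2_adeleI[OF \<kappa>c _ _ finite.emptyI])
    have "sin \<theta> * sin \<theta> + cos \<theta> * cos \<theta> = 1" by (simp flip: power2_eq_square)
    then show "comp_inf \<kappa> \<in> carrier (GL2 real_ring)"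
      unfolding ci GL2_real_iff by (simp add: rot2_def add.commute)
  qed (use cf k in auto)
  then have \<kappa>: "\<kappa> \<in> max_compact" using ci cf X(4) rot2_O2 by (simp add: max_compact_def)
  have "m = Mat2 a b \<zero>\<^bsub>adele_ring\<^esub> d \<otimes>\<^bsub>GL2 adele_ring\<^esub> \<kappa>"
  proof (rule mat2_adele_eqI)
    show "m \<in> carrier (mat2_monoid adele_ring)" using m by (simp add: adele.GL2_iff)
    have "Mat2 a b \<zero>\<^bsub>adele_ring\<^esub> d \<in> carrier (mat2_monoid adele_ring)"
      using a b d by (auto simp: mat2_carrier_iff)
    then show "Mat2 a b \<zero>\<^bsub>adele_ring\<^esub> d \<otimes>\<^bsub>GL2 adele_ring\<^esub> \<kappa> \<in> carrier (mat2_monoid adele_ring)"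
      unfolding GL2_mult using monoid.m_closed[OF adele.monoid_mat2 _ \<kappa>c] by blast
    have "comp_inf (Mat2 a b \<zero>\<^bsub>adele_ring\<^esub> d) = Mat2 ra rb 0 rd"
      by (rule mat2.expand) (simp add: comp_inf_sel a_def b_def d_def adele_simps)
    then show "comp_inf m = comp_inf (Mat2 a b \<zero>\<^bsub>adele_ring\<^esub> d \<otimes>\<^bsub>GL2 adele_ring\<^esub> \<kappa>)"
      unfolding comp_inf_mult ci using r(3) by simp
    fix p :: nat assume p: "prime p"
    have "comp_fin p (Mat2 a b \<zero>\<^bsub>adele_ring\<^esub> d) = Mat2 (xa p) (xb p) \<zero>\<^bsub>Qp p\<^esub> (xd p)"
      by (rule mat2.expand) (simp add: comp_fin_sel a_def b_def d_def adele_simps p)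
    then show "comp_fin p m = comp_fin p (Mat2 a b \<zero>\<^bsub>adele_ring\<^esub> d \<otimes>\<^bsub>GL2 adele_ring\<^esub> \<kappa>)"
      unfolding comp_fin_mult[OF p] cf[OF p] using X(5)[OF p] by simp
  qed
  with a b d \<kappa> show ?thesis by blast
qed

lemma height_quot_eq:
  assumes "m \<in> carrier (GL2 adele_ring)"
  shows "height_quot m = adele_height m"
  unfolding height_quot_def
proof (rule the_equality)
  show "\<exists>a \<in> Units adele_ring. \<exists>b \<in> carrier adele_ring.
     \<exists>d \<in> Units adele_ring. \<exists>\<kappa> \<in> max_compact.
       m = Mat2 a b \<zero>\<^bsub>adele_ring\<^esub> d \<otimes>\<^bsub>GL2 adele_ring\<^esub> \<kappa> \<and>
       adele_height m = adele_abs (a \<otimes>\<^bsub>adele_ring\<^esub> inv\<^bsub>adele_ring\<^esub> d)"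
    using adelic_iwasawa[OF assms] adele_abs_decomposition by metis
qed (use adele_abs_decomposition in blast)

section \<open>The product formula and rational matrices\<close>

definition padic_factor :: "rat \<Rightarrow> nat \<Rightarrow> real" where
  "padic_factor q p = (if prime p then rat_padic_abs p q else 1)"

lemma padic_factor_mult: "padic_factor (q * r) p = padic_factor q p * padic_factor r p"
  by (simp add: padic_factor_def rat_padic_abs_mult)

lemma product_formula_mult:
  assumes "finite {p. padic_factor q p \<noteq> 1}" "Prod_any (padic_factor q) = 1 / \<bar>of_rat q\<bar>"
    and "finite {p. padic_factor r p \<noteq> 1}" "Prod_any (padic_factor r) = 1 / \<bar>of_rat r\<bar>"
  shows "finite {p. padic_factor (q * r) p \<noteq> 1}" "Prod_any (padic_factor (q * r)) = 1 / \<bar>of_rat (q * r)\<bar>"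
proof -
  have "{p. padic_factor (q * r) p \<noteq> 1} \<subseteq> {p. padic_factor q p \<noteq> 1} \<union> {p. padic_factor r p \<noteq> 1}"
    by (auto simp: padic_factor_mult)
  then show "finite {p. padic_factor (q * r) p \<noteq> 1}" using assms(1,3) finite_subset by blast
  have "Prod_any (\<lambda>p. padic_factor q p * padic_factor r p) = Prod_any (padic_factor q) * Prod_any (padic_factor r)"
    by (rule Prod_any.distrib[OF assms(1,3)])
  moreover have "padic_factor (q * r) = (\<lambda>p. padic_factor q p * padic_factor r p)"
    by (rule ext) (rule padic_factor_mult)
  ultimately show "Prod_any (padic_factor (q * r)) = 1 / \<bar>of_rat (q * r)\<bar>"
    using assms(2,4) by (simp add: of_rat_mult abs_mult)
qed

lemma rat_padic_abs_other_prime: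
  assumes "prime p" "prime l" "p \<noteq> l"
  shows "rat_padic_abs p (of_nat l) = 1"
proof -
  have "\<not> p dvd l" using assms primes_dvd_imp_eq by blast
  then have "multiplicity (int p) (int l) = 0"
    by (intro not_dvd_imp_multiplicity_0) simp
  moreover have "int l \<noteq> 0" using assms(2) by auto
  ultimately show ?thesis
    using rat_padic_abs_divide[OF assms(1), of "int l" 1] by simp
qed

lemma product_formula_prime:
  assumes l: "prime l"
  shows "finite {p. padic_factor (of_nat l) p \<noteq> 1}" "Prod_any (padic_factor (of_nat l)) = 1 / \<bar>of_rat (of_nat l)\<bar>"
proof -
  have eq: "padic_factor (of_nat l) p = (if p = l then 1 / real l else 1)" for p
  proof (cases "p = l")
    case True
    then show ?thesis using l rat_padic_abs_self[OF l] by (simp only: padic_factor_def if_True simp_thms)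
  next
    case False
    then show ?thesis
      using rat_padic_abs_other_prime[OF _ l False] by (cases "prime p") (simp_all only: padic_factor_def if_True if_False simp_thms)
  qed
  show "finite {p. padic_factor (of_nat l) p \<noteq> 1}"
    by (rule finite_subset[of _ "{l}"]) (auto simp: eq)
  have "Prod_any (padic_factor (of_nat l)) = (\<Prod>p\<in>{l}. padic_factor (of_nat l) p)"
    by (rule Prod_any.expand_superset) (auto simp: eq)
  then show "Prod_any (padic_factor (of_nat l)) = 1 / \<bar>of_rat (of_nat l)\<bar>" by (simp add: eq)
qed

lemma product_formula_nat:
  "n > 0 \<Longrightarrow> finite {p. padic_factor (of_nat n) p \<noteq> 1} \<and> Prod_any (padic_factor (of_nat n)) = 1 / \<bar>of_rat (of_nat n)\<bar>"
proof (induction n rule: prime_divisors_induct)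
  case (unit n)
  have "padic_factor 1 = (\<lambda>_. 1)" by (rule ext) (simp add: padic_factor_def rat_padic_abs_1)
  then show ?case using unit by simp
next
  case (factor l n)
  then have IH: "finite {p. padic_factor (of_nat n) p \<noteq> 1}" "Prod_any (padic_factor (of_nat n)) = 1 / \<bar>of_rat (of_nat n)\<bar>"
    by auto
  from product_formula_mult[OF product_formula_prime[OF factor(1)] IH] show ?case unfolding of_nat_mult by blast
qed simp

lemma product_formula_inverse:
  assumes "finite {p. padic_factor q p \<noteq> 1}" "Prod_any (padic_factor q) = 1 / \<bar>of_rat q\<bar>" "q \<noteq> 0"
  shows "finite {p. padic_factor (inverse q) p \<noteq> 1}" "Prod_any (padic_factor (inverse q)) = 1 / \<bar>of_rat (inverse q)\<bar>"
proof -
  have eq: "padic_factor (inverse q) p = inverse (padic_factor q p)" for p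
    by (simp add: padic_factor_def rat_padic_abs_inverse)
  have "{p. padic_factor (inverse q) p \<noteq> 1} \<subseteq> {p. padic_factor q p \<noteq> 1}" by (auto simp: eq)
  then show fin: "finite {p. padic_factor (inverse q) p \<noteq> 1}" using assms(1) finite_subset by blast
  have "Prod_any (\<lambda>p. padic_factor q p * padic_factor (inverse q) p) = Prod_any (padic_factor q) * Prod_any (padic_factor (inverse q))"
    by (rule Prod_any.distrib[OF assms(1) fin])
  moreover have "padic_factor q p * padic_factor (inverse q) p = 1" for p
    using assms(3) rat_padic_abs_pos[of p q] by (auto simp: padic_factor_def rat_padic_abs_inverse)
  ultimately have "Prod_any (padic_factor q) * Prod_any (padic_factor (inverse q)) = 1" by simp
  then have *: "1 / \<bar>of_rat q\<bar> * Prod_any (padic_factor (inverse q)) = 1" unfolding assms(2) .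
  have "P = 1 / inverse r" if "1 / r * P = 1" "r \<noteq> 0" for P r :: real using that by (simp add: field_simps)
  from this[OF *] show "Prod_any (padic_factor (inverse q)) = 1 / \<bar>of_rat (inverse q)\<bar>"
    using assms(3) by (simp only: of_rat_inverse abs_inverse abs_eq_0 of_rat_eq_0_iff not_False_eq_True)
qed

text \<open>The formula is multiplicative and compatible with inverses, so it reduces to primes. The
  finiteness statement accompanies it throughout because \<open>Prod_any\<close> is multiplicative
  only for finite support.\<close>

lemma product_formula:
  assumes "q \<noteq> 0"
  shows "finite {p. padic_factor q p \<noteq> 1}" "Prod_any (padic_factor q) = 1 / \<bar>of_rat q\<bar>"
proof -
  have int: "finite {p. padic_factor (of_int a) p \<noteq> 1} \<and> Prod_any (padic_factor (of_int a)) = 1 / \<bar>of_rat (of_int a)\<bar>"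
    if "a \<noteq> 0" for a :: int
  proof -
    have pos: "nat \<bar>a\<bar> > 0" using that by simp
    have eq: "padic_factor (of_int a) = padic_factor (of_nat (nat \<bar>a\<bar>))"
    proof (rule ext)
      fix p
      have "of_nat (nat \<bar>a\<bar>) = (if a \<ge> 0 then of_int a else - of_int a :: rat)" by simp
      then show "padic_factor (of_int a) p = padic_factor (of_nat (nat \<bar>a\<bar>)) p"
        by (auto simp: padic_factor_def rat_padic_abs_minus)
    qed
    show ?thesis using product_formula_nat[OF pos] unfolding eq by (simp add: abs_if of_rat_minus)
  qed
  obtain a b where ab: "q = of_int a / of_int b" "a \<noteq> 0" "b > 0"
    using assms by (cases q rule: rat_fraction_cases) auto
  have q: "q = of_int a * inverse (of_int b)" using ab by (simp add: divide_inverse)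
  have b: "b \<noteq> 0" "of_int b \<noteq> (0 :: rat)" using ab by auto
  note A = conjunct1[OF int[OF ab(2)]] conjunct2[OF int[OF ab(2)]]
  note B = product_formula_inverse[OF conjunct1[OF int[OF b(1)]] conjunct2[OF int[OF b(1)]] b(2)]
  show "finite {p. padic_factor q p \<noteq> 1}" "Prod_any (padic_factor q) = 1 / \<bar>of_rat q\<bar>"
    unfolding q by (rule product_formula_mult[OF A B])+
qed

lemma padic_of_rat_minus:
  assumes p: "prime p"
  shows "padic_of_rat p (q - r) = padic_of_rat p q \<ominus>\<^bsub>Qp p\<^esub> padic_of_rat p r"
proof -
  interpret Q: ultrametric_field "Qp p" "padic_abs p" by (rule ultrametric_field_Qp[OF p])
  have "padic_of_rat p q = padic_of_rat p (q - r) \<oplus>\<^bsub>Qp p\<^esub> padic_of_rat p r"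
    by (simp flip: padic_of_rat_add[OF p])
  moreover have "u = v \<ominus>\<^bsub>Qp p\<^esub> w" if "v = u \<oplus>\<^bsub>Qp p\<^esub> w" "u \<in> carrier (Qp p)" "w \<in> carrier (Qp p)" for u v w
    unfolding that(1) using that(2,3) by algebra
  ultimately show ?thesis using padic_of_rat_closed[OF p] by blast
qed

lemma adele_of_rat_closed: "adele_of_rat q \<in> carrier adele_ring"
proof (cases "q = 0")
  case True
  have "adele_of_rat 0 = \<zero>\<^bsub>adele_ring\<^esub>"
    unfolding adele_of_rat_def adele_simps by (auto simp: padic_of_rat_0 intro!: restrict_ext)
  then show ?thesis using True adele_zero_closed by simp
next
  case False
  show ?thesis
    unfolding adele_of_rat_def
  proof (rule adeleI[OF _ product_formula(1)[OF False]])
    fix p :: nat assume p: "prime p"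
    show "padic_of_rat p q \<in> carrier (Qp p)" by (rule padic_of_rat_closed[OF p])
    show "padic_abs p (padic_of_rat p q) \<le> 1" if "p \<notin> {p. padic_factor q p \<noteq> 1}"
      using that p by (simp add: padic_factor_def padic_abs_of_rat[OF p])
  qed
qed

section \<open>Rational and real matrices in the adelic group\<close>

definition rat_det :: "rat mat2 \<Rightarrow> rat" where
  "rat_det m = ul m * lr m - ur m * ll m"

lemma GL2_rat_iff: "m \<in> carrier (GL2 rat_ring) \<longleftrightarrow> rat_det m \<noteq> 0"
  using cring_class.GL2_iff[of m] field_class.field_Units[where ?'a = rat]
  by (simp add: mat2_carrier_iff class_simps mat2_det_def rat_det_def)

lemma map_mat2_sel: "ul (map_mat2 f m) = f (ul m)" "ur (map_mat2 f m) = f (ur m)"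
  "ll (map_mat2 f m) = f (ll m)" "lr (map_mat2 f m) = f (lr m)"
  by (cases m; simp)+

lemma comp_fin_of_rat:
  "prime p \<Longrightarrow> comp_fin p (map_mat2 adele_of_rat m) = map_mat2 (padic_of_rat p) m"
  by (rule mat2.expand) (simp add: comp_fin_sel map_mat2_sel adele_of_rat_def)

lemma comp_inf_of_rat: "comp_inf (map_mat2 adele_of_rat m) = map_mat2 of_rat m"
  by (rule mat2.expand) (simp add: comp_inf_sel map_mat2_sel adele_of_rat_def)

lemma mat2_det_of_rat:
  "prime p \<Longrightarrow> mat2_det (Qp p) (map_mat2 (padic_of_rat p) m) = padic_of_rat p (rat_det m)"
  by (simp add: mat2_det_def map_mat2_sel rat_det_def padic_of_rat_minus padic_of_rat_mult)

lemma GL2_adele_of_rat: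
  assumes m: "m \<in> carrier (GL2 rat_ring)"
  shows "map_mat2 adele_of_rat m \<in> carrier (GL2 adele_ring)"
proof (rule GL2_adeleI[OF _ _ _ product_formula(1)])
  have d: "rat_det m \<noteq> 0" using m by (simp add: GL2_rat_iff)
  show "map_mat2 adele_of_rat m \<in> carrier (mat2_monoid adele_ring)"
    by (simp add: mat2_carrier_iff map_mat2_sel adele_of_rat_closed)
  have "of_rat (ul m) * of_rat (lr m) - of_rat (ur m) * of_rat (ll m) = (of_rat (rat_det m) :: real)"
    by (simp add: rat_det_def of_rat_diff of_rat_mult)
  then show "comp_inf (map_mat2 adele_of_rat m) \<in> carrier (GL2 real_ring)"
    unfolding comp_inf_of_rat GL2_real_iff map_mat2_sel using d by simp
  show "rat_det m \<noteq> 0" by (rule d)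
  fix p :: nat assume p: "prime p"
  interpret Q: ultrametric_field "Qp p" "padic_abs p" by (rule ultrametric_field_Qp[OF p])
  have "padic_abs p (padic_of_rat p (rat_det m)) \<noteq> 0"
    using d by (simp add: padic_abs_of_rat[OF p] rat_padic_abs_eq_0_iff[OF p])
  then have "padic_of_rat p (rat_det m) \<in> Units (Qp p)"
    using padic_of_rat_closed[OF p] by (auto simp: Q.Units_iff)
  then show "comp_fin p (map_mat2 adele_of_rat m) \<in> carrier (GL2 (Qp p))"
    unfolding comp_fin_of_rat[OF p] Q.GL2_iff mat2_det_of_rat[OF p]
    by (simp add: mat2_carrier_iff map_mat2_sel padic_of_rat_closed[OF p])
  show "padic_abs p (mat2_det (Qp p) (comp_fin p (map_mat2 adele_of_rat m))) = 1"
    if "p \<notin> {p. padic_factor (rat_det m) p \<noteq> 1}"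
    using that p unfolding comp_fin_of_rat[OF p] mat2_det_of_rat[OF p] padic_abs_of_rat[OF p]
    by (simp add: padic_factor_def)
qed

lemma comp_inf_of_GL2_real: "comp_inf (of_GL2_real g) = g"
  by (rule mat2.expand) (simp add: comp_inf_sel of_GL2_real_def)

lemma comp_fin_of_GL2_real: "prime p \<Longrightarrow> comp_fin p (of_GL2_real g) = \<one>\<^bsub>mat2_monoid (Qp p)\<^esub>"
  by (rule mat2.expand) (simp add: comp_fin_sel of_GL2_real_def mat2_one adele_simps)

lemma GL2_adele_of_real:
  assumes g: "g \<in> carrier (GL2 real_ring)"
  shows "of_GL2_real g \<in> carrier (GL2 adele_ring)"
proof (rule GL2_adeleI[OF _ _ _ finite.emptyI])
  have "(r, snd \<one>\<^bsub>adele_ring\<^esub>) \<in> carrier adele_ring" "(r, snd \<zero>\<^bsub>adele_ring\<^esub>) \<in> carrier adele_ring" for r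
    using adele_one_closed adele_zero_closed by (simp_all add: adele_carrier_iff)
  then show "of_GL2_real g \<in> carrier (mat2_monoid adele_ring)"
    by (simp add: mat2_carrier_iff of_GL2_real_def)
  show "comp_inf (of_GL2_real g) \<in> carrier (GL2 real_ring)" using g by (simp add: comp_inf_of_GL2_real)
  fix p :: nat assume p: "prime p"
  interpret Q: ultrametric_field "Qp p" "padic_abs p" by (rule ultrametric_field_Qp[OF p])
  show "comp_fin p (of_GL2_real g) \<in> carrier (GL2 (Qp p))"
    unfolding comp_fin_of_GL2_real[OF p] GL2_carrier by (rule monoid.Units_one_closed[OF Q.monoid_mat2])
  show "padic_abs p (mat2_det (Qp p) (comp_fin p (of_GL2_real g))) = 1"
    unfolding comp_fin_of_GL2_real[OF p] by (simp add: mat2_det_def mat2_one a_minus_def)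
qed

section \<open>Borel cosets and primitive bottom rows\<close>

definition row_coset :: "int \<times> int \<Rightarrow> rat mat2 set" where
  "row_coset = (\<lambda>(c, d). {m \<in> carrier (GL2 rat_ring). ll m * of_int d = lr m * of_int c})"

lemma GL2_rat_mult:
  "m \<otimes>\<^bsub>GL2 rat_ring\<^esub> n = Mat2 (ul m * ul n + ur m * ll n) (ul m * ur n + ur m * lr n)
    (ll m * ul n + lr m * ll n) (ll m * ur n + lr m * lr n)"
  by (simp add: GL2_mult mat2_mult class_simps)

text \<open>The lower left entry of m times the inverse of a, multiplied by det a, is the 2 by 2
  minor of the two bottom rows. So m lies in the coset of a exactly when these rows are
  proportional.\<close>

lemma borel_coset:
  assumes a: "a \<in> carrier (GL2 rat_ring)"
  shows "borel2 rat_ring #>\<^bsub>GL2 rat_ring\<^esub> a = {m \<in> carrier (GL2 rat_ring). ll m * lr a = lr m * ll a}"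
proof -
  interpret G: group "GL2 rat_ring" by (rule cring.GL2_group[OF cring_class])
  have a0: "rat_det a \<noteq> 0" using a by (simp add: GL2_rat_iff)
  show ?thesis
  proof (intro equalityI subsetI)
    fix m assume "m \<in> borel2 rat_ring #>\<^bsub>GL2 rat_ring\<^esub> a"
    then obtain h where h: "h \<in> carrier (GL2 rat_ring)" "ll h = 0" "m = h \<otimes>\<^bsub>GL2 rat_ring\<^esub> a"
      by (auto simp: r_coset_def borel2_def class_simps)
    then show "m \<in> {m \<in> carrier (GL2 rat_ring). ll m * lr a = lr m * ll a}"
      using G.m_closed[OF h(1) a] by (simp add: GL2_rat_mult)
  next
    fix m assume "m \<in> {m \<in> carrier (GL2 rat_ring). ll m * lr a = lr m * ll a}"
    then have m: "m \<in> carrier (GL2 rat_ring)" "ll m * lr a = lr m * ll a" by auto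
    define h where "h = m \<otimes>\<^bsub>GL2 rat_ring\<^esub> inv\<^bsub>GL2 rat_ring\<^esub> a"
    have h: "h \<in> carrier (GL2 rat_ring)" "h \<otimes>\<^bsub>GL2 rat_ring\<^esub> a = m"
      using m a unfolding h_def by (auto simp: G.m_assoc)
    have r: "ll m = ll h * ul a + lr h * ll a" "lr m = ll h * ur a + lr h * lr a"
      unfolding h(2)[symmetric] by (simp_all add: GL2_rat_mult)
    have "ll h * rat_det a = ll m * lr a - lr m * ll a" unfolding r rat_det_def by (simp add: algebra_simps)
    then have "ll h = 0" using m(2) a0 by simp
    then have "h \<in> borel2 rat_ring" using h by (simp add: borel2_def class_simps)
    then show "m \<in> borel2 rat_ring #>\<^bsub>GL2 rat_ring\<^esub> a" using h(2) unfolding r_coset_def by blast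
  qed
qed

lemma rat_row_primitive:
  fixes x y :: rat
  assumes "(x, y) \<noteq> (0, 0)"
  obtains l c d where "l \<noteq> 0" "x = l * of_int c" "y = l * of_int d" "coprime c d" "c > 0 \<or> c = 0 \<and> d = 1"
proof -
  obtain a b where x: "x = of_int a / of_int b" "b > 0"
    by (cases x rule: rat_fraction_cases) (auto intro: that[of 0 1])
  obtain a' b' where y: "y = of_int a' / of_int b'" "b' > 0"
    by (cases y rule: rat_fraction_cases) (auto intro: that[of 0 1])
  define m n where "m = a * b'" and "n = a' * b"
  define D where "D = (of_int (b * b') :: rat)"
  have D: "D \<noteq> 0" "x = of_int m / D" "y = of_int n / D" using x y by (auto simp: D_def m_def n_def)
  define g where "g = gcd m n"
  have mn: "m \<noteq> 0 \<or> n \<noteq> 0" using assms D by auto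
  then have g: "g \<noteq> 0" by (simp add: g_def)
  have cop: "coprime (m div g) (n div g)" unfolding g_def using mn by (intro div_gcd_coprime) auto
  have eq: "m = g * (m div g)" "n = g * (n div g)" by (auto simp: g_def)
  define l where "l = of_int g / D"
  have l: "l \<noteq> 0" "x = l * of_int (m div g)" "y = l * of_int (n div g)"
    using D g eq by (auto simp: l_def simp flip: of_int_mult)
  show thesis
  proof (cases "m div g > 0 \<or> m div g = 0 \<and> n div g = 1")
    case True
    then show thesis using that[OF l cop] by blast
  next
    case False
    have "m div g = 0 \<Longrightarrow> \<bar>n div g\<bar> = 1" using cop by simp
    then have "- (m div g) > 0 \<or> - (m div g) = 0 \<and> - (n div g) = 1" using False by linarith
    then show thesis using that[of "- l" "- (m div g)" "- (n div g)"] l cop by simp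
  qed
qed

text \<open>The Eisenstein sum uses representatives picked by \<open>SOME\<close>, about which
  nothing is known but membership; this recovers their bottom row up to a rational factor.\<close>

lemma row_coset_some:
  assumes "coprime c d" and m: "m \<in> row_coset (c, d)"
  obtains l where "l \<noteq> 0" "ll m = l * of_int c" "lr m = l * of_int d"
proof -
  have m': "m \<in> carrier (GL2 rat_ring)" "ll m * of_int d = lr m * of_int c" using m by (auto simp: row_coset_def)
  have nz: "(ll m, lr m) \<noteq> (0, 0)" using m'(1) by (auto simp: GL2_rat_iff rat_det_def)
  show thesis
  proof (cases "c = 0")
    case True
    then have d: "\<bar>d\<bar> = 1" using assms(1) by simp
    then have "(of_int d :: rat) \<noteq> 0" by auto
    then have "ll m = 0" "lr m = (lr m / of_int d) * of_int d" using m' True by auto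
    then show thesis using that[of "lr m / of_int d"] nz True \<open>(of_int d :: rat) \<noteq> 0\<close> by auto
  next
    case False
    then have c: "(of_int c :: rat) \<noteq> 0" by simp
    have "ll m = (ll m / of_int c) * of_int c" "lr m = (ll m / of_int c) * of_int d"
      using c m'(2) by (simp_all add: field_simps)
    moreover have "ll m \<noteq> 0"
    proof
      assume "ll m = 0"
      then have "lr m = 0" using m'(2) c by simp
      with \<open>ll m = 0\<close> nz show False by simp
    qed
    ultimately show thesis using that[of "ll m / of_int c"] c by auto
  qed
qed

lemma row_coset_nonempty:
  assumes "coprime c d"
  obtains m where "m \<in> row_coset (c, d)" "m \<in> carrier (GL2 rat_ring)" "ll m = of_int c" "lr m = of_int d"
proof -
  obtain u v where uv: "u * c + v * d = 1" using assms bezout_int[of c d] by auto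
  define m where "m = Mat2 (of_int v) (- of_int u) (of_int c) (of_int d :: rat)"
  have "rat_det m = of_int (u * c + v * d)" by (simp add: m_def rat_det_def)
  then have "m \<in> carrier (GL2 rat_ring)" by (simp add: GL2_rat_iff uv del: of_int_add of_int_mult)
  then show ?thesis using that[of m] by (simp add: row_coset_def m_def)
qed

section \<open>The adelic Eisenstein series\<close>

text \<open>The cosets are the rational points of the projective line: clearing denominators,
  dividing by the gcd and fixing the sign selects one primitive row for each.\<close>

lemma bij_betw_row_coset:
  "bij_betw row_coset primitive_pairs (rcosets\<^bsub>GL2 rat_ring\<^esub> (borel2 rat_ring))"
proof (rule bij_betw_imageI)
  have coset: "row_coset (c, d) = borel2 rat_ring #>\<^bsub>GL2 rat_ring\<^esub> a"
    if a: "a \<in> carrier (GL2 rat_ring)" and l: "l \<noteq> 0" "ll a = l * of_int c" "lr a = l * of_int d" for a l c d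
  proof -
    have "ll m * lr a = lr m * ll a \<longleftrightarrow> ll m * of_int d = lr m * of_int c" for m
    proof -
      have e: "ll m * lr a = l * (ll m * of_int d)" "lr m * ll a = l * (lr m * of_int c)"
        unfolding l by (simp_all only: mult_ac)
      show ?thesis unfolding e using l(1) by simp
    qed
    then show ?thesis unfolding borel_coset[OF a] row_coset_def by simp
  qed
  show "inj_on row_coset primitive_pairs"
  proof (rule inj_onI, clarify)
    fix c d c' d' assume 1: "(c, d) \<in> primitive_pairs" and 2: "(c', d') \<in> primitive_pairs"
      and eq: "row_coset (c, d) = row_coset (c', d')"
    have cd: "coprime c d" "c > 0 \<or> c = 0 \<and> d = 1" and cd': "coprime c' d'" "c' > 0 \<or> c' = 0 \<and> d' = 1"
      using 1 2 by (auto simp: primitive_pairs_def)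
    from row_coset_nonempty[OF cd(1)] obtain m where
      m: "m \<in> row_coset (c, d)" "ll m = of_int c" "lr m = of_int d" by blast
    then have "ll m * of_int d' = lr m * of_int c'" unfolding eq by (auto simp: row_coset_def)
    then have "(of_int (c * d') :: rat) = of_int (d * c')" unfolding m of_int_mult .
    then have e: "c * d' = d * c'" by (simp only: of_int_eq_iff)
    have "c dvd d * c'" by (metis e dvd_triv_left)
    then have "c dvd c'" using cd(1) by (simp add: coprime_dvd_mult_right_iff)
    moreover have "c' dvd c * d'" by (metis e dvd_triv_right)
    then have "c' dvd c" using cd'(1) by (simp add: coprime_dvd_mult_left_iff)
    ultimately have cc: "c = c'" using cd(2) cd'(2) by (auto intro: zdvd_antisym_nonneg)
    show "c = c' \<and> d = d'"
    proof (cases "c = 0")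
      case True
      then show ?thesis using cd(2) cd'(2) cc by auto
    next
      case False
      then show ?thesis using e cc by simp
    qed
  qed
  show "row_coset ` primitive_pairs = rcosets\<^bsub>GL2 rat_ring\<^esub> (borel2 rat_ring)"
  proof (intro equalityI subsetI)
    fix C assume "C \<in> row_coset ` primitive_pairs"
    then obtain c d where cd: "C = row_coset (c, d)" "coprime c d" by (auto simp: primitive_pairs_def)
    from row_coset_nonempty[OF cd(2)] obtain m where
      m: "m \<in> carrier (GL2 rat_ring)" "ll m = of_int c" "lr m = of_int d" by blast
    have "C = borel2 rat_ring #>\<^bsub>GL2 rat_ring\<^esub> m" unfolding cd(1) by (rule coset[OF m(1), of 1]) (simp_all add: m)
    then show "C \<in> rcosets\<^bsub>GL2 rat_ring\<^esub> (borel2 rat_ring)" using m(1) by (auto simp: RCOSETS_def)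
  next
    fix C assume "C \<in> rcosets\<^bsub>GL2 rat_ring\<^esub> (borel2 rat_ring)"
    then obtain a where a: "a \<in> carrier (GL2 rat_ring)" "C = borel2 rat_ring #>\<^bsub>GL2 rat_ring\<^esub> a"
      by (auto simp: RCOSETS_def)
    have "(ll a, lr a) \<noteq> (0, 0)" using a(1) by (auto simp: GL2_rat_iff rat_det_def)
    from rat_row_primitive[OF this] obtain l c d where
      l: "l \<noteq> 0" "ll a = l * of_int c" "lr a = l * of_int d" "coprime c d" "c > 0 \<or> c = 0 \<and> d = 1" .
    have "C = row_coset (c, d)" unfolding a(2) by (rule coset[OF a(1) l(1-3), symmetric])
    moreover have "(c, d) \<in> primitive_pairs" using l by (simp add: primitive_pairs_def)
    ultimately show "C \<in> row_coset ` primitive_pairs" by blast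
  qed
qed

definition uhp_matrix :: "complex \<Rightarrow> real mat2" where
  "uhp_matrix z = Mat2 1 (Re z) 0 1 \<otimes>\<^bsub>GL2 real_ring\<^esub> Mat2 (Im z) 0 0 1"

lemma uhp_matrix_eq: "uhp_matrix z = Mat2 (Im z) (Re z) 0 1"
  by (simp add: uhp_matrix_def GL2_real_mult)

text \<open>A primitive row has maximum norm 1 at every prime, so only det / l^2 enters the height.
  The two comparisons of the bottom entries are the two cases in which the Steinberg vector has been
  evaluated.\<close>

lemma padic_height_row:
  assumes p: "prime p" and m: "m \<in> carrier (GL2 rat_ring)"
    and l: "l \<noteq> 0" "ll m = l * of_int c" "lr m = l * of_int d" and cd: "coprime c d"
  shows "padic_height p (map_mat2 (padic_of_rat p) m) = rat_padic_abs p (rat_det m / l ^ 2)"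
    and "int p dvd c \<Longrightarrow> rat_padic_abs p (ll m) \<le> rat_padic_abs p (lr m) / real p"
    and "\<not> int p dvd c \<Longrightarrow> rat_padic_abs p (lr m) \<le> rat_padic_abs p (ll m)"
proof -
  interpret Q: ultrametric_field "Qp p" "padic_abs p" by (rule ultrametric_field_Qp[OF p])
  have lpos: "rat_padic_abs p l > 0" by (rule rat_padic_abs_pos[OF p l(1)])
  have nu: "\<not> is_unit (int p)" using p not_prime_unit prime_nat_int_transfer by blast
  have unit: "rat_padic_abs p (of_int x) = 1" if "\<not> int p dvd x" for x
  proof -
    have "x \<noteq> 0" using that by auto
    moreover have "multiplicity (int p) x = 0" by (rule not_dvd_imp_multiplicity_0[OF that])
    ultimately show ?thesis using rat_padic_abs_divide[OF p, of x 1] by simp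
  qed
  have div: "rat_padic_abs p (of_int x) \<le> 1 / real p" if dvd: "int p dvd x" for x
  proof -
    obtain y where "x = int p * y" using dvd by blast
    then have "rat_padic_abs p (of_int x) = 1 / real p * rat_padic_abs p (of_int y)"
      using rat_padic_abs_self[OF p] by (simp add: rat_padic_abs_mult[OF p])
    also have "\<dots> \<le> 1 / real p * 1"
      using rat_padic_abs_of_int_le_1[OF p] by (intro mult_left_mono) auto
    finally show ?thesis by simp
  qed
  have row: "rat_padic_abs p (ll m) = rat_padic_abs p l * rat_padic_abs p (of_int c)"
    "rat_padic_abs p (lr m) = rat_padic_abs p l * rat_padic_abs p (of_int d)"
    unfolding l by (rule rat_padic_abs_mult[OF p])+
  have nd: "\<not> int p dvd d" if "int p dvd c"
    using that cd nu coprime_common_divisor[of c d "int p"] by blast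
  have mx: "max (rat_padic_abs p (of_int c)) (rat_padic_abs p (of_int d)) = 1"
  proof (cases "int p dvd c")
    case True
    then show ?thesis using unit[OF nd[OF True]] rat_padic_abs_of_int_le_1[OF p, of c] by simp
  next
    case False
    then show ?thesis using unit[OF False] rat_padic_abs_of_int_le_1[OF p, of d] by simp
  qed
  have "max (rat_padic_abs p (ll m)) (rat_padic_abs p (lr m)) = rat_padic_abs p l * 1"
    unfolding row mx[symmetric] using lpos by (simp add: max_mult_distrib_left)
  then have "padic_height p (map_mat2 (padic_of_rat p) m) = rat_padic_abs p (rat_det m) / rat_padic_abs p l ^ 2"
    unfolding Q.height_def mat2_det_of_rat[OF p] map_mat2_sel padic_abs_of_rat[OF p] by simp
  also have "\<dots> = rat_padic_abs p (rat_det m / l ^ 2)"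
    by (simp add: divide_inverse power2_eq_square rat_padic_abs_mult[OF p] rat_padic_abs_inverse[OF p])
  finally show "padic_height p (map_mat2 (padic_of_rat p) m) = rat_padic_abs p (rat_det m / l ^ 2)" .
  show "rat_padic_abs p (ll m) \<le> rat_padic_abs p (lr m) / real p" if "int p dvd c"
    unfolding row using unit[OF nd[OF that]] mult_left_mono[OF div[OF that] less_imp_le[OF lpos]] by simp
  show "rat_padic_abs p (lr m) \<le> rat_padic_abs p (ll m)" if "\<not> int p dvd c"
    unfolding row using unit[OF that] mult_left_mono[OF rat_padic_abs_of_int_le_1[OF p, of d] less_imp_le[OF lpos]] by simp
qed

text \<open>The local heights contribute |q|_p at all primes and |q| at the real place, with q = det
  / l^2. By the product formula these cancel, which leaves an expression in z, c and d independent
  of the representative m.\<close>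

lemma flat_section_value:
  assumes N: "N > 1" and z: "Im z > 0" and m: "m \<in> carrier (GL2 rat_ring)"
    and l: "l \<noteq> 0" "ll m = l * of_int c" "lr m = l * of_int d" and cd: "coprime c d"
  shows "flat_section (1/2) (f2 N) s (map_mat2 adele_of_rat m \<otimes>\<^bsub>GL2 adele_ring\<^esub> of_GL2_real (uhp_matrix z)) =
    of_real (Im z) powr (s - 1/2) * of_real (Im z) * (psi N c * hecke_kernel (s - 1/2) (of_int c * z + of_int d))"
proof -
  define y where "y = Im z"
  define w where "w = of_int c * z + of_int d"
  let ?g = "map_mat2 adele_of_rat m \<otimes>\<^bsub>GL2 adele_ring\<^esub> of_GL2_real (uhp_matrix z)"
  define q where "q = rat_det m / l ^ 2"
  have D: "rat_det m \<noteq> 0" using m by (simp add: GL2_rat_iff)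
  have q: "q \<noteq> 0" using D l by (simp add: q_def)
  have y: "y > 0" using z by (simp add: y_def)
  have w: "w \<noteq> 0"
  proof
    assume "w = 0"
    then have "Im w = 0" "Re w = 0" by auto
    then have "c = 0" "d = 0" using y by (auto simp: w_def y_def)
    then show False using cd by simp
  qed
  have gR: "uhp_matrix z \<in> carrier (GL2 real_ring)" using y by (simp add: uhp_matrix_eq GL2_real_iff y_def)
  have g: "?g \<in> carrier (GL2 adele_ring)"
    by (rule adele.GL2_mult_closed[OF GL2_adele_of_rat[OF m] GL2_adele_of_real[OF gR]])
  have fin: "comp_fin p ?g = map_mat2 (padic_of_rat p) m" if p: "prime p" for p
  proof -
    interpret Q: ultrametric_field "Qp p" "padic_abs p" by (rule ultrametric_field_Qp[OF p])
    have "map_mat2 (padic_of_rat p) m \<in> carrier (mat2_monoid (Qp p))"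
      by (simp add: mat2_carrier_iff map_mat2_sel padic_of_rat_closed[OF p])
    then show ?thesis
      unfolding comp_fin_mult[OF p] comp_fin_of_rat[OF p] comp_fin_of_GL2_real[OF p]
      unfolding GL2_mult
      by (rule monoid.r_one[OF Q.monoid_mat2])
  qed
  have finG: "map_mat2 (padic_of_rat p) m \<in> carrier (GL2 (Qp p))" if "prime p" for p
    using GL2_adele_components(2)[OF g that] fin[OF that] by simp
  define L where "L = (of_rat l :: real)"
  have L: "L \<noteq> 0" using l by (simp add: L_def)
  define M where "M = comp_inf ?g"
  have M: "ll M = L * (of_int c * y)" "lr M = L * (of_int c * Re z + of_int d)"
    "ul M * lr M - ur M * ll M = of_rat (rat_det m) * y"
    unfolding M_def comp_inf_mult comp_inf_of_rat comp_inf_of_GL2_real uhp_matrix_eq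
    by (simp_all add: GL2_real_mult map_mat2_sel l of_rat_mult L_def y_def rat_det_def of_rat_diff algebra_simps)
  have MG: "M \<in> carrier (GL2 real_ring)" unfolding M_def by (rule GL2_adele_components(1)[OF g])
  have ww: "(of_int c * y) ^ 2 + (of_int c * Re z + of_int d) ^ 2 = norm w ^ 2"
    by (simp add: cmod_power2 w_def y_def)
  have row: "ll M ^ 2 + lr M ^ 2 = L ^ 2 * norm w ^ 2"
    unfolding M power_mult_distrib ww[symmetric] by (simp add: distrib_left power_mult_distrib)
  have absq: "\<bar>of_rat q :: real\<bar> = \<bar>of_rat (rat_det m)\<bar> / L ^ 2"
    by (simp add: q_def of_rat_divide of_rat_power L_def)
  have rh: "\<bar>ul M * lr M - ur M * ll M\<bar> / (ll M ^ 2 + lr M ^ 2) = \<bar>of_rat q\<bar> * (y / norm w ^ 2)"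
    unfolding M(3) row absq using y by (simp add: abs_mult)
  have loc: "padic_height p (comp_fin p ?g) = rat_padic_abs p q" if "prime p" for p
    unfolding fin[OF that] q_def by (rule padic_height_row(1)[OF that m l cd])
  have lam: "(\<lambda>p. if prime p then padic_height p (comp_fin p ?g) else 1) = padic_factor q"
    by (rule ext) (simp add: padic_factor_def loc)
  have "height_quot ?g = \<bar>of_rat q\<bar> * (y / norm w ^ 2) * (1 / \<bar>of_rat q\<bar>)"
    unfolding height_quot_eq[OF g] adele_height_def real_height_def M_def[symmetric] rh lam product_formula(2)[OF q] ..
  then have hq: "height_quot ?g = y / norm w ^ 2" using q by simp
  have "f_real 2 (1/2) M = of_real (\<bar>of_rat q\<bar>) * (of_real y / w ^ 2)"
  proof -
    \<comment> \<open>The weight 2 factor is a square of the conjugate of c z + d divided by a norm;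
      together with y / |w|^2 it yields the holomorphic y / w^2.\<close>
    have cw: "of_real (lr M) - \<i> * of_real (ll M) = of_real L * cnj w"
      unfolding M by (rule complex_eqI) (simp_all add: w_def y_def)
    have nw: "of_real (norm w ^ 2) = w * cnj w" by (rule complex_norm_square)
    have cnz: "cnj w \<noteq> 0" using w by simp
    have "f_real 2 (1/2) M = of_real (\<bar>of_rat q\<bar> * (y / norm w ^ 2)) * ((of_real L * cnj w) ^ 2 / of_real (L ^ 2 * norm w ^ 2))"
      unfolding f_real_2_half[OF MG] rh cw
      unfolding row ..
    also have "\<dots> = of_real \<bar>of_rat q\<bar> * (of_real y / (w * cnj w)) * (of_real L ^ 2 * cnj w ^ 2 / (of_real L ^ 2 * (w * cnj w)))"
      unfolding of_real_mult of_real_divide nw[symmetric] power_mult_distrib of_real_power ..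
    also have "\<dots> = of_real \<bar>of_rat q\<bar> * (of_real y / w ^ 2)"
    proof -
      have "Q * (Y / (w * v)) * (L2 * v ^ 2 / (L2 * (w * v))) = Q * (Y / w ^ 2)" if "L2 \<noteq> 0" "v \<noteq> 0" for Q L2 Y v :: complex
        using that w by (simp add: field_simps power2_eq_square)
      then show ?thesis using cnz L by (metis of_real_eq_0_iff power_not_zero)
    qed
    finally show ?thesis .
  qed
  moreover have "Prod_any (\<lambda>p. if prime p then (if p dvd N then f_St p else f_sph (1/2) p) (comp_fin p ?g) else 1)
    = of_real (1 / \<bar>of_rat q\<bar>) * psi N c"
  proof -
    \<comment> \<open>The quotient of the local section by its spherical counterpart; it differs
      from 1 only at primes of \<open>N\<close>, so the infinite product separates into the product
      formula and \<open>psi N c\<close>.\<close>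
    define \<epsilon> where "\<epsilon> p = (if p \<in> prime_factors N then if int p dvd c then 1 else - 1 / of_nat p else 1 :: complex)" for p
    let ?F = "\<lambda>p. if prime p then (if p dvd N then f_St p else f_sph (1/2) p) (comp_fin p ?g) else 1"
    have F: "?F p = of_real (padic_factor q p) * \<epsilon> p" for p
    proof (cases "prime p")
      case p: True
      have h: "padic_height p (map_mat2 (padic_of_rat p) m) = padic_factor q p"
        using loc[OF p] p by (simp add: fin[OF p] padic_factor_def)
      show ?thesis
      proof (cases "p dvd N")
        case True
        then have pN: "p \<in> prime_factors N" using p N by (simp add: in_prime_factors_iff)
        show ?thesis
        proof (cases "int p dvd c")
          case c: True
          have "f_St p (map_mat2 (padic_of_rat p) m) = of_real (padic_factor q p)"
            unfolding h[symmetric] by (rule f_St_small[OF p finG[OF p]])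
              (simp add: map_mat2_sel padic_abs_of_rat[OF p] padic_height_row(2)[OF p m l cd c])
          then show ?thesis using p True c pN by (simp add: \<epsilon>_def fin)
        next
          case c: False
          have "f_St p (map_mat2 (padic_of_rat p) m) = of_real (padic_factor q p) * (- 1 / of_nat p)"
            unfolding h[symmetric] by (rule f_St_large[OF p finG[OF p]])
              (simp add: map_mat2_sel padic_abs_of_rat[OF p] padic_height_row(3)[OF p m l cd c])
          then show ?thesis unfolding \<epsilon>_def if_P[OF p] if_P[OF True] if_P[OF pN] if_not_P[OF c] fin[OF p] .
        qed
      next
        case False
        then have "p \<notin> prime_factors N" by auto
        then show ?thesis using p False by (simp add: \<epsilon>_def fin f_sph_half[OF p finG[OF p]] h)
      qed
    next
      case False
      then have "p \<notin> prime_factors N" by auto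
      with False show ?thesis by (simp add: \<epsilon>_def padic_factor_def)
    qed
    define S where "S = {p. padic_factor q p \<noteq> 1} \<union> prime_factors N"
    have S: "finite S" unfolding S_def using product_formula(1)[OF q] by simp
    have out: "padic_factor q p = 1" "\<epsilon> p = 1" if "p \<notin> S" for p using that by (auto simp: S_def \<epsilon>_def)
    have "Prod_any ?F = (\<Prod>p\<in>S. ?F p)"
      by (rule Prod_any.expand_superset[OF S]) (use F out in force)
    also have "\<dots> = (\<Prod>p\<in>S. of_real (padic_factor q p)) * (\<Prod>p\<in>S. \<epsilon> p)"
      unfolding F by (rule prod.distrib)
    also have "(\<Prod>p\<in>S. of_real (padic_factor q p)) = of_real (Prod_any (padic_factor q))"
    proof -
      have "Prod_any (padic_factor q) = (\<Prod>p\<in>S. padic_factor q p)"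
        by (rule Prod_any.expand_superset[OF S]) (auto simp: S_def)
      then show ?thesis by simp
    qed
    also have "(\<Prod>p\<in>S. \<epsilon> p) = (\<Prod>p\<in>prime_factors N. \<epsilon> p)"
      by (rule prod.mono_neutral_right[OF S]) (auto simp: S_def \<epsilon>_def)
    also have "\<dots> = psi N c" unfolding psi_def by (rule prod.cong[OF refl]) (simp only: \<epsilon>_def if_True)
    finally show ?thesis unfolding product_formula(2)[OF q] .
  qed
  ultimately have "f2 N ?g = of_real (\<bar>of_rat q\<bar>) * (of_real y / w ^ 2) * (of_real (1 / \<bar>of_rat q\<bar>) * psi N c)"
    using g unfolding f2_def pure_tensor_def M_def by (simp only: restrict_apply')
  also have "\<dots> = of_real y * (psi N c / w ^ 2)"
  proof -
    have "x * (Y / W) * (of_real (1 / r) * P) = Y * (P / W)" if "x = of_real r" "r \<noteq> 0" for x Y W P :: complex and r :: real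
      using that by simp
    from this[OF refl] show ?thesis using q by simp
  qed
  finally have f2: "f2 N ?g = of_real y * (psi N c / w ^ 2)" .
  have pw: "complex_of_real (y / norm w ^ 2) powr (s - 1/2) = of_real y powr (s - 1/2) * of_real (norm w) powr (- 2 * (s - 1/2))"
  proof -
    have n: "norm w > 0" using w by simp
    have "ln (y / norm w ^ 2) = ln y - 2 * ln (norm w)" using y n by (simp add: ln_div ln_realpow)
    then show ?thesis
      using y n by (simp add: powr_def Ln_of_real ln_div ln_realpow of_real_power[symmetric] of_real_divide[symmetric]
        exp_add[symmetric] algebra_simps del: of_real_power of_real_divide)
  qed
  show ?thesis
    using g unfolding flat_section_def restrict_apply'[OF g] hq f2 pw hecke_kernel_def y_def[symmetric] w_def[symmetric]
    by (simp add: mult_ac)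
qed

lemma eisenstein_sum_f2:
  assumes N: "N > 1" and z: "Im z > 0"
  shows "eisenstein_sum (flat_section (1/2) (f2 N) s) (of_GL2_real (uhp_matrix z)) E \<longleftrightarrow>
    ((\<lambda>(c, d). of_real (Im z) powr (s - 1/2) * of_real (Im z) *
      (psi N c * hecke_kernel (s - 1/2) (of_int c * z + of_int d))) has_sum E) primitive_pairs"
proof -
  let ?f = "\<lambda>C. flat_section (1/2) (f2 N) s (map_mat2 adele_of_rat (SOME \<gamma>. \<gamma> \<in> C) \<otimes>\<^bsub>GL2 adele_ring\<^esub> of_GL2_real (uhp_matrix z))"
  have "eisenstein_sum (flat_section (1/2) (f2 N) s) (of_GL2_real (uhp_matrix z)) E \<longleftrightarrow>
    ((\<lambda>x. ?f (row_coset x)) has_sum E) primitive_pairs"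
    unfolding eisenstein_sum_def by (rule has_sum_reindex_bij_betw[OF bij_betw_row_coset, symmetric])
  also have "\<dots> \<longleftrightarrow> ((\<lambda>(c, d). of_real (Im z) powr (s - 1/2) * of_real (Im z) *
      (psi N c * hecke_kernel (s - 1/2) (of_int c * z + of_int d))) has_sum E) primitive_pairs"
  proof (rule has_sum_cong)
    fix x assume "x \<in> primitive_pairs"
    then obtain c d where x: "x = (c, d)" "coprime c d" by (auto simp: primitive_pairs_def)
    \<comment> \<open>Whatever representative the choice operator returns, the value depends only on
      the primitive row.\<close>
    define m where "m = (SOME \<gamma>. \<gamma> \<in> row_coset (c, d))"
    have "\<exists>\<gamma>. \<gamma> \<in> row_coset (c, d)" by (rule row_coset_nonempty[OF x(2)]) blast
    then have m: "m \<in> row_coset (c, d)" unfolding m_def by (rule someI_ex)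
    have mG: "m \<in> carrier (GL2 rat_ring)" using m by (auto simp: row_coset_def)
    from row_coset_some[OF x(2) m] obtain l where l: "l \<noteq> 0" "ll m = l * of_int c" "lr m = l * of_int d" .
    show "?f (row_coset x) = (case x of (c, d) \<Rightarrow> of_real (Im z) powr (s - 1/2) * of_real (Im z) *
      (psi N c * hecke_kernel (s - 1/2) (of_int c * z + of_int d)))"
      unfolding x(1) prod.case m_def[symmetric] by (rule flat_section_value[OF N z mG l x(2)])
  qed
  finally show ?thesis .
qed

text \<open>The continuation is an explicit quotient, continuous at 1/2 because
  \<open>eis_L N 0\<close> is nonzero; so its limit is obtained by inserting t = 0.\<close>

lemma eisenstein_f2:
  assumes N: "N > 1" "squarefree N" and z: "Im z > 0"
  shows "eisenstein (1/2) (f2 N) (of_GL2_real (uhp_matrix z)) =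
    of_real (Im z) * (periodic_weight.hecke_sum N (eis_weight N) 0 z / eis_L N 0)"
proof -
  interpret periodic_weight N "eis_weight N" by (rule periodic_weight_eis_weight[OF N])
  define y where "y = complex_of_real (Im z)"
  have y: "y \<noteq> 0" using z by (simp add: y_def)
  define F where "F s = y powr (s - 1/2) * y * (hecke_sum (s - 1/2) z / eis_L N (s - 1/2))" for s
  define E where "E = y * (hecke_sum 0 z / eis_L N 0)"
  let ?g = "of_GL2_real (uhp_matrix z)"
  \<comment> \<open>Re s > 0 means Re t > -1/2, the domain of the continued series. Only a
    meromorphic function is asked for there, so zeros of the denominator away from s = 1/2 would do
    no harm.\<close>
  let ?H = "{s :: complex. Re s > 0}"
  have H: "open ?H" by (rule open_halfspace_Re_gt)
  have half: "1/2 \<in> ?H" by simp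
  have shift: "(\<lambda>s. s - 1/2) ` ?H \<subseteq> {t. Re t > - 1/2}" by auto
  have sum: "eisenstein_sum (flat_section (1/2) (f2 N) s) ?g (F s)" if "Re s > 1/2" for s
  proof -
    have t: "Re (s - 1/2) > 0" using that by simp
    have "((\<lambda>x. y powr (s - 1/2) * y * (case x of (c, d) \<Rightarrow> psi N c * hecke_kernel (s - 1/2) (of_int c * z + of_int d)))
      has_sum F s) primitive_pairs"
      unfolding F_def by (rule has_sum_cmult_right[OF has_sum_primitive_pairs[OF z t N]])
    then show ?thesis unfolding eisenstein_sum_f2[OF N(1) z] y_def by (simp only: case_prod_unfold)
  qed
  have "(\<lambda>s. s - 1/2) holomorphic_on ?H" by (intro holomorphic_intros)
  then have h: "((\<lambda>t. hecke_sum t z) \<circ> (\<lambda>s. s - 1/2)) holomorphic_on ?H" "(eis_L N \<circ> (\<lambda>s. s - 1/2)) holomorphic_on ?H"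
    using holomorphic_on_compose_gen[OF _ holomorphic_hecke_sum[OF z] shift]
      holomorphic_on_compose_gen[OF _ holomorphic_eis_L shift] by blast+
  have p: "(\<lambda>s. y powr (s - 1/2) * y) holomorphic_on ?H"
    using y by (intro holomorphic_intros) auto
  have "F = (\<lambda>s. (y powr (s - 1/2) * y) * ((hecke_sum (s - 1/2) z) / (eis_L N (s - 1/2))))"
    by (rule ext) (simp only: F_def)
  moreover have "(\<lambda>s. (y powr (s - 1/2) * y) * ((hecke_sum (s - 1/2) z) / (eis_L N (s - 1/2)))) meromorphic_on ?H"
    using h p H unfolding o_def
    by (intro meromorphic_on_mult meromorphic_on_divide analytic_on_imp_meromorphic_on) (simp_all only: analytic_on_open)
  ultimately have mero: "F meromorphic_on ?H" by simp
  have cont: "isCont f (1/2)" if "f holomorphic_on ?H" for f :: "complex \<Rightarrow> complex"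
    using holomorphic_on_imp_continuous_on[OF that] continuous_on_eq_continuous_at[OF H] half by blast
  have "isCont F (1/2)"
    unfolding F_def
  proof (rule isCont_mult[OF cont[OF p] isCont_divide])
    show "isCont (\<lambda>s. hecke_sum (s - 1/2) z) (1/2)" "isCont (\<lambda>s. eis_L N (s - 1/2)) (1/2)"
      using cont[OF h(1)] cont[OF h(2)] by (simp_all only: o_def)
    show "eis_L N (1/2 - 1/2) \<noteq> 0" using eis_L_0_nonzero[OF N(1)] by simp
  qed
  then have lim: "(F \<longlongrightarrow> E) (at (1/2))"
    unfolding isCont_def using y by (simp add: F_def E_def)
  have "eisenstein (1/2) (f2 N) ?g = E"
    unfolding eisenstein_def
  proof (rule the_equality)
    show "\<exists>F c. c < Re (1/2) \<and> c < 1/2 \<and> F meromorphic_on {s. Re s > c} \<and>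
      (\<forall>s. Re s > 1/2 \<longrightarrow> eisenstein_sum (flat_section (1/2) (f2 N) s) ?g (F s)) \<and> (F \<longlongrightarrow> E) (at (1/2))"
      using mero sum lim by (intro exI[of _ F] exI[of _ 0]) simp
  next
    fix E' assume "\<exists>F c. c < Re (1/2) \<and> c < 1/2 \<and> F meromorphic_on {s. Re s > c} \<and>
      (\<forall>s. Re s > 1/2 \<longrightarrow> eisenstein_sum (flat_section (1/2) (f2 N) s) ?g (F s)) \<and> (F \<longlongrightarrow> E') (at (1/2))"
    then obtain F' where F': "\<And>s. Re s > 1/2 \<Longrightarrow> eisenstein_sum (flat_section (1/2) (f2 N) s) ?g (F' s)"
      "(F' \<longlongrightarrow> E') (at (1/2))" by blast
    \<comment> \<open>Both continuations agree on \<open>Re s > 1/2\<close>, which has \<open>1/2\<close> in its closure, so the limits agree.\<close>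
    define X where "X n = 1/2 + complex_of_real (inverse (real (Suc n)))" for n
    have X: "Re (X n) > 1/2" for n by (simp add: X_def)
    have "X \<longlonglongrightarrow> 1/2 + complex_of_real 0"
      unfolding X_def by (intro tendsto_intros LIMSEQ_inverse_real_of_nat)
    moreover have "X n \<noteq> 1/2" for n
    proof
      assume "X n = 1/2"
      then have "Re (X n) = 1/2" by (simp only: Re_divide_numeral one_complex.sel)
      then show False using X[of n] by simp
    qed
    ultimately have X_at: "filterlim X (at (1/2)) sequentially"
      by (intro filterlim_atI) auto
    have eq: "F' (X n) = F (X n)" for n
      using F'(1)[OF X] sum[OF X] unfolding eisenstein_sum_def by (rule has_sum_unique)
    have "(\<lambda>n. F' (X n)) \<longlonglongrightarrow> E'" by (rule filterlim_compose[OF F'(2) X_at])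
    moreover have "(\<lambda>n. F (X n)) \<longlonglongrightarrow> E" by (rule filterlim_compose[OF lim X_at])
    ultimately show "E' = E" unfolding eq by (rule LIMSEQ_unique)
  qed
  then show ?thesis by (simp only: E_def y_def)
qed

theorem theorem5p5:
  fixes N :: nat
  assumes "N > 1" and "squarefree N"
  shows "(\<forall>z\<in>upper_half_plane.
            uhp_function (eisenstein (1/2) (f2 N)) z =
            1 - 24 * (of_int (moebius_mu N) / of_nat (totient N)) *
              (\<Sum>\<^sub>\<infinity>n\<in>{1..}. of_nat (divisor_sum (coprime_part N n)) *
                 exp (2 * of_real pi * \<i> * of_nat n * z))) \<and>
         modular_form 2 (Gamma0 N) (uhp_function (eisenstein (1/2) (f2 N)))"
proof -
  have eis: "uhp_function (eisenstein (1/2) (f2 N)) z = periodic_weight.hecke_sum N (eis_weight N) 0 z / eis_L N 0"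
    if "z \<in> upper_half_plane" for z
  proof -
    have z: "Im z > 0" using that by (simp add: upper_half_plane_def)
    show ?thesis
      unfolding uhp_function_def uhp_matrix_def[symmetric] eisenstein_f2[OF assms z] using z by simp
  qed
  have "uhp_function (eisenstein (1/2) (f2 N)) z = 1 - 24 * (of_int (moebius_mu N) / of_nat (totient N)) *
      (\<Sum>\<^sub>\<infinity>n\<in>{1..}. of_nat (divisor_sum (coprime_part N n)) * exp (2 * of_real pi * \<i> * of_nat n * z))"
    if "z \<in> upper_half_plane" for z
    using eis[OF that] hecke_sum_eis_weight[of z N] assms that by (simp only: upper_half_plane_def mem_Collect_eq)
  moreover have "modular_form 2 (Gamma0 N) (uhp_function (eisenstein (1/2) (f2 N)))"
    by (rule modular_form_eis[OF assms eis])
  ultimately show ?thesis by blast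
qed

end
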